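(* Let $B,\bar B$ be Banach spaces over $\mathbb K\in\{\mathbb R,\mathbb C\}$, let $k\ge 1$, $q\ge 2k+2$, and let $G\in C^q(B,\bar B)$ with $G[0]=0$. Suppose there exist $\bar z_1,\dots,\bar z_{2k}\in B$ with $$T^{2k}[\bar z_{2k},\dots,\bar z_1]=\cdots=T^1[\bar z_1]=0$$ (approximation of order $2k$) and such that the bounded linear map $W^{2k+1}(\bar z_k,\dots,\bar z_1):B\times N[\Delta^k]\to\bar B$ is surjective, i.e. $R[W^{2k+1}(\bar z_k,\dots,\bar z_1)]=\bar B$ (nondegeneracy of order $k$). Suppose its kernel $N\subset B\times N[\Delta^k]$ has a closed direct complement $N_c$, so $B\times N[\Delta^k]=N_c\oplus N$. Let $\bar b\in N_c$ be the unique element of $N_c$ with $W^{2k+1}(\bar z_k,\dots,\bar z_1)\cdot\bar b=-T^{2k+1}[0,\bar z_{2k},\dots,\bar z_1]$, and put $\bar z_{2k+1}:=0$. Let $\gamma>0$ be arbitrary (finite), and write $\mathcal B_{\delta_1}(0)=\{\varepsilon\in\mathbb K:|\varepsilon|<\delta_1\}$, $\mathcal B_\gamma(0)=\{n\in N:\|n\|<\gamma\}$, $\mathcal B_{\delta_2}(\bar b)=\{n_c\in N_c:\|n_c-\bar b\|<\delta_2\}$, with $\delta_1,\delta_2>0$ sufficiently small. Then, for $\varepsilon\in\mathcal B_{\delta_1}(0)$ and $(b_{2k+1},\dots,b_{k+1})\in\mathcal B_{\delta_2}(\bar b)\oplus\mathcal B_\gamma(0)$, all solutions of $G[z]=0$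 within the cone of approximations of order $2k$, i.e. among the points $$z=\sum_{i=1}^{k}\tfrac1{i!}\varepsilon^i\bar z_i+\sum_{i=k+1}^{2k+1}\tfrac{1}{i!}\varepsilon^i(\bar z_i+b_i),$$ are given by $$z(\varepsilon,n)=\varepsilon\bar z_1+\cdots+\tfrac1{k!}\varepsilon^k\bar z_k+\sum_{i=k+1}^{2k+1}\tfrac1{i!}\varepsilon^i\big(\bar z_i+b_i(\varepsilon,n)\big)$$ with $$(b_{2k+1},\dots,b_{k+1})(\varepsilon,n)\in C^{q-2k-1}\big(\mathcal B_{\delta_1}(0)\times\mathcal B_\gamma(0),\ \mathcal B_{\delta_2}(\bar b)\big),\qquad (b_{2k+1},\dots,b_{k+1})(0,n)=\bar b\in N_c.$$
   Context: $G_0^\beta$ denotes the $\beta$-th Fréchet derivative of $G$ at $0$ (a symmetric bounded $\beta$-linear map). For $i\ge1$ the undetermined-coefficient maps are $$T^i[z_i,\dots,z_1]=\sum_{\beta=1}^{i}G_0^\beta\sum_{\substack{n_1+\cdots+n_i=\beta\\ 1\cdot n_1+\cdots+i\cdot n_i=i}}\frac{i!}{n_1!\cdots n_i!}\prod_{\tau=1}^{i}\Big(\frac1{\tau!}z_\tau\Big)^{n_\tau}\in\bar B ,$$ i.e. $T^i$ is the $i$-th $\varepsilon$-derivative at $\varepsilon=0$ of $G[\varepsilon z_1+\frac1{2!}\varepsilon^2z_2+\cdots]$ (for example $T^1=G_0^1z_1$, $T^2=G_0^1z_2+G_0^2z_1^2$). For fixed $z_1,\dots,z_k$, the vector $(T^{2k},\dots,T^{k+1})$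 is an affine function of $(z_{2k},\dots,z_{k+1})\in B^k$; its linear part is denoted $\Delta^k=\Delta^k(z_{k-1},\dots,z_1)\in L[B^k,\bar B^k]$ (an upper triangular matrix operator with $G_0^1$ on the diagonal; it depends only on $z_1,\dots,z_{k-1}$). $N[\Delta^k]\subset B^k$ is the kernel of $\Delta^k(\bar z_{k-1},\dots,\bar z_1)$. For fixed $z_1,\dots,z_k$, $T^{2k+1}$ is an affine function of $(z_{2k+1},\dots,z_{k+1})\in B^{k+1}$; its linear part is denoted $W^{2k+1}(z_k,\dots,z_1)\in L[B^{k+1},\bar B]$. In the claim it is restricted to the closed subspace $B\times N[\Delta^k]$ of $B^{k+1}$ (with $z_{2k+1}\in B$, $(z_{2k},\dots,z_{k+1})\in N[\Delta^k]$). $N[\cdot]$ and $R[\cdot]$ denote kernel and range. $L[X,Y]$ denotes bounded linear operators.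
   Formalization: In the solution formula, b(ε,n) is read as the N_c-component and the parameter n ∈ N is added to it: the coefficients used in z(ε,n) are those of b(ε,n)+n; without adding n the claim fails, e.g. for G(x,y)=y on R² with zero approximations. *)

theory Defs
  imports "HOL-Analysis.Analysis"
begin

text \<open>
  A Banach space over a field \<open>'k\<close> of class \<open>real_normed_field\<close>: the type class \<open>banach\<close> supplies the
  norm, completeness and the underlying real structure, and \<open>scale\<close> is a compatible multiplication
  by scalars from \<open>'k\<close>.  Both \<open>real\<close> and \<open>complex\<close> are instances for \<open>'k\<close> (and, by the Gelfand-Mazur
  theorem, up to isometric isomorphism the only ones).
\<close>

locale banach_over = vector_space scale
  for scale :: "'k::real_normed_field \<Rightarrow> 'b::banach \<Rightarrow> 'b" +
  assumes norm_scale: "norm (scale c x) = norm c * norm x"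
    and scale_of_real: "scale (of_real r) x = r *\<^sub>R x"

lemma banach_over_scaleR: "banach_over ((*\<^sub>R) :: real \<Rightarrow> 'b::banach \<Rightarrow> 'b)"
  by unfold_locales (auto simp: algebra_simps)

lemma banach_over_complex: "banach_over ((*) :: complex \<Rightarrow> complex \<Rightarrow> complex)"
  by unfold_locales (auto simp: algebra_simps norm_mult scaleR_conv_of_real)


subsection \<open>Frechet derivatives of higher order\<close>

text \<open>
  A \<open>m\<close>-linear map is a function on lists of length \<open>m\<close>; its values on other lists are irrelevant.
  It is defined on a \<open>'k\<close>-subspace \<open>V\<close> of the ambient type.
\<close>

definition bounded_multilinear_on ::
  "('k \<Rightarrow> 'a \<Rightarrow> 'a) \<Rightarrow> ('k \<Rightarrow> 'c \<Rightarrow> 'c) \<Rightarrow> 'a set \<Rightarrow> nat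
    \<Rightarrow> ('a::real_normed_vector list \<Rightarrow> 'c::real_normed_vector) \<Rightarrow> bool"
  where "bounded_multilinear_on sa sc V m L \<longleftrightarrow>
    (\<forall>vs. set vs \<subseteq> V \<and> length vs = m \<longrightarrow> (\<forall>j<m. \<forall>u\<in>V. \<forall>v\<in>V. \<forall>c.
       L (vs[j := sa c u + v]) = sc c (L (vs[j := u])) + L (vs[j := v]))) \<and>
    (\<exists>C. \<forall>vs. set vs \<subseteq> V \<and> length vs = m \<longrightarrow> norm (L vs) \<le> C * prod_list (map norm vs))"

text \<open>
  \<open>has_frechet_derivs sa sc V U r f D\<close>: on the relatively open subset \<open>U\<close> of the subspace \<open>V\<close>, the map
  \<open>f\<close> is of class \<open>C\<^sup>r\<close>, and \<open>D m x\<close> is its \<open>m\<close>-th Frechet derivative at \<open>x\<close>, for \<open>m \<le> r\<close>.  Here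
  \<open>D (Suc m) x (h # vs)\<close> is the derivative of \<open>D m\<close> at \<open>x\<close> in direction \<open>h\<close>, evaluated at \<open>vs\<close>; the
  estimates uniform in \<open>vs\<close> are estimates in the operator norm of \<open>m\<close>-linear maps on \<open>V\<close>.
\<close>

definition has_frechet_derivs ::
  "('k \<Rightarrow> 'a \<Rightarrow> 'a) \<Rightarrow> ('k \<Rightarrow> 'c \<Rightarrow> 'c) \<Rightarrow> 'a set \<Rightarrow> 'a set \<Rightarrow> nat
    \<Rightarrow> ('a::real_normed_vector \<Rightarrow> 'c::real_normed_vector)
    \<Rightarrow> (nat \<Rightarrow> 'a \<Rightarrow> 'a list \<Rightarrow> 'c) \<Rightarrow> bool"
  where "has_frechet_derivs sa sc V U r f D \<longleftrightarrow>
    (\<forall>x\<in>U. D 0 x [] = f x) \<and>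
    (\<forall>m\<le>r. \<forall>x\<in>U. bounded_multilinear_on sa sc V m (D m x)) \<and>
    (\<forall>m<r. \<forall>x\<in>U. \<forall>e>0. \<forall>\<^sub>F y in at x within U. \<forall>vs. set vs \<subseteq> V \<and> length vs = m \<longrightarrow>
       norm (D m y vs - D m x vs - D (Suc m) x ((y - x) # vs))
         \<le> e * norm (y - x) * prod_list (map norm vs)) \<and>
    (\<forall>x\<in>U. \<forall>e>0. \<forall>\<^sub>F y in at x within U. \<forall>vs. set vs \<subseteq> V \<and> length vs = r \<longrightarrow>
       norm (D r y vs - D r x vs) \<le> e * prod_list (map norm vs))"

definition C_frechet ::
  "('k \<Rightarrow> 'a \<Rightarrow> 'a) \<Rightarrow> ('k \<Rightarrow> 'c \<Rightarrow> 'c) \<Rightarrow> 'a set \<Rightarrow> 'a set \<Rightarrow> nat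
    \<Rightarrow> ('a::real_normed_vector \<Rightarrow> 'c::real_normed_vector) \<Rightarrow> bool"
  where "C_frechet sa sc V U r f \<longleftrightarrow> (\<exists>D. has_frechet_derivs sa sc V U r f D)"


subsection \<open>The maps \<open>T\<^sup>i\<close>, \<open>\<Delta>\<^sup>k\<close> and \<open>W\<^sup>2\<^sup>k\<^sup>+\<^sup>1\<close>\<close>

text \<open>
  \<open>G0 \<beta>\<close> stands for the \<open>\<beta>\<close>-th derivative of \<open>G\<close> at \<open>0\<close>.  The tuple \<open>(z\<^sub>i, \<dots>, z\<^sub>1)\<close> is a function
  on the index set; only its values at \<open>1, \<dots>, i\<close> are used.
\<close>

definition T :: "(nat \<Rightarrow> 'b list \<Rightarrow> 'c) \<Rightarrow> nat \<Rightarrow> (nat \<Rightarrow> 'b::real_vector) \<Rightarrow> 'c::real_vector"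
  where "T G0 i z =
    (\<Sum>\<beta>=1..i.
      \<Sum>n | (\<forall>\<tau>. \<tau> \<notin> {1..i} \<longrightarrow> n \<tau> = (0::nat)) \<and> (\<Sum>\<tau>=1..i. n \<tau>) = \<beta> \<and> (\<Sum>\<tau>=1..i. \<tau> * n \<tau>) = i.
        (fact i / (\<Prod>\<tau>=1..i. fact (n \<tau>))) *\<^sub>R
          G0 \<beta> (concat (map (\<lambda>\<tau>. replicate (n \<tau>) ((1 / fact \<tau>) *\<^sub>R z \<tau>)) [1..<Suc i])))"

text \<open>The tuple with entries \<open>z\<^sub>i\<close> for \<open>i \<le> k\<close> and \<open>y\<^sub>i\<close> for \<open>i > k\<close>.\<close>

definition join :: "nat \<Rightarrow> (nat \<Rightarrow> 'b) \<Rightarrow> (nat \<Rightarrow> 'b) \<Rightarrow> nat \<Rightarrow> 'b"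
  where "join k z y = (\<lambda>i. if i \<le> k then z i else y i)"

text \<open>The linear part of an affine function of a tuple.\<close>

definition linear_part :: "((nat \<Rightarrow> 'b::zero) \<Rightarrow> 'c::minus) \<Rightarrow> (nat \<Rightarrow> 'b) \<Rightarrow> 'c"
  where "linear_part A y = A y - A (\<lambda>_. 0)"

text \<open>Elements of \<open>B\<^sup>k\<close> are indexed by \<open>k+1, \<dots>, 2k\<close> and are \<open>0\<close> at all other indices.\<close>

definition Delta :: "(nat \<Rightarrow> 'b list \<Rightarrow> 'c) \<Rightarrow> nat \<Rightarrow> (nat \<Rightarrow> 'b::real_vector)
    \<Rightarrow> (nat \<Rightarrow> 'b) \<Rightarrow> nat \<Rightarrow> 'c::real_vector"
  where "Delta G0 k z y =
    (\<lambda>i. if i \<in> {k+1..2*k} then linear_part (\<lambda>y. T G0 i (join k z y)) y else 0)"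

definition kernel_Delta :: "(nat \<Rightarrow> 'b list \<Rightarrow> 'c::real_vector) \<Rightarrow> nat \<Rightarrow> (nat \<Rightarrow> 'b::real_vector)
    \<Rightarrow> (nat \<Rightarrow> 'b) set"
  where "kernel_Delta G0 k z =
    {y. (\<forall>i. i \<notin> {k+1..2*k} \<longrightarrow> y i = 0) \<and> Delta G0 k z y = (\<lambda>_. 0)}"

definition W :: "(nat \<Rightarrow> 'b list \<Rightarrow> 'c) \<Rightarrow> nat \<Rightarrow> (nat \<Rightarrow> 'b::real_vector)
    \<Rightarrow> (nat \<Rightarrow> 'b) \<Rightarrow> 'c::real_vector"
  where "W G0 k z y = linear_part (\<lambda>y. T G0 (2*k+1) (join k z y)) y"


subsection \<open>The space \<open>B \<times> N[\<Delta>\<^sup>k]\<close>\<close>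

text \<open>
  \<open>B\<^sup>k\<^sup>+\<^sup>1\<close>, indexed by \<open>k+1, \<dots>, 2k+1\<close>, is the closed subspace of those elements of
  \<open>nat \<Rightarrow>\<^sub>C 'b\<close> (bounded sequences with the supremum norm, as \<open>nat\<close> is discrete) that vanish at all
  other indices.  It thus carries the maximum norm.
\<close>

definition B_times_kernel_Delta :: "(nat \<Rightarrow> 'b list \<Rightarrow> 'c::real_vector) \<Rightarrow> nat
    \<Rightarrow> (nat \<Rightarrow> 'b::real_normed_vector) \<Rightarrow> (nat \<Rightarrow>\<^sub>C 'b) set"
  where "B_times_kernel_Delta G0 k z =
    {y. (\<forall>i. i \<notin> {k+1..2*k+1} \<longrightarrow> apply_bcontfun y i = 0) \<and>
        (apply_bcontfun y)(2*k+1 := 0) \<in> kernel_Delta G0 k z}"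

definition scale_seq :: "('k \<Rightarrow> 'b \<Rightarrow> 'b) \<Rightarrow> 'k \<Rightarrow> (nat \<Rightarrow>\<^sub>C 'b) \<Rightarrow> (nat \<Rightarrow>\<^sub>C 'b::real_normed_vector)"
  where "scale_seq s c y = Bcontfun (\<lambda>i. s c (apply_bcontfun y i))"

lemma (in banach_over) apply_scale_seq:
  "apply_bcontfun (scale_seq scale c y) i = scale c (apply_bcontfun y i)"
proof -
  obtain M where M: "\<And>i. norm (apply_bcontfun y i) \<le> M"
    using bounded_apply_bcontfun[of y] by (auto simp: bounded_iff)
  have "(\<lambda>i. scale c (apply_bcontfun y i)) \<in> bcontfun"
    by (auto simp: bcontfun_def bounded_iff norm_scale continuous_on_def tendsto_discrete at_discrete
        intro!: exI[of _ "norm c * M"] mult_left_mono M)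
  then show ?thesis
    by (simp add: scale_seq_def Bcontfun_inverse)
qed

definition scale_pair :: "('k \<Rightarrow> 'a \<Rightarrow> 'a) \<Rightarrow> 'k \<Rightarrow> 'k \<times> 'a \<Rightarrow> 'k::times \<times> 'a"
  where "scale_pair s c p = (c * fst p, s c (snd p))"


subsection \<open>Points of the cone of approximations of order \<open>2k\<close>\<close>

definition cone_point :: "('k::real_normed_field \<Rightarrow> 'b \<Rightarrow> 'b) \<Rightarrow> nat \<Rightarrow> (nat \<Rightarrow> 'b)
    \<Rightarrow> 'k \<Rightarrow> (nat \<Rightarrow>\<^sub>C 'b) \<Rightarrow> 'b::real_normed_vector"
  where "cone_point s k z \<epsilon> b =
    (\<Sum>i=1..k. s (\<epsilon>^i / fact i) (z i)) +
    (\<Sum>i=k+1..2*k+1. s (\<epsilon>^i / fact i) (z i + apply_bcontfun b i))"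

end

theory Submission
  imports Defs
begin

text \<open>
  Along the cone, \<open>g (\<epsilon>, b) = G (cone_point \<epsilon> b)\<close> vanishes to order \<open>2k + 1\<close> in \<open>\<epsilon>\<close>: its first \<open>2k\<close> derivatives in
  \<open>\<epsilon>\<close> at \<open>0\<close> are \<open>T\<^sup>1, \<dots>, T\<^sup>2\<^sup>k\<close>, which are not changed by a perturbation \<open>b\<close> in the kernel of \<open>\<Delta>\<^sup>k\<close>.
  Dividing \<open>2k + 1\<close> times by \<open>\<epsilon>\<close> with Hadamard's integral formula, each time at the cost of one derivative, gives
  \<open>g (\<epsilon>, b) = \<epsilon>\<^sup>2\<^sup>k\<^sup>+\<^sup>1 H (\<epsilon>, b)\<close> with \<open>H\<close> of class \<open>C\<^sup>q\<^sup>-\<^sup>2\<^sup>k\<^sup>-\<^sup>1\<close> and \<open>(2k + 1)! H (0, b) = T\<^sup>2\<^sup>k\<^sup>+\<^sup>1[z] + W b\<close>, which is affine in \<open>b\<close>.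
  By the open mapping theorem \<open>W\<close> restricted to \<open>N\<^sub>c\<close> has a bounded inverse. Since cone points tend to \<open>0\<close> uniformly for
  bounded \<open>b\<close>, \<open>H\<close> and its derivative are uniformly close to their values at \<open>\<epsilon> = 0\<close>, so that a contraction solves
  \<open>H (\<epsilon>, n\<^sub>c + n) = 0\<close> uniquely for \<open>n\<^sub>c\<close>, with one \<open>\<delta>\<^sub>1\<close> for all \<open>n\<close> in the ball of radius \<open>\<gamma>\<close>. The derivatives of the
  solution are found by solving the formula of Faa di Bruno for the inner derivative of top order.
\<close>

text \<open>The radius \<open>\<gamma>\<close> may be arbitrary because \<open>W\<close> annihilates
  \<open>N\<close>: at \<open>\<epsilon> = 0\<close> the blown-up equation does not see
  \<open>n\<close>, and \<open>bbar\<close> solves it for every \<open>n\<close>. What remains is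
  uniformity in \<open>n\<close>, and bounded sets are not compact; hence every function in the
  chain carries, besides its derivatives, their convergence as \<open>\<epsilon>\<close> tends to
  \<open>0\<close> uniformly on bounded sets. At \<open>\<epsilon> = 0\<close> the quotient
  \<open>H\<close> is affine in \<open>b\<close> because two indices above \<open>k\<close> already
  have weight at least \<open>2k + 2\<close>. Its value there is identified as a limit over real
  \<open>s > 0\<close>, from the Taylor polynomial of \<open>G\<close> at \<open>0\<close>, and not
  by differentiating the composition; collecting equal powers of \<open>s\<close> requires that the
  derivatives of \<open>G\<close> be symmetric. The condition \<open>q \<ge> 2k + 2\<close> leaves
  one derivative after the \<open>2k + 1\<close> divisions, the one that the contraction uses. The
  locale \<open>normed_over\<close> drops completeness, since pairs of a scalar and a vector need
  not form a complete space for a general \<open>'k\<close>.\<close>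

locale normed_over = vector_space scale
  for scale :: "'k::real_normed_field \<Rightarrow> 'b::real_normed_vector \<Rightarrow> 'b" +
  assumes norm_scale: "norm (scale c x) = norm c * norm x"
    and scale_of_real: "scale (of_real r) x = r *\<^sub>R x"

sublocale banach_over \<subseteq> normed_over
  by unfold_locales (simp_all add: norm_scale scale_of_real)

context normed_over
begin

lemma subspace_scaleR: "subspace V \<Longrightarrow> x \<in> V \<Longrightarrow> r *\<^sub>R x \<in> V"
  by (metis subspace_scale scale_of_real)

lemma scale_scaleR: "scale c (r *\<^sub>R x) = r *\<^sub>R scale c x"
  by (metis scale_of_real scale_left_commute)

lemma bounded_linear_scale: "bounded_linear (scale c)"
  by (rule bounded_linear_intro[where K = "norm c"])
    (simp_all add: scale_right_distrib scale_scaleR norm_scale mult.commute)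

end

text \<open>The weight of an argument list: \<open>L\<close> has operator norm at most
  \<open>C\<close> exactly when \<open>norm (L vs) \<le> C * pn vs\<close> throughout.\<close>

definition pn :: "'a::real_normed_vector list \<Rightarrow> real"
  where "pn vs = prod_list (map norm vs)"

lemma pn_simps [simp]:
  "pn [] = 1" "pn (x # xs) = norm x * pn xs" "pn (xs @ ys) = pn xs * pn ys"
  by (simp_all add: pn_def)

lemma pn_nonneg [simp]: "0 \<le> pn vs"
  by (induction vs) auto

lemma pn_mset: "mset xs = mset ys \<Longrightarrow> pn xs = pn ys"
  by (metis pn_def mset_map prod_mset_prod_list)

definition vl :: "'a set \<Rightarrow> nat \<Rightarrow> 'a list set"
  where "vl V m = {vs. set vs \<subseteq> V \<and> length vs = m}"

lemma vl_0 [simp]: "vl V 0 = {[]}"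
  by (auto simp: vl_def)

lemma Cons_vl_Suc [simp]: "h # vs \<in> vl V (Suc m) \<longleftrightarrow> h \<in> V \<and> vs \<in> vl V m"
  by (auto simp: vl_def)

section \<open>Bounded multilinear maps on lists\<close>

text \<open>The slot is marked by a splitting \<open>as @ _ # bs\<close> instead of an index; this
  is the form that simplification of \<open>map\<close> and \<open>@\<close> and induction on lists
  can use.\<close>

definition mlin :: "('k \<Rightarrow> 'a \<Rightarrow> 'a) \<Rightarrow> ('k \<Rightarrow> 'c \<Rightarrow> 'c) \<Rightarrow> 'a set \<Rightarrow> nat
    \<Rightarrow> ('a::real_normed_vector list \<Rightarrow> 'c::real_normed_vector) \<Rightarrow> bool"
  where "mlin sa sc V m L \<longleftrightarrow> (\<forall>as bs u v c. set as \<subseteq> V \<and> set bs \<subseteq> V \<and> u \<in> V \<and> v \<in> V \<and>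
      length as + length bs + 1 = m \<longrightarrow>
      L (as @ (sa c u + v) # bs) = sc c (L (as @ u # bs)) + L (as @ v # bs))"

definition mbdd :: "'a set \<Rightarrow> nat \<Rightarrow> ('a::real_normed_vector list \<Rightarrow> 'c::real_normed_vector) \<Rightarrow> bool"
  where "mbdd V m L \<longleftrightarrow> (\<exists>C\<ge>0. \<forall>vs\<in>vl V m. norm (L vs) \<le> C * pn vs)"

lemma mlinI:
  assumes "\<And>as bs u v c. set as \<subseteq> V \<Longrightarrow> set bs \<subseteq> V \<Longrightarrow> u \<in> V \<Longrightarrow> v \<in> V \<Longrightarrow>
      length as + length bs + 1 = m \<Longrightarrow>
      L (as @ (sa c u + v) # bs) = sc c (L (as @ u # bs)) + L (as @ v # bs)"
  shows "mlin sa sc V m L"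
  using assms by (auto simp: mlin_def)

lemma mlinD:
  assumes "mlin sa sc V m L" "set as \<subseteq> V" "set bs \<subseteq> V" "u \<in> V" "v \<in> V"
    "length as + length bs + 1 = m"
  shows "L (as @ (sa c u + v) # bs) = sc c (L (as @ u # bs)) + L (as @ v # bs)"
  using assms by (auto simp: mlin_def)

lemma bounded_multilinear_on_iff:
  "bounded_multilinear_on sa sc V m L \<longleftrightarrow> mlin sa sc V m L \<and> mbdd V m L"
proof -
  have 1: "(\<forall>vs. set vs \<subseteq> V \<and> length vs = m \<longrightarrow> (\<forall>j<m. \<forall>u\<in>V. \<forall>v\<in>V. \<forall>c.
       L (vs[j := sa c u + v]) = sc c (L (vs[j := u])) + L (vs[j := v]))) \<longleftrightarrow> mlin sa sc V m L"
    (is "?A \<longleftrightarrow> ?B")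
  proof
    assume A: ?A
    show ?B
    proof (rule mlinI)
      fix as bs u v c
      assume *: "set as \<subseteq> V" "set bs \<subseteq> V" "u \<in> V" "v \<in> V" "length as + length bs + 1 = m"
      have "L ((as @ u # bs)[length as := sa c u + v])
        = sc c (L ((as @ u # bs)[length as := u])) + L ((as @ u # bs)[length as := v])"
        using A[rule_format, of "as @ u # bs" "length as" u v c] * by simp
      then show "L (as @ (sa c u + v) # bs) = sc c (L (as @ u # bs)) + L (as @ v # bs)"
        by simp
    qed
  next
    assume B: ?B
    show ?A
    proof (intro allI impI ballI)
      fix vs j u v c
      assume *: "set vs \<subseteq> V \<and> length vs = m" "j < m" "u \<in> V" "v \<in> V"
      have "set (take j vs) \<subseteq> V" "set (drop (Suc j) vs) \<subseteq> V"
        using * set_take_subset set_drop_subset by fast+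
      with mlinD[OF B this *(3,4), of c] *
      show "L (vs[j := sa c u + v]) = sc c (L (vs[j := u])) + L (vs[j := v])"
        by (simp add: upd_conv_take_nth_drop)
    qed
  qed
  have 2: "(\<exists>C. \<forall>vs. set vs \<subseteq> V \<and> length vs = m \<longrightarrow> norm (L vs) \<le> C * prod_list (map norm vs))
      \<longleftrightarrow> mbdd V m L" (is "?A \<longleftrightarrow> ?B")
  proof
    assume ?A
    then obtain C where "\<And>vs. vs \<in> vl V m \<Longrightarrow> norm (L vs) \<le> C * pn vs"
      by (auto simp: vl_def pn_def)
    \<comment> \<open>The constant in the given definition may be negative, for instance when every
      product of norms is zero; its positive part serves as well.\<close>
    moreover have "C * pn vs \<le> max C 0 * pn vs" for vs :: "'b list"
      by (intro mult_right_mono) auto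
    ultimately show ?B
      unfolding mbdd_def by (intro exI[of _ "max C 0"]) (auto intro: order_trans)
  next
    assume ?B
    then show ?A
      by (auto simp: mbdd_def vl_def pn_def)
  qed
  show ?thesis
    unfolding bounded_multilinear_on_def 1 2 ..
qed

locale two_spaces = A: normed_over sa + C: normed_over sc
  for sa :: "'k::real_normed_field \<Rightarrow> 'a::real_normed_vector \<Rightarrow> 'a"
    and sc :: "'k \<Rightarrow> 'c::real_normed_vector \<Rightarrow> 'c"
begin

context
  fixes V m and L :: "'a list \<Rightarrow> 'c"
  assumes L: "mlin sa sc V m L" and V: "A.subspace V"
begin

lemma mlin_add:
  "\<lbrakk>set as \<subseteq> V; set bs \<subseteq> V; u \<in> V; v \<in> V; length as + length bs + 1 = m\<rbrakk>
    \<Longrightarrow> L (as @ (u + v) # bs) = L (as @ u # bs) + L (as @ v # bs)"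
  using mlinD[OF L, of as bs u v 1] by simp

lemma mlin_zero:
  "\<lbrakk>set as \<subseteq> V; set bs \<subseteq> V; length as + length bs + 1 = m\<rbrakk> \<Longrightarrow> L (as @ 0 # bs) = 0"
  using mlin_add[of as bs 0 0] A.subspace_0[OF V] by simp

lemma mlin_scale:
  "\<lbrakk>set as \<subseteq> V; set bs \<subseteq> V; u \<in> V; length as + length bs + 1 = m\<rbrakk>
    \<Longrightarrow> L (as @ sa c u # bs) = sc c (L (as @ u # bs))"
  using mlinD[OF L, of as bs u 0 c] A.subspace_0[OF V] mlin_zero by simp

lemma mlin_scaleR:
  "\<lbrakk>set as \<subseteq> V; set bs \<subseteq> V; u \<in> V; length as + length bs + 1 = m\<rbrakk>
    \<Longrightarrow> L (as @ (r *\<^sub>R u) # bs) = r *\<^sub>R L (as @ u # bs)"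
  using mlin_scale[of as bs u "of_real r"] by (simp add: A.scale_of_real C.scale_of_real)

lemma mlin_diff:
  assumes "set as \<subseteq> V" "set bs \<subseteq> V" "u \<in> V" "v \<in> V" "length as + length bs + 1 = m"
  shows "L (as @ (u - v) # bs) = L (as @ u # bs) - L (as @ v # bs)"
proof -
  have "L (as @ (u - v + v) # bs) = L (as @ (u - v) # bs) + L (as @ v # bs)"
    using assms by (intro mlin_add A.subspace_diff[OF V])
  then show ?thesis by simp
qed

end

lemma mlin_plus: "mlin sa sc V m L \<Longrightarrow> mlin sa sc V m L' \<Longrightarrow> mlin sa sc V m (\<lambda>vs. L vs + L' vs)"
  by (simp add: mlin_def C.scale_right_distrib algebra_simps)

end

lemma mbdd_plus: "mbdd V m L \<Longrightarrow> mbdd V m L' \<Longrightarrow> mbdd V m (\<lambda>vs. L vs + L' vs)"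
  unfolding mbdd_def
proof (elim exE conjE)
  fix C C' assume *: "C \<ge> 0" "C' \<ge> 0" "\<forall>vs\<in>vl V m. norm (L vs) \<le> C * pn vs"
    "\<forall>vs\<in>vl V m. norm (L' vs) \<le> C' * pn vs"
  show "\<exists>C\<ge>0. \<forall>vs\<in>vl V m. norm (L vs + L' vs) \<le> C * pn vs"
    using * by (intro exI[of _ "C + C'"])
      (auto simp: distrib_right intro!: norm_triangle_le add_mono)
qed

section \<open>Estimates uniform over a parameter set\<close>

text \<open>Derivatives are functions on lists, so there is no operator norm to speak of. With \<open>P = vl V m\<close> and
  \<open>w = (\<lambda>i. pn)\<close> the following predicates say that the \<open>m\<close>-linear maps \<open>f i\<close> tend to \<open>0\<close>, or stay bounded,
  in operator norm along \<open>F\<close>.\<close>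

definition usmall :: "'i filter \<Rightarrow> 'p set \<Rightarrow> ('i \<Rightarrow> 'p \<Rightarrow> real) \<Rightarrow> ('i \<Rightarrow> 'p \<Rightarrow> 'c::real_normed_vector) \<Rightarrow> bool"
  where "usmall F P w f \<longleftrightarrow> (\<forall>e>0. \<forall>\<^sub>F i in F. \<forall>p\<in>P. norm (f i p) \<le> e * w i p)"

definition ubdd :: "'i filter \<Rightarrow> 'p set \<Rightarrow> ('i \<Rightarrow> 'p \<Rightarrow> real) \<Rightarrow> ('i \<Rightarrow> 'p \<Rightarrow> 'c::real_normed_vector) \<Rightarrow> bool"
  where "ubdd F P w f \<longleftrightarrow> (\<exists>C>0. \<forall>\<^sub>F i in F. \<forall>p\<in>P. norm (f i p) \<le> C * w i p)"

lemma usmallD: "usmall F P w f \<Longrightarrow> e > 0 \<Longrightarrow> \<forall>\<^sub>F i in F. \<forall>p\<in>P. norm (f i p) \<le> e * w i p"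
  by (simp add: usmall_def)

lemma ubddE:
  assumes "ubdd F P w f"
  obtains C where "C > 0" "\<forall>\<^sub>F i in F. \<forall>p\<in>P. norm (f i p) \<le> C * w i p"
  using assms by (auto simp: ubdd_def)

lemma usmall_imp_ubdd: "usmall F P w f \<Longrightarrow> ubdd F P w f"
  unfolding ubdd_def using usmallD[of F P w f 1] zero_less_one by blast

text \<open>A comparison principle that may also change the parameter set: the dominating
  \<open>p\<close> can depend on \<open>i\<close> and \<open>q\<close>.\<close>

lemma usmall_le:
  assumes f: "usmall F P w f" and K: "K \<ge> 0"
    and le: "\<forall>\<^sub>F i in F. \<forall>q\<in>Q. \<exists>p\<in>P. norm (g i q) \<le> K * norm (f i p) \<and> w i p \<le> w' i q"
  shows "usmall F Q w' g"
  unfolding usmall_def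
proof (intro allI impI)
  fix e :: real assume "e > 0"
  \<comment> \<open>\<open>K + 1\<close> instead of \<open>K\<close>, as \<open>K = 0\<close> is
    allowed.\<close>
  then have e: "e / (K + 1) > 0" using K by simp
  show "\<forall>\<^sub>F i in F. \<forall>q\<in>Q. norm (g i q) \<le> e * w' i q"
    using usmallD[OF f e] le
  proof eventually_elim
    case (elim i)
    show ?case
    proof
      fix q assume "q \<in> Q"
      then obtain p where p: "p \<in> P" "norm (g i q) \<le> K * norm (f i p)" "w i p \<le> w' i q"
        using elim(2) by blast
      have 1: "norm (f i p) \<le> e / (K + 1) * w i p" using elim(1) p by blast
      \<comment> \<open>The weight carries no sign hypothesis; its nonnegativity at this
        \<open>p\<close> is read off from the estimate.\<close>
      have "0 \<le> e / (K + 1) * w i p" using 1 norm_ge_zero order_trans by blast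
      then have w: "0 \<le> w i p" using e by (metis linorder_not_less mult_pos_neg)
      have "norm (g i q) \<le> K * (e / (K + 1) * w i p)"
        using p(2) mult_left_mono[OF 1 K] by linarith
      also have "\<dots> \<le> (K + 1) * (e / (K + 1) * w i p)"
        using 1 norm_ge_zero[of "f i p"] by (intro mult_right_mono) (simp, linarith)
      also have "\<dots> = e * w i p" using K by simp
      also have "\<dots> \<le> e * w' i q" using p \<open>e > 0\<close> by simp
      finally show "norm (g i q) \<le> e * w' i q" .
    qed
  qed
qed

text \<open>Typical use: with \<open>p = (y - x) # vs\<close>, a bound for a fixed
  \<open>(m + 1)\<close>-linear map becomes a bound of order \<open>norm (y - x)\<close> for its
  partial evaluation.\<close>

lemma ubdd_le:
  assumes f: "ubdd F P w f" and K: "K \<ge> 0"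
    and le: "\<forall>\<^sub>F i in F. \<forall>q\<in>Q. \<exists>p\<in>P. norm (g i q) \<le> K * norm (f i p) \<and> w i p \<le> w' i q"
  shows "ubdd F Q w' g"
proof -
  obtain C where C: "C > 0" and ev: "\<forall>\<^sub>F i in F. \<forall>p\<in>P. norm (f i p) \<le> C * w i p"
    using f by (rule ubddE)
  show ?thesis
    unfolding ubdd_def
  proof (intro exI[of _ "(K + 1) * C"] conjI)
    show "(K + 1) * C > 0" using K C by simp
    show "\<forall>\<^sub>F i in F. \<forall>q\<in>Q. norm (g i q) \<le> (K + 1) * C * w' i q"
      using ev le
    proof eventually_elim
      case (elim i)
      show ?case
      proof
        fix q assume "q \<in> Q"
        then obtain p where p: "p \<in> P" "norm (g i q) \<le> K * norm (f i p)" "w i p \<le> w' i q"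
          using elim(2) by blast
        have 1: "norm (f i p) \<le> C * w i p" using elim(1) p by blast
        have "norm (g i q) \<le> K * (C * w i p)"
          using p(2) mult_left_mono[OF 1 K] by linarith
        also have "\<dots> \<le> (K + 1) * (C * w i p)"
          using 1 norm_ge_zero[of "f i p"] by (intro mult_right_mono) (simp, linarith)
        also have "\<dots> \<le> (K + 1) * (C * w' i q)"
          using p K C by (intro mult_left_mono) auto
        finally show "norm (g i q) \<le> (K + 1) * C * w' i q" by (simp add: mult.assoc)
      qed
    qed
  qed
qed

lemma usmall_add:
  assumes "usmall F P w f" "usmall F P w g"
  shows "usmall F P w (\<lambda>i p. f i p + g i p)"
  unfolding usmall_def
proof (intro allI impI)
  fix e :: real assume "e > 0"
  then have e: "e / 2 > 0" by simp
  show "\<forall>\<^sub>F i in F. \<forall>p\<in>P. norm (f i p + g i p) \<le> e * w i p"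
    using usmallD[OF assms(1) e] usmallD[OF assms(2) e]
  proof eventually_elim
    case (elim i)
    show ?case
    proof
      fix p assume p: "p \<in> P"
      have "norm (f i p + g i p) \<le> e / 2 * w i p + e / 2 * w i p"
        using elim p by (intro norm_triangle_le add_mono) auto
      then show "norm (f i p + g i p) \<le> e * w i p" by simp
    qed
  qed
qed

lemma ubdd_add:
  assumes "ubdd F P w f" "ubdd F P w g"
  shows "ubdd F P w (\<lambda>i p. f i p + g i p)"
proof -
  obtain C where C: "C > 0" "\<forall>\<^sub>F i in F. \<forall>p\<in>P. norm (f i p) \<le> C * w i p"
    using assms(1) by (rule ubddE)
  obtain D where D: "D > 0" "\<forall>\<^sub>F i in F. \<forall>p\<in>P. norm (g i p) \<le> D * w i p"
    using assms(2) by (rule ubddE)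
  show ?thesis
    unfolding ubdd_def
  proof (intro exI[of _ "C + D"] conjI)
    show "\<forall>\<^sub>F i in F. \<forall>p\<in>P. norm (f i p + g i p) \<le> (C + D) * w i p"
      using C(2) D(2)
      by eventually_elim (auto simp: distrib_right intro!: norm_triangle_le add_mono)
  qed (use C D in auto)
qed

lemma usmall_uminus: "usmall F P w (\<lambda>i p. - f i p) \<longleftrightarrow> usmall F P w f"
  by (simp add: usmall_def)

lemma ubdd_uminus: "ubdd F P w (\<lambda>i p. - f i p) \<longleftrightarrow> ubdd F P w f"
  by (simp add: ubdd_def)

lemma usmall_cong:
  assumes "usmall F P w f" "\<forall>\<^sub>F i in F. \<forall>p\<in>P. f i p = g i p"
  shows "usmall F P w g"
  by (rule usmall_le[OF assms(1), of 1]) (use assms(2) in \<open>auto elim!: eventually_mono\<close>)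

lemma ubdd_cong:
  assumes "ubdd F P w f" "\<forall>\<^sub>F i in F. \<forall>p\<in>P. f i p = g i p"
  shows "ubdd F P w g"
  by (rule ubdd_le[OF assms(1), of 1]) (use assms(2) in \<open>auto elim!: eventually_mono\<close>)

lemma usmall_zero: "(\<And>i p. p \<in> P \<Longrightarrow> 0 \<le> w i p) \<Longrightarrow> usmall F P w (\<lambda>i p. 0)"
  by (auto simp: usmall_def)

lemma mbdd_imp_ubdd: "mbdd V m L \<Longrightarrow> ubdd F (vl V m) (\<lambda>i. pn) (\<lambda>i. L)"
  unfolding mbdd_def ubdd_def
proof (elim exE conjE)
  fix C assume "C \<ge> 0" and C: "\<forall>vs\<in>vl V m. norm (L vs) \<le> C * pn vs"
  have "C * pn vs \<le> (C + 1) * pn vs" for vs :: "'a list"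
    by (intro mult_right_mono) auto
  then show "\<exists>C>0. \<forall>\<^sub>F i in F. \<forall>vs\<in>vl V m. norm (L vs) \<le> C * pn vs"
    using C \<open>C \<ge> 0\<close>
    by (intro exI[of _ "C + 1"] conjI always_eventually) (auto intro: order_trans)
qed

section \<open>Set partitions of lists and products of multilinear families\<close>

text \<open>\<open>splits vs\<close> enumerates the set partitions of the positions of \<open>vs\<close>; a new head either forms its own
  first block or is prepended to an existing block. Differentiating a term of the formula of Faa di Bruno in a new
  direction \<open>h\<close> has exactly this effect, and \<open>h\<close> is always the first argument of the next derivative.\<close>

definition ext :: "'a \<Rightarrow> 'a list list \<Rightarrow> 'a list list list"
  where "ext h bs = ([h] # bs) # map (\<lambda>i. bs[i := h # bs ! i]) [0..<length bs]"

primrec splits :: "'a list \<Rightarrow> 'a list list list" where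
  "splits [] = [[]]"
| "splits (h # vs) = concat (map (ext h) (splits vs))"

lemma sum_list_concat_map:
  "(\<Sum>y\<leftarrow>concat (map g xs). f y) = (\<Sum>x\<leftarrow>xs. \<Sum>y\<leftarrow>g x. (f y :: 'b::comm_monoid_add))"
  by (induction xs) auto

lemma sum_ext: "(\<Sum>cs\<leftarrow>ext h bs. t cs)
    = t ([h] # bs) + (\<Sum>i<length bs. (t (bs[i := h # bs ! i]) :: 'b::comm_monoid_add))"
  by (simp add: ext_def comp_def interv_sum_list_conv_sum_set_nat atLeast0LessThan)

lemma sum_splits_Cons: "(\<Sum>bs\<leftarrow>splits (h # vs). t bs)
    = (\<Sum>bs\<leftarrow>splits vs. t ([h] # bs) + (\<Sum>i<length bs. (t (bs[i := h # bs ! i]) :: 'b::comm_monoid_add)))"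
  by (simp add: sum_list_concat_map sum_ext)

text \<open>Only the multiset of entries is recorded, since products of norms and membership in a
  subspace do not depend on the order.\<close>

definition is_part :: "'a list \<Rightarrow> 'a list list \<Rightarrow> bool"
  where "is_part vs bs \<longleftrightarrow> [] \<notin> set bs \<and> mset (concat bs) = mset vs"

lemma ext_part:
  assumes "is_part vs bs" "cs \<in> set (ext h bs)"
  shows "is_part (h # vs) cs"
proof -
  have "is_part (h # vs) (bs[i := h # bs ! i])" if i: "i < length bs" for i
  proof -
    have bs: "mset (concat bs) = mset (concat (take i bs)) + mset (bs ! i) + mset (concat (drop (Suc i) bs))"
      by (subst id_take_nth_drop[OF i]) simp
    have "mset (concat (bs[i := h # bs ! i]))
        = mset (concat (take i bs)) + mset (h # bs ! i) + mset (concat (drop (Suc i) bs))"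
      using i by (simp add: upd_conv_take_nth_drop)
    moreover have "[] \<notin> set (bs[i := h # bs ! i])"
      using assms(1) set_update_subset_insert[of bs i "h # bs ! i"] by (auto simp: is_part_def)
    ultimately show ?thesis
      using assms(1) bs by (simp add: is_part_def)
  qed
  with assms show ?thesis
    by (auto simp: ext_def is_part_def)
qed

lemma splits_part: "bs \<in> set (splits vs) \<Longrightarrow> is_part vs bs"
proof (induction vs arbitrary: bs)
  case Nil
  then show ?case by (simp add: is_part_def)
next
  case (Cons h vs)
  then show ?case by (auto intro: ext_part)
qed

lemma partD:
  assumes "is_part vs bs" "vs \<in> vl V m"
  shows "\<forall>b\<in>set bs. set b \<subseteq> V" "pn (concat bs) = pn vs" "sum_list (map length bs) = m"
    "length bs \<le> m" "\<forall>b\<in>set bs. 0 < length b \<and> length b \<le> m"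
proof -
  have ms: "mset (concat bs) = mset vs" and ne: "[] \<notin> set bs"
    using assms by (auto simp: is_part_def)
  have "set (concat bs) \<subseteq> V"
    using mset_eq_setD[OF ms] assms(2) by (auto simp: vl_def)
  then show "\<forall>b\<in>set bs. set b \<subseteq> V" by auto
  show "pn (concat bs) = pn vs" using pn_mset[OF ms] .
  show s: "sum_list (map length bs) = m"
    using mset_eq_length[OF ms] assms(2) by (simp add: length_concat vl_def)
  have "length bs \<le> sum_list (map length bs)"
    using ne
  proof (induction bs)
    case (Cons b bs)
    then have "length b \<ge> 1" by (cases b) auto
    moreover have "length bs \<le> sum_list (map length bs)" using Cons by simp
    ultimately show ?case by simp
  qed simp
  then show "length bs \<le> m" by (simp add: s)
  show "\<forall>b\<in>set bs. 0 < length b \<and> length b \<le> m"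
    using ne member_le_sum_list[of _ "map length bs"] s by force
qed

text \<open>The possible lists of block lengths. They are finitely many, so a bound that holds
  eventually for each shape holds eventually for all partitions at once.\<close>

definition shapes :: "nat \<Rightarrow> nat list set"
  where "shapes m = {ls. sum_list ls = m \<and> 0 \<notin> set ls}"

lemma shapes_length: "ls \<in> shapes m \<Longrightarrow> length ls \<le> m"
proof -
  have "0 \<notin> set ls \<Longrightarrow> length ls \<le> sum_list ls" for ls :: "nat list"
    by (induction ls) auto
  then show "ls \<in> shapes m \<Longrightarrow> length ls \<le> m" by (auto simp: shapes_def)
qed

lemma shapes_elem: "ls \<in> shapes m \<Longrightarrow> l \<in> set ls \<Longrightarrow> 0 < l \<and> l \<le> m"
  using member_le_sum_list[of l ls] by (auto simp: shapes_def intro: gr0I)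

lemma finite_shapes: "finite (shapes m)"
proof (rule finite_subset)
  show "shapes m \<subseteq> {ls. set ls \<subseteq> {..m} \<and> length ls \<le> m}"
    using shapes_length shapes_elem by blast
qed (simp add: finite_lists_length_le)

lemma part_shape: fixes vs :: "'a::real_normed_vector list" shows "is_part vs bs \<Longrightarrow> vs \<in> vl V m \<Longrightarrow> map length bs \<in> shapes m"
  using partD[of vs bs V m] by (auto simp: shapes_def)

text \<open>A set partition of \<open>m\<close> points has at most \<open>m\<close> blocks, hence at
  most \<open>m + 1\<close> extensions by a new head.\<close>

lemma length_splits_bound: "\<exists>K>0. \<forall>vs::'a::real_normed_vector list. length vs = m \<longrightarrow> length (splits vs) \<le> K"
proof (induction m)
  case 0
  show ?case by (rule exI[of _ 1]) auto
next
  case (Suc m)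
  then obtain K where K: "K > 0" and K': "\<forall>vs::'a list. length vs = m \<longrightarrow> length (splits vs) \<le> K"
    by (elim exE conjE)
  have "length (splits vs) \<le> K * Suc m" if len: "length vs = Suc m" for vs :: "'a list"
  proof -
    obtain h ws where vs: "vs = h # ws" "length ws = m"
      using len by (cases vs) auto
    have "length (splits vs) = (\<Sum>bs\<leftarrow>splits ws. Suc (length bs))"
      by (simp add: vs length_concat comp_def ext_def)
    also have "\<dots> \<le> (\<Sum>bs\<leftarrow>splits ws. Suc m)"
    proof (rule sum_list_mono)
      fix bs assume "bs \<in> set (splits ws)"
      then show "Suc (length bs) \<le> Suc m"
        using partD(4)[OF splits_part, of bs ws UNIV m] vs by (simp add: vl_def)
    qed
    also have "\<dots> = length (splits ws) * Suc m" by (simp add: sum_list_triv)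
    also have "\<dots> \<le> K * Suc m" using K' vs by (intro mult_right_mono) auto
    finally show ?thesis .
  qed
  with K show ?case by (intro exI[of _ "K * Suc m"]) auto
qed

definition blks :: "'a set \<Rightarrow> nat list \<Rightarrow> 'a list list set"
  where "blks V ls = {bs. map length bs = ls \<and> (\<forall>b\<in>set bs. set b \<subseteq> V)}"

lemma part_blks: fixes vs :: "'a::real_normed_vector list" shows "is_part vs bs \<Longrightarrow> vs \<in> vl V m \<Longrightarrow> bs \<in> blks V (map length bs)"
  using partD(1)[of vs bs V m] by (auto simp: blks_def)

lemma blks_snocE:
  assumes "bs \<in> blks V (ls @ [m])"
  obtains bs' b where "bs = bs' @ [b]" "bs' \<in> blks V ls" "b \<in> vl V m"
proof -
  have "map length bs = ls @ [m]" using assms by (simp add: blks_def)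
  then obtain bs' b where "bs = bs' @ [b]" "map length bs' = ls" "length b = m"
    by (auto simp: map_eq_append_conv)
  with assms that show ?thesis by (auto simp: blks_def vl_def)
qed

lemma eventually_splits:
  assumes "\<And>ls. ls \<in> shapes m \<Longrightarrow> \<forall>\<^sub>F i in F. \<forall>bs\<in>blks V ls. norm (t i bs) \<le> C ls * (\<eta> i * pn (concat bs))"
  shows "\<forall>\<^sub>F i in F. \<forall>vs\<in>vl V m. \<forall>bs. is_part vs bs \<longrightarrow> norm (t i bs) \<le> C (map length bs) * (\<eta> i * pn vs)"
proof -
  have "\<forall>\<^sub>F i in F. \<forall>ls\<in>shapes m. \<forall>bs\<in>blks V ls. norm (t i bs) \<le> C ls * (\<eta> i * pn (concat bs))"
    using assms by (intro eventually_ball_finite finite_shapes) auto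
  then show ?thesis
  proof eventually_elim
    case (elim i)
    show ?case
    proof (intro ballI allI impI)
      fix vs bs assume vs: "vs \<in> vl V m" and bs: "is_part vs bs"
      show "norm (t i bs) \<le> C (map length bs) * (\<eta> i * pn vs)"
        using elim[rule_format, OF part_shape[OF bs vs] part_blks[OF bs vs]]
        by (simp only: partD(2)[OF bs vs])
    qed
  qed
qed

lemma norm_sum_list_le:
  fixes f :: "'x \<Rightarrow> 'y::real_normed_vector"
  shows "(\<And>x. x \<in> set xs \<Longrightarrow> norm (f x) \<le> c) \<Longrightarrow> norm (\<Sum>x\<leftarrow>xs. f x) \<le> real (length xs) * c"
  by (induction xs) (auto simp: algebra_simps intro!: norm_triangle_le add_mono)

text \<open>\<open>S\<close> stands for \<open>splits\<close> or for \<open>rests\<close>. Smallness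
  of \<open>t\<close> is asked only for shapes that occur in \<open>S\<close>: for
  \<open>rests\<close> the one-block shape, which carries the derivative of top order, is not under
  control when the lemma is applied.\<close>

lemma usmall_splits:
  fixes t :: "'i \<Rightarrow> 'a::real_normed_vector list list \<Rightarrow> 'c::real_normed_vector"
  assumes t: "\<And>ls. ls \<in> shapes m \<Longrightarrow> (\<exists>vs\<in>vl V m. \<exists>bs\<in>set (S vs). map length bs = ls) \<Longrightarrow>
      usmall F (blks V ls) (\<lambda>i bs. \<eta> i * pn (concat bs)) t"
    and S: "\<And>vs. set (S vs) \<subseteq> set (splits vs)" and len: "\<And>vs. length (S vs) \<le> length (splits vs)"
    and \<eta>: "\<And>i. \<eta> i \<ge> 0"
  shows "usmall F (vl V m) (\<lambda>i vs. \<eta> i * pn vs) (\<lambda>i vs. \<Sum>bs\<leftarrow>S vs. t i bs)"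
  unfolding usmall_def
proof (intro allI impI)
  fix e :: real assume "e > 0"
  obtain K where K: "K > 0" "\<forall>vs::'a list. length vs = m \<longrightarrow> length (splits vs) \<le> K"
    using length_splits_bound[of m] by (elim exE conjE)
  have e: "e / K > 0" using \<open>e > 0\<close> K by simp
  \<comment> \<open>Terms of shapes that do not occur are replaced by \<open>0\<close>, so that
    \<open>eventually_splits\<close> can be applied to all shapes.\<close>
  define ok where "ok = (\<lambda>ls. \<exists>vs\<in>vl V m. \<exists>bs\<in>set (S vs). map length bs = ls)"
  have "\<forall>\<^sub>F i in F. \<forall>vs\<in>vl V m. \<forall>bs. is_part vs bs \<longrightarrow>
      norm (if ok (map length bs) then t i bs else 0) \<le> (e / K) * (\<eta> i * pn vs)"
  proof (rule eventually_splits[where C = "\<lambda>_. e / K" and t = "\<lambda>i bs. if ok (map length bs) then t i bs else 0"])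
    fix ls assume ls: "ls \<in> shapes m"
    show "\<forall>\<^sub>F i in F. \<forall>bs\<in>blks V ls.
        norm (if ok (map length bs) then t i bs else 0) \<le> (e / K) * (\<eta> i * pn (concat bs))"
    proof (cases "ok ls")
      case True
      then show ?thesis
        using usmallD[OF t[OF ls] e] by (simp add: ok_def blks_def)
    next
      case False
      then show ?thesis
        using \<open>e > 0\<close> \<eta> by (auto simp: blks_def intro!: always_eventually)
    qed
  qed
  then show "\<forall>\<^sub>F i in F. \<forall>vs\<in>vl V m. norm (\<Sum>bs\<leftarrow>S vs. t i bs) \<le> e * (\<eta> i * pn vs)"
  proof eventually_elim
    case (elim i)
    show ?case
    proof
      fix vs assume vs: "vs \<in> vl V m"
      have "norm (\<Sum>bs\<leftarrow>S vs. t i bs) \<le> real (length (S vs)) * (e / real K * (\<eta> i * pn vs))"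
      proof (rule norm_sum_list_le)
        fix bs assume "bs \<in> set (S vs)"
        then have "is_part vs bs" "ok (map length bs)"
          using S splits_part vs by (blast, auto simp: ok_def)
        with elim vs show "norm (t i bs) \<le> e / K * (\<eta> i * pn vs)"
          by fastforce
      qed
      also have "\<dots> \<le> K * (e / K * (\<eta> i * pn vs))"
        using K(2)[rule_format, of vs] len[of vs] vs \<eta> e by (intro mult_right_mono mult_nonneg_nonneg) (auto simp: vl_def)
      also have "\<dots> = e * (\<eta> i * pn vs)" using K by simp
      finally show "norm (\<Sum>bs\<leftarrow>S vs. t i bs) \<le> e * (\<eta> i * pn vs)" .
    qed
  qed
qed

lemma ubdd_splits:
  fixes t :: "'i \<Rightarrow> 'a::real_normed_vector list list \<Rightarrow> 'c::real_normed_vector"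
  assumes t: "\<And>ls. ls \<in> shapes m \<Longrightarrow> ubdd F (blks V ls) (\<lambda>i bs. pn (concat bs)) t"
  shows "ubdd F (vl V m) (\<lambda>i. pn) (\<lambda>i vs. \<Sum>bs\<leftarrow>splits vs. t i bs)"
proof -
  obtain K where K: "K > 0" "\<forall>vs::'a list. length vs = m \<longrightarrow> length (splits vs) \<le> K"
    using length_splits_bound[of m] by (elim exE conjE)
  obtain C where C: "\<And>ls. ls \<in> shapes m \<Longrightarrow> C ls > 0 \<and>
      (\<forall>\<^sub>F i in F. \<forall>bs\<in>blks V ls. norm (t i bs) \<le> C ls * pn (concat bs))"
  proof -
    have "\<forall>ls\<in>shapes m. \<exists>C>0. \<forall>\<^sub>F i in F. \<forall>bs\<in>blks V ls. norm (t i bs) \<le> C * pn (concat bs)"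
      using t unfolding ubdd_def by blast
    from bchoice[OF this] show thesis using that by blast
  qed
  \<comment> \<open>One constant for all of the finitely many shapes; the entry \<open>1\<close>
    makes it positive.\<close>
  define M where "M = Max (insert 1 (C ` shapes m))"
  have M: "M \<ge> 1" "\<And>ls. ls \<in> shapes m \<Longrightarrow> C ls \<le> M"
    using finite_shapes by (auto simp: M_def)
  have "\<forall>\<^sub>F i in F. \<forall>vs\<in>vl V m. \<forall>bs. is_part vs bs \<longrightarrow> norm (t i bs) \<le> C (map length bs) * (1 * pn vs)"
    using C by (intro eventually_splits[where \<eta> = "\<lambda>_. 1"]) auto
  then have "\<forall>\<^sub>F i in F. \<forall>vs\<in>vl V m. norm (\<Sum>bs\<leftarrow>splits vs. t i bs) \<le> K * M * pn vs"
  proof eventually_elim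
    case (elim i)
    show ?case
    proof
      fix vs assume vs: "vs \<in> vl V m"
      have "norm (\<Sum>bs\<leftarrow>splits vs. t i bs) \<le> length (splits vs) * (M * pn vs)"
      proof (rule norm_sum_list_le)
        fix bs assume "bs \<in> set (splits vs)"
        then have bs: "is_part vs bs" by (rule splits_part)
        then have "norm (t i bs) \<le> C (map length bs) * pn vs" using elim vs by simp
        also have "\<dots> \<le> M * pn vs"
          using M(2)[OF part_shape[OF bs vs]] by (intro mult_right_mono) auto
        finally show "norm (t i bs) \<le> M * pn vs" .
      qed
      also have "\<dots> \<le> K * (M * pn vs)"
        using K(2)[rule_format, of vs] vs M by (intro mult_right_mono) (auto simp: vl_def)
      finally show "norm (\<Sum>bs\<leftarrow>splits vs. t i bs) \<le> K * M * pn vs" by (simp add: mult.assoc)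
    qed
  qed
  then show ?thesis unfolding ubdd_def using K M by (intro exI[of _ "K * M"]) auto
qed

section \<open>Products of multilinear families: bounds, limits and the product rule\<close>

definition mdiff :: "'a set \<Rightarrow> nat \<Rightarrow> ('a::minus list \<Rightarrow> 'c::minus) \<Rightarrow> bool"
  where "mdiff V m L \<longleftrightarrow> (\<forall>as bs u v. set as \<subseteq> V \<and> set bs \<subseteq> V \<and> u \<in> V \<and> v \<in> V \<and> length as + length bs + 1 = m
    \<longrightarrow> L (as @ (u - v) # bs) = L (as @ u # bs) - L (as @ v # bs))"

lemma mdiffD:
  assumes "mdiff V m L" "set as \<subseteq> V" "set bs \<subseteq> V" "u \<in> V" "v \<in> V" "length as + length bs + 1 = m"
  shows "L (as @ (u - v) # bs) = L (as @ u # bs) - L (as @ v # bs)"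
  using assms by (auto simp: mdiff_def)

lemma (in two_spaces) mlin_mdiff: "mlin sa sc V m L \<Longrightarrow> A.subspace V \<Longrightarrow> mdiff V m L"
  using mlin_diff unfolding mdiff_def by blast

lemma half_half: "e / 2 * r + e / 2 * r = e * (r::real)"
  by simp

lemma three_thirds: "e / 3 * r + e / 3 * r + e / 3 * r = e * (r::real)"
  by simp

lemma weight_mono1:
  "norm v \<le> y \<Longrightarrow> 0 \<le> D \<Longrightarrow> D * (pn as * pn (v # rest)) \<le> D * (pn as * (y * pn rest))"
  by (simp add: mult_left_mono mult_right_mono)

lemma weight_mono2:
  "norm v \<le> y \<Longrightarrow> 0 \<le> D \<Longrightarrow> 0 \<le> h \<Longrightarrow>
    D * (h * (pn as * pn (v # rest))) \<le> D * (h * (pn as * (y * pn rest)))"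
  by (simp add: mult_left_mono mult_right_mono)

text \<open>Partially filled argument lists of a \<open>j\<close>-linear map: the first
  \<open>length ls\<close> slots take images of blocks, the others hold free vectors
  \<open>rest\<close>. The inductions on \<open>ls\<close> move the image of the last block from
  \<open>bs\<close> into \<open>rest\<close>.\<close>

definition tset :: "'a set \<Rightarrow> 'b set \<Rightarrow> nat list \<Rightarrow> nat \<Rightarrow> ('a list list \<times> 'b list) set"
  where "tset V V2 ls j = {(bs, rest). bs \<in> blks V ls \<and> rest \<in> vl V2 (j - length ls)}"

lemma map_blks_vl:
  assumes "bs \<in> blks V ls" "\<And>b. length b \<in> set ls \<Longrightarrow> set b \<subseteq> V \<Longrightarrow> Y b \<in> V2"
  shows "map Y bs \<in> vl V2 (length ls)"
  using assms unfolding blks_def vl_def by (auto simp: subset_iff)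

lemma term_bdd:
  assumes Y: "\<And>m. m \<in> set ls \<Longrightarrow> ubdd F (vl V m) (\<lambda>i. pn) Y"
    and YV: "\<forall>\<^sub>F i in F. \<forall>b. length b \<in> set ls \<longrightarrow> set b \<subseteq> V \<longrightarrow> Y i b \<in> V2"
    and X: "ubdd F (vl V2 j) (\<lambda>i vs. \<eta> i * pn vs) X" and \<eta>: "\<And>i. \<eta> i \<ge> 0"
    and len: "length ls \<le> j"
  shows "ubdd F (tset V V2 ls j) (\<lambda>i (bs, rest). \<eta> i * (pn (concat bs) * pn rest))
    (\<lambda>i (bs, rest). X i (map (Y i) bs @ rest))"
  using Y YV len
proof (induction ls rule: rev_induct)
  case Nil
  show ?case
    by (rule ubdd_le[OF X, of 1]) (auto simp: tset_def blks_def intro!: always_eventually)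
next
  case (snoc m ls)
  have IH: "ubdd F (tset V V2 ls j) (\<lambda>i (bs, rest). \<eta> i * (pn (concat bs) * pn rest))
      (\<lambda>i (bs, rest). X i (map (Y i) bs @ rest))"
  proof (rule snoc.IH)
    show "\<forall>\<^sub>F i in F. \<forall>b. length b \<in> set ls \<longrightarrow> set b \<subseteq> V \<longrightarrow> Y i b \<in> V2"
      using snoc.prems(2) by (elim eventually_mono) auto
  qed (use snoc.prems in auto)
  obtain C where C: "C > 0" "\<forall>\<^sub>F i in F. \<forall>b\<in>vl V m. norm (Y i b) \<le> C * pn b"
    using snoc.prems(1)[of m] by (auto elim: ubddE)
  obtain D where D: "D > 0" "\<forall>\<^sub>F i in F. \<forall>p\<in>tset V V2 ls j.
      norm (case p of (bs, rest) \<Rightarrow> X i (map (Y i) bs @ rest))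
        \<le> D * (case p of (bs, rest) \<Rightarrow> \<eta> i * (pn (concat bs) * pn rest))"
    using IH by (rule ubddE)
  show ?case
    unfolding ubdd_def
  proof (intro exI[of _ "D * C"] conjI)
    show "D * C > 0" using C D by simp
    show "\<forall>\<^sub>F i in F. \<forall>p\<in>tset V V2 (ls @ [m]) j.
      norm (case p of (bs, rest) \<Rightarrow> X i (map (Y i) bs @ rest))
        \<le> D * C * (case p of (bs, rest) \<Rightarrow> \<eta> i * (pn (concat bs) * pn rest))"
      using C(2) D(2) snoc.prems(2)
    proof eventually_elim
      case (elim i)
      show ?case
      proof (clarify)
        fix bs0 rest assume p: "(bs0, rest) \<in> tset V V2 (ls @ [m]) j"
        then obtain bs b where bs: "bs0 = bs @ [b]" "bs \<in> blks V ls" "b \<in> vl V m"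
          by (auto simp: tset_def elim: blks_snocE)
        have q: "(bs, Y i b # rest) \<in> tset V V2 ls j"
          using p bs elim(3) snoc.prems(3)
          by (auto simp: tset_def vl_def)
        have "norm (X i (map (Y i) bs @ Y i b # rest)) \<le> D * (\<eta> i * (pn (concat bs) * pn (Y i b # rest)))"
          using bspec[OF elim(2) q] by (simp only: prod.case mult_1)
        also have "\<dots> \<le> D * (\<eta> i * (pn (concat bs) * ((C * pn b) * pn rest)))"
          using elim(1) bs D \<eta> by (intro weight_mono1 weight_mono2) auto
        finally show "norm (X i (map (Y i) bs0 @ rest)) \<le> D * C * (\<eta> i * (pn (concat bs0) * pn rest))"
          by (simp add: bs mult_ac)
      qed
    qed
  qed
qed

text \<open>A product of convergent factors converges. With the last block \<open>b\<close> moved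
  into \<open>rest\<close>, the difference is the induction hypothesis at
  \<open>Y i b # rest\<close> plus \<open>X' i\<close> with \<open>Y i b - Y' i b\<close> in the
  slot of \<open>b\<close>.\<close>

lemma term_cont:
  assumes Y: "\<And>m. m \<in> set ls \<Longrightarrow> ubdd F (vl V m) (\<lambda>i. pn) Y"
    and Y': "\<And>m. m \<in> set ls \<Longrightarrow> ubdd F (vl V m) (\<lambda>i. pn) Y'"
    and YY': "\<And>m. m \<in> set ls \<Longrightarrow> usmall F (vl V m) (\<lambda>i. pn) (\<lambda>i b. Y i b - Y' i b)"
    and YV: "\<forall>\<^sub>F i in F. \<forall>b. length b \<in> set ls \<longrightarrow> set b \<subseteq> V \<longrightarrow> Y i b \<in> V2 \<and> Y' i b \<in> V2"
    and V2: "\<And>u v. u \<in> V2 \<Longrightarrow> v \<in> V2 \<Longrightarrow> u - v \<in> V2"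
    and X': "ubdd F (vl V2 j) (\<lambda>i. pn) X'"
    and XX': "usmall F (vl V2 j) (\<lambda>i. pn) (\<lambda>i vs. X i vs - X' i vs)"
    and md: "\<forall>\<^sub>F i in F. mdiff V2 j (X' i)"
    and len: "length ls \<le> j"
  shows "usmall F (tset V V2 ls j) (\<lambda>i (bs, rest). pn (concat bs) * pn rest)
    (\<lambda>i (bs, rest). X i (map (Y i) bs @ rest) - X' i (map (Y' i) bs @ rest))"
  using Y Y' YY' YV len
proof (induction ls rule: rev_induct)
  case Nil
  show ?case
    by (rule usmall_le[OF XX', of 1]) (auto simp: tset_def blks_def intro!: always_eventually)
next
  case (snoc m ls)
  have YV: "\<forall>\<^sub>F i in F. \<forall>b. length b \<in> set ls \<longrightarrow> set b \<subseteq> V \<longrightarrow> Y i b \<in> V2 \<and> Y' i b \<in> V2"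
    using snoc.prems(4) by (elim eventually_mono) auto
  have IH: "usmall F (tset V V2 ls j) (\<lambda>i (bs, rest). pn (concat bs) * pn rest)
    (\<lambda>i (bs, rest). X i (map (Y i) bs @ rest) - X' i (map (Y' i) bs @ rest))"
    by (rule snoc.IH) (use snoc.prems YV in auto)
  have B: "ubdd F (tset V V2 ls j) (\<lambda>i (bs, rest). 1 * (pn (concat bs) * pn rest))
      (\<lambda>i (bs, rest). X' i (map (Y' i) bs @ rest))"
  proof (rule term_bdd)
    show "\<forall>\<^sub>F i in F. \<forall>b. length b \<in> set ls \<longrightarrow> set b \<subseteq> V \<longrightarrow> Y' i b \<in> V2"
      using YV by (elim eventually_mono) auto
  qed (use snoc.prems X' in auto)
  obtain C where C: "C > 0" "\<forall>\<^sub>F i in F. \<forall>b\<in>vl V m. norm (Y i b) \<le> C * pn b"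
    using snoc.prems(1)[of m] by (auto elim: ubddE)
  obtain D where D: "D > 0" "\<forall>\<^sub>F i in F. \<forall>p\<in>tset V V2 ls j.
      norm (case p of (bs, rest) \<Rightarrow> X' i (map (Y' i) bs @ rest))
        \<le> D * (case p of (bs, rest) \<Rightarrow> 1 * (pn (concat bs) * pn rest))"
    using B by (rule ubddE)
  show ?case
    unfolding usmall_def
  proof (intro allI impI)
    fix e :: real assume e: "e > 0"
    \<comment> \<open>\<open>C\<close> bounds the image of the last block, \<open>D\<close> the
      product of the other factors; each of the two terms then contributes
      \<open>e / 2\<close>.\<close>
    define e1 where "e1 = e / (2 * C)"
    define e2 where "e2 = e / (2 * D)"
    have e12: "e1 > 0" "e2 > 0" using e C D by (auto simp: e1_def e2_def)
    have small: "\<forall>\<^sub>F i in F. \<forall>b\<in>vl V m. norm (Y i b - Y' i b) \<le> e2 * pn b"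
      using snoc.prems(3)[of m] e12 by (auto dest: usmallD)
    show "\<forall>\<^sub>F i in F. \<forall>p\<in>tset V V2 (ls @ [m]) j.
        norm (case p of (bs, rest) \<Rightarrow> X i (map (Y i) bs @ rest) - X' i (map (Y' i) bs @ rest))
        \<le> e * (case p of (bs, rest) \<Rightarrow> pn (concat bs) * pn rest)"
      using C(2) D(2) usmallD[OF IH e12(1)] small snoc.prems(4) md
    proof eventually_elim
      case (elim i)
      show ?case
      proof clarify
        fix bs0 rest assume p: "(bs0, rest) \<in> tset V V2 (ls @ [m]) j"
        then obtain bs b where bs: "bs0 = bs @ [b]" "bs \<in> blks V ls" "b \<in> vl V m"
          by (auto simp: tset_def elim: blks_snocE)
        have Yb: "Y i b \<in> V2" "Y' i b \<in> V2"
          using elim(5) bs by (auto simp: vl_def)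
        have q: "(bs, y # rest) \<in> tset V V2 ls j" if "y \<in> V2" for y
          using p bs that snoc.prems(5) by (auto simp: tset_def vl_def)
        have mv: "map (Y' i) bs \<in> vl V2 (length ls)"
          by (rule map_blks_vl[OF bs(2)]) (use elim(5) in auto)
        have rest: "rest \<in> vl V2 (j - Suc (length ls))" using p by (auto simp: tset_def)
        have *: "X' i (map (Y' i) bs @ (Y i b - Y' i b) # rest)
            = X' i (map (Y' i) bs @ Y i b # rest) - X' i (map (Y' i) bs @ Y' i b # rest)"
          by (rule mdiffD[OF elim(6)]) (use mv rest Yb snoc.prems(5) in \<open>auto simp: vl_def\<close>)
        have 1: "norm (X i (map (Y i) bs @ Y i b # rest) - X' i (map (Y' i) bs @ Y i b # rest))
            \<le> e1 * (pn (concat bs) * pn (Y i b # rest))"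
          using bspec[OF elim(3) q[OF Yb(1)]] by (simp only: prod.case mult_1)
        also have "\<dots> \<le> e1 * (pn (concat bs) * ((C * pn b) * pn rest))"
          using elim(1) bs e12 by (intro weight_mono1 weight_mono2) auto
        also have "\<dots> = e / 2 * (pn (concat bs0) * pn rest)"
          using C by (simp add: e1_def bs field_simps)
        finally have 1: "norm (X i (map (Y i) bs @ Y i b # rest) - X' i (map (Y' i) bs @ Y i b # rest))
            \<le> e / 2 * (pn (concat bs0) * pn rest)" .
        have "norm (X' i (map (Y' i) bs @ (Y i b - Y' i b) # rest))
            \<le> D * (pn (concat bs) * pn ((Y i b - Y' i b) # rest))"
          using bspec[OF elim(2) q[OF V2[OF Yb]]] by (simp only: prod.case mult_1)
        also have "\<dots> \<le> D * (pn (concat bs) * ((e2 * pn b) * pn rest))"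
          using elim(4) bs D by (intro weight_mono1 weight_mono2) auto
        also have "\<dots> = e / 2 * (pn (concat bs0) * pn rest)"
          using D by (simp add: e2_def bs field_simps)
        finally have 2: "norm (X' i (map (Y' i) bs @ (Y i b - Y' i b) # rest))
            \<le> e / 2 * (pn (concat bs0) * pn rest)" .
        have "norm (X i (map (Y i) bs0 @ rest) - X' i (map (Y' i) bs0 @ rest))
          = norm ((X i (map (Y i) bs @ Y i b # rest) - X' i (map (Y' i) bs @ Y i b # rest))
              + X' i (map (Y' i) bs @ (Y i b - Y' i b) # rest))"
          unfolding * by (simp add: bs)
        also have "\<dots> \<le> e / 2 * (pn (concat bs0) * pn rest) + e / 2 * (pn (concat bs0) * pn rest)"
          using 1 2 by (rule norm_triangle_mono)
        finally show "norm (X i (map (Y i) bs0 @ rest) - X' i (map (Y' i) bs0 @ rest))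
            \<le> e * (pn (concat bs0) * pn rest)" by (simp only: half_half)
      qed
    qed
  qed
qed

text \<open>The right hand side of the product rule for \<open>X (map Y bs @ rest)\<close>, where
  \<open>X1\<close> and \<open>Y1\<close> stand for the linear increments of \<open>X\<close> and
  \<open>Y\<close> in a fixed direction.\<close>

definition dterm :: "('b list \<Rightarrow> 'c) \<Rightarrow> ('b list \<Rightarrow> 'c) \<Rightarrow> ('a list \<Rightarrow> 'b) \<Rightarrow> ('a list \<Rightarrow> 'b)
    \<Rightarrow> 'a list list \<Rightarrow> 'b list \<Rightarrow> 'c::comm_monoid_add"
  where "dterm X X1 Y Y1 bs rest = X1 (map Y bs @ rest)
    + (\<Sum>l<length bs. X ((map Y bs)[l := Y1 (bs ! l)] @ rest))"

lemma dterm_snoc: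
  "dterm X X1 Y Y1 (bs @ [b]) rest
    = dterm X X1 Y Y1 bs (Y b # rest) + X (map Y bs @ Y1 b # rest)"
proof -
  have "X ((map Y (bs @ [b]))[l := Y1 ((bs @ [b]) ! l)] @ rest)
      = X ((map Y bs)[l := Y1 (bs ! l)] @ Y b # rest)" if "l < length bs" for l
    using that by (simp add: list_update_append nth_append)
  then have "(\<Sum>l<length bs. X ((map Y (bs @ [b]))[l := Y1 ((bs @ [b]) ! l)] @ rest))
      = (\<Sum>l<length bs. X ((map Y bs)[l := Y1 (bs ! l)] @ Y b # rest))"
    by (intro sum.cong) auto
  moreover have "(map Y (bs @ [b]))[length bs := Y1 ((bs @ [b]) ! length bs)] @ rest = map Y bs @ Y1 b # rest"
    by (simp add: list_update_append)
  ultimately show ?thesis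
    unfolding dterm_def by (simp only: length_append list.size add_0_right add_Suc_right
        sum.lessThan_Suc) (simp add: add_ac)
qed

text \<open>The product rule, with a remainder uniform over all arguments and \<open>\<eta>\<close>
  as the size of the increment. The three claims are proved together: besides the remainder, the
  induction step needs that \<open>dterm\<close> is of order \<open>\<eta>\<close> and additive in
  the free slots.\<close>

lemma term_diff:
  fixes \<eta> :: "'i \<Rightarrow> real" and X0 :: "'b::real_normed_vector list \<Rightarrow> 'c::real_normed_vector"
    and Y0 :: "'a::real_normed_vector list \<Rightarrow> 'b"
  assumes Y0: "\<And>m. m \<in> set ls \<Longrightarrow> ubdd F (vl V m) (\<lambda>i. pn) (\<lambda>i. Y0)"
    and Y1: "\<And>m. m \<in> set ls \<Longrightarrow> ubdd F (vl V m) (\<lambda>i b. \<eta> i * pn b) Y1"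
    and YY: "\<And>m. m \<in> set ls \<Longrightarrow> usmall F (vl V m) (\<lambda>i b. \<eta> i * pn b) (\<lambda>i b. Y i b - Y0 b - Y1 i b)"
    and YV: "\<forall>\<^sub>F i in F. \<forall>b. length b \<in> set ls \<longrightarrow> set b \<subseteq> V \<longrightarrow> Y i b \<in> V2 \<and> Y0 b \<in> V2 \<and> Y1 i b \<in> V2"
    and V2: "\<And>u v. u \<in> V2 \<Longrightarrow> v \<in> V2 \<Longrightarrow> u - v \<in> V2"
    and X0: "ubdd F (vl V2 j) (\<lambda>i. pn) (\<lambda>i. X0)"
    and X1: "ubdd F (vl V2 j) (\<lambda>i vs. \<eta> i * pn vs) X1"
    and XX: "usmall F (vl V2 j) (\<lambda>i vs. \<eta> i * pn vs) (\<lambda>i vs. X i vs - X0 vs - X1 i vs)"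
    and md: "mdiff V2 j X0" and md1: "\<forall>\<^sub>F i in F. mdiff V2 j (X1 i)"
    and \<eta>: "\<And>i. \<eta> i \<ge> 0" "(\<eta> \<longlongrightarrow> 0) F"
    and len: "length ls \<le> j"
  shows "usmall F (tset V V2 ls j) (\<lambda>i (bs, rest). \<eta> i * (pn (concat bs) * pn rest))
    (\<lambda>i (bs, rest). X i (map (Y i) bs @ rest) - X0 (map Y0 bs @ rest) - dterm X0 (X1 i) Y0 (Y1 i) bs rest)
    \<and> ubdd F (tset V V2 ls j) (\<lambda>i (bs, rest). \<eta> i * (pn (concat bs) * pn rest))
    (\<lambda>i (bs, rest). dterm X0 (X1 i) Y0 (Y1 i) bs rest)
    \<and> (\<forall>\<^sub>F i in F. \<forall>bs\<in>blks V ls. mdiff V2 (j - length ls) (dterm X0 (X1 i) Y0 (Y1 i) bs))"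
  using Y0 Y1 YY YV len
proof (induction ls rule: rev_induct)
  case Nil
  have "usmall F (tset V V2 [] j) (\<lambda>i (bs, rest). \<eta> i * (pn (concat bs) * pn rest))
    (\<lambda>i (bs, rest). X i (map (Y i) bs @ rest) - X0 (map Y0 bs @ rest) - dterm X0 (X1 i) Y0 (Y1 i) bs rest)"
    by (rule usmall_le[OF XX, of 1]) (auto simp: tset_def blks_def dterm_def intro!: always_eventually)
  moreover have "ubdd F (tset V V2 [] j) (\<lambda>i (bs, rest). \<eta> i * (pn (concat bs) * pn rest))
    (\<lambda>i (bs, rest). dterm X0 (X1 i) Y0 (Y1 i) bs rest)"
    by (rule ubdd_le[OF X1, of 1]) (auto simp: tset_def blks_def dterm_def intro!: always_eventually)
  moreover have "\<forall>\<^sub>F i in F. \<forall>bs\<in>blks V []. mdiff V2 (j - length ([]::nat list)) (dterm X0 (X1 i) Y0 (Y1 i) bs)"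
    using md1 by (elim eventually_mono) (simp add: blks_def mdiff_def dterm_def)
  ultimately show ?case by blast
next
  case (snoc m ls)
  have YV: "\<forall>\<^sub>F i in F. \<forall>b. length b \<in> set ls \<longrightarrow> set b \<subseteq> V \<longrightarrow> Y i b \<in> V2 \<and> Y0 b \<in> V2 \<and> Y1 i b \<in> V2"
    using snoc.prems(4) by (elim eventually_mono) auto
  have IH: "usmall F (tset V V2 ls j) (\<lambda>i (bs, rest). \<eta> i * (pn (concat bs) * pn rest))
    (\<lambda>i (bs, rest). X i (map (Y i) bs @ rest) - X0 (map Y0 bs @ rest) - dterm X0 (X1 i) Y0 (Y1 i) bs rest)"
    "ubdd F (tset V V2 ls j) (\<lambda>i (bs, rest). \<eta> i * (pn (concat bs) * pn rest))
    (\<lambda>i (bs, rest). dterm X0 (X1 i) Y0 (Y1 i) bs rest)"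
    "\<forall>\<^sub>F i in F. \<forall>bs\<in>blks V ls. mdiff V2 (j - length ls) (dterm X0 (X1 i) Y0 (Y1 i) bs)"
    using snoc.IH[OF _ _ _ YV] snoc.prems by auto
  have B: "ubdd F (tset V V2 ls j) (\<lambda>i (bs, rest). 1 * (pn (concat bs) * pn rest))
      (\<lambda>i (bs, rest). X0 (map Y0 bs @ rest))"
  proof (rule term_bdd[where Y = "\<lambda>i. Y0" and X = "\<lambda>i. X0"])
    show "\<forall>\<^sub>F i in F. \<forall>b. length b \<in> set ls \<longrightarrow> set b \<subseteq> V \<longrightarrow> Y0 b \<in> V2"
      using YV by (elim eventually_mono) auto
  qed (use snoc.prems X0 in auto)
  obtain C0 where C0: "C0 > 0" "\<forall>\<^sub>F i in F. \<forall>b\<in>vl V m. norm (Y0 b) \<le> C0 * pn b"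
    using snoc.prems(1)[of m] by (auto elim: ubddE)
  obtain C1 where C1: "C1 > 0" "\<forall>\<^sub>F i in F. \<forall>b\<in>vl V m. norm (Y1 i b) \<le> C1 * (\<eta> i * pn b)"
    using snoc.prems(2)[of m] by (auto elim: ubddE)
  obtain D where D: "D > 0" "\<forall>\<^sub>F i in F. \<forall>p\<in>tset V V2 ls j.
      norm (case p of (bs, rest) \<Rightarrow> X0 (map Y0 bs @ rest))
        \<le> D * (case p of (bs, rest) \<Rightarrow> 1 * (pn (concat bs) * pn rest))"
    using B by (rule ubddE)
  obtain D1 where D1: "D1 > 0" "\<forall>\<^sub>F i in F. \<forall>p\<in>tset V V2 ls j.
      norm (case p of (bs, rest) \<Rightarrow> dterm X0 (X1 i) Y0 (Y1 i) bs rest)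
        \<le> D1 * (case p of (bs, rest) \<Rightarrow> \<eta> i * (pn (concat bs) * pn rest))"
    using IH(2) by (rule ubddE)
  have YY: "usmall F (vl V m) (\<lambda>i b. \<eta> i * pn b) (\<lambda>i b. Y i b - Y0 b - Y1 i b)"
    using snoc.prems(3)[of m] by simp
  \<comment> \<open>Bounds \<open>Y i b\<close> itself: \<open>C0\<close> for the base value and
    \<open>C1 + 1\<close> for the increment, once \<open>\<eta> i < 1\<close>.\<close>
  define C where "C = C0 + (C1 + 1)"
  have "C > 0" using C0 C1 by (simp add: C_def)
  have "\<forall>\<^sub>F i in F. \<eta> i < 1" using order_tendstoD(2)[OF \<eta>(2), of 1] by simp
  have inc: "\<forall>\<^sub>F i in F. \<forall>b\<in>vl V m. norm (Y i b - Y0 b) \<le> (C1 + 1) * (\<eta> i * pn b)"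
    using usmallD[OF YY zero_less_one] C1(2)
  proof eventually_elim
    case (elim i)
    show ?case
    proof
      fix b assume "b \<in> vl V m"
      then have "norm (Y i b - Y0 b - Y1 i b) \<le> 1 * (\<eta> i * pn b)" "norm (Y1 i b) \<le> C1 * (\<eta> i * pn b)"
        using elim by auto
      moreover have "norm (Y i b - Y0 b) \<le> norm (Y i b - Y0 b - Y1 i b) + norm (Y1 i b)"
        by (metis diff_add_cancel norm_triangle_ineq)
      ultimately show "norm (Y i b - Y0 b) \<le> (C1 + 1) * (\<eta> i * pn b)"
        by (simp add: algebra_simps)
    qed
  qed
  have Yb: "\<forall>\<^sub>F i in F. \<forall>b\<in>vl V m. norm (Y i b) \<le> C * pn b"
    using inc C0(2) \<open>\<forall>\<^sub>F i in F. \<eta> i < 1\<close>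
  proof eventually_elim
    case (elim i)
    show ?case
    proof
      fix b assume b: "b \<in> vl V m"
      have "norm (Y i b) \<le> norm (Y i b - Y0 b) + norm (Y0 b)"
        by (metis diff_add_cancel norm_triangle_ineq)
      also have "\<dots> \<le> (C1 + 1) * (1 * pn b) + C0 * pn b"
      proof (rule add_mono)
        have "norm (Y i b - Y0 b) \<le> (C1 + 1) * (\<eta> i * pn b)" using elim b by blast
        also have "\<dots> \<le> (C1 + 1) * (1 * pn b)"
          using elim(3) C1 by (intro mult_left_mono mult_right_mono) auto
        finally show "norm (Y i b - Y0 b) \<le> (C1 + 1) * (1 * pn b)" .
      qed (use elim b in auto)
      finally show "norm (Y i b) \<le> C * pn b" by (simp add: C_def algebra_simps)
    qed
  qed
  let ?E = "\<lambda>i bs rest. X i (map (Y i) bs @ rest) - X0 (map Y0 bs @ rest) - dterm X0 (X1 i) Y0 (Y1 i) bs rest"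
  have aux: thesis
    if p: "(bs0, rest) \<in> tset V V2 (ls @ [m]) j"
      and YVi: "\<forall>b. length b \<in> set (ls @ [m]) \<longrightarrow> set b \<subseteq> V \<longrightarrow> Y i b \<in> V2 \<and> Y0 b \<in> V2 \<and> Y1 i b \<in> V2"
      and th: "\<And>bs b. \<lbrakk>bs0 = bs @ [b]; bs \<in> blks V ls; b \<in> vl V m; Y i b \<in> V2; Y0 b \<in> V2; Y1 i b \<in> V2;
        \<forall>y\<in>V2. (bs, y # rest) \<in> tset V V2 ls j; map Y0 bs \<in> vl V2 (length ls);
        rest \<in> vl V2 (j - Suc (length ls)); j = Suc (length ls + length rest)\<rbrakk> \<Longrightarrow> thesis"
    for bs0 rest i thesis
  proof -
    obtain bs b where bs: "bs0 = bs @ [b]" "bs \<in> blks V ls" "b \<in> vl V m"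
      using p by (auto simp: tset_def elim: blks_snocE)
    show thesis
    proof (rule th[OF bs])
      show "map Y0 bs \<in> vl V2 (length ls)"
        by (rule map_blks_vl[OF bs(2)]) (use YVi in auto)
    qed (use p bs YVi snoc.prems(5) in \<open>auto simp: tset_def vl_def\<close>)
  qed
  have 1: "usmall F (tset V V2 (ls @ [m]) j) (\<lambda>i (bs, rest). \<eta> i * (pn (concat bs) * pn rest))
    (\<lambda>i (bs, rest). ?E i bs rest)"
    unfolding usmall_def
  proof (intro allI impI)
    fix e :: real assume e: "e > 0"
    define e1 where "e1 = e / (3 * C)"
    define e2 where "e2 = e / (3 * D)"
    \<comment> \<open>The third term is a product of two increments, hence of second order; it
      becomes small against \<open>\<eta> i\<close> once \<open>\<eta> i < e3\<close>.\<close>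
    define e3 where "e3 = e / (3 * D1 * (C1 + 1))"
    have e12: "e1 > 0" "e2 > 0" "e3 > 0"
      using e C1 \<open>C > 0\<close> D D1 by (auto simp: e1_def e2_def e3_def)
    have ev3: "\<forall>\<^sub>F i in F. \<eta> i < e3" using order_tendstoD(2)[OF \<eta>(2) e12(3)] .
    show "\<forall>\<^sub>F i in F. \<forall>p\<in>tset V V2 (ls @ [m]) j.
        norm (case p of (bs, rest) \<Rightarrow> ?E i bs rest)
        \<le> e * (case p of (bs, rest) \<Rightarrow> \<eta> i * (pn (concat bs) * pn rest))"
      using Yb D(2) D1(2) usmallD[OF IH(1) e12(1)] usmallD[OF YY e12(2)] snoc.prems(4) IH(3) inc ev3
    proof eventually_elim
      case (elim i)
      show ?case
      proof clarify
        fix bs0 rest assume p: "(bs0, rest) \<in> tset V V2 (ls @ [m]) j"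
        from p elim(6) obtain bs b where bs: "bs0 = bs @ [b]" "bs \<in> blks V ls" "b \<in> vl V m"
          and Yb: "Y i b \<in> V2" "Y0 b \<in> V2" "Y1 i b \<in> V2"
          and q: "\<forall>y\<in>V2. (bs, y # rest) \<in> tset V V2 ls j"
          and mv: "map Y0 bs \<in> vl V2 (length ls)" and rest: "rest \<in> vl V2 (j - Suc (length ls))"
          and j: "j = Suc (length ls + length rest)"
          by (rule aux) (rule that)
        let ?R = "\<eta> i * (pn (concat bs0) * pn rest)"
        have *: "X0 (map Y0 bs @ (u - v) # rest) = X0 (map Y0 bs @ u # rest) - X0 (map Y0 bs @ v # rest)"
          if "u \<in> V2" "v \<in> V2" for u v
          by (rule mdiffD[OF md]) (use mv rest that j in \<open>auto simp: vl_def\<close>)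
        have **: "dterm X0 (X1 i) Y0 (Y1 i) bs ((Y i b - Y0 b) # rest)
            = dterm X0 (X1 i) Y0 (Y1 i) bs (Y i b # rest) - dterm X0 (X1 i) Y0 (Y1 i) bs (Y0 b # rest)"
          using mdiffD[OF elim(7)[rule_format, OF bs(2)], of "[]" rest "Y i b" "Y0 b"] Yb rest j
          by (auto simp: vl_def)
        have "norm (?E i bs (Y i b # rest)) \<le> e1 * (\<eta> i * (pn (concat bs) * pn (Y i b # rest)))"
          using bspec[OF elim(4) q[rule_format, OF Yb(1)]] by (simp only: prod.case mult_1)
        also have "\<dots> \<le> e1 * (\<eta> i * (pn (concat bs) * ((C * pn b) * pn rest)))"
          using elim(1) bs e12 \<eta>(1) by (intro weight_mono1 weight_mono2) auto
        also have "\<dots> = e / 3 * ?R"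
          using \<open>C > 0\<close> by (simp add: e1_def bs field_simps)
        finally have 1: "norm (?E i bs (Y i b # rest)) \<le> e / 3 * ?R" .
        have "norm (X0 (map Y0 bs @ (Y i b - Y0 b - Y1 i b) # rest))
            \<le> D * (pn (concat bs) * pn ((Y i b - Y0 b - Y1 i b) # rest))"
          using bspec[OF elim(2) q[rule_format, OF V2[OF V2[OF Yb(1,2)] Yb(3)]]] by (simp only: prod.case mult_1)
        also have "\<dots> \<le> D * (pn (concat bs) * ((e2 * (\<eta> i * pn b)) * pn rest))"
          using elim(5) bs D by (intro weight_mono1 weight_mono2) auto
        also have "\<dots> = e / 3 * ?R"
          using D by (simp add: e2_def bs field_simps)
        finally have 2: "norm (X0 (map Y0 bs @ (Y i b - Y0 b - Y1 i b) # rest)) \<le> e / 3 * ?R" .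
        have "norm (dterm X0 (X1 i) Y0 (Y1 i) bs ((Y i b - Y0 b) # rest))
            \<le> D1 * (\<eta> i * (pn (concat bs) * pn ((Y i b - Y0 b) # rest)))"
          using bspec[OF elim(3) q[rule_format, OF V2[OF Yb(1,2)]]] by (simp only: prod.case mult_1)
        also have "\<dots> \<le> D1 * (\<eta> i * (pn (concat bs) * (((C1 + 1) * (e3 * pn b)) * pn rest)))"
        proof -
          have "norm (Y i b - Y0 b) \<le> (C1 + 1) * (\<eta> i * pn b)" using elim(8) bs by blast
          also have "\<dots> \<le> (C1 + 1) * (e3 * pn b)"
            using elim(9) C1 by (intro mult_left_mono mult_right_mono) auto
          finally show ?thesis
            using D1 \<eta>(1) by (intro weight_mono1 weight_mono2) auto
        qed
        also have "\<dots> = D1 * (C1 + 1) * e3 * ?R" by (simp add: bs mult_ac)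
        also have "D1 * (C1 + 1) * e3 = e / 3"
        proof -
          have "D1 * K * (e / (3 * D1 * K)) = e / 3" if "K > 0" for K using D1 that by simp
          then show ?thesis using C1 by (simp only: e3_def)
        qed
        finally have 3: "norm (dterm X0 (X1 i) Y0 (Y1 i) bs ((Y i b - Y0 b) # rest)) \<le> e / 3 * ?R" .
        \<comment> \<open>The remainder with one more block: the remainder for \<open>bs\<close>
          with \<open>Y i b\<close> as a free vector, the mixed term of second order, and the
          remainder of \<open>Y\<close> at \<open>b\<close>.\<close>
        have E: "?E i bs0 rest = ?E i bs (Y i b # rest) + dterm X0 (X1 i) Y0 (Y1 i) bs ((Y i b - Y0 b) # rest)
            + X0 (map Y0 bs @ (Y i b - Y0 b - Y1 i b) # rest)" (is "_ = ?S")
          unfolding ** *[OF V2[OF Yb(1,2)] Yb(3)] *[OF Yb(1,2)]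
          by (simp add: bs dterm_snoc)
        have "norm ?S \<le> e / 3 * ?R + e / 3 * ?R + e / 3 * ?R"
          by (rule norm_triangle_mono[OF norm_triangle_mono[OF 1 3] 2])
        then show "norm (?E i bs0 rest) \<le> e * ?R"
          unfolding E by (simp only: three_thirds)
      qed
    qed
  qed
  have 2: "ubdd F (tset V V2 (ls @ [m]) j) (\<lambda>i (bs, rest). \<eta> i * (pn (concat bs) * pn rest))
    (\<lambda>i (bs, rest). dterm X0 (X1 i) Y0 (Y1 i) bs rest)"
    unfolding ubdd_def
  proof (intro exI[of _ "D1 * C0 + D * C1"] conjI)
    show "D1 * C0 + D * C1 > 0" using D1 C0 D C1 by (simp add: add_pos_pos)
    show "\<forall>\<^sub>F i in F. \<forall>p\<in>tset V V2 (ls @ [m]) j.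
        norm (case p of (bs, rest) \<Rightarrow> dterm X0 (X1 i) Y0 (Y1 i) bs rest)
        \<le> (D1 * C0 + D * C1) * (case p of (bs, rest) \<Rightarrow> \<eta> i * (pn (concat bs) * pn rest))"
      using C0(2) C1(2) D(2) D1(2) snoc.prems(4)
    proof eventually_elim
      case (elim i)
      show ?case
      proof clarify
        fix bs0 rest assume p: "(bs0, rest) \<in> tset V V2 (ls @ [m]) j"
        from p elim(5) obtain bs b where bs: "bs0 = bs @ [b]" "bs \<in> blks V ls" "b \<in> vl V m"
          and Yb: "Y i b \<in> V2" "Y0 b \<in> V2" "Y1 i b \<in> V2"
          and q: "\<forall>y\<in>V2. (bs, y # rest) \<in> tset V V2 ls j"
          by (rule aux) (rule that)
        let ?R = "\<eta> i * (pn (concat bs0) * pn rest)"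
        have "norm (dterm X0 (X1 i) Y0 (Y1 i) bs (Y0 b # rest))
            \<le> D1 * (\<eta> i * (pn (concat bs) * pn (Y0 b # rest)))"
          using bspec[OF elim(4) q[rule_format, OF Yb(2)]] by (simp only: prod.case mult_1)
        also have "\<dots> \<le> D1 * (\<eta> i * (pn (concat bs) * ((C0 * pn b) * pn rest)))"
          using elim(1) bs D1 \<eta>(1) by (intro weight_mono1 weight_mono2) auto
        finally have 1: "norm (dterm X0 (X1 i) Y0 (Y1 i) bs (Y0 b # rest)) \<le> D1 * C0 * ?R"
          by (simp add: bs mult_ac)
        have "norm (X0 (map Y0 bs @ Y1 i b # rest)) \<le> D * (pn (concat bs) * pn (Y1 i b # rest))"
          using bspec[OF elim(3) q[rule_format, OF Yb(3)]] by (simp only: prod.case mult_1)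
        also have "\<dots> \<le> D * (pn (concat bs) * ((C1 * (\<eta> i * pn b)) * pn rest))"
          using elim(2) bs D by (intro weight_mono1 weight_mono2) auto
        finally have 2: "norm (X0 (map Y0 bs @ Y1 i b # rest)) \<le> D * C1 * ?R"
          by (simp add: bs mult_ac)
        show "norm (dterm X0 (X1 i) Y0 (Y1 i) bs0 rest) \<le> (D1 * C0 + D * C1) * ?R"
          unfolding bs(1) dterm_snoc distrib_right using 1 2 unfolding bs(1)
          by (rule norm_triangle_mono)
      qed
    qed
  qed
  have 3: "\<forall>\<^sub>F i in F. \<forall>bs\<in>blks V (ls @ [m]).
      mdiff V2 (j - length (ls @ [m])) (dterm X0 (X1 i) Y0 (Y1 i) bs)"
    using IH(3) snoc.prems(4)
  proof eventually_elim
    case (elim i)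
    show ?case
    proof
      fix bs0 assume "bs0 \<in> blks V (ls @ [m])"
      then obtain bs b where bs: "bs0 = bs @ [b]" "bs \<in> blks V ls" "b \<in> vl V m"
        by (auto elim: blks_snocE)
      have Yb: "Y0 b \<in> V2" "Y1 i b \<in> V2" using elim(2) bs by (auto simp: vl_def)
      have mv: "map Y0 bs \<in> vl V2 (length ls)"
        by (rule map_blks_vl[OF bs(2)]) (use elim in auto)
      show "mdiff V2 (j - length (ls @ [m])) (dterm X0 (X1 i) Y0 (Y1 i) bs0)"
        unfolding mdiff_def
      proof (intro allI impI)
        fix as cs u v
        assume a: "set as \<subseteq> V2 \<and> set cs \<subseteq> V2 \<and> u \<in> V2 \<and> v \<in> V2 \<and> length as + length cs + 1 = j - length (ls @ [m])"
        have 1: "dterm X0 (X1 i) Y0 (Y1 i) bs ((Y0 b # as) @ (u - v) # cs)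
            = dterm X0 (X1 i) Y0 (Y1 i) bs ((Y0 b # as) @ u # cs) - dterm X0 (X1 i) Y0 (Y1 i) bs ((Y0 b # as) @ v # cs)"
          by (rule mdiffD[OF elim(1)[rule_format, OF bs(2)]]) (use a Yb in auto)
        have 2: "X0 ((map Y0 bs @ Y1 i b # as) @ (u - v) # cs)
            = X0 ((map Y0 bs @ Y1 i b # as) @ u # cs) - X0 ((map Y0 bs @ Y1 i b # as) @ v # cs)"
          by (rule mdiffD[OF md]) (use a Yb mv in \<open>auto simp: vl_def\<close>)
        show "dterm X0 (X1 i) Y0 (Y1 i) bs0 (as @ (u - v) # cs)
          = dterm X0 (X1 i) Y0 (Y1 i) bs0 (as @ u # cs) - dterm X0 (X1 i) Y0 (Y1 i) bs0 (as @ v # cs)"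
          using 1 2 by (simp add: bs dterm_snoc)
      qed
    qed
  qed
  show ?case using 1 2 3 by blast
qed

section \<open>Derivatives expressed by uniform estimates\<close>

lemma hfd_iff: "has_frechet_derivs sa sc V U r f D \<longleftrightarrow>
    (\<forall>x\<in>U. D 0 x [] = f x) \<and>
    (\<forall>m\<le>r. \<forall>x\<in>U. mlin sa sc V m (D m x) \<and> mbdd V m (D m x)) \<and>
    (\<forall>m<r. \<forall>x\<in>U. usmall (at x within U) (vl V m) (\<lambda>y vs. norm (y - x) * pn vs)
      (\<lambda>y vs. D m y vs - D m x vs - D (Suc m) x ((y - x) # vs))) \<and>
    (\<forall>x\<in>U. usmall (at x within U) (vl V r) (\<lambda>y. pn) (\<lambda>y vs. D r y vs - D r x vs))"
  by (simp add: has_frechet_derivs_def bounded_multilinear_on_iff usmall_def vl_def pn_def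
      mult.assoc Ball_def)

text \<open>Unlike \<open>at x within U\<close>, this filter keeps the point \<open>x\<close>. An
  inner map may take the value \<open>f x\<close> at points other than \<open>x\<close>, so in
  compositions the filter of the outer map must not be punctured.\<close>

definition nin :: "'a::topological_space \<Rightarrow> 'a set \<Rightarrow> 'a filter"
  where "nin x U = inf (nhds x) (principal U)"

lemma eventually_nin: "eventually P (nin x U) \<longleftrightarrow> (\<exists>d>0. \<forall>y\<in>U. dist y x < d \<longrightarrow> P (y::'a::metric_space))"
  by (auto simp: nin_def eventually_inf_principal eventually_nhds_metric)

lemma eventually_nin_at: "x \<in> U \<Longrightarrow> eventually P (nin x U) \<longleftrightarrow> P x \<and> eventually P (at x within U)"
  by (auto simp: nin_def eventually_inf_principal eventually_at_filter eventually_nhds_x_imp_x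
      elim: eventually_mono dest: eventually_nhds_x_imp_x)

lemma at_le_nin: "at x within U \<le> nin x U"
  by (auto simp: nin_def at_within_def intro: le_infI2)

lemma usmall_mono_filter: "usmall F P w f \<Longrightarrow> F' \<le> F \<Longrightarrow> usmall F' P w f"
  by (auto simp: usmall_def filter_leD)

lemma ubdd_mono_filter: "ubdd F P w f \<Longrightarrow> F' \<le> F \<Longrightarrow> ubdd F' P w f"
  by (auto simp: ubdd_def filter_leD)

lemma usmall_filtermap: "usmall F P w f \<Longrightarrow> filterlim g F F' \<Longrightarrow> usmall F' P (\<lambda>i. w (g i)) (\<lambda>i. f (g i))"
  unfolding usmall_def filterlim_iff by auto

lemma tendsto_norm_diff_nin: "((\<lambda>y. norm (y - x)) \<longlongrightarrow> 0) (nin x (U::'a::real_normed_vector set))"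
proof -
  have "((\<lambda>y. norm (y - x)) \<longlongrightarrow> norm (x - x)) (nhds x)"
    by (intro tendsto_intros filterlim_ident)
  then have "((\<lambda>y. norm (y - x)) \<longlongrightarrow> 0) (nhds x)" by simp
  then show ?thesis unfolding nin_def by (rule tendsto_mono[rotated]) simp
qed

lemma usmall_shrink:
  assumes "ubdd F P (\<lambda>i p. \<eta> i * w p) f" "(\<eta> \<longlongrightarrow> 0) F" "\<And>p. p \<in> P \<Longrightarrow> 0 \<le> w p"
  shows "usmall F P (\<lambda>i. w) f"
  unfolding usmall_def
proof (intro allI impI)
  fix e :: real assume e: "e > 0"
  obtain C where C: "C > 0" "\<forall>\<^sub>F i in F. \<forall>p\<in>P. norm (f i p) \<le> C * (\<eta> i * w p)"
    using assms(1) by (rule ubddE)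
  have "\<forall>\<^sub>F i in F. \<eta> i < e / C" using e C by (intro order_tendstoD(2)[OF assms(2)]) simp
  with C(2) show "\<forall>\<^sub>F i in F. \<forall>p\<in>P. norm (f i p) \<le> e * w p"
  proof eventually_elim
    case (elim i)
    show ?case
    proof
      fix p assume p: "p \<in> P"
      have "norm (f i p) \<le> C * (\<eta> i * w p)" using elim p by blast
      also have "\<dots> \<le> C * (e / C * w p)"
        using elim C assms(3)[OF p] by (intro mult_left_mono mult_right_mono) auto
      finally show "norm (f i p) \<le> e * w p" using C by simp
    qed
  qed
qed

context two_spaces
begin

context
  fixes V U r f D
  assumes D: "has_frechet_derivs sa sc V U r f D" and V: "A.subspace V" and UV: "U \<subseteq> V"
begin

lemma hfd_mlin: "m \<le> r \<Longrightarrow> x \<in> U \<Longrightarrow> mlin sa sc V m (D m x)"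
  and hfd_mbdd: "m \<le> r \<Longrightarrow> x \<in> U \<Longrightarrow> mbdd V m (D m x)"
  and hfd_0: "x \<in> U \<Longrightarrow> D 0 x [] = f x"
  using D by (auto simp: hfd_iff)

text \<open>At \<open>y = x\<close> the remainder is \<open>D (Suc m) x (0 # vs) = 0\<close>, so the
  estimate extends to the unpunctured filter.\<close>

lemma hfd_diff:
  assumes "m < r" "x \<in> U"
  shows "usmall (nin x U) (vl V m) (\<lambda>y vs. norm (y - x) * pn vs)
      (\<lambda>y vs. D m y vs - D m x vs - D (Suc m) x ((y - x) # vs))"
proof -
  have "D (Suc m) x (0 # vs) = 0" if "vs \<in> vl V m" for vs
    using mlin_zero[OF hfd_mlin[of "Suc m" x] V, of "[]" vs] assms that by (simp add: vl_def)
  moreover have "usmall (at x within U) (vl V m) (\<lambda>y vs. norm (y - x) * pn vs)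
      (\<lambda>y vs. D m y vs - D m x vs - D (Suc m) x ((y - x) # vs))"
    using D assms by (simp add: hfd_iff)
  ultimately show ?thesis
    using assms(2) by (simp add: usmall_def eventually_nin_at)
qed

lemma hfd_lip:
  assumes "m < r" "x \<in> U"
  shows "ubdd (nin x U) (vl V m) (\<lambda>y vs. norm (y - x) * pn vs) (\<lambda>y vs. D m y vs - D m x vs)"
proof -
  have "ubdd (nin x U) (vl V m) (\<lambda>y vs. norm (y - x) * pn vs) (\<lambda>y vs. D (Suc m) x ((y - x) # vs))"
  proof (rule ubdd_le[where K = 1])
    show "ubdd (nin x U) (vl V (Suc m)) (\<lambda>y. pn) (\<lambda>y. D (Suc m) x)"
      using assms by (intro mbdd_imp_ubdd hfd_mbdd) auto
    show "\<forall>\<^sub>F y in nin x U. \<forall>q\<in>vl V m. \<exists>p\<in>vl V (Suc m).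
        norm (D (Suc m) x ((y - x) # q)) \<le> 1 * norm (D (Suc m) x p) \<and> pn p \<le> norm (y - x) * pn q"
      unfolding eventually_nin
    proof (intro exI[of _ 1] conjI ballI impI)
      fix y q assume "y \<in> U" "q \<in> vl V m"
      then show "\<exists>p\<in>vl V (Suc m).
        norm (D (Suc m) x ((y - x) # q)) \<le> 1 * norm (D (Suc m) x p) \<and> pn p \<le> norm (y - x) * pn q"
        using UV assms(2) by (intro bexI[of _ "(y - x) # q"]) (auto intro!: A.subspace_diff[OF V])
    qed simp
  qed simp
  from ubdd_add[OF usmall_imp_ubdd[OF hfd_diff[OF assms]] this] show ?thesis
    by simp
qed

lemma hfd_cont:
  assumes "m \<le> r" "x \<in> U"
  shows "usmall (nin x U) (vl V m) (\<lambda>y. pn) (\<lambda>y vs. D m y vs - D m x vs)"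
proof (cases "m < r")
  case True
  show ?thesis
    using hfd_lip[OF True assms(2)] tendsto_norm_diff_nin by (rule usmall_shrink) simp
next
  case False
  with assms have "m = r" by simp
  then have "usmall (at x within U) (vl V m) (\<lambda>y. pn) (\<lambda>y vs. D m y vs - D m x vs)"
    using D assms by (simp add: hfd_iff)
  then show ?thesis
    using assms(2) by (simp add: usmall_def eventually_nin_at)
qed

lemma hfd_tendsto:
  assumes "x \<in> U"
  shows "(f \<longlongrightarrow> f x) (nin x U)"
proof (rule tendstoI)
  fix e :: real assume "e > 0"
  then have "e / 2 > 0" by simp
  from usmallD[OF hfd_cont[of 0 x] this] assms
  have "\<forall>\<^sub>F y in nin x U. norm (D 0 y [] - D 0 x []) \<le> e / 2" by simp
  moreover have "\<forall>\<^sub>F y in nin x U. y \<in> U" by (auto simp: eventually_nin intro: exI[of _ 1])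
  ultimately show "\<forall>\<^sub>F y in nin x U. dist (f y) (f x) < e"
  proof eventually_elim
    case (elim y)
    then have "norm (f y - f x) \<le> e / 2" using assms by (simp add: hfd_0)
    also have "\<dots> < e" using \<open>e > 0\<close> by simp
    finally show ?case by (simp add: dist_norm)
  qed
qed

end

end

text \<open>Two moving points instead of a point and its limit: with \<open>a p = p\<close> and
  \<open>c p = (0, snd p)\<close> this expresses convergence as \<open>\<epsilon>\<close> tends to
  \<open>0\<close> while \<open>b\<close> stays free, and with \<open>c\<close> constant it is
  ordinary continuity.\<close>

definition ccont :: "'i filter \<Rightarrow> 'a set \<Rightarrow> nat \<Rightarrow> (nat \<Rightarrow> 'a \<Rightarrow> 'a::real_normed_vector list \<Rightarrow> 'c::real_normed_vector)
    \<Rightarrow> ('i \<Rightarrow> 'a) \<Rightarrow> ('i \<Rightarrow> 'a) \<Rightarrow> bool"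
  where "ccont F V r D a c \<longleftrightarrow> (\<forall>m\<le>r. usmall F (vl V m) (\<lambda>i. pn) (\<lambda>i vs. D m (a i) vs - D m (c i) vs)
    \<and> ubdd F (vl V m) (\<lambda>i. pn) (\<lambda>i. D m (a i)) \<and> ubdd F (vl V m) (\<lambda>i. pn) (\<lambda>i. D m (c i)))"

lemma ccontI:
  assumes "\<And>m. m \<le> r \<Longrightarrow> usmall F (vl V m) (\<lambda>i. pn) (\<lambda>i vs. D m (a i) vs - D m (c i) vs)"
    "\<And>m. m \<le> r \<Longrightarrow> ubdd F (vl V m) (\<lambda>i. pn) (\<lambda>i. D m (c i))"
  shows "ccont F V r D a c"
proof -
  have "ubdd F (vl V m) (\<lambda>i. pn) (\<lambda>i. D m (a i))" if "m \<le> r" for m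
    using ubdd_add[OF usmall_imp_ubdd[OF assms(1)[OF that]] assms(2)[OF that]] by simp
  with assms show ?thesis by (simp add: ccont_def)
qed

lemma ccontD:
  assumes "ccont F V r D a c" "m \<le> r"
  shows "usmall F (vl V m) (\<lambda>i. pn) (\<lambda>i vs. D m (a i) vs - D m (c i) vs)"
    "ubdd F (vl V m) (\<lambda>i. pn) (\<lambda>i. D m (a i))" "ubdd F (vl V m) (\<lambda>i. pn) (\<lambda>i. D m (c i))"
  using assms by (auto simp: ccont_def)

lemma (in two_spaces) hfd_ccont:
  assumes "has_frechet_derivs sa sc V U r f D" "A.subspace V" "U \<subseteq> V" "x \<in> U"
  shows "ccont (nin x U) V r D (\<lambda>y. y) (\<lambda>y. x)"
  by (rule ccontI) (auto intro: hfd_cont[OF assms(1-3)] mbdd_imp_ubdd hfd_mbdd[OF assms(1-3)] assms(4))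

section \<open>The formula of Faa di Bruno\<close>

definition fdt :: "(nat \<Rightarrow> 'b \<Rightarrow> 'b list \<Rightarrow> 'c) \<Rightarrow> (nat \<Rightarrow> 'a \<Rightarrow> 'a list \<Rightarrow> 'b) \<Rightarrow> ('a \<Rightarrow> 'b) \<Rightarrow> 'a \<Rightarrow> 'a list list \<Rightarrow> 'c"
  where "fdt Dg Df f x bs = Dg (length bs) (f x) (map (\<lambda>b. Df (length b) x b) bs)"

definition FD :: "(nat \<Rightarrow> 'b \<Rightarrow> 'b list \<Rightarrow> 'c::comm_monoid_add) \<Rightarrow> (nat \<Rightarrow> 'a \<Rightarrow> 'a list \<Rightarrow> 'b) \<Rightarrow> ('a \<Rightarrow> 'b)
    \<Rightarrow> nat \<Rightarrow> 'a \<Rightarrow> 'a list \<Rightarrow> 'c"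
  where "FD Dg Df f m x vs = (\<Sum>bs\<leftarrow>splits vs. fdt Dg Df f x bs)"

text \<open>The formula of the next order is the sum of the product rule increments of the present
  one; with \<open>rest = []\<close> these are the increments that \<open>term_diff\<close>
  produces.\<close>

lemma FD_Suc:
  "FD Dg Df f n x (h # vs) = (\<Sum>bs\<leftarrow>splits vs. dterm (Dg (length bs) (f x))
      (\<lambda>vs. Dg (Suc (length bs)) (f x) (Df 1 x [h] # vs))
      (\<lambda>b. Df (length b) x b) (\<lambda>b. Df (Suc (length b)) x (h # b)) bs [])"
  unfolding FD_def sum_splits_Cons
  by (simp add: fdt_def dterm_def map_update)

text \<open>Linearity of a term in one vector that sits inside one of its blocks. The other blocks
  are nonempty, matching \<open>FD_mlin\<close>, whose hypotheses on the inner family concern orders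
  from \<open>1\<close> on.\<close>

definition bmlin :: "('k \<Rightarrow> 'a::plus \<Rightarrow> 'a) \<Rightarrow> ('k \<Rightarrow> 'c \<Rightarrow> 'c) \<Rightarrow> 'a set \<Rightarrow> nat \<Rightarrow> ('a list list \<Rightarrow> 'c::plus) \<Rightarrow> bool"
  where "bmlin sa sc V m t \<longleftrightarrow> (\<forall>xs ys as bs u v c.
    \<Union>(set ` set xs) \<subseteq> V \<and> \<Union>(set ` set ys) \<subseteq> V \<and> set as \<subseteq> V \<and> set bs \<subseteq> V \<and> u \<in> V \<and> v \<in> V
    \<and> [] \<notin> set xs \<and> [] \<notin> set ys
    \<and> sum_list (map length xs) + length as + length bs + 1 + sum_list (map length ys) = m \<longrightarrow>
    t (xs @ (as @ (sa c u + v) # bs) # ys) = sc c (t (xs @ (as @ u # bs) # ys)) + t (xs @ (as @ v # bs) # ys))"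

lemma bmlinD:
  assumes "bmlin sa sc V m t" "\<Union>(set ` set xs) \<subseteq> V" "\<Union>(set ` set ys) \<subseteq> V" "set as \<subseteq> V" "set bs \<subseteq> V" "u \<in> V" "v \<in> V"
    "[] \<notin> set xs" "[] \<notin> set ys" "sum_list (map length xs) + length as + length bs + 1 + sum_list (map length ys) = m"
  shows "t (xs @ (as @ (sa c u + v) # bs) # ys) = sc c (t (xs @ (as @ u # bs) # ys)) + t (xs @ (as @ v # bs) # ys)"
  using assms unfolding bmlin_def by blast

lemma (in normed_over) sum_list_lin:
  "(\<And>b. b \<in> set xs \<Longrightarrow> f b = scale c (g b) + h b) \<Longrightarrow>
    (\<Sum>b\<leftarrow>xs. f b) = scale c (\<Sum>b\<leftarrow>xs. g b) + (\<Sum>b\<leftarrow>xs. h b)"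
  by (induction xs) (auto simp: scale_right_distrib)

lemma (in normed_over) sum_lin:
  "(\<And>b. b \<in> X \<Longrightarrow> f b = scale c (g b) + h b) \<Longrightarrow>
    (\<Sum>b\<in>X. f b) = scale c (\<Sum>b\<in>X. g b) + (\<Sum>b\<in>X. h b)"
  by (simp add: sum.distrib scale_sum_right)

lemma sum_length_update:
  "i < length xs \<Longrightarrow> sum_list (map length (xs[i := a # xs ! i])) = Suc (sum_list (map length xs))"
  by (induction xs arbitrary: i) (auto split: nat.splits)

lemma Union_update:
  assumes i: "i < length xs" and a: "a \<in> V" and xs: "\<Union>(set ` set xs) \<subseteq> V"
  shows "\<Union>(set ` set (xs[i := a # xs ! i])) \<subseteq> V"
proof (rule UN_least)
  fix b assume b: "b \<in> set (xs[i := a # xs ! i])"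
  have xi: "set (xs ! i) \<subseteq> V" using nth_mem[OF i] xs by blast
  from b set_update_subset_insert have "b = a # xs ! i \<or> b \<in> set xs" by fast
  then show "set b \<subseteq> V" using xi a xs by auto
qed

lemma nonempty_update: "[] \<notin> set xs \<Longrightarrow> [] \<notin> set (xs[i := a # y])"
  using set_update_subset_insert[of xs i "a # y"] by auto

text \<open>Freezing the head \<open>a\<close> of the list turns the terms of order
  \<open>m + 1\<close> into a sum of order \<open>m\<close>; this lets the induction in
  \<open>splits_mlin\<close> walk past \<open>a\<close>.\<close>

lemma (in two_spaces) bmlin_dt:
  assumes t: "bmlin sa sc V (Suc m) t" and a: "a \<in> V"
  shows "bmlin sa sc V m (\<lambda>bs. t ([a] # bs) + (\<Sum>i<length bs. t (bs[i := a # bs ! i])))"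
  unfolding bmlin_def
proof (intro allI impI)
  fix xs ys as bs u v c
  assume *: "\<Union>(set ` set xs) \<subseteq> V \<and> \<Union>(set ` set ys) \<subseteq> V \<and> set as \<subseteq> V \<and> set bs \<subseteq> V \<and> u \<in> V \<and> v \<in> V
    \<and> [] \<notin> set xs \<and> [] \<notin> set ys
    \<and> sum_list (map length xs) + length as + length bs + 1 + sum_list (map length ys) = m"
  let ?B = "\<lambda>x. xs @ (as @ x # bs) # ys"
  have 1: "t ([a] # ?B (sa c u + v)) = sc c (t ([a] # ?B u)) + t ([a] # ?B v)"
    using bmlinD[OF t, of "[a] # xs" ys as bs u v c] * a by simp
  have 2: "t ((?B (sa c u + v))[i := a # ?B (sa c u + v) ! i])
      = sc c (t ((?B u)[i := a # ?B u ! i])) + t ((?B v)[i := a # ?B v ! i])"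
    if i: "i < length (?B u)" for i
  proof -
    \<comment> \<open>The position of the block that receives \<open>a\<close>, relative to the
      block that contains the varying vector.\<close>
    consider "i < length xs" | "i = length xs" | j where "i = length xs + Suc j" "j < length ys"
    proof -
      assume a1: "i < length xs \<Longrightarrow> thesis" and a2: "i = length xs \<Longrightarrow> thesis"
        and a3: "\<And>j. i = length xs + Suc j \<Longrightarrow> j < length ys \<Longrightarrow> thesis"
      show thesis
      proof (cases "i > length xs")
        case True
        then show thesis using a3[of "i - length xs - 1"] i by simp
      qed (use a1 a2 in force)
    qed
    then show ?thesis
    proof cases
      case 1
      then have "t (xs[i := a # xs ! i] @ (as @ (sa c u + v) # bs) # ys)
          = sc c (t (xs[i := a # xs ! i] @ (as @ u # bs) # ys)) + t (xs[i := a # xs ! i] @ (as @ v # bs) # ys)"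
        using * a
        by (intro bmlinD[OF t] Union_update nonempty_update) (auto simp: sum_length_update)
      with 1 show ?thesis by (simp add: list_update_append nth_append)
    next
      case 2
      have "t (xs @ ((a # as) @ (sa c u + v) # bs) # ys)
          = sc c (t (xs @ ((a # as) @ u # bs) # ys)) + t (xs @ ((a # as) @ v # bs) # ys)"
        by (rule bmlinD[OF t]) (use * a in auto)
      with 2 show ?thesis by (simp add: list_update_append nth_append)
    next
      case 3
      then have "t (xs @ (as @ (sa c u + v) # bs) # ys[j := a # ys ! j])
          = sc c (t (xs @ (as @ u # bs) # ys[j := a # ys ! j])) + t (xs @ (as @ v # bs) # ys[j := a # ys ! j])"
        using * a
        by (intro bmlinD[OF t] Union_update nonempty_update) (auto simp: sum_length_update)
      with 3 show ?thesis by (simp add: list_update_append nth_append)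
    qed
  qed
  have len: "length (?B x) = length (?B u)" for x by simp
  have "(\<Sum>i<length (?B u). t ((?B (sa c u + v))[i := a # ?B (sa c u + v) ! i]))
      = sc c (\<Sum>i<length (?B u). t ((?B u)[i := a # ?B u ! i])) + (\<Sum>i<length (?B u). t ((?B v)[i := a # ?B v ! i]))"
    by (rule C.sum_lin) (use 2 in blast)
  then show "t ([a] # ?B (sa c u + v)) + (\<Sum>i<length (?B (sa c u + v)). t ((?B (sa c u + v))[i := a # ?B (sa c u + v) ! i]))
    = sc c (t ([a] # ?B u) + (\<Sum>i<length (?B u). t ((?B u)[i := a # ?B u ! i])))
      + (t ([a] # ?B v) + (\<Sum>i<length (?B v). t ((?B v)[i := a # ?B v ! i])))"
    unfolding 1 len[of "sa c u + v"] len[of v] C.scale_right_distrib by (simp add: add_ac)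
qed

text \<open>Induction on the entries before the varying vector. In the base case that vector is the
  new head, which forms a block of its own or opens an existing one.\<close>

lemma (in two_spaces) splits_mlin:
  assumes "bmlin sa sc V m t"
  shows "mlin sa sc V m (\<lambda>vs. \<Sum>bs\<leftarrow>splits vs. t bs)"
proof (rule mlinI)
  fix as bs u v c
  assume "set as \<subseteq> V" "set bs \<subseteq> V" "u \<in> V" "v \<in> V" "length as + length bs + 1 = m"
  then show "(\<Sum>cs\<leftarrow>splits (as @ (sa c u + v) # bs). t cs)
      = sc c (\<Sum>cs\<leftarrow>splits (as @ u # bs). t cs) + (\<Sum>cs\<leftarrow>splits (as @ v # bs). t cs)"
    using assms
  proof (induction as arbitrary: t m)
    case Nil
    note t = Nil.prems(6)
    show ?case
      unfolding append_Nil sum_splits_Cons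
    proof (rule C.sum_list_lin)
      fix cs assume "cs \<in> set (splits bs)"
      then have cs: "is_part bs cs" by (rule splits_part)
      have bs: "bs \<in> vl V (length bs)" using Nil.prems by (simp add: vl_def)
      note P = partD[OF cs bs]
      have ne: "[] \<notin> set cs" using cs by (simp add: is_part_def)
      have 1: "t ([sa c u + v] # cs) = sc c (t ([u] # cs)) + t ([v] # cs)"
        using bmlinD[OF t, of "[]" cs "[]" "[]" u v c] P Nil.prems ne by auto
      have "(\<Sum>i<length cs. t (cs[i := (sa c u + v) # cs ! i]))
          = sc c (\<Sum>i<length cs. t (cs[i := u # cs ! i])) + (\<Sum>i<length cs. t (cs[i := v # cs ! i]))"
      proof (rule C.sum_lin)
        fix i assume "i \<in> {..<length cs}"
        then have i: "i < length cs" by simp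
        have s: "cs = take i cs @ cs ! i # drop (Suc i) cs" by (rule id_take_nth_drop[OF i])
        have l: "sum_list (map length cs) = sum_list (map length (take i cs)) + length (cs ! i)
            + sum_list (map length (drop (Suc i) cs))"
          by (subst s) simp
        have "t (take i cs @ ([] @ (sa c u + v) # cs ! i) # drop (Suc i) cs)
          = sc c (t (take i cs @ ([] @ u # cs ! i) # drop (Suc i) cs)) + t (take i cs @ ([] @ v # cs ! i) # drop (Suc i) cs)"
        proof (rule bmlinD[OF t])
          show "\<Union> (set ` set (take i cs)) \<subseteq> V" "\<Union> (set ` set (drop (Suc i) cs)) \<subseteq> V"
            "[] \<notin> set (take i cs)" "[] \<notin> set (drop (Suc i) cs)"
            using P(1) ne by (auto dest: in_set_takeD in_set_dropD)
          show "set (cs ! i) \<subseteq> V" using P(1) i by simp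
        qed (use P l Nil.prems in auto)
        then show "t (cs[i := (sa c u + v) # cs ! i]) = sc c (t (cs[i := u # cs ! i])) + t (cs[i := v # cs ! i])"
          using i by (simp add: upd_conv_take_nth_drop)
      qed
      with 1 show "t ([sa c u + v] # cs) + (\<Sum>i<length cs. t (cs[i := (sa c u + v) # cs ! i]))
        = sc c (t ([u] # cs) + (\<Sum>i<length cs. t (cs[i := u # cs ! i])))
          + (t ([v] # cs) + (\<Sum>i<length cs. t (cs[i := v # cs ! i])))"
        by (simp add: C.scale_right_distrib add_ac)
    qed
  next
    case (Cons a as)
    have "bmlin sa sc V (length as + length bs + 1) (\<lambda>bs. t ([a] # bs) + (\<Sum>i<length bs. t (bs[i := a # bs ! i])))"
      using Cons.prems by (intro bmlin_dt) auto
    then show ?case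
      unfolding append_Cons sum_splits_Cons
      using Cons.prems by (intro Cons.IH) auto
  qed
qed

locale three_spaces = two_spaces sa s2 + B: two_spaces s2 sc
  for sa :: "'k::real_normed_field \<Rightarrow> 'a::real_normed_vector \<Rightarrow> 'a"
    and s2 :: "'k \<Rightarrow> 'b::real_normed_vector \<Rightarrow> 'b"
    and sc :: "'k \<Rightarrow> 'c::real_normed_vector \<Rightarrow> 'c"
begin

sublocale AC: two_spaces sa sc ..

lemma FD_mlin:
  assumes f: "\<And>l. 1 \<le> l \<Longrightarrow> l \<le> m \<Longrightarrow> mlin sa s2 V1 l (Df l x)"
    and g: "\<And>l. l \<le> m \<Longrightarrow> mlin s2 sc V2 l (Dg l (f x))"
    and rng: "\<And>l vs. 1 \<le> l \<Longrightarrow> l \<le> m \<Longrightarrow> vs \<in> vl V1 l \<Longrightarrow> Df l x vs \<in> V2"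
    and V1: "A.subspace V1"
  shows "mlin sa sc V1 m (FD Dg Df f n x)"
  unfolding FD_def
proof (rule AC.splits_mlin, unfold bmlin_def, intro allI impI)
  fix xs ys as bs u v c
  assume *: "\<Union>(set ` set xs) \<subseteq> V1 \<and> \<Union>(set ` set ys) \<subseteq> V1 \<and> set as \<subseteq> V1 \<and> set bs \<subseteq> V1 \<and> u \<in> V1 \<and> v \<in> V1
    \<and> [] \<notin> set xs \<and> [] \<notin> set ys
    \<and> sum_list (map length xs) + length as + length bs + 1 + sum_list (map length ys) = m"
  let ?Y = "\<lambda>b. Df (length b) x b" and ?l = "Suc (length as + length bs)"
  have len: "[] \<notin> set zs \<Longrightarrow> length zs \<le> sum_list (map length zs)" for zs :: "'a list list"
  proof (induction zs)
    case (Cons b bs)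
    then have "length b \<ge> 1" by (cases b) auto
    moreover have "length bs \<le> sum_list (map length bs)" using Cons by simp
    ultimately show ?case by simp
  qed simp
  have j: "Suc (length xs + length ys) \<le> m" using len[of xs] len[of ys] * by simp
  have rng': "?Y b \<in> V2" if "b \<noteq> []" "set b \<subseteq> V1" "length b \<le> m" for b
    using rng[of "length b" b] that by (simp add: vl_def Suc_le_eq)
  have mem: "length b \<le> m" if "b \<in> set xs \<union> set ys" for b
    using member_le_sum_list[of "length b" "map length xs"] member_le_sum_list[of "length b" "map length ys"]
      that * by auto
  have rxs: "set (map ?Y xs) \<subseteq> V2" "set (map ?Y ys) \<subseteq> V2"
  proof -
    have "?Y b \<in> V2" if "b \<in> set xs \<union> set ys" for b
    proof (rule rng')
      show "b \<noteq> []" "set b \<subseteq> V1" using * that by auto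
    qed (rule mem[OF that])
    then show "set (map ?Y xs) \<subseteq> V2" "set (map ?Y ys) \<subseteq> V2" by auto
  qed
  have yx: "Df ?l x (as @ w # bs) \<in> V2" if "w \<in> V1" for w
    using rng'[of "as @ w # bs"] * that by auto
  have "Df ?l x (as @ (sa c u + v) # bs) = s2 c (Df ?l x (as @ u # bs)) + Df ?l x (as @ v # bs)"
    by (rule mlinD[OF f]) (use * in auto)
  moreover have "Dg (Suc (length xs + length ys)) (f x)
      (map ?Y xs @ (s2 c (Df ?l x (as @ u # bs)) + Df ?l x (as @ v # bs)) # map ?Y ys)
    = sc c (Dg (Suc (length xs + length ys)) (f x) (map ?Y xs @ Df ?l x (as @ u # bs) # map ?Y ys))
      + Dg (Suc (length xs + length ys)) (f x) (map ?Y xs @ Df ?l x (as @ v # bs) # map ?Y ys)"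
    by (rule mlinD[OF g[OF j]]) (use rxs yx * in auto)
  ultimately show "fdt Dg Df f x (xs @ (as @ (sa c u + v) # bs) # ys)
      = sc c (fdt Dg Df f x (xs @ (as @ u # bs) # ys)) + fdt Dg Df f x (xs @ (as @ v # bs) # ys)"
    by (simp add: fdt_def)
qed

end

lemma FD_ubdd:
  assumes f: "\<And>l. 1 \<le> l \<Longrightarrow> l \<le> m \<Longrightarrow> ubdd F (vl V1 l) (\<lambda>i. pn) (\<lambda>i. Df l (a i))"
    and g: "\<And>l. l \<le> m \<Longrightarrow> ubdd F (vl V2 l) (\<lambda>i. pn) (\<lambda>i. Dg l (f (a i)))"
    and rng: "\<forall>\<^sub>F i in F. \<forall>l\<in>{1..m}. \<forall>vs\<in>vl V1 l. Df l (a i) vs \<in> V2"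
  shows "ubdd F (vl V1 m) (\<lambda>i. pn) (\<lambda>i. FD Dg Df f n (a i))"
  unfolding FD_def
proof (rule ubdd_splits)
  fix ls assume ls: "ls \<in> shapes m"
  note sl = shapes_elem[OF ls] shapes_length[OF ls]
  let ?j = "length ls"
  have "ubdd F (tset V1 V2 ls ?j) (\<lambda>i (bs, rest). 1 * (pn (concat bs) * pn rest))
    (\<lambda>i (bs, rest). Dg ?j (f (a i)) (map (\<lambda>b. Df (length b) (a i) b) bs @ rest))"
  proof (rule term_bdd)
    fix m' assume "m' \<in> set ls"
    with sl have "1 \<le> m'" "m' \<le> m" by (auto simp: Suc_le_eq)
    from f[OF this] show "ubdd F (vl V1 m') (\<lambda>i. pn) (\<lambda>i b. Df (length b) (a i) b)"
      by (rule ubdd_cong) (auto simp: vl_def intro!: always_eventually)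
  next
    show "\<forall>\<^sub>F i in F. \<forall>b. length b \<in> set ls \<longrightarrow> set b \<subseteq> V1 \<longrightarrow> Df (length b) (a i) b \<in> V2"
      using rng
    proof eventually_elim
      case (elim i)
      show ?case
      proof (intro allI impI)
        fix b assume b: "length b \<in> set ls" "set b \<subseteq> V1"
        then have "length b \<in> {1..m}" "b \<in> vl V1 (length b)"
          using sl(1)[of "length b"] by (simp_all add: vl_def Suc_le_eq)
        with elim show "Df (length b) (a i) b \<in> V2" by blast
      qed
    qed
  next
    show "ubdd F (vl V2 ?j) (\<lambda>i vs. 1 * pn vs) (\<lambda>i. Dg ?j (f (a i)))"
      using g[of ?j] sl by simp
  qed auto
  then show "ubdd F (blks V1 ls) (\<lambda>i bs. pn (concat bs)) (\<lambda>i. fdt Dg Df f (a i))"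
  proof (rule ubdd_le[where K = 1])
    show "\<forall>\<^sub>F i in F. \<forall>q\<in>blks V1 ls. \<exists>p\<in>tset V1 V2 ls ?j.
       norm (fdt Dg Df f (a i) q) \<le> 1 * norm (case p of (bs, rest) \<Rightarrow> Dg ?j (f (a i)) (map (\<lambda>b. Df (length b) (a i) b) bs @ rest)) \<and>
       (case p of (bs, rest) \<Rightarrow> 1 * (pn (concat bs) * pn rest)) \<le> pn (concat q)"
    proof (intro always_eventually allI ballI)
      fix i q assume "q \<in> blks V1 ls"
      then show "\<exists>p\<in>tset V1 V2 ls ?j.
       norm (fdt Dg Df f (a i) q) \<le> 1 * norm (case p of (bs, rest) \<Rightarrow> Dg ?j (f (a i)) (map (\<lambda>b. Df (length b) (a i) b) bs @ rest)) \<and>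
       (case p of (bs, rest) \<Rightarrow> 1 * (pn (concat bs) * pn rest)) \<le> pn (concat q)"
        by (intro bexI[of _ "(q, [])"]) (auto simp: tset_def fdt_def blks_def)
    qed
  qed simp
qed

lemma FD_ccont:
  assumes f: "\<And>l. 1 \<le> l \<Longrightarrow> l \<le> m \<Longrightarrow> ubdd F (vl V1 l) (\<lambda>i. pn) (\<lambda>i. Df l (a i))"
      "\<And>l. 1 \<le> l \<Longrightarrow> l \<le> m \<Longrightarrow> ubdd F (vl V1 l) (\<lambda>i. pn) (\<lambda>i. Df l (c i))"
      "\<And>l. 1 \<le> l \<Longrightarrow> l \<le> m \<Longrightarrow> usmall F (vl V1 l) (\<lambda>i. pn) (\<lambda>i vs. Df l (a i) vs - Df l (c i) vs)"
    and g: "\<And>l. l \<le> m \<Longrightarrow> ubdd F (vl V2 l) (\<lambda>i. pn) (\<lambda>i. Dg l (f (c i)))"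
      "\<And>l. l \<le> m \<Longrightarrow> usmall F (vl V2 l) (\<lambda>i. pn) (\<lambda>i vs. Dg l (f (a i)) vs - Dg l (f (c i)) vs)"
      "\<And>l. l \<le> m \<Longrightarrow> \<forall>\<^sub>F i in F. mdiff V2 l (Dg l (f (c i)))"
    and rng: "\<forall>\<^sub>F i in F. \<forall>l\<in>{1..m}. \<forall>vs\<in>vl V1 l. Df l (a i) vs \<in> V2 \<and> Df l (c i) vs \<in> V2"
    and V2: "\<And>u v. u \<in> V2 \<Longrightarrow> v \<in> V2 \<Longrightarrow> u - v \<in> V2"
  shows "usmall F (vl V1 m) (\<lambda>i. pn) (\<lambda>i vs. FD Dg Df f n (a i) vs - FD Dg Df f n (c i) vs)"
proof -
  have "usmall F (vl V1 m) (\<lambda>i vs. 1 * pn vs) (\<lambda>i vs. \<Sum>bs\<leftarrow>splits vs. fdt Dg Df f (a i) bs - fdt Dg Df f (c i) bs)"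
  proof (rule usmall_splits)
    fix ls assume ls: "ls \<in> shapes m"
    note sl = shapes_elem[OF ls] shapes_length[OF ls]
    let ?j = "length ls"
    have "usmall F (tset V1 V2 ls ?j) (\<lambda>i (bs, rest). pn (concat bs) * pn rest)
      (\<lambda>i (bs, rest). Dg ?j (f (a i)) (map (\<lambda>b. Df (length b) (a i) b) bs @ rest)
        - Dg ?j (f (c i)) (map (\<lambda>b. Df (length b) (c i) b) bs @ rest))"
    proof (rule term_cont)
      fix m' assume "m' \<in> set ls"
      with sl have m': "1 \<le> m'" "m' \<le> m" by (auto simp: Suc_le_eq)
      show "ubdd F (vl V1 m') (\<lambda>i. pn) (\<lambda>i b. Df (length b) (a i) b)"
        using f(1)[OF m'] by (rule ubdd_cong) (auto simp: vl_def intro!: always_eventually)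
      show "ubdd F (vl V1 m') (\<lambda>i. pn) (\<lambda>i b. Df (length b) (c i) b)"
        using f(2)[OF m'] by (rule ubdd_cong) (auto simp: vl_def intro!: always_eventually)
      show "usmall F (vl V1 m') (\<lambda>i. pn) (\<lambda>i b. Df (length b) (a i) b - Df (length b) (c i) b)"
        using f(3)[OF m'] by (rule usmall_cong) (auto simp: vl_def intro!: always_eventually)
    next
      show "\<forall>\<^sub>F i in F. \<forall>b. length b \<in> set ls \<longrightarrow> set b \<subseteq> V1 \<longrightarrow>
          Df (length b) (a i) b \<in> V2 \<and> Df (length b) (c i) b \<in> V2"
        using rng
      proof eventually_elim
        case (elim i)
        show ?case
        proof (intro allI impI)
          fix b assume b: "length b \<in> set ls" "set b \<subseteq> V1"
          then have "length b \<in> {1..m}" "b \<in> vl V1 (length b)"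
            using sl(1)[of "length b"] by (simp_all add: vl_def Suc_le_eq)
          with elim show "Df (length b) (a i) b \<in> V2 \<and> Df (length b) (c i) b \<in> V2" by blast
        qed
      qed
    qed (use g V2 sl in auto)
    then show "usmall F (blks V1 ls) (\<lambda>i bs. 1 * pn (concat bs)) (\<lambda>i bs. fdt Dg Df f (a i) bs - fdt Dg Df f (c i) bs)"
    proof (rule usmall_le[where K = 1])
      show "\<forall>\<^sub>F i in F. \<forall>q\<in>blks V1 ls. \<exists>p\<in>tset V1 V2 ls ?j.
         norm (fdt Dg Df f (a i) q - fdt Dg Df f (c i) q) \<le> 1 * norm (case p of (bs, rest) \<Rightarrow>
           Dg ?j (f (a i)) (map (\<lambda>b. Df (length b) (a i) b) bs @ rest)
          - Dg ?j (f (c i)) (map (\<lambda>b. Df (length b) (c i) b) bs @ rest)) \<and>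
         (case p of (bs, rest) \<Rightarrow> pn (concat bs) * pn rest) \<le> 1 * pn (concat q)"
      proof (intro always_eventually allI ballI)
        fix i q assume "q \<in> blks V1 ls"
        then show "\<exists>p\<in>tset V1 V2 ls ?j.
         norm (fdt Dg Df f (a i) q - fdt Dg Df f (c i) q) \<le> 1 * norm (case p of (bs, rest) \<Rightarrow>
           Dg ?j (f (a i)) (map (\<lambda>b. Df (length b) (a i) b) bs @ rest)
          - Dg ?j (f (c i)) (map (\<lambda>b. Df (length b) (c i) b) bs @ rest)) \<and>
         (case p of (bs, rest) \<Rightarrow> pn (concat bs) * pn rest) \<le> 1 * pn (concat q)"
          by (intro bexI[of _ "(q, [])"]) (auto simp: tset_def fdt_def blks_def)
      qed
    qed simp
  qed auto
  then show ?thesis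
    by (simp add: FD_def sum_list_subtractf)
qed

context three_spaces
begin

text \<open>The chain rule for the outer factor \<open>Dg j (f y)\<close>. The derivative of
  \<open>f\<close> enters only through the increment \<open>L\<close>, so the result also applies to
  implicitly defined maps, of which only some derivatives are known at that stage.\<close>

lemma outer_diff:
  assumes g: "has_frechet_derivs s2 sc V2 U2 r g Dg" and V2: "C.subspace V2" and UV2: "U2 \<subseteq> V2"
    and V1: "A.subspace V1" and UV1: "U1 \<subseteq> V1" and x: "x \<in> U1" and fU: "f ` U1 \<subseteq> U2"
    and jr: "j < r"
    and fsm: "\<forall>e>0. \<forall>\<^sub>F y in at x within U1. norm (f y - f x - L (y - x)) \<le> e * norm (y - x)"
    and C1: "C1 > 0" "\<forall>\<^sub>F y in at x within U1. norm (L (y - x)) \<le> C1 * norm (y - x)"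
    and LV: "\<forall>y\<in>U1. L (y - x) \<in> V2"
  shows "filterlim f (nin (f x) U2) (at x within U1)"
    and "ubdd (at x within U1) (vl V2 j) (\<lambda>y vs. norm (y - x) * pn vs) (\<lambda>y vs. Dg (Suc j) (f x) (L (y - x) # vs))"
    and "usmall (at x within U1) (vl V2 j) (\<lambda>y vs. norm (y - x) * pn vs)
      (\<lambda>y vs. Dg j (f y) vs - Dg j (f x) vs - Dg (Suc j) (f x) (L (y - x) # vs))"
    and "\<forall>\<^sub>F y in at x within U1. mdiff V2 j (\<lambda>vs. Dg (Suc j) (f x) (L (y - x) # vs))"
proof -
  let ?F = "at x within U1" and ?\<eta> = "\<lambda>y. norm (y - x)"
  have evU: "\<forall>\<^sub>F y in ?F. y \<in> U1" by (simp add: eventually_at_filter)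
  have fxU: "f y \<in> U2" if "y \<in> U1" for y using that fU by blast
  have tend: "(?\<eta> \<longlongrightarrow> 0) ?F"
    by (rule tendsto_mono[OF at_le_nin tendsto_norm_diff_nin])
  have flip: "\<forall>\<^sub>F y in ?F. norm (f y - f x) \<le> (C1 + 1) * ?\<eta> y"
    using fsm[rule_format, OF zero_less_one] C1(2)
  proof eventually_elim
    case (elim y)
    have "norm (f y - f x) \<le> norm (f y - f x - L (y - x)) + norm (L (y - x))"
      by (metis diff_add_cancel norm_triangle_ineq)
    with elim show ?case by (simp add: algebra_simps)
  qed
  have ftend: "filterlim f (nin (f x) U2) ?F"
    unfolding nin_def filterlim_inf filterlim_principal
  proof
    show "(f \<longlongrightarrow> f x) ?F"
    proof (rule LIM_zero_cancel, rule Lim_null_comparison)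
      show "\<forall>\<^sub>F y in ?F. norm (f y - f x) \<le> (C1 + 1) * ?\<eta> y" by (rule flip)
      show "((\<lambda>y. (C1 + 1) * ?\<eta> y) \<longlongrightarrow> 0) ?F" using tendsto_mult_right_zero[OF tend] .
    qed
    show "\<forall>\<^sub>F y in ?F. f y \<in> U2" using evU by (rule eventually_mono) (rule fxU)
  qed
  obtain Cg where Cg: "Cg \<ge> 0" "\<And>vs. vs \<in> vl V2 (Suc j) \<Longrightarrow> norm (Dg (Suc j) (f x) vs) \<le> Cg * pn vs"
    using B.hfd_mbdd[OF g V2 UV2, of "Suc j" "f x"] jr fxU[OF x] by (auto simp: mbdd_def)
  have fdV: "f y - f x \<in> V2" if "y \<in> U1" for y
    using fxU[OF that] fxU[OF x] UV2 by (intro C.subspace_diff[OF V2]) auto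
  have mg: "mlin s2 sc V2 (Suc j) (Dg (Suc j) (f x))"
    using B.hfd_mlin[OF g V2 UV2] jr fxU[OF x] by simp
  have X1: "ubdd ?F (vl V2 j) (\<lambda>y vs. ?\<eta> y * pn vs) (\<lambda>y vs. Dg (Suc j) (f x) (L (y - x) # vs))"
    unfolding ubdd_def
  proof (intro exI[of _ "(Cg + 1) * C1"] conjI)
    show "(Cg + 1) * C1 > 0" using Cg C1 by simp
    show "\<forall>\<^sub>F y in ?F. \<forall>vs\<in>vl V2 j. norm (Dg (Suc j) (f x) (L (y - x) # vs)) \<le> (Cg + 1) * C1 * (?\<eta> y * pn vs)"
      using evU C1(2)
    proof eventually_elim
      case (elim y)
      show ?case
      proof
        fix vs assume vs: "vs \<in> vl V2 j"
        have "norm (Dg (Suc j) (f x) (L (y - x) # vs)) \<le> Cg * (norm (L (y - x)) * pn vs)"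
          using Cg(2)[of "L (y - x) # vs"] LV[rule_format, OF elim(1)] vs by simp
        also have "\<dots> \<le> (Cg + 1) * ((C1 * ?\<eta> y) * pn vs)"
          using elim Cg C1 by (intro mult_mono mult_right_mono) auto
        finally show "norm (Dg (Suc j) (f x) (L (y - x) # vs)) \<le> (Cg + 1) * C1 * (?\<eta> y * pn vs)"
          by (simp add: mult_ac)
      qed
    qed
  qed
  have XX1: "usmall ?F (vl V2 j) (\<lambda>y vs. ?\<eta> y * pn vs)
      (\<lambda>y vs. Dg j (f y) vs - Dg j (f x) vs - Dg (Suc j) (f x) ((f y - f x) # vs))"
  proof (rule usmall_le[where K = 1 and P = "vl V2 j"])
    have g': "usmall ?F (vl V2 j) (\<lambda>y vs. norm (f y - f x) * pn vs)
      (\<lambda>y vs. Dg j (f y) vs - Dg j (f x) vs - Dg (Suc j) (f x) ((f y - f x) # vs))"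
      by (rule usmall_filtermap[OF B.hfd_diff[OF g V2 UV2 jr fxU[OF x]] ftend])
    show "usmall ?F (vl V2 j) (\<lambda>y vs. ?\<eta> y * pn vs)
      (\<lambda>y vs. Dg j (f y) vs - Dg j (f x) vs - Dg (Suc j) (f x) ((f y - f x) # vs))"
      unfolding usmall_def
    proof (intro allI impI)
      fix e :: real assume "e > 0"
      then have e: "e / (C1 + 1) > 0" using C1 by simp
      show "\<forall>\<^sub>F y in ?F. \<forall>vs\<in>vl V2 j. norm (Dg j (f y) vs - Dg j (f x) vs - Dg (Suc j) (f x) ((f y - f x) # vs))
          \<le> e * (?\<eta> y * pn vs)"
        using usmallD[OF g' e] flip
      proof eventually_elim
        case (elim y)
        show ?case
        proof
          fix vs assume vs: "vs \<in> vl V2 j"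
          have "norm (Dg j (f y) vs - Dg j (f x) vs - Dg (Suc j) (f x) ((f y - f x) # vs))
              \<le> e / (C1 + 1) * (norm (f y - f x) * pn vs)" using elim vs by blast
          also have "\<dots> \<le> e / (C1 + 1) * (((C1 + 1) * ?\<eta> y) * pn vs)"
            using elim e by (intro mult_left_mono mult_right_mono) auto
          also have "\<dots> = (e / (C1 + 1) * (C1 + 1)) * (?\<eta> y * pn vs)" by (simp only: mult_ac)
          also have "e / (C1 + 1) * (C1 + 1) = e" using C1 by simp
          finally show "norm (Dg j (f y) vs - Dg j (f x) vs - Dg (Suc j) (f x) ((f y - f x) # vs))
          \<le> e * (?\<eta> y * pn vs)" .
        qed
      qed
    qed
  qed (auto intro!: always_eventually)
  \<comment> \<open>Replacing \<open>f y - f x\<close> by \<open>L (y - x)\<close> costs the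
    remainder of \<open>f\<close>, which is small against \<open>norm (y - x)\<close>.\<close>
  have XX2: "usmall ?F (vl V2 j) (\<lambda>y vs. ?\<eta> y * pn vs)
      (\<lambda>y vs. Dg (Suc j) (f x) ((f y - f x - L (y - x)) # vs))"
    unfolding usmall_def
  proof (intro allI impI)
    fix e :: real assume "e > 0"
    then have e: "e / (Cg + 1) > 0" using Cg by simp
    show "\<forall>\<^sub>F y in ?F. \<forall>vs\<in>vl V2 j. norm (Dg (Suc j) (f x) ((f y - f x - L (y - x)) # vs)) \<le> e * (?\<eta> y * pn vs)"
      using fsm[rule_format, OF e] evU
    proof eventually_elim
      case (elim y)
      show ?case
      proof
        fix vs assume vs: "vs \<in> vl V2 j"
        have "norm (Dg (Suc j) (f x) ((f y - f x - L (y - x)) # vs))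
            \<le> Cg * (norm (f y - f x - L (y - x)) * pn vs)"
          using Cg(2)[of "(f y - f x - L (y - x)) # vs"] C.subspace_diff[OF V2 fdV[OF elim(2)] LV[rule_format, OF elim(2)]] vs by simp
        also have "\<dots> \<le> (Cg + 1) * ((e / (Cg + 1) * ?\<eta> y) * pn vs)"
          using elim Cg by (intro mult_mono mult_right_mono) auto
        also have "\<dots> = (e / (Cg + 1) * (Cg + 1)) * (?\<eta> y * pn vs)" by (simp only: mult_ac)
        also have "e / (Cg + 1) * (Cg + 1) = e" using Cg by simp
        finally show "norm (Dg (Suc j) (f x) ((f y - f x - L (y - x)) # vs)) \<le> e * (?\<eta> y * pn vs)" .
      qed
    qed
  qed
  have XX: "usmall ?F (vl V2 j) (\<lambda>y vs. ?\<eta> y * pn vs)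
      (\<lambda>y vs. Dg j (f y) vs - Dg j (f x) vs - Dg (Suc j) (f x) (L (y - x) # vs))"
  proof (rule usmall_cong[OF usmall_add[OF XX1 XX2]])
    show "\<forall>\<^sub>F y in ?F. \<forall>vs\<in>vl V2 j.
        Dg j (f y) vs - Dg j (f x) vs - Dg (Suc j) (f x) ((f y - f x) # vs)
          + Dg (Suc j) (f x) ((f y - f x - L (y - x)) # vs)
        = Dg j (f y) vs - Dg j (f x) vs - Dg (Suc j) (f x) (L (y - x) # vs)"
      using evU
    proof eventually_elim
      case (elim y)
      show ?case
      proof
        fix vs assume "vs \<in> vl V2 j"
        then have "Dg (Suc j) (f x) ((f y - f x - L (y - x)) # vs)
            = Dg (Suc j) (f x) ((f y - f x) # vs) - Dg (Suc j) (f x) (L (y - x) # vs)"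
          using B.mlin_diff[OF mg V2, of "[]" vs] LV[rule_format, OF elim] fdV[OF elim] by (simp add: vl_def)
        then show "Dg j (f y) vs - Dg j (f x) vs - Dg (Suc j) (f x) ((f y - f x) # vs)
          + Dg (Suc j) (f x) ((f y - f x - L (y - x)) # vs)
          = Dg j (f y) vs - Dg j (f x) vs - Dg (Suc j) (f x) (L (y - x) # vs)" by simp
      qed
    qed
  qed
  have md1: "\<forall>\<^sub>F y in ?F. mdiff V2 j (\<lambda>vs. Dg (Suc j) (f x) (L (y - x) # vs))"
    using evU
  proof eventually_elim
    case (elim y)
    show ?case
      unfolding mdiff_def
    proof (intro allI impI)
      fix as bs u v
      assume "set as \<subseteq> V2 \<and> set bs \<subseteq> V2 \<and> u \<in> V2 \<and> v \<in> V2 \<and> length as + length bs + 1 = j"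
      then show "Dg (Suc j) (f x) (L (y - x) # as @ (u - v) # bs)
        = Dg (Suc j) (f x) (L (y - x) # as @ u # bs) - Dg (Suc j) (f x) (L (y - x) # as @ v # bs)"
        using B.mlin_diff[OF mg V2, of "L (y - x) # as" bs u v] LV[rule_format, OF elim] by simp
    qed
  qed
  show "filterlim f (nin (f x) U2) ?F" by (rule ftend)
  show "ubdd ?F (vl V2 j) (\<lambda>y vs. ?\<eta> y * pn vs) (\<lambda>y vs. Dg (Suc j) (f x) (L (y - x) # vs))" by (rule X1)
  show "usmall ?F (vl V2 j) (\<lambda>y vs. ?\<eta> y * pn vs)
      (\<lambda>y vs. Dg j (f y) vs - Dg j (f x) vs - Dg (Suc j) (f x) (L (y - x) # vs))" by (rule XX)
  show "\<forall>\<^sub>F y in ?F. mdiff V2 j (\<lambda>vs. Dg (Suc j) (f x) (L (y - x) # vs))" by (rule md1)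
qed

text \<open>Differentiates the terms of one shape. Differentiability of \<open>Df l\<close> is asked
  only for order \<open>0\<close> and the block lengths in \<open>ls\<close>; in the implicit case
  the derivative of order \<open>m\<close> is not yet known to be differentiable, and no block of
  the shapes considered there has that length.\<close>

lemma fdt_diff:
  assumes g: "has_frechet_derivs s2 sc V2 U2 r g Dg" and V2: "C.subspace V2" and UV2: "U2 \<subseteq> V2"
    and V1: "A.subspace V1" and UV1: "U1 \<subseteq> V1" and x: "x \<in> U1" and fU: "f ` U1 \<subseteq> U2"
    and f0: "\<And>y. y \<in> U1 \<Longrightarrow> Df 0 y [] = f y"
    and jr: "length ls < r"
    and f: "\<And>l. l \<in> insert 0 (set ls) \<Longrightarrow> usmall (at x within U1) (vl V1 l) (\<lambda>y vs. norm (y - x) * pn vs)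
      (\<lambda>y vs. Df l y vs - Df l x vs - Df (Suc l) x ((y - x) # vs))"
    and fb: "\<And>l. l \<in> insert 0 (set ls) \<Longrightarrow> mbdd V1 l (Df l x) \<and> mbdd V1 (Suc l) (Df (Suc l) x)"
    and rng: "\<And>l y vs. l \<in> set ls \<Longrightarrow> y \<in> U1 \<Longrightarrow> vs \<in> vl V1 l \<Longrightarrow> Df l y vs \<in> V2"
      "\<And>l y vs. l \<in> insert 0 (set ls) \<Longrightarrow> y \<in> U1 \<Longrightarrow> vs \<in> vl V1 (Suc l) \<Longrightarrow> Df (Suc l) y vs \<in> V2"
  shows "usmall (at x within U1) (blks V1 ls) (\<lambda>y bs. norm (y - x) * pn (concat bs))
    (\<lambda>y bs. fdt Dg Df f y bs - fdt Dg Df f x bs - dterm (Dg (length bs) (f x))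
      (\<lambda>vs. Dg (Suc (length bs)) (f x) (Df 1 x [y - x] # vs))
      (\<lambda>b. Df (length b) x b) (\<lambda>b. Df (Suc (length b)) x ((y - x) # b)) bs [])"
proof -
  let ?F = "at x within U1" and ?j = "length ls" and ?\<eta> = "\<lambda>y. norm (y - x)"
  have evU: "\<forall>\<^sub>F y in ?F. y \<in> U1" by (simp add: eventually_at_filter)
  have hV: "y - x \<in> V1" if "y \<in> U1" for y using that x UV1 A.subspace_diff[OF V1] by blast
  have fxU: "f y \<in> U2" if "y \<in> U1" for y using that fU by blast
  have tend: "(?\<eta> \<longlongrightarrow> 0) ?F"
    by (rule tendsto_mono[OF at_le_nin tendsto_norm_diff_nin])
  have Y1b: "ubdd ?F (vl V1 l) (\<lambda>y vs. ?\<eta> y * pn vs) (\<lambda>y vs. Df (Suc l) x ((y - x) # vs))"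
    if l: "l \<in> insert 0 (set ls)" for l
  proof (rule ubdd_le[where K = 1])
    show "ubdd ?F (vl V1 (Suc l)) (\<lambda>y. pn) (\<lambda>y. Df (Suc l) x)"
      using fb[OF l] by (intro mbdd_imp_ubdd) auto
    show "\<forall>\<^sub>F y in ?F. \<forall>q\<in>vl V1 l. \<exists>p\<in>vl V1 (Suc l).
        norm (Df (Suc l) x ((y - x) # q)) \<le> 1 * norm (Df (Suc l) x p) \<and> pn p \<le> ?\<eta> y * pn q"
      using evU
    proof eventually_elim
      case (elim y)
      show ?case
      proof
        fix q assume "q \<in> vl V1 l"
        then show "\<exists>p\<in>vl V1 (Suc l).
          norm (Df (Suc l) x ((y - x) # q)) \<le> 1 * norm (Df (Suc l) x p) \<and> pn p \<le> ?\<eta> y * pn q"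
          using hV[OF elim] by (intro bexI[of _ "(y - x) # q"]) auto
      qed
    qed
  qed simp
  obtain C1 where C1: "C1 > 0" "\<forall>\<^sub>F y in ?F. norm (Df 1 x [y - x]) \<le> C1 * ?\<eta> y"
    using Y1b[of 0] by (auto elim!: ubddE)
  have fsm: "\<forall>\<^sub>F y in ?F. norm (f y - f x - Df 1 x [y - x]) \<le> e * ?\<eta> y" if "e > 0" for e
    using usmallD[OF f[of 0] that] evU x by (auto simp: f0 elim: eventually_elim2)
  have Df1V: "Df 1 x [y - x] \<in> V2" if "y \<in> U1" for y
    using rng(2)[of 0 x "[y - x]"] x hV[OF that] by simp
  have "\<forall>e>0. \<forall>\<^sub>F y in ?F. norm (f y - f x - Df 1 x [y - x]) \<le> e * ?\<eta> y"
    and "\<forall>y\<in>U1. Df 1 x [y - x] \<in> V2"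
    using fsm Df1V by auto
  note od = outer_diff[OF g V2 UV2 V1 UV1 x fU jr, of "\<lambda>h. Df 1 x [h]", OF this(1) C1 this(2)]
  note X1 = od(2) and XX = od(3) and md1 = od(4)
  have main: "usmall ?F (tset V1 V2 ls ?j) (\<lambda>y (bs, rest). ?\<eta> y * (pn (concat bs) * pn rest))
    (\<lambda>y (bs, rest). Dg ?j (f y) (map (\<lambda>b. Df (length b) y b) bs @ rest)
      - Dg ?j (f x) (map (\<lambda>b. Df (length b) x b) bs @ rest)
      - dterm (Dg ?j (f x)) (\<lambda>vs. Dg (Suc ?j) (f x) (Df 1 x [y - x] # vs))
      (\<lambda>b. Df (length b) x b) (\<lambda>b. Df (Suc (length b)) x ((y - x) # b)) bs rest)"
  proof (rule conjunct1[OF term_diff])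
    fix l assume "l \<in> set ls"
    then have l: "l \<in> insert 0 (set ls)" by simp
    have "ubdd ?F (vl V1 l) (\<lambda>y. pn) (\<lambda>y. Df l x)" using fb[OF l] by (intro mbdd_imp_ubdd) simp
    then show "ubdd ?F (vl V1 l) (\<lambda>y. pn) (\<lambda>y b. Df (length b) x b)"
      by (rule ubdd_cong) (auto simp: vl_def intro!: always_eventually)
    show "ubdd ?F (vl V1 l) (\<lambda>y b. ?\<eta> y * pn b) (\<lambda>y b. Df (Suc (length b)) x ((y - x) # b))"
      by (rule ubdd_cong[OF Y1b[OF l]]) (auto simp: vl_def intro!: always_eventually)
    show "usmall ?F (vl V1 l) (\<lambda>y b. ?\<eta> y * pn b)
      (\<lambda>y b. Df (length b) y b - Df (length b) x b - Df (Suc (length b)) x ((y - x) # b))"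
      by (rule usmall_cong[OF f[OF l]]) (auto simp: vl_def intro!: always_eventually)
  next
    show "\<forall>\<^sub>F y in ?F. \<forall>b. length b \<in> set ls \<longrightarrow> set b \<subseteq> V1 \<longrightarrow> Df (length b) y b \<in> V2 \<and> Df (length b) x b \<in> V2
        \<and> Df (Suc (length b)) x ((y - x) # b) \<in> V2"
      using evU
    proof eventually_elim
      case (elim y)
      show ?case
        using rng elim hV[OF elim] x by (auto simp: vl_def)
    qed
    show "ubdd ?F (vl V2 ?j) (\<lambda>y. pn) (\<lambda>y. Dg ?j (f x))"
      using B.hfd_mbdd[OF g V2 UV2] jr fxU[OF x] by (intro mbdd_imp_ubdd) auto
    show "mdiff V2 ?j (Dg ?j (f x))"
      using B.hfd_mlin[OF g V2 UV2] jr fxU[OF x] by (intro B.mlin_mdiff V2) auto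
  qed (use X1 XX md1 tend C.subspace_diff[OF V2] in auto)
  show ?thesis
  proof (rule usmall_le[OF main, where K = 1])
    show "\<forall>\<^sub>F y in ?F. \<forall>q\<in>blks V1 ls. \<exists>p\<in>tset V1 V2 ls ?j.
      norm (fdt Dg Df f y q - fdt Dg Df f x q - dterm (Dg (length q) (f x))
        (\<lambda>vs. Dg (Suc (length q)) (f x) (Df 1 x [y - x] # vs))
        (\<lambda>b. Df (length b) x b) (\<lambda>b. Df (Suc (length b)) x ((y - x) # b)) q []) \<le>
      1 * norm (case p of (bs, rest) \<Rightarrow> Dg ?j (f y) (map (\<lambda>b. Df (length b) y b) bs @ rest)
      - Dg ?j (f x) (map (\<lambda>b. Df (length b) x b) bs @ rest)
      - dterm (Dg ?j (f x)) (\<lambda>vs. Dg (Suc ?j) (f x) (Df 1 x [y - x] # vs))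
      (\<lambda>b. Df (length b) x b) (\<lambda>b. Df (Suc (length b)) x ((y - x) # b)) bs rest)
      \<and> (case p of (bs, rest) \<Rightarrow> ?\<eta> y * (pn (concat bs) * pn rest)) \<le> ?\<eta> y * pn (concat q)"
    proof (intro always_eventually allI ballI)
      fix y q assume q: "q \<in> blks V1 ls"
      then have "length q = ?j" by (auto simp: blks_def)
      then show "\<exists>p\<in>tset V1 V2 ls ?j.
      norm (fdt Dg Df f y q - fdt Dg Df f x q - dterm (Dg (length q) (f x))
        (\<lambda>vs. Dg (Suc (length q)) (f x) (Df 1 x [y - x] # vs))
        (\<lambda>b. Df (length b) x b) (\<lambda>b. Df (Suc (length b)) x ((y - x) # b)) q []) \<le>
      1 * norm (case p of (bs, rest) \<Rightarrow> Dg ?j (f y) (map (\<lambda>b. Df (length b) y b) bs @ rest)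
      - Dg ?j (f x) (map (\<lambda>b. Df (length b) x b) bs @ rest)
      - dterm (Dg ?j (f x)) (\<lambda>vs. Dg (Suc ?j) (f x) (Df 1 x [y - x] # vs))
      (\<lambda>b. Df (length b) x b) (\<lambda>b. Df (Suc (length b)) x ((y - x) # b)) bs rest)
      \<and> (case p of (bs, rest) \<Rightarrow> ?\<eta> y * (pn (concat bs) * pn rest)) \<le> ?\<eta> y * pn (concat q)"
        using q by (intro bexI[of _ "(q, [])"]) (auto simp: tset_def fdt_def)
    qed
  qed simp
qed

theorem hfd_compose:
  assumes f: "has_frechet_derivs sa s2 V1 U1 r f Df" and g: "has_frechet_derivs s2 sc V2 U2 r g Dg"
    and V1: "A.subspace V1" and V2: "C.subspace V2" and UV1: "U1 \<subseteq> V1" and UV2: "U2 \<subseteq> V2"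
    and fU: "f ` U1 \<subseteq> U2"
    and rng: "\<And>l x vs. 1 \<le> l \<Longrightarrow> l \<le> r \<Longrightarrow> x \<in> U1 \<Longrightarrow> vs \<in> vl V1 l \<Longrightarrow> Df l x vs \<in> V2"
  shows "has_frechet_derivs sa sc V1 U1 r (\<lambda>x. g (f x)) (FD Dg Df f)"
  unfolding hfd_iff
proof (intro conjI allI impI ballI)
  fix x assume x: "x \<in> U1"
  then have fx: "f x \<in> U2" using fU by blast
  show "FD Dg Df f 0 x [] = g (f x)"
    using B.hfd_0[OF g V2 UV2 fx] by (simp add: FD_def fdt_def)
  { fix m assume m: "m \<le> r"
    show "mlin sa sc V1 m (FD Dg Df f m x)"
      by (rule FD_mlin[where ?V2.0 = V2])
        (use m x fx rng in \<open>auto intro: hfd_mlin[OF f V1 UV1] B.hfd_mlin[OF g V2 UV2] V1\<close>)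
    have "ubdd (top::unit filter) (vl V1 m) (\<lambda>i. pn) (\<lambda>i. FD Dg Df f m x)"
      by (rule FD_ubdd[where ?V2.0 = V2])
        (use m x fx rng in \<open>auto intro!: mbdd_imp_ubdd hfd_mbdd[OF f V1 UV1] B.hfd_mbdd[OF g V2 UV2] always_eventually\<close>)
    then show "mbdd V1 m (FD Dg Df f m x)"
      by (auto simp: ubdd_def mbdd_def intro: less_imp_le) }
  { fix m assume m: "m < r"
    have "usmall (at x within U1) (vl V1 m) (\<lambda>y vs. norm (y - x) * pn vs)
      (\<lambda>y vs. \<Sum>bs\<leftarrow>splits vs. fdt Dg Df f y bs - fdt Dg Df f x bs - dterm (Dg (length bs) (f x))
      (\<lambda>vs. Dg (Suc (length bs)) (f x) (Df 1 x [y - x] # vs))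
      (\<lambda>b. Df (length b) x b) (\<lambda>b. Df (Suc (length b)) x ((y - x) # b)) bs [])"
    proof (rule usmall_splits)
      fix ls assume ls: "ls \<in> shapes m"
      note sl = shapes_elem[OF ls] shapes_length[OF ls]
      show "usmall (at x within U1) (blks V1 ls) (\<lambda>y bs. norm (y - x) * pn (concat bs))
        (\<lambda>y bs. fdt Dg Df f y bs - fdt Dg Df f x bs - dterm (Dg (length bs) (f x))
          (\<lambda>vs. Dg (Suc (length bs)) (f x) (Df 1 x [y - x] # vs))
          (\<lambda>b. Df (length b) x b) (\<lambda>b. Df (Suc (length b)) x ((y - x) # b)) bs [])"
      proof (rule fdt_diff[OF g V2 UV2 V1 UV1 x fU])
        show "length ls < r" using sl m by simp
        fix l assume "l \<in> insert 0 (set ls)"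
        then have l: "l < r" using sl(1)[of l] m by auto
        show "usmall (at x within U1) (vl V1 l) (\<lambda>y vs. norm (y - x) * pn vs)
          (\<lambda>y vs. Df l y vs - Df l x vs - Df (Suc l) x ((y - x) # vs))"
          using f l x by (simp add: hfd_iff)
        show "mbdd V1 l (Df l x) \<and> mbdd V1 (Suc l) (Df (Suc l) x)"
          using hfd_mbdd[OF f V1 UV1] l x by simp
        fix y vs assume "y \<in> U1" "vs \<in> vl V1 (Suc l)"
        then show "Df (Suc l) y vs \<in> V2" using rng[of "Suc l" y vs] l by simp
      next
        fix l y vs assume "l \<in> set ls" "y \<in> U1" "vs \<in> vl V1 l"
        then show "Df l y vs \<in> V2" using rng[of l y vs] sl m by force
      qed (simp add: hfd_0[OF f V1 UV1])
    qed auto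
    then show "usmall (at x within U1) (vl V1 m) (\<lambda>y vs. norm (y - x) * pn vs)
      (\<lambda>y vs. FD Dg Df f m y vs - FD Dg Df f m x vs - FD Dg Df f (Suc m) x ((y - x) # vs))"
      unfolding FD_Suc by (simp add: FD_def sum_list_subtractf) }
  have fl: "filterlim f (nin (f x) U2) (at x within U1)"
    unfolding nin_def filterlim_inf filterlim_principal
    using tendsto_mono[OF at_le_nin hfd_tendsto[OF f V1 UV1 x]] fU
    by (auto simp: eventually_at_filter intro!: always_eventually)
  note cf = hfd_ccont[OF f V1 UV1 x] and cg = B.hfd_ccont[OF g V2 UV2 fx]
  show "usmall (at x within U1) (vl V1 r) (\<lambda>y. pn) (\<lambda>y vs. FD Dg Df f r y vs - FD Dg Df f r x vs)"
  proof (rule FD_ccont[where ?V2.0 = V2])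
    show "\<forall>\<^sub>F y in at x within U1. \<forall>l\<in>{1..r}. \<forall>vs\<in>vl V1 l. Df l y vs \<in> V2 \<and> Df l x vs \<in> V2"
      using rng x by (auto simp: eventually_at_filter intro!: always_eventually)
    fix l assume l: "l \<le> r"
    show "ubdd (at x within U1) (vl V1 l) (\<lambda>i. pn) (\<lambda>i. Df l i)"
      "ubdd (at x within U1) (vl V1 l) (\<lambda>i. pn) (\<lambda>i. Df l x)"
      "usmall (at x within U1) (vl V1 l) (\<lambda>i. pn) (\<lambda>i vs. Df l i vs - Df l x vs)"
      using ccontD[OF cf l] by (auto intro: ubdd_mono_filter usmall_mono_filter at_le_nin)
    show "ubdd (at x within U1) (vl V2 l) (\<lambda>i. pn) (\<lambda>i. Dg l (f x))"
      using B.hfd_mbdd[OF g V2 UV2 l fx] by (rule mbdd_imp_ubdd)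
    show "usmall (at x within U1) (vl V2 l) (\<lambda>i. pn) (\<lambda>i vs. Dg l (f i) vs - Dg l (f x) vs)"
      by (rule usmall_filtermap[OF ccontD(1)[OF cg l] fl])
    show "\<forall>\<^sub>F i in at x within U1. mdiff V2 l (Dg l (f x))"
      using B.mlin_mdiff[OF B.hfd_mlin[OF g V2 UV2 l fx] V2] by simp
  qed (rule C.subspace_diff[OF V2])
qed

end

section \<open>Smoothness of implicitly defined maps\<close>

text \<open>The partitions counted by \<open>splits\<close> with at least two blocks: the terms of the formula of Faa di Bruno
  in which the inner derivative of top order does not occur.\<close>

primrec rests :: "'a list \<Rightarrow> 'a list list list" where
  "rests [] = []"
| "rests (h # vs) = (if vs = [] then [] else [[h], vs] # concat (map (ext h) (rests vs)))"

lemma sum_splits_single: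
  "vs \<noteq> [] \<Longrightarrow> (\<Sum>bs\<leftarrow>splits vs. t bs) = t [vs] + (\<Sum>bs\<leftarrow>rests vs. (t bs :: 'b::comm_monoid_add))"
proof (induction vs arbitrary: t)
  case (Cons h vs)
  show ?case
  proof (cases "vs = []")
    case True
    then show ?thesis by (simp add: ext_def)
  next
    case False
    then show ?thesis
      using Cons.IH[OF False, of "\<lambda>bs. \<Sum>cs\<leftarrow>ext h bs. t cs"]
      by (simp add: sum_list_concat_map sum_ext add_ac)
  qed
qed simp

lemma single_in_splits: "vs \<noteq> [] \<Longrightarrow> [vs] \<in> set (splits vs)"
proof (induction vs)
  case (Cons h vs)
  then show ?case by (cases "vs = []") (auto simp: ext_def intro!: bexI[of _ "[vs]"])
qed simp

lemma rests_subset: "set (rests vs) \<subseteq> set (splits vs)"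
proof (induction vs)
  case (Cons h vs)
  show ?case
  proof (cases "vs = []")
    case False
    have "[[h], vs] \<in> set (ext h [vs])" by (simp add: ext_def)
    then have "[[h], vs] \<in> set (splits (h # vs))" using single_in_splits[OF False] by force
    then show ?thesis using Cons by auto
  qed simp
qed simp

lemma length_rests: "length (rests vs) \<le> length (splits vs)"
proof (cases "vs = []")
  case False
  then show ?thesis
    using sum_splits_single[of vs "\<lambda>_. 1::nat"] by (simp add: sum_list_triv)
qed simp

lemma rests_length: "bs \<in> set (rests vs) \<Longrightarrow> 2 \<le> length bs"
proof (induction vs arbitrary: bs)
  case (Cons h vs)
  then show ?case
    by (cases "vs = []") (auto simp: ext_def dest: Cons.IH)
qed simp

text \<open>There are at least two blocks and none is empty, so each is shorter than the whole
  list.\<close>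

lemma rests_block_length:
  assumes "bs \<in> set (rests vs)" "b \<in> set bs"
  shows "0 < length b" "length b < length vs"
proof -
  have p: "is_part vs bs" using assms rests_subset splits_part by blast
  then have ne: "[] \<notin> set bs" and ms: "mset (concat bs) = mset vs"
    by (auto simp: is_part_def)
  from mset_eq_length[OF ms] have s: "sum_list (map length bs) = length vs"
    by (simp add: length_concat)
  show "0 < length b" using ne assms by auto
  obtain xs ys where bs: "bs = xs @ b # ys" using assms(2) by (auto simp: in_set_conv_decomp)
  have "xs @ ys \<noteq> []" using rests_length[OF assms(1)] bs by auto
  then obtain c where c: "c \<in> set (xs @ ys)" by (metis list.set_sel(1))
  then have "c \<noteq> []" using ne bs by auto
  moreover have "length c \<le> sum_list (map length (xs @ ys))"
    using c by (intro member_le_sum_list) auto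
  ultimately have "0 < sum_list (map length (xs @ ys))"
    using length_greater_0_conv[of c] by linarith
  moreover have "length vs = length b + sum_list (map length (xs @ ys))"
    using s by (simp add: bs)
  ultimately show "length b < length vs" by linarith
qed

text \<open>The equation \<open>H (x + \<iota> (b x)) = 0\<close> with parameter \<open>x\<close>
  and unknown \<open>b x\<close> in \<open>Nc\<close>, embedded by \<open>\<iota>\<close> into the
  space in which \<open>x\<close> lives. In the application \<open>x = (\<epsilon>, n)\<close> and
  \<open>\<iota> u = (0, u)\<close>. Of \<open>b\<close> only continuity is assumed.
  \<open>invA x\<close> is some right inverse of the partial derivative on \<open>Nc\<close>, and
  \<open>K_bound\<close> makes that derivative injective there with a bound independent of
  \<open>x\<close>.\<close>

locale implicit_setup = two_spaces sx sc + E: normed_over se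
  for sx :: "'k::real_normed_field \<Rightarrow> 'x::real_normed_vector \<Rightarrow> 'x"
    and sc :: "'k \<Rightarrow> 'c::real_normed_vector \<Rightarrow> 'c"
    and se :: "'k \<Rightarrow> 'e::real_normed_vector \<Rightarrow> 'e" +
  fixes V2 :: "'x set" and r :: nat and H :: "'x \<Rightarrow> 'c" and DH :: "nat \<Rightarrow> 'x \<Rightarrow> 'x list \<Rightarrow> 'c"
    and V1 U :: "'x set" and Nc :: "'e set" and \<iota> :: "'e \<Rightarrow> 'x" and b :: "'x \<Rightarrow> 'e"
    and invA :: "'x \<Rightarrow> 'c \<Rightarrow> 'e" and K :: real
  assumes H: "has_frechet_derivs sx sc V2 V2 r H DH" and V2: "A.subspace V2"
    and V1: "A.subspace V1" and V12: "V1 \<subseteq> V2" and UV: "U \<subseteq> V1" and Nc: "E.subspace Nc"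
    and \<iota>_add: "\<iota> (u + v) = \<iota> u + \<iota> v" and \<iota>_scale: "\<iota> (se c u) = sx c (\<iota> u)"
    and norm_\<iota>: "norm (\<iota> u) = norm u" and \<iota>V: "u \<in> Nc \<Longrightarrow> \<iota> u \<in> V2"
    and bNc: "x \<in> U \<Longrightarrow> b x \<in> Nc" and b_cont: "x \<in> U \<Longrightarrow> (b \<longlongrightarrow> b x) (at x within U)"
    and zero: "x \<in> U \<Longrightarrow> H (x + \<iota> (b x)) = 0"
    and invA_Nc: "x \<in> U \<Longrightarrow> invA x y \<in> Nc"
    and invA: "x \<in> U \<Longrightarrow> DH 1 (x + \<iota> (b x)) [\<iota> (invA x y)] = y"
    and K: "K > 0" and K_bound: "x \<in> U \<Longrightarrow> u \<in> Nc \<Longrightarrow> norm u \<le> K * norm (DH 1 (x + \<iota> (b x)) [\<iota> u])"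
    and r1: "r \<ge> 1"
begin

sublocale X3: three_spaces sx sx sc ..

definition w where "w x = x + \<iota> (b x)"

text \<open>The derivatives of the identity map, so that \<open>Dw D\<close> is the family for
  \<open>w x = x + \<iota> (b x)\<close>.\<close>

definition J :: "nat \<Rightarrow> 'x \<Rightarrow> 'x list \<Rightarrow> 'x"
  where "J m x vs = (if m = 0 then x else if m = 1 then hd vs else 0)"

definition Dw where "Dw D m x vs = J m x vs + \<iota> (D m x vs)"

definition A where "A x u = DH 1 (w x) [\<iota> u]"

lemma \<iota>_0 [simp]: "\<iota> 0 = 0"
  using norm_\<iota>[of 0] by simp

lemma \<iota>_diff: "\<iota> (u - v) = \<iota> u - \<iota> v"
  using \<iota>_add[of "u - v" v] by simp

lemma wV: "x \<in> U \<Longrightarrow> w x \<in> V2"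
  unfolding w_def using UV V12 by (intro A.subspace_add[OF V2] \<iota>V bNc) auto

lemma DH1: "x \<in> U \<Longrightarrow> mlin sx sc V2 1 (DH 1 (w x))" "x \<in> U \<Longrightarrow> mbdd V2 1 (DH 1 (w x))"
  using hfd_mlin[OF H V2 order_refl r1 wV] hfd_mbdd[OF H V2 order_refl r1 wV] by auto

lemma DH1_add: "x \<in> U \<Longrightarrow> u \<in> V2 \<Longrightarrow> v \<in> V2 \<Longrightarrow> DH 1 (w x) [u + v] = DH 1 (w x) [u] + DH 1 (w x) [v]"
  using mlin_add[OF DH1(1) V2, of x "[]" "[]" u v] by simp

lemma DH1_diff: "x \<in> U \<Longrightarrow> u \<in> V2 \<Longrightarrow> v \<in> V2 \<Longrightarrow> DH 1 (w x) [u - v] = DH 1 (w x) [u] - DH 1 (w x) [v]"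
  using mlin_diff[OF DH1(1) V2, of x "[]" "[]" u v] by simp

lemma A_diff: "x \<in> U \<Longrightarrow> u \<in> Nc \<Longrightarrow> v \<in> Nc \<Longrightarrow> A x (u - v) = A x u - A x v"
  unfolding A_def \<iota>_diff by (intro DH1_diff \<iota>V)

lemma A_lin: "x \<in> U \<Longrightarrow> u \<in> Nc \<Longrightarrow> v \<in> Nc \<Longrightarrow> A x (se c u + v) = sc c (A x u) + A x v"
  unfolding A_def \<iota>_add \<iota>_scale using mlinD[OF DH1(1), of x "[]" "[]" "\<iota> u" "\<iota> v" c] \<iota>V by simp

lemma A_inv: "x \<in> U \<Longrightarrow> A x (invA x y) = y"
  using invA by (simp add: A_def w_def)

lemma A_K: "x \<in> U \<Longrightarrow> u \<in> Nc \<Longrightarrow> norm u \<le> K * norm (A x u)"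
  using K_bound by (simp add: A_def w_def)

lemma A_inj: "x \<in> U \<Longrightarrow> u \<in> Nc \<Longrightarrow> v \<in> Nc \<Longrightarrow> A x u = A x v \<Longrightarrow> u = v"
  using A_K[of x "u - v"] A_diff[of x u v] E.subspace_diff[OF Nc] by simp

lemma w_tendsto:
  assumes x: "x \<in> U"
  shows "filterlim w (nin (w x) V2) (at x within U)"
  unfolding nin_def filterlim_inf filterlim_principal
proof
  have "((\<lambda>y. \<iota> (b y) - \<iota> (b x)) \<longlongrightarrow> 0) (at x within U)"
    using LIM_zero[OF b_cont[OF x]] unfolding \<iota>_diff[symmetric]
    by (subst tendsto_norm_zero_iff[symmetric], subst (asm) tendsto_norm_zero_iff[symmetric])
      (simp add: norm_\<iota>)
  then have "((\<lambda>y. y + \<iota> (b y)) \<longlongrightarrow> x + \<iota> (b x)) (at x within U)"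
    by (rule tendsto_add[OF tendsto_ident_at LIM_zero_cancel])
  then show "(w \<longlongrightarrow> w x) (at x within U)" by (simp add: w_def[abs_def])
  show "\<forall>\<^sub>F y in at x within U. w y \<in> V2" by (simp add: eventually_at_filter wV)
qed

text \<open>The induction invariant. Its second clause says that the derivatives of the composition
  of \<open>H\<close> with \<open>w\<close>, as computed by the formula of Faa di Bruno, vanish up
  to order \<open>m\<close>; comparing this identity at two points gives the differentiability of
  \<open>D m\<close>.\<close>

definition good :: "nat \<Rightarrow> (nat \<Rightarrow> 'x \<Rightarrow> 'x list \<Rightarrow> 'e) \<Rightarrow> bool"
  where "good m D \<longleftrightarrow> has_frechet_derivs sx se V1 U m b D \<and>
    (\<forall>j\<le>m. \<forall>x\<in>U. \<forall>vs\<in>vl V1 j. D j x vs \<in> Nc \<and> FD DH (Dw D) w j x vs = 0)"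

lemma good_0: "good 0 (\<lambda>m x vs. b x)"
proof -
  have "mbdd V1 0 (\<lambda>vs. b x)" for x
    by (auto simp: mbdd_def intro!: exI[of _ "norm (b x)"])
  moreover have "usmall (at x within U) (vl V1 0) (\<lambda>y. pn) (\<lambda>y vs. b y - b x)" if "x \<in> U" for x
    unfolding usmall_def
  proof (intro allI impI)
    fix e :: real assume "e > 0"
    with tendstoD[OF b_cont[OF that] this]
    show "\<forall>\<^sub>F y in at x within U. \<forall>p\<in>vl V1 0. norm (b y - b x) \<le> e * pn p"
      by (auto simp: dist_norm elim: eventually_mono)
  qed
  moreover have "FD DH (Dw (\<lambda>m x vs. b x)) w 0 x [] = 0" if "x \<in> U" for x
    using that hfd_0[OF H V2 order_refl wV[OF that]] zero by (simp add: FD_def fdt_def w_def)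
  ultimately show ?thesis
    using bNc by (auto simp: good_def hfd_iff mlin_def)
qed

lemma DwV:
  assumes "\<And>j x vs. j \<le> m \<Longrightarrow> x \<in> U \<Longrightarrow> vs \<in> vl V1 j \<Longrightarrow> D j x vs \<in> Nc"
    and "j \<le> m" "x \<in> U" "vs \<in> vl V1 j"
  shows "Dw D j x vs \<in> V2"
proof -
  have "J j x vs \<in> V2"
    using assms(2-4) UV V12 A.subspace_0[OF V2] by (cases vs) (auto simp: J_def vl_def)
  then show ?thesis
    unfolding Dw_def using assms by (intro A.subspace_add[OF V2] \<iota>V) auto
qed

lemma J_diff: "vs \<in> vl V1 m \<Longrightarrow> J m y vs - J m x vs = J (Suc m) x ((y - x) # vs)"
  by (cases vs) (auto simp: J_def vl_def)

lemma Dw_diff: "vs \<in> vl V1 m \<Longrightarrow> Dw D m y vs - Dw D m x vs - Dw D (Suc m) x ((y - x) # vs)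
    = \<iota> (D m y vs - D m x vs - D (Suc m) x ((y - x) # vs))"
  unfolding Dw_def \<iota>_diff using J_diff[of vs m y x] by (simp add: algebra_simps)

lemma Dw_diff1: "1 \<le> l \<Longrightarrow> Dw D l y vs - Dw D l x vs = \<iota> (D l y vs - D l x vs)"
  unfolding Dw_def \<iota>_diff by (simp add: J_def)

lemma Dw_mlin:
  assumes "1 \<le> l" "mlin sx se V1 l (D l x)" "\<And>vs. vs \<in> vl V1 l \<Longrightarrow> D l x vs \<in> Nc"
  shows "mlin sx sx V1 l (Dw D l x)"
proof (rule mlinI)
  fix as bs u v c
  assume *: "set as \<subseteq> V1" "set bs \<subseteq> V1" "u \<in> V1" "v \<in> V1" "length as + length bs + 1 = l"
  have "J l x (as @ (sx c u + v) # bs) = sx c (J l x (as @ u # bs)) + J l x (as @ v # bs)"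
    using *(5) by (cases as) (auto simp: J_def)
  moreover have "D l x (as @ (sx c u + v) # bs) = se c (D l x (as @ u # bs)) + D l x (as @ v # bs)"
    by (rule mlinD[OF assms(2) *])
  ultimately show "Dw D l x (as @ (sx c u + v) # bs) = sx c (Dw D l x (as @ u # bs)) + Dw D l x (as @ v # bs)"
    by (simp add: Dw_def \<iota>_add \<iota>_scale A.scale_right_distrib algebra_simps)
qed

lemma J_mbdd: "mbdd V1 l (J l x)"
proof -
  have "norm (J l x vs) \<le> (norm x + 1) * pn vs" if "vs \<in> vl V1 l" for vs
  proof (cases "l = 1")
    case True
    then obtain h where "vs = [h]" using \<open>vs \<in> vl V1 l\<close> by (auto simp: vl_def length_Suc_conv)
    then show ?thesis using True by (simp add: J_def distrib_right)
  next
    case False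
    then show ?thesis using \<open>vs \<in> vl V1 l\<close> by (auto simp: J_def)
  qed
  then show ?thesis unfolding mbdd_def by (intro exI[of _ "norm x + 1"]) auto
qed

lemma Dw_mbdd: "mbdd V1 l (D l x) \<Longrightarrow> mbdd V1 l (Dw D l x)"
proof -
  assume "mbdd V1 l (D l x)"
  then have "mbdd V1 l (\<lambda>vs. \<iota> (D l x vs))" by (simp add: mbdd_def norm_\<iota>)
  from mbdd_plus[OF J_mbdd this] show "mbdd V1 l (Dw D l x)" by (simp add: Dw_def[abs_def])
qed

lemma FD_split:
  assumes "vs \<in> vl V1 (Suc m)"
  shows "FD DH (Dw D) w n x vs = DH 1 (w x) [Dw D (Suc m) x vs] + (\<Sum>bs\<leftarrow>rests vs. fdt DH (Dw D) w x bs)"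
proof -
  have "vs \<noteq> []" "length vs = Suc m" using assms by (auto simp: vl_def)
  then show ?thesis by (simp add: FD_def sum_splits_single fdt_def)
qed

lemma rest_sum_cong:
  assumes "vs \<in> vl V1 (Suc m)" "\<And>l. l \<le> m \<Longrightarrow> D l = D' l"
  shows "(\<Sum>bs\<leftarrow>rests vs. fdt DH (Dw D) w x bs) = (\<Sum>bs\<leftarrow>rests vs. fdt DH (Dw D') w x bs)"
proof (rule arg_cong[of _ _ sum_list], rule map_cong[OF refl])
  fix bs assume bs: "bs \<in> set (rests vs)"
  have "Dw D (length c) x c = Dw D' (length c) x c" if "c \<in> set bs" for c
    using rests_block_length[OF bs that] assms by (simp add: Dw_def vl_def)
  then show "fdt DH (Dw D) w x bs = fdt DH (Dw D') w x bs"
    by (simp add: fdt_def cong: map_cong)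
qed

context
  fixes m D
  assumes mr: "m < r" and D: "good m D"
begin

text \<open>\<open>D0\<close> sets the unknown derivative of order \<open>m + 1\<close> to zero, so
  \<open>Rest\<close> collects the known part of the formula, and \<open>\<beta>\<close> solves
  \<open>A x (\<beta> x vs) + Rest x vs = 0\<close>.\<close>

definition "D0 = D(Suc m := \<lambda>x vs. 0)"
definition "Rest x vs = FD DH (Dw D0) w (Suc m) x vs"
definition "\<beta> x vs = invA x (- Rest x vs)"
definition "D' = D(Suc m := \<beta>)"

lemma hD: "has_frechet_derivs sx se V1 U m b D" and DNc: "j \<le> m \<Longrightarrow> x \<in> U \<Longrightarrow> vs \<in> vl V1 j \<Longrightarrow> D j x vs \<in> Nc"
  and FD0: "j \<le> m \<Longrightarrow> x \<in> U \<Longrightarrow> vs \<in> vl V1 j \<Longrightarrow> FD DH (Dw D) w j x vs = 0"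
  using D by (auto simp: good_def)

interpretation XE: two_spaces sx se ..

lemma \<beta>_Nc: "x \<in> U \<Longrightarrow> \<beta> x vs \<in> Nc"
  by (simp add: \<beta>_def invA_Nc)

lemma D'_le: "l \<le> m \<Longrightarrow> D' l = D l" "D' (Suc m) = \<beta>"
  by (auto simp: D'_def)

lemma D0_le: "l \<le> m \<Longrightarrow> D0 l = D l" "D0 (Suc m) = (\<lambda>x vs. 0)"
  by (auto simp: D0_def)

lemma D'_Nc: "j \<le> Suc m \<Longrightarrow> x \<in> U \<Longrightarrow> vs \<in> vl V1 j \<Longrightarrow> D' j x vs \<in> Nc"
  using DNc \<beta>_Nc by (auto simp: D'_def)

lemma D0_Nc: "j \<le> Suc m \<Longrightarrow> x \<in> U \<Longrightarrow> vs \<in> vl V1 j \<Longrightarrow> D0 j x vs \<in> Nc"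
  using DNc E.subspace_0[OF Nc] by (auto simp: D0_def)

lemma JV: "x \<in> U \<Longrightarrow> vs \<in> vl V1 (Suc m) \<Longrightarrow> J (Suc m) x vs \<in> V2"
  using V12 A.subspace_0[OF V2] by (cases vs) (auto simp: J_def vl_def)

lemma FD_D':
  assumes x: "x \<in> U" and vs: "vs \<in> vl V1 (Suc m)"
  shows "FD DH (Dw D') w n x vs = 0"
proof -
  have "Rest x vs = DH 1 (w x) [J (Suc m) x vs] + (\<Sum>bs\<leftarrow>rests vs. fdt DH (Dw D0) w x bs)"
    unfolding Rest_def FD_split[OF vs] by (simp add: Dw_def D0_le)
  moreover have "(\<Sum>bs\<leftarrow>rests vs. fdt DH (Dw D0) w x bs) = (\<Sum>bs\<leftarrow>rests vs. fdt DH (Dw D') w x bs)"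
    by (rule rest_sum_cong[OF vs]) (simp add: D0_le D'_le)
  moreover have "DH 1 (w x) [Dw D' (Suc m) x vs] = DH 1 (w x) [J (Suc m) x vs] + A x (\<beta> x vs)"
    unfolding Dw_def D'_le A_def using x vs by (intro DH1_add JV \<iota>V \<beta>_Nc)
  moreover have "A x (\<beta> x vs) = - Rest x vs" using x by (simp add: \<beta>_def A_inv)
  ultimately show ?thesis unfolding FD_split[OF vs] by simp
qed

lemma D0_mlin: "l \<le> Suc m \<Longrightarrow> x \<in> U \<Longrightarrow> mlin sx se V1 l (D0 l x)"
  using XE.hfd_mlin[OF hD V1 UV] by (cases "l = Suc m") (auto simp: D0_def mlin_def)

lemma D0_mbdd: "l \<le> Suc m \<Longrightarrow> x \<in> U \<Longrightarrow> mbdd V1 l (D0 l x)"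
  using XE.hfd_mbdd[OF hD V1 UV] by (cases "l = Suc m") (auto simp: D0_def mbdd_def)

lemma Rest_mlin: "x \<in> U \<Longrightarrow> mlin sx sc V1 (Suc m) (Rest x)"
  unfolding Rest_def[abs_def]
proof (rule X3.FD_mlin[where ?V2.0 = V2])
  assume x: "x \<in> U"
  fix l assume l: "l \<le> Suc m"
  show "mlin sx sc V2 l (DH l (w x))"
    using hfd_mlin[OF H V2 order_refl] l mr wV[OF x] by simp
  assume "1 \<le> l"
  then show "mlin sx sx V1 l (Dw D0 l x)"
    using l x by (intro Dw_mlin D0_mlin D0_Nc)
  fix vs assume "vs \<in> vl V1 l"
  with l x show "Dw D0 l x vs \<in> V2" by (intro DwV[where m = "Suc m"] D0_Nc)
qed (rule V1)

text \<open>\<open>invA x\<close> is chosen pointwise and is not known to be linear. Linearity of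
  \<open>\<beta> x\<close> comes from that of \<open>Rest x\<close> and from the injectivity of
  \<open>A x\<close> on \<open>Nc\<close>.\<close>

lemma \<beta>_mlin:
  assumes x: "x \<in> U"
  shows "mlin sx se V1 (Suc m) (\<beta> x)"
proof (rule mlinI)
  fix as bs u v c
  assume "set as \<subseteq> V1" "set bs \<subseteq> V1" "u \<in> V1" "v \<in> V1" "length as + length bs + 1 = Suc m"
  note R = mlinD[OF Rest_mlin[OF x] this, of c]
  note [simp] = \<beta>_Nc[OF x] and bn = \<beta>_Nc[OF x]
  show "\<beta> x (as @ (sx c u + v) # bs) = se c (\<beta> x (as @ u # bs)) + \<beta> x (as @ v # bs)"
  proof (rule A_inj[OF x])
    show "se c (\<beta> x (as @ u # bs)) + \<beta> x (as @ v # bs) \<in> Nc"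
      by (intro E.subspace_add[OF Nc] E.subspace_scale[OF Nc] bn)
    show "A x (\<beta> x (as @ (sx c u + v) # bs)) = A x (se c (\<beta> x (as @ u # bs)) + \<beta> x (as @ v # bs))"
      unfolding A_lin[OF x bn bn] by (simp add: \<beta>_def A_inv[OF x] R C.scale_minus_right)
  qed simp
qed

lemma Rest_ubdd: 
  assumes "\<And>l. l \<le> Suc m \<Longrightarrow> ubdd F (vl V1 l) (\<lambda>i. pn) (\<lambda>i. Dw D0 l (a i))"
    and "\<And>l. l \<le> Suc m \<Longrightarrow> ubdd F (vl V2 l) (\<lambda>i. pn) (\<lambda>i. DH l (w (a i)))"
    and aU: "\<forall>\<^sub>F i in F. a i \<in> U"
  shows "ubdd F (vl V1 (Suc m)) (\<lambda>i. pn) (\<lambda>i. \<beta> (a i))"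
proof -
  have "ubdd F (vl V1 (Suc m)) (\<lambda>i. pn) (\<lambda>i. Rest (a i))"
    unfolding Rest_def[abs_def]
  proof (rule FD_ubdd[where ?V2.0 = V2])
    show "\<forall>\<^sub>F i in F. \<forall>l\<in>{1..Suc m}. \<forall>vs\<in>vl V1 l. Dw D0 l (a i) vs \<in> V2"
      using aU
    proof eventually_elim
      case (elim i)
      show ?case
      proof (intro ballI)
        fix l vs assume "l \<in> {1..Suc m}" "vs \<in> vl V1 l"
        then show "Dw D0 l (a i) vs \<in> V2" using elim by (intro DwV[where m = "Suc m"] D0_Nc) auto
      qed
    qed
  qed (use assms in auto)
  then show ?thesis
  proof (rule ubdd_le[where K = K])
    show "\<forall>\<^sub>F i in F. \<forall>q\<in>vl V1 (Suc m). \<exists>p\<in>vl V1 (Suc m).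
        norm (\<beta> (a i) q) \<le> K * norm (Rest (a i) p) \<and> pn p \<le> pn q"
      using aU
    proof eventually_elim
      case (elim i)
      show ?case
      proof
        fix q assume "q \<in> vl V1 (Suc m)"
        then show "\<exists>p\<in>vl V1 (Suc m). norm (\<beta> (a i) q) \<le> K * norm (Rest (a i) p) \<and> pn p \<le> pn q"
          using A_K[OF elim \<beta>_Nc[OF elim, of q]] by (intro bexI[of _ q]) (auto simp: \<beta>_def A_inv[OF elim])
      qed
    qed
  qed (use K in simp)
qed

lemma \<beta>_mbdd:
  assumes x: "x \<in> U"
  shows "mbdd V1 (Suc m) (\<beta> x)"
proof -
  have "ubdd (top::unit filter) (vl V1 (Suc m)) (\<lambda>i. pn) (\<lambda>i. \<beta> x)"
  proof (rule Rest_ubdd)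
    fix l assume l: "l \<le> Suc m"
    show "ubdd (top::unit filter) (vl V1 l) (\<lambda>i. pn) (\<lambda>i. Dw D0 l x)"
      using l x by (intro mbdd_imp_ubdd Dw_mbdd D0_mbdd)
    show "ubdd (top::unit filter) (vl V2 l) (\<lambda>i. pn) (\<lambda>i. DH l (w x))"
      using l mr wV[OF x] by (intro mbdd_imp_ubdd hfd_mbdd[OF H V2 order_refl]) auto
  qed (use x in auto)
  then show ?thesis by (auto simp: ubdd_def mbdd_def intro: less_imp_le)
qed

lemma DH_along:
  assumes x: "x \<in> U" and l: "l \<le> r"
  shows "usmall (at x within U) (vl V2 l) (\<lambda>i. pn) (\<lambda>i vs. DH l (w i) vs - DH l (w x) vs)"
    "ubdd (at x within U) (vl V2 l) (\<lambda>i. pn) (\<lambda>i. DH l (w i))"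
    "ubdd (at x within U) (vl V2 l) (\<lambda>i. pn) (\<lambda>i. DH l (w x))"
proof -
  show 1: "usmall (at x within U) (vl V2 l) (\<lambda>i. pn) (\<lambda>i vs. DH l (w i) vs - DH l (w x) vs)"
    by (rule usmall_filtermap[OF hfd_cont[OF H V2 order_refl l wV[OF x]] w_tendsto[OF x]])
  show 2: "ubdd (at x within U) (vl V2 l) (\<lambda>i. pn) (\<lambda>i. DH l (w x))"
    by (intro mbdd_imp_ubdd hfd_mbdd[OF H V2 order_refl l wV[OF x]])
  show "ubdd (at x within U) (vl V2 l) (\<lambda>i. pn) (\<lambda>i. DH l (w i))"
    using ubdd_add[OF usmall_imp_ubdd[OF 1] 2] by simp
qed

lemma Dw_along:
  assumes x: "x \<in> U" and l: "1 \<le> l" "l \<le> Suc m"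
  shows "usmall (at x within U) (vl V1 l) (\<lambda>i. pn) (\<lambda>i vs. Dw D0 l i vs - Dw D0 l x vs)"
    "ubdd (at x within U) (vl V1 l) (\<lambda>i. pn) (\<lambda>i. Dw D0 l i)"
    "ubdd (at x within U) (vl V1 l) (\<lambda>i. pn) (\<lambda>i. Dw D0 l x)"
proof -
  have "usmall (at x within U) (vl V1 l) (\<lambda>i. pn) (\<lambda>i vs. D0 l i vs - D0 l x vs)"
  proof (cases "l = Suc m")
    case True
    then show ?thesis by (simp add: D0_def usmall_zero)
  next
    case False
    then have "l \<le> m" using l by simp
    then show ?thesis
      using usmall_mono_filter[OF XE.hfd_cont[OF hD V1 UV] at_le_nin] x by (simp add: D0_le)
  qed
  then show 1: "usmall (at x within U) (vl V1 l) (\<lambda>i. pn) (\<lambda>i vs. Dw D0 l i vs - Dw D0 l x vs)"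
    using l by (simp add: Dw_diff1 usmall_def norm_\<iota>)
  show 2: "ubdd (at x within U) (vl V1 l) (\<lambda>i. pn) (\<lambda>i. Dw D0 l x)"
    using l x by (intro mbdd_imp_ubdd Dw_mbdd D0_mbdd)
  show "ubdd (at x within U) (vl V1 l) (\<lambda>i. pn) (\<lambda>i. Dw D0 l i)"
    using ubdd_add[OF usmall_imp_ubdd[OF 1] 2] by simp
qed

lemma J0_along: "x \<in> U \<Longrightarrow> ubdd (at x within U) (vl V1 0) (\<lambda>i. pn) (\<lambda>i. Dw D0 0 i)"
proof -
  assume x: "x \<in> U"
  have "ubdd (at x within U) (vl V1 0) (\<lambda>i. pn) (\<lambda>i vs. w i)"
  proof -
    have "(w \<longlongrightarrow> w x) (at x within U)"
      using w_tendsto[OF x] by (simp add: nin_def filterlim_inf)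
    from tendstoD[OF this zero_less_one]
    have "\<forall>\<^sub>F y in at x within U. norm (w y) \<le> norm (w x) + 1"
    proof eventually_elim
      case (elim y)
      then show ?case using norm_triangle_ineq2[of "w y" "w x"] by (simp add: dist_norm)
    qed
    then show ?thesis unfolding ubdd_def by (intro exI[of _ "norm (w x) + 1"]) (auto simp: add_nonneg_pos)
  qed
  then show ?thesis
  proof (rule ubdd_cong)
    show "\<forall>\<^sub>F i in at x within U. \<forall>p\<in>vl V1 0. w i = Dw D0 0 i p"
      using XE.hfd_0[OF hD V1 UV] by (auto simp: eventually_at_filter Dw_def J_def w_def D0_le)
  qed
qed

lemma \<beta>_cont:
  assumes x: "x \<in> U"
  shows "usmall (at x within U) (vl V1 (Suc m)) (\<lambda>y. pn) (\<lambda>y vs. \<beta> y vs - \<beta> x vs)"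
proof -
  let ?F = "at x within U"
  have evU: "\<forall>\<^sub>F y in ?F. y \<in> U" by (simp add: eventually_at_filter)
  have Rc: "usmall ?F (vl V1 (Suc m)) (\<lambda>i. pn) (\<lambda>i vs. Rest i vs - Rest x vs)"
    unfolding Rest_def
  proof (rule FD_ccont[where ?V2.0 = V2])
    fix l assume l: "l \<le> Suc m"
    then have lr: "l \<le> r" using mr by simp
    show "ubdd ?F (vl V2 l) (\<lambda>i. pn) (\<lambda>i. DH l (w x))"
      "usmall ?F (vl V2 l) (\<lambda>i. pn) (\<lambda>i vs. DH l (w i) vs - DH l (w x) vs)"
      by (rule DH_along[OF x lr])+
    show "\<forall>\<^sub>F i in ?F. mdiff V2 l (DH l (w x))"
      using mlin_mdiff[OF hfd_mlin[OF H V2 order_refl lr wV[OF x]] V2] by simp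
    assume l1: "1 \<le> l"
    show "ubdd ?F (vl V1 l) (\<lambda>i. pn) (\<lambda>i. Dw D0 l i)" "ubdd ?F (vl V1 l) (\<lambda>i. pn) (\<lambda>i. Dw D0 l x)"
      "usmall ?F (vl V1 l) (\<lambda>i. pn) (\<lambda>i vs. Dw D0 l i vs - Dw D0 l x vs)"
      by (rule Dw_along[OF x l1 l])+
  next
    show "\<forall>\<^sub>F i in ?F. \<forall>l\<in>{1..Suc m}. \<forall>vs\<in>vl V1 l. Dw D0 l i vs \<in> V2 \<and> Dw D0 l x vs \<in> V2"
      using evU
    proof eventually_elim
      case (elim y)
      show ?case
        using elim x by (auto intro!: DwV[where m = "Suc m"] D0_Nc)
    qed
  qed (rule A.subspace_diff[OF V2])
  have \<beta>b: "ubdd ?F (vl V1 (Suc m)) (\<lambda>i. pn) (\<lambda>i. \<beta> i)"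
  proof (rule Rest_ubdd[where a = "\<lambda>i. i"])
    fix l assume l: "l \<le> Suc m"
    show "ubdd ?F (vl V1 l) (\<lambda>i. pn) (\<lambda>i. Dw D0 l i)"
      using J0_along[OF x] Dw_along(2)[OF x _ l] by (cases "l = 0") auto
    show "ubdd ?F (vl V2 l) (\<lambda>i. pn) (\<lambda>i. DH l (w i))"
      using DH_along(2)[OF x] l mr by simp
  qed (rule evU)
  then obtain C where C: "C > 0" "\<forall>\<^sub>F y in ?F. \<forall>vs\<in>vl V1 (Suc m). norm (\<beta> y vs) \<le> C * pn vs"
    by (rule ubddE)
  show ?thesis
    unfolding usmall_def
  proof (intro allI impI)
    fix e :: real assume e: "e > 0"
    have e1: "e / (2 * K) > 0" and e2: "e / (2 * K * C) > 0" using e K C by auto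
    show "\<forall>\<^sub>F y in ?F. \<forall>vs\<in>vl V1 (Suc m). norm (\<beta> y vs - \<beta> x vs) \<le> e * pn vs"
      using evU usmallD[OF Rc e1] usmallD[OF DH_along(1)[OF x r1] e2] C(2)
    proof eventually_elim
      case (elim y)
      show ?case
      proof
        fix vs assume vs: "vs \<in> vl V1 (Suc m)"
        note bn = \<beta>_Nc[OF elim(1)] \<beta>_Nc[OF x]
        have "A x (\<beta> y vs - \<beta> x vs) = A x (\<beta> y vs) - A x (\<beta> x vs)"
          by (rule A_diff[OF x bn])
        also have "A x (\<beta> y vs) = - Rest y vs - (A y (\<beta> y vs) - A x (\<beta> y vs))"
          by (simp add: \<beta>_def A_inv[OF elim(1)])
        also have "A x (\<beta> x vs) = - Rest x vs" by (simp add: \<beta>_def A_inv[OF x])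
        finally have eq: "A x (\<beta> y vs - \<beta> x vs) = - ((Rest y vs - Rest x vs) + (A y (\<beta> y vs) - A x (\<beta> y vs)))"
          by simp
        have 1: "norm (Rest y vs - Rest x vs) \<le> e / (2 * K) * pn vs" using elim(2) vs by blast
        have "norm (A y (\<beta> y vs) - A x (\<beta> y vs)) \<le> e / (2 * K * C) * pn [\<iota> (\<beta> y vs)]"
          unfolding A_def by (rule bspec[OF elim(3)]) (use bn \<iota>V in simp)
        also have "\<dots> \<le> e / (2 * K * C) * (C * pn vs)"
          using elim(4) vs e2 by (intro mult_left_mono) (auto simp: norm_\<iota>)
        also have "\<dots> = e / (2 * K) * pn vs" using C by simp
        finally have 2: "norm (A y (\<beta> y vs) - A x (\<beta> y vs)) \<le> e / (2 * K) * pn vs" .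
        have "norm (\<beta> y vs - \<beta> x vs) \<le> K * norm (A x (\<beta> y vs - \<beta> x vs))"
          by (intro A_K[OF x] E.subspace_diff[OF Nc] bn)
        also have "\<dots> \<le> K * (e / (2 * K) * pn vs + e / (2 * K) * pn vs)"
          unfolding eq norm_minus_cancel using K by (intro mult_left_mono norm_triangle_mono 1 2) auto
        also have "\<dots> = e * pn vs" using K by (simp add: field_simps)
        finally show "norm (\<beta> y vs - \<beta> x vs) \<le> e * pn vs" .
      qed
    qed
  qed
qed

text \<open>By \<open>A_K\<close>, smallness of a family in \<open>Nc\<close> may be tested after
  applying \<open>A x\<close> at the fixed point \<open>x\<close>.\<close>

lemma usmall_via_A:
  assumes x: "x \<in> U"
    and u: "\<forall>\<^sub>F y in at x within U. \<forall>p\<in>P. u y p \<in> Nc"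
    and s: "usmall (at x within U) P wt (\<lambda>y p. A x (u y p))"
  shows "usmall (at x within U) P wt u"
  using s
proof (rule usmall_le[where K = K])
  show "\<forall>\<^sub>F y in at x within U. \<forall>q\<in>P. \<exists>p\<in>P. norm (u y q) \<le> K * norm (A x (u y p)) \<and> wt y p \<le> wt y q"
    using u by eventually_elim (use A_K[OF x] in blast)
qed (use K in simp)

text \<open>Order \<open>0\<close> is separate: \<open>w\<close> is only known to be continuous, so
  the chain rule is not at hand. As \<open>H\<close> vanishes at \<open>w y\<close> and
  \<open>w x\<close>, the value of \<open>DH 1 (w x)\<close> at \<open>w y - w x\<close> is small
  against \<open>norm (w y - w x)\<close>. This first makes \<open>b\<close> Lipschitz at
  \<open>x\<close>, and then the remainder is small against \<open>norm (y - x)\<close>.\<close>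

lemma \<beta>_diff_0:
  assumes x: "x \<in> U" and m0: "m = 0"
  shows "usmall (at x within U) (vl V1 m) (\<lambda>y vs. norm (y - x) * pn vs)
      (\<lambda>y vs. D m y vs - D m x vs - \<beta> x ((y - x) # vs))"
proof (rule usmall_via_A[OF x])
  let ?F = "at x within U"
  have evU: "\<forall>\<^sub>F y in ?F. y \<in> U" by (simp add: eventually_at_filter)
  have hV: "y - x \<in> V1" if "y \<in> U" for y using that x UV A.subspace_diff[OF V1] by blast
  have D0b: "D 0 y [] = b y" if "y \<in> U" for y using XE.hfd_0[OF hD V1 UV that] .
  show "\<forall>\<^sub>F y in ?F. \<forall>vs\<in>vl V1 m. D m y vs - D m x vs - \<beta> x ((y - x) # vs) \<in> Nc"
    using evU by eventually_elim (auto intro!: E.subspace_diff[OF Nc] DNc \<beta>_Nc x)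
  obtain C0 where C0: "C0 \<ge> 0" "\<And>vs. vs \<in> vl V2 1 \<Longrightarrow> norm (DH 1 (w x) vs) \<le> C0 * pn vs"
    using DH1(2)[OF x] by (auto simp: mbdd_def)
  have small: "\<forall>\<^sub>F y in ?F. norm (DH 1 (w x) [w y - w x]) \<le> e * norm (w y - w x)" if "e > 0" for e
  proof -
    have "0 < r" using r1 by simp
    from usmallD[OF usmall_filtermap[OF hfd_diff[OF H V2 order_refl this wV[OF x]] w_tendsto[OF x]] that]
    show ?thesis using evU
    proof eventually_elim
      case (elim y)
      have "DH 0 (w y) [] = 0" "DH 0 (w x) [] = 0"
        using hfd_0[OF H V2 order_refl wV] zero x elim by (auto simp: w_def)
      with elim show ?case by simp
    qed
  qed
  have wdiff: "w y - w x = (y - x) + \<iota> (b y - b x)" for y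
    by (simp add: w_def \<iota>_diff)
  have wn: "norm (w y - w x) \<le> norm (y - x) + norm (b y - b x)" for y
    unfolding wdiff by (rule order_trans[OF norm_triangle_ineq]) (simp add: norm_\<iota>)
  have dec: "DH 1 (w x) [w y - w x] = DH 1 (w x) [y - x] + A x (b y - b x)" if "y \<in> U" for y
    unfolding wdiff A_def using that x hV V12
    by (intro DH1_add \<iota>V E.subspace_diff[OF Nc] bNc) auto
  \<comment> \<open>With the accuracy \<open>1 / (2 * K)\<close> below,
    \<open>norm (b y - b x)\<close> reappears on the right with coefficient \<open>1 / 2\<close>;
    absorbing it leaves this Lipschitz constant.\<close>
  define M where "M = 1 + 2 * K * C0"
  have M: "M \<ge> 1" using K C0 by (simp add: M_def)
  have blip: "\<forall>\<^sub>F y in ?F. norm (b y - b x) \<le> M * norm (y - x)"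
  proof -
    have "1 / (2 * K) > 0" using K by simp
    from small[OF this] evU show ?thesis
    proof eventually_elim
      case (elim y)
      have bn: "b y - b x \<in> Nc" using elim x by (intro E.subspace_diff[OF Nc] bNc)
      have "norm (A x (b y - b x)) = norm (DH 1 (w x) [w y - w x] - DH 1 (w x) [y - x])"
        by (simp only: dec[OF elim(2)] add_diff_cancel_left')
      also have "\<dots> \<le> 1 / (2 * K) * (norm (y - x) + norm (b y - b x)) + C0 * norm (y - x)"
      proof (rule norm_triangle_le_diff, rule add_mono)
        show "norm (DH 1 (w x) [w y - w x]) \<le> 1 / (2 * K) * (norm (y - x) + norm (b y - b x))"
          using elim(1) mult_left_mono[OF wn[of y], of "1 / (2 * K)"] K by simp
        show "norm (DH 1 (w x) [y - x]) \<le> C0 * norm (y - x)"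
          using C0(2)[of "[y - x]"] hV[OF elim(2)] V12 by auto
      qed
      finally have *: "norm (A x (b y - b x)) \<le> 1 / (2 * K) * (norm (y - x) + norm (b y - b x)) + C0 * norm (y - x)" .
      have "norm (b y - b x) \<le> K * norm (A x (b y - b x))" by (rule A_K[OF x bn])
      also have "\<dots> \<le> K * (1 / (2 * K) * (norm (y - x) + norm (b y - b x)) + C0 * norm (y - x))"
        using * K by (intro mult_left_mono) auto
      also have "\<dots> = 1 / 2 * norm (y - x) + 1 / 2 * norm (b y - b x) + K * C0 * norm (y - x)"
        using K by (simp add: field_simps)
      finally show ?case by (simp add: M_def algebra_simps)
    qed
  qed
  show "usmall ?F (vl V1 m) (\<lambda>y vs. norm (y - x) * pn vs)
      (\<lambda>y vs. A x (D m y vs - D m x vs - \<beta> x ((y - x) # vs)))"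
    unfolding usmall_def
  proof (intro allI impI)
    fix e :: real assume e: "e > 0"
    then have "e / (1 + M) > 0" using M by simp
    from small[OF this] blip evU
    show "\<forall>\<^sub>F y in ?F. \<forall>vs\<in>vl V1 m. norm (A x (D m y vs - D m x vs - \<beta> x ((y - x) # vs))) \<le> e * (norm (y - x) * pn vs)"
    proof eventually_elim
      case (elim y)
      have bn: "b y - b x \<in> Nc" using elim x by (intro E.subspace_diff[OF Nc] bNc)
      have "FD DH (Dw D') w 0 x [y - x] = 0"
        using FD_D'[OF x, of "[y - x]"] hV[OF elim(3)] m0 by simp
      then have "DH 1 (w x) [y - x + \<iota> (\<beta> x [y - x])] = 0"
        using D'_le(2) m0 by (simp add: FD_def ext_def fdt_def Dw_def J_def)
      then have 0: "DH 1 (w x) [y - x] + A x (\<beta> x [y - x]) = 0"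
        using DH1_add[OF x, of "y - x" "\<iota> (\<beta> x [y - x])"] hV[OF elim(3)] V12 \<iota>V[OF \<beta>_Nc[OF x]]
        by (auto simp: A_def)
      have "A x (b y - b x - \<beta> x [y - x]) = A x (b y - b x) - A x (\<beta> x [y - x])"
        by (rule A_diff[OF x bn \<beta>_Nc[OF x]])
      also have "\<dots> = DH 1 (w x) [w y - w x]"
        unfolding dec[OF elim(3)] using 0 by (simp only: eq_neg_iff_add_eq_0[symmetric]) simp
      finally have "norm (A x (b y - b x - \<beta> x [y - x])) \<le> e / (1 + M) * norm (w y - w x)"
        using elim(1) by simp
      also have "\<dots> \<le> e / (1 + M) * ((1 + M) * norm (y - x))"
        using wn[of y] elim(2) e M by (intro mult_left_mono) (auto simp: algebra_simps)
      also have "\<dots> = e * norm (y - x)" using M by simp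
      finally show ?case
        using m0 D0b[OF elim(3)] D0b[OF x] by simp
    qed
  qed
qed

text \<open>The vanishing formulas of order \<open>m\<close> at \<open>y\<close> and at
  \<open>x\<close> and of order \<open>m + 1\<close> at \<open>x\<close> are combined. Terms with at
  least two blocks involve inner derivatives of order below \<open>m\<close>, which are known to be
  differentiable, and fall under \<open>fdt_diff\<close>. The one-block term contains
  \<open>D m\<close>, whose differentiability is at stake, and is expanded by hand.\<close>

lemma \<beta>_diff_Suc:
  assumes x: "x \<in> U" and m1: "m \<ge> 1"
  shows "usmall (at x within U) (vl V1 m) (\<lambda>y vs. norm (y - x) * pn vs)
      (\<lambda>y vs. D m y vs - D m x vs - \<beta> x ((y - x) # vs))"
proof (rule usmall_via_A[OF x])
  let ?F = "at x within U" and ?\<eta> = "\<lambda>y. norm (y - x)"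
  have evU: "\<forall>\<^sub>F y in ?F. y \<in> U" by (simp add: eventually_at_filter)
  have hV: "y - x \<in> V1" if "y \<in> U" for y using that x UV A.subspace_diff[OF V1] by blast
  have tend: "(?\<eta> \<longlongrightarrow> 0) ?F"
    by (rule tendsto_mono[OF at_le_nin tendsto_norm_diff_nin])
  show "\<forall>\<^sub>F y in ?F. \<forall>vs\<in>vl V1 m. D m y vs - D m x vs - \<beta> x ((y - x) # vs) \<in> Nc"
    using evU by eventually_elim (auto intro!: E.subspace_diff[OF Nc] DNc \<beta>_Nc x)
  have wU: "w ` U \<subseteq> V2" using wV by blast
  define Y where "Y = (\<lambda>y c. Dw D' (length c) y c)"
  have D'V: "Dw D' l y vs \<in> V2" if "l \<le> Suc m" "y \<in> U" "vs \<in> vl V1 l" for l y vs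
    using that by (intro DwV[where m = "Suc m"] D'_Nc)
  have D'mbdd: "mbdd V1 l (Dw D' l x)" if "l \<le> Suc m" for l
    using that XE.hfd_mbdd[OF hD V1 UV _ x] \<beta>_mbdd[OF x]
    by (intro Dw_mbdd) (auto simp: D'_def)
  have w0: "Dw D' 0 y [] = w y" if "y \<in> U" for y
    using XE.hfd_0[OF hD V1 UV that] by (simp add: Dw_def J_def w_def D'_le)
  have f: "usmall ?F (vl V1 l) (\<lambda>y vs. ?\<eta> y * pn vs)
      (\<lambda>y vs. Dw D' l y vs - Dw D' l x vs - Dw D' (Suc l) x ((y - x) # vs))" if "l < m" for l
  proof -
    have "usmall ?F (vl V1 l) (\<lambda>y vs. ?\<eta> y * pn vs)
      (\<lambda>y vs. D l y vs - D l x vs - D (Suc l) x ((y - x) # vs))"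
      using hD that x by (simp add: hfd_iff)
    then show ?thesis using that by (simp add: usmall_def Dw_diff norm_\<iota> D'_le)
  qed
  have restsmall: "usmall ?F (vl V1 m) (\<lambda>y vs. ?\<eta> y * pn vs)
      (\<lambda>y vs. \<Sum>bs\<leftarrow>rests vs. fdt DH (Dw D') w y bs - fdt DH (Dw D') w x bs - dterm (DH (length bs) (w x))
      (\<lambda>vs. DH (Suc (length bs)) (w x) (Dw D' 1 x [y - x] # vs))
      (\<lambda>b. Dw D' (length b) x b) (\<lambda>b. Dw D' (Suc (length b)) x ((y - x) # b)) bs [])"
  proof (rule usmall_splits)
    fix ls assume ls: "ls \<in> shapes m" and "\<exists>vs\<in>vl V1 m. \<exists>bs\<in>set (rests vs). map length bs = ls"
    then obtain vs bs where vs: "vs \<in> vl V1 m" "bs \<in> set (rests vs)" "map length bs = ls" by blast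
    have lm: "l < m" if "l \<in> set ls" for l
    proof -
      from that obtain c where "c \<in> set bs" "l = length c" using vs by auto
      then show ?thesis using rests_block_length(2)[OF vs(2)] vs(1) by (simp add: vl_def)
    qed
    have lm': "l < m" if "l \<in> insert 0 (set ls)" for l using lm that m1 by auto
    show "usmall ?F (blks V1 ls) (\<lambda>y bs. ?\<eta> y * pn (concat bs))
      (\<lambda>y bs. fdt DH (Dw D') w y bs - fdt DH (Dw D') w x bs - dterm (DH (length bs) (w x))
      (\<lambda>vs. DH (Suc (length bs)) (w x) (Dw D' 1 x [y - x] # vs))
      (\<lambda>b. Dw D' (length b) x b) (\<lambda>b. Dw D' (Suc (length b)) x ((y - x) # b)) bs [])"
    proof (rule X3.fdt_diff[OF H V2 order_refl V1 UV x wU])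
      show "length ls < r" using shapes_length[OF ls] mr by simp
      fix l assume l: "l \<in> insert 0 (set ls)"
      note lm'[OF l]
      then show "usmall ?F (vl V1 l) (\<lambda>y vs. ?\<eta> y * pn vs)
          (\<lambda>y vs. Dw D' l y vs - Dw D' l x vs - Dw D' (Suc l) x ((y - x) # vs))" by (rule f)
      show "mbdd V1 l (Dw D' l x) \<and> mbdd V1 (Suc l) (Dw D' (Suc l) x)"
        using lm'[OF l] by (auto intro!: D'mbdd)
      fix y vs assume "y \<in> U" "vs \<in> vl V1 (Suc l)"
      then show "Dw D' (Suc l) y vs \<in> V2" using lm'[OF l] by (intro D'V) auto
    next
      fix l y vs assume "l \<in> set ls" "y \<in> U" "vs \<in> vl V1 l"
      then show "Dw D' l y vs \<in> V2" using lm[of l] by (intro D'V) auto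
    qed (rule w0)
  qed (use rests_subset length_rests in auto)
  have DwV1: "Dw D' 1 x [y - x] \<in> V2" if "y \<in> U" for y
    using D'V[of 1 x "[y - x]"] hV[OF that] x by simp
  obtain C0 where C0: "C0 \<ge> 0" "\<And>vs. vs \<in> vl V1 1 \<Longrightarrow> norm (Dw D' 1 x vs) \<le> C0 * pn vs"
    using D'mbdd[of 1] by (auto simp: mbdd_def)
  have r1': "1 < r" using mr m1 by simp
  have wsm: "\<forall>\<^sub>F y in ?F. norm (w y - w x - Dw D' 1 x [y - x]) \<le> e * ?\<eta> y" if "e > 0" for e
    using usmallD[OF f[of 0] that] m1 evU by (auto simp: w0 x elim: eventually_elim2)
  have C1: "C0 + 1 > 0" "\<forall>\<^sub>F y in ?F. norm (Dw D' 1 x [y - x]) \<le> (C0 + 1) * ?\<eta> y"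
  proof -
    show "\<forall>\<^sub>F y in ?F. norm (Dw D' 1 x [y - x]) \<le> (C0 + 1) * ?\<eta> y"
      using evU
    proof eventually_elim
      case (elim y)
      have "norm (Dw D' 1 x [y - x]) \<le> C0 * ?\<eta> y" using C0(2)[of "[y - x]"] hV[OF elim] by simp
      then show ?case by (simp add: distrib_right add_increasing2)
    qed
  qed (use C0 in simp)
  have "\<forall>e>0. \<forall>\<^sub>F y in ?F. norm (w y - w x - Dw D' 1 x [y - x]) \<le> e * ?\<eta> y"
    and "\<forall>y\<in>U. Dw D' 1 x [y - x] \<in> V2"
    using wsm DwV1 by auto
  note od = X3.outer_diff[OF H V2 order_refl V1 UV x wU r1', of "\<lambda>h. Dw D' 1 x [h]", OF this(1) C1 this(2)]
  have Dw_m_diff: "Dw D' m y vs - Dw D' m x vs = \<iota> (D m y vs - D m x vs)" for y vs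
    using Dw_diff1[OF m1] by (simp add: D'_le)
  have sm: "usmall ?F (vl V1 m) (\<lambda>y. pn) (\<lambda>y vs. Dw D' m y vs - Dw D' m x vs)"
    using usmall_mono_filter[OF XE.hfd_cont[OF hD V1 UV order_refl x] at_le_nin]
    unfolding Dw_m_diff by (simp add: usmall_def norm_\<iota>)
  have bd: "ubdd ?F (vl V1 m) (\<lambda>y. pn) (\<lambda>y vs. Dw D' m y vs)"
    using ubdd_add[OF usmall_imp_ubdd[OF sm] mbdd_imp_ubdd[OF D'mbdd[of m]]] by simp
  obtain C where C: "C > 0" "\<forall>\<^sub>F y in ?F. \<forall>vs\<in>vl V1 m. norm (Dw D' m y vs) \<le> C * pn vs"
    using bd by (rule ubddE)
  obtain C2 where C2: "C2 > 0" "\<forall>\<^sub>F y in ?F. \<forall>vs\<in>vl V2 1. norm (DH (Suc 1) (w x) (Dw D' 1 x [y - x] # vs)) \<le> C2 * (?\<eta> y * pn vs)"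
    using od(2) by (rule ubddE)
  have S1: "usmall ?F (vl V1 m) (\<lambda>y vs. ?\<eta> y * pn vs)
      (\<lambda>y vs. DH 1 (w y) [Dw D' m y vs] - DH 1 (w x) [Dw D' m y vs] - DH (Suc 1) (w x) (Dw D' 1 x [y - x] # [Dw D' m y vs]))"
    unfolding usmall_def
  proof (intro allI impI)
    fix e :: real assume e: "e > 0"
    have e1: "e / C > 0" using e C by simp
    show "\<forall>\<^sub>F y in ?F. \<forall>vs\<in>vl V1 m. norm (DH 1 (w y) [Dw D' m y vs] - DH 1 (w x) [Dw D' m y vs]
        - DH (Suc 1) (w x) (Dw D' 1 x [y - x] # [Dw D' m y vs])) \<le> e * (?\<eta> y * pn vs)"
      using evU usmallD[OF od(3) e1] C(2)
    proof eventually_elim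
      case (elim y)
      show ?case
      proof
        fix vs assume vs: "vs \<in> vl V1 m"
        have "norm (DH 1 (w y) [Dw D' m y vs] - DH 1 (w x) [Dw D' m y vs]
            - DH (Suc 1) (w x) (Dw D' 1 x [y - x] # [Dw D' m y vs])) \<le> e / C * (?\<eta> y * pn [Dw D' m y vs])"
          by (rule bspec[OF elim(2)]) (use D'V[OF _ elim(1) vs] in simp)
        also have "\<dots> \<le> e / C * (?\<eta> y * (C * pn vs))"
          using elim(3) vs e1 by (intro mult_left_mono) auto
        also have "\<dots> = e * (?\<eta> y * pn vs)" using C by simp
        finally show "norm (DH 1 (w y) [Dw D' m y vs] - DH 1 (w x) [Dw D' m y vs]
          - DH (Suc 1) (w x) (Dw D' 1 x [y - x] # [Dw D' m y vs])) \<le> e * (?\<eta> y * pn vs)" .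
      qed
    qed
  qed
  \<comment> \<open>Continuity of \<open>D m\<close> suffices here, as the first argument is already
    of order \<open>norm (y - x)\<close>.\<close>
  have S2: "usmall ?F (vl V1 m) (\<lambda>y vs. ?\<eta> y * pn vs)
      (\<lambda>y vs. DH (Suc 1) (w x) (Dw D' 1 x [y - x] # [Dw D' m y vs - Dw D' m x vs]))"
    unfolding usmall_def
  proof (intro allI impI)
    fix e :: real assume e: "e > 0"
    have e1: "e / C2 > 0" using e C2 by simp
    show "\<forall>\<^sub>F y in ?F. \<forall>vs\<in>vl V1 m. norm (DH (Suc 1) (w x) (Dw D' 1 x [y - x] # [Dw D' m y vs - Dw D' m x vs])) \<le> e * (?\<eta> y * pn vs)"
      using evU usmallD[OF sm e1] C2(2)
    proof eventually_elim
      case (elim y)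
      show ?case
      proof
        fix vs assume vs: "vs \<in> vl V1 m"
        have "norm (DH (Suc 1) (w x) (Dw D' 1 x [y - x] # [Dw D' m y vs - Dw D' m x vs]))
            \<le> C2 * (?\<eta> y * pn [Dw D' m y vs - Dw D' m x vs])"
          by (rule bspec[OF elim(3)]) (use D'V[OF _ elim(1) vs] D'V[OF _ x vs] A.subspace_diff[OF V2] in simp)
        also have "\<dots> \<le> C2 * (?\<eta> y * (e / C2 * pn vs))"
          using elim(2) vs C2 by (intro mult_left_mono) auto
        also have "\<dots> = e * (?\<eta> y * pn vs)" using C2 by simp
        finally show "norm (DH (Suc 1) (w x) (Dw D' 1 x [y - x] # [Dw D' m y vs - Dw D' m x vs])) \<le> e * (?\<eta> y * pn vs)" .
      qed
    qed
  qed
  show "usmall ?F (vl V1 m) (\<lambda>y vs. ?\<eta> y * pn vs)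
      (\<lambda>y vs. A x (D m y vs - D m x vs - \<beta> x ((y - x) # vs)))"
  proof (rule usmall_cong)
    show "usmall ?F (vl V1 m) (\<lambda>y vs. ?\<eta> y * pn vs) (\<lambda>y vs. - (
      (\<Sum>bs\<leftarrow>rests vs. fdt DH (Dw D') w y bs - fdt DH (Dw D') w x bs - dterm (DH (length bs) (w x))
      (\<lambda>vs. DH (Suc (length bs)) (w x) (Dw D' 1 x [y - x] # vs))
      (\<lambda>b. Dw D' (length b) x b) (\<lambda>b. Dw D' (Suc (length b)) x ((y - x) # b)) bs [])
      + ((DH 1 (w y) [Dw D' m y vs] - DH 1 (w x) [Dw D' m y vs] - DH (Suc 1) (w x) (Dw D' 1 x [y - x] # [Dw D' m y vs]))
      + DH (Suc 1) (w x) (Dw D' 1 x [y - x] # [Dw D' m y vs - Dw D' m x vs]))))"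
      unfolding usmall_uminus by (intro usmall_add restsmall S1 S2)
    show "\<forall>\<^sub>F y in ?F. \<forall>vs\<in>vl V1 m. - (
      (\<Sum>bs\<leftarrow>rests vs. fdt DH (Dw D') w y bs - fdt DH (Dw D') w x bs - dterm (DH (length bs) (w x))
      (\<lambda>vs. DH (Suc (length bs)) (w x) (Dw D' 1 x [y - x] # vs))
      (\<lambda>b. Dw D' (length b) x b) (\<lambda>b. Dw D' (Suc (length b)) x ((y - x) # b)) bs [])
      + ((DH 1 (w y) [Dw D' m y vs] - DH 1 (w x) [Dw D' m y vs] - DH (Suc 1) (w x) (Dw D' 1 x [y - x] # [Dw D' m y vs]))
      + DH (Suc 1) (w x) (Dw D' 1 x [y - x] # [Dw D' m y vs - Dw D' m x vs])))
      = A x (D m y vs - D m x vs - \<beta> x ((y - x) # vs))"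
      using evU
    proof eventually_elim
      case (elim y)
      show ?case
      proof
        fix vs assume vs: "vs \<in> vl V1 m"
        let ?d = "\<lambda>bs. dterm (DH (length bs) (w x)) (\<lambda>vs. DH (Suc (length bs)) (w x) (Dw D' 1 x [y - x] # vs))
          (\<lambda>b. Dw D' (length b) x b) (\<lambda>b. Dw D' (Suc (length b)) x ((y - x) # b)) bs []"
        obtain m' where m': "m = Suc m'" using m1 by (cases m) auto
        have ne: "vs \<noteq> []" and len: "length vs = m" using vs m1 by (auto simp: vl_def)
        have sp: "FD DH (Dw E) w n y' vs
            = DH 1 (w y') [Dw E m y' vs] + (\<Sum>bs\<leftarrow>rests vs. fdt DH (Dw E) w y' bs)" for E n y'
          using FD_split[OF vs[unfolded m']] unfolding m' by blast
        have rc: "(\<Sum>bs\<leftarrow>rests vs. fdt DH (Dw D') w y' bs) = (\<Sum>bs\<leftarrow>rests vs. fdt DH (Dw D) w y' bs)" for y'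
          by (rule rest_sum_cong[OF vs[unfolded m']], rule D'_le(1)) (simp add: m')
        have z: "DH 1 (w y') [Dw D' m y' vs] + (\<Sum>bs\<leftarrow>rests vs. fdt DH (Dw D') w y' bs) = 0" if "y' \<in> U" for y'
          using FD0[OF order_refl that vs] unfolding sp rc by (simp add: Dw_def D'_le(1)[OF order_refl])
        note 1 = z[OF elim] and 2 = z[OF x]
        have "(y - x) # vs \<in> vl V1 (Suc m)" using vs hV[OF elim] by simp
        from FD_D'[OF x this, of 0]
        have "(\<Sum>bs\<leftarrow>splits vs. ?d bs) = 0" unfolding FD_Suc .
        then have 3: "?d [vs] + (\<Sum>bs\<leftarrow>rests vs. ?d bs) = 0"
          by (simp add: sum_splits_single[OF ne])
        have 4: "?d [vs] = DH (Suc 1) (w x) [Dw D' 1 x [y - x], Dw D' m x vs] + DH 1 (w x) [Dw D' (Suc m) x ((y - x) # vs)]"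
          by (simp add: dterm_def len)
        have mV: "Dw D' m y vs \<in> V2" "Dw D' m x vs \<in> V2" "Dw D' (Suc m) x ((y - x) # vs) \<in> V2"
          using D'V elim x vs hV[OF elim] by auto
        have ml2: "mlin sx sc V2 (Suc 1) (DH (Suc 1) (w x))"
          using hfd_mlin[OF H V2 order_refl] r1' wV[OF x] by simp
        have 5: "DH (Suc 1) (w x) [Dw D' 1 x [y - x], Dw D' m y vs - Dw D' m x vs]
            = DH (Suc 1) (w x) [Dw D' 1 x [y - x], Dw D' m y vs] - DH (Suc 1) (w x) [Dw D' 1 x [y - x], Dw D' m x vs]"
          using mlin_diff[OF ml2 V2, of "[Dw D' 1 x [y - x]]" "[]"] DwV1[OF elim] mV by simp
        have "A x (D m y vs - D m x vs - \<beta> x ((y - x) # vs))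
            = DH 1 (w x) [Dw D' m y vs - Dw D' m x vs - Dw D' (Suc m) x ((y - x) # vs)]"
          unfolding Dw_diff[OF vs] by (simp add: A_def D'_le)
        also have "\<dots> = DH 1 (w x) [Dw D' m y vs] - DH 1 (w x) [Dw D' m x vs] - DH 1 (w x) [Dw D' (Suc m) x ((y - x) # vs)]"
          using DH1_diff[OF x A.subspace_diff[OF V2 mV(1,2)] mV(3)] DH1_diff[OF x mV(1,2)] by simp
        finally have fin: "A x (D m y vs - D m x vs - \<beta> x ((y - x) # vs))
            = DH 1 (w x) [Dw D' m y vs] - DH 1 (w x) [Dw D' m x vs] - DH 1 (w x) [Dw D' (Suc m) x ((y - x) # vs)]" .
        show "- (
          (\<Sum>bs\<leftarrow>rests vs. fdt DH (Dw D') w y bs - fdt DH (Dw D') w x bs - ?d bs)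
          + ((DH 1 (w y) [Dw D' m y vs] - DH 1 (w x) [Dw D' m y vs] - DH (Suc 1) (w x) (Dw D' 1 x [y - x] # [Dw D' m y vs]))
          + DH (Suc 1) (w x) (Dw D' 1 x [y - x] # [Dw D' m y vs - Dw D' m x vs])))
          = A x (D m y vs - D m x vs - \<beta> x ((y - x) # vs))"
        proof -
          \<comment> \<open>The three hypotheses are the vanishing formulas of order
            \<open>m\<close> at \<open>y\<close>, of order \<open>m\<close> at \<open>x\<close>, and
            of order \<open>m + 1\<close> at \<open>x\<close>, each split into its one-block term
            and the rest.\<close>
          have alg: "- ((sy - sx - sd) + ((ay - p - q) + (q - q'))) = p - p' - p''"
            if "ay + sy = 0" "p' + sx = 0" "(q' + p'') + sd = 0" for ay sy p p' sx q q' p'' sd :: 'c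
          proof -
            have "ay = - sy" "p' = - sx" "q' + p'' = - sd"
              using that by (simp_all only: eq_neg_iff_add_eq_0)
            then have "ay = - sy" "p' = - sx" "q' = - sd - p''"
              by (simp_all add: algebra_simps)
            then show ?thesis by simp
          qed
          show ?thesis
            unfolding 5 sum_list_subtractf fin by (rule alg[OF 1 2 3[unfolded 4]])
        qed
      qed
    qed
  qed
qed

lemma good_Suc: "good (Suc m) D'"
  unfolding good_def
proof (intro conjI allI impI ballI)
  show "has_frechet_derivs sx se V1 U (Suc m) b D'"
    unfolding hfd_iff
  proof (intro conjI allI impI ballI)
    fix x assume x: "x \<in> U"
    show "D' 0 x [] = b x" using XE.hfd_0[OF hD V1 UV x] by (simp add: D'_def)
    show "usmall (at x within U) (vl V1 (Suc m)) (\<lambda>y. pn) (\<lambda>y vs. D' (Suc m) y vs - D' (Suc m) x vs)"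
      using \<beta>_cont[OF x] by (simp add: D'_def)
    fix l
    { assume "l \<le> Suc m"
      then show "mlin sx se V1 l (D' l x)" "mbdd V1 l (D' l x)"
        using XE.hfd_mlin[OF hD V1 UV _ x] XE.hfd_mbdd[OF hD V1 UV _ x] \<beta>_mlin[OF x] \<beta>_mbdd[OF x]
        by (auto simp: D'_def le_Suc_eq) }
    assume l: "l < Suc m"
    show "usmall (at x within U) (vl V1 l) (\<lambda>y vs. norm (y - x) * pn vs)
      (\<lambda>y vs. D' l y vs - D' l x vs - D' (Suc l) x ((y - x) # vs))"
    proof (cases "l = m")
      case True
      then show ?thesis
        using \<beta>_diff_0[OF x] \<beta>_diff_Suc[OF x] unfolding True D'_le(1)[OF order_refl] D'_le(2)
        by (cases "m = 0") simp_all
    next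
      case False
      then have "l < m" using l by simp
      moreover from this have "usmall (at x within U) (vl V1 l) (\<lambda>y vs. norm (y - x) * pn vs)
        (\<lambda>y vs. D l y vs - D l x vs - D (Suc l) x ((y - x) # vs))"
        using hD x by (simp add: hfd_iff)
      ultimately show ?thesis by (simp add: D'_le)
    qed
  qed
  fix j x vs assume j: "j \<le> Suc m" and x: "x \<in> U" and vs: "vs \<in> vl V1 j"
  show "D' j x vs \<in> Nc" using j x vs by (rule D'_Nc)
  show "FD DH (Dw D') w j x vs = 0"
  proof (cases "j = Suc m")
    case True
    with FD_D'[OF x] vs show ?thesis by simp
  next
    case False
    then have jm: "j \<le> m" using j by simp
    have "FD DH (Dw D') w j x vs = FD DH (Dw D) w j x vs"
      unfolding FD_def
    proof (rule arg_cong[of _ _ sum_list], rule map_cong[OF refl])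
      fix bs assume "bs \<in> set (splits vs)"
      then have bs: "is_part vs bs" by (rule splits_part)
      have "Dw D' (length c) x c = Dw D (length c) x c" if "c \<in> set bs" for c
      proof -
        have "length c \<le> m" using partD(5)[OF bs vs] that jm by fastforce
        then show ?thesis by (simp add: Dw_def D'_le(1))
      qed
      then show "fdt DH (Dw D') w x bs = fdt DH (Dw D) w x bs"
        by (simp add: fdt_def cong: map_cong)
    qed
    then show ?thesis using FD0[OF jm x vs] by simp
  qed
qed

end

theorem implicit_C_frechet: "C_frechet sx se V1 U r b"
proof -
  have "\<exists>D. good m D" if "m \<le> r" for m
    using that
  proof (induction m)
    case 0
    show ?case using good_0 by blast
  next
    case (Suc m)
    then obtain D where "good m D" by auto
    with Suc.prems show ?case using good_Suc[of m D] by auto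
  qed
  from this[OF order_refl] show ?thesis by (auto simp: C_frechet_def good_def)
qed

end

section \<open>Regular functions of a scalar and a vector\<close>

context two_spaces
begin

lemma hfd_line:
  assumes D: "has_frechet_derivs sa sc V V r f D" and V: "A.subspace V"
    and m: "m < r" and x: "x \<in> V" and h: "h \<in> V" and vs: "vs \<in> vl V m"
  shows "((\<lambda>s. D m (x + s *\<^sub>R h) vs) has_vector_derivative D (Suc m) (x + s0 *\<^sub>R h) (h # vs)) (at s0 within S)"
proof -
  define y where "y = x + s0 *\<^sub>R h"
  have mem: "x + s *\<^sub>R h \<in> V" for s
    using A.subspace_add[OF V x A.subspace_scaleR[OF V h]] .
  have y: "y \<in> V" by (simp add: y_def mem)
  have "((\<lambda>s. D m (x + s *\<^sub>R h) vs) has_vector_derivative D (Suc m) y (h # vs)) (at s0)"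
    unfolding has_vector_derivative_def has_derivative_at_alt
  proof (intro conjI allI impI)
    show "bounded_linear (\<lambda>t. t *\<^sub>R D (Suc m) y (h # vs))"
      by (rule bounded_linear_scaleR_left)
    fix e :: real assume e: "e > 0"
    define e1 where "e1 = e / (norm h * pn vs + 1)"
    have pos: "norm h * pn vs + 1 > 0" by (simp add: add_nonneg_pos)
    have e1: "e1 > 0" using e pos by (simp add: e1_def)
    obtain d where d: "d > 0" "\<And>x'. x' \<in> V \<Longrightarrow> dist x' y < d \<Longrightarrow>
        norm (D m x' vs - D m y vs - D (Suc m) y ((x' - y) # vs)) \<le> e1 * (norm (x' - y) * pn vs)"
      using usmallD[OF hfd_diff[OF D V order_refl m y] e1] vs by (auto simp: eventually_nin)
    show "\<exists>d>0. \<forall>s. norm (s - s0) < d \<longrightarrow>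
        norm (D m (x + s *\<^sub>R h) vs - D m (x + s0 *\<^sub>R h) vs - (s - s0) *\<^sub>R D (Suc m) y (h # vs)) \<le> e * norm (s - s0)"
    proof (intro exI[of _ "d / (norm h + 1)"] conjI allI impI)
      show "d / (norm h + 1) > 0" using d by (simp add: add_nonneg_pos)
      fix s assume s: "norm (s - s0) < d / (norm h + 1)"
      have diff: "x + s *\<^sub>R h - y = (s - s0) *\<^sub>R h" by (simp add: y_def algebra_simps)
      have "norm (s - s0) * norm h \<le> norm (s - s0) * (norm h + 1)" by (intro mult_left_mono) auto
      also have "\<dots> < d" using s by (simp add: pos_less_divide_eq add_nonneg_pos)
      finally have "dist (x + s *\<^sub>R h) y < d" unfolding dist_norm diff by simp
      from d(2)[OF mem this]
      have "norm (D m (x + s *\<^sub>R h) vs - D m y vs - D (Suc m) y (((s - s0) *\<^sub>R h) # vs))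
          \<le> e1 * (norm ((s - s0) *\<^sub>R h) * pn vs)" unfolding diff .
      moreover have "D (Suc m) y (((s - s0) *\<^sub>R h) # vs) = (s - s0) *\<^sub>R D (Suc m) y (h # vs)"
        using mlin_scaleR[OF hfd_mlin[OF D V order_refl _ y] V, of "Suc m" "[]" vs h] m h vs
        by (simp add: vl_def)
      moreover have "e1 * (norm ((s - s0) *\<^sub>R h) * pn vs) = e1 * (norm h * pn vs) * norm (s - s0)" by simp
      moreover have "e1 * (norm h * pn vs) \<le> e1 * (norm h * pn vs + 1)" using e1 by (intro mult_left_mono) auto
      moreover have "e1 * (norm h * pn vs + 1) = e" using pos by (simp add: e1_def)
      ultimately show "norm (D m (x + s *\<^sub>R h) vs - D m (x + s0 *\<^sub>R h) vs - (s - s0) *\<^sub>R D (Suc m) y (h # vs)) \<le> e * norm (s - s0)"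
        unfolding y_def by (smt (verit) mult_right_mono norm_ge_zero)
    qed
  qed
  then show ?thesis unfolding y_def by (rule has_vector_derivative_at_within)
qed

text \<open>The oscillation of the next derivative along the segment bounds the remainder, with the
  same constant for all \<open>vs\<close>; in this form the estimate can be integrated over a
  parameter.\<close>

lemma hfd_mvt:
  assumes D: "has_frechet_derivs sa sc V V r f D" and V: "A.subspace V"
    and m: "m < r" and x: "x \<in> V" and y: "y \<in> V" and vs: "vs \<in> vl V m"
    and bd: "\<And>s us. s \<in> {0..1} \<Longrightarrow> us \<in> vl V (Suc m) \<Longrightarrow>
      norm (D (Suc m) (x + s *\<^sub>R (y - x)) us - D (Suc m) x us) \<le> e * pn us"
  shows "norm (D m y vs - D m x vs - D (Suc m) x ((y - x) # vs)) \<le> e * (norm (y - x) * pn vs)"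
proof -
  have h: "y - x \<in> V" using x y A.subspace_diff[OF V] by blast
  have "norm (D m (x + 1 *\<^sub>R (y - x)) vs - D m (x + 0 *\<^sub>R (y - x)) vs
      - (1 - 0) *\<^sub>R D (Suc m) (x + 0 *\<^sub>R (y - x)) ((y - x) # vs)) \<le> norm (1 - 0 :: real) * (e * pn ((y - x) # vs))"
  proof (rule vector_differentiable_bound_linearization[where S = "{0..1}"])
    fix s :: real assume "s \<in> {0..1}"
    then show "norm (D (Suc m) (x + s *\<^sub>R (y - x)) ((y - x) # vs) - D (Suc m) (x + 0 *\<^sub>R (y - x)) ((y - x) # vs))
        \<le> e * pn ((y - x) # vs)"
      using bd[of s "(y - x) # vs"] h vs by simp
  qed (use hfd_line[OF D V m x h vs] in \<open>auto simp: closed_segment_eq_real_ivl\<close>)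
  then show ?thesis by simp
qed

text \<open>Uniform continuity at a compact set, with \<open>d\<close> obtained from a Lebesgue
  number of a cover. The point \<open>y\<close> may leave the compact set, since a neighbourhood of
  it is in general not compact.\<close>

lemma hfd_compact:
  assumes D: "has_frechet_derivs sa sc V V r f D" and V: "A.subspace V" and m: "m \<le> r"
    and K: "compact K" "K \<subseteq> V" and e: "e > 0"
  obtains d where "d > 0" "\<And>x y vs. x \<in> K \<Longrightarrow> y \<in> V \<Longrightarrow> dist y x < d \<Longrightarrow> vs \<in> vl V m \<Longrightarrow>
    norm (D m y vs - D m x vs) \<le> e * pn vs"
proof -
  have "\<forall>x\<in>K. \<exists>d>0. \<forall>y\<in>V. dist y x < d \<longrightarrow> (\<forall>vs\<in>vl V m. norm (D m y vs - D m x vs) \<le> e / 2 * pn vs)"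
  proof
    fix x assume "x \<in> K"
    then have x: "x \<in> V" using K by blast
    have "e / 2 > 0" using e by simp
    from usmallD[OF hfd_cont[OF D V order_refl m x] this]
    show "\<exists>d>0. \<forall>y\<in>V. dist y x < d \<longrightarrow> (\<forall>vs\<in>vl V m. norm (D m y vs - D m x vs) \<le> e / 2 * pn vs)"
      by (simp add: eventually_nin)
  qed
  then obtain \<delta> where \<delta>: "\<And>x. x \<in> K \<Longrightarrow> \<delta> x > 0"
    "\<And>x y vs. x \<in> K \<Longrightarrow> y \<in> V \<Longrightarrow> dist y x < \<delta> x \<Longrightarrow> vs \<in> vl V m \<Longrightarrow> norm (D m y vs - D m x vs) \<le> e / 2 * pn vs"
    by (metis (no_types, lifting))
  obtain d where d: "d > 0" "\<forall>x\<in>K. \<exists>G\<in>(\<lambda>x. ball x (\<delta> x)) ` K. ball x d \<subseteq> G"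
  proof (rule Heine_Borel_lemma[OF K(1)])
    show "K \<subseteq> \<Union>((\<lambda>x. ball x (\<delta> x)) ` K)" using \<delta>(1) by force
  qed auto
  show thesis
  proof (rule that[OF d(1)])
    fix x y vs assume *: "x \<in> K" "y \<in> V" "dist y x < d" "vs \<in> vl V m"
    obtain z where z: "z \<in> K" "ball x d \<subseteq> ball z (\<delta> z)" using d(2) *(1) by auto
    have "x \<in> ball z (\<delta> z)" "y \<in> ball z (\<delta> z)" 
      using subsetD[OF z(2), of x] subsetD[OF z(2), of y] d(1) *(3) by (simp_all add: dist_commute)
    then have "norm (D m x vs - D m z vs) \<le> e / 2 * pn vs" "norm (D m y vs - D m z vs) \<le> e / 2 * pn vs"
      using \<delta>(2)[OF z(1)] * K by (auto simp: dist_commute)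
    moreover have "norm (D m y vs - D m x vs) \<le> norm (D m y vs - D m z vs) + norm (D m x vs - D m z vs)"
      using norm_triangle_ineq4[of "D m y vs - D m z vs" "D m x vs - D m z vs"] by simp
    ultimately show "norm (D m y vs - D m x vs) \<le> e * pn vs" by simp
  qed
qed

lemma hfd_from_ccont:
  assumes "\<And>x. x \<in> U \<Longrightarrow> D 0 x [] = f x"
    and "\<And>m x. m \<le> r \<Longrightarrow> x \<in> U \<Longrightarrow> mlin sa sc V m (D m x)"
    and "\<And>m x. m \<le> r \<Longrightarrow> x \<in> U \<Longrightarrow> mbdd V m (D m x)"
    and "\<And>m x. m < r \<Longrightarrow> x \<in> U \<Longrightarrow> usmall (nin x U) (vl V m) (\<lambda>y vs. norm (y - x) * pn vs)
      (\<lambda>y vs. D m y vs - D m x vs - D (Suc m) x ((y - x) # vs))"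
    and "\<And>x. x \<in> U \<Longrightarrow> usmall (nin x U) (vl V r) (\<lambda>y. pn) (\<lambda>y vs. D r y vs - D r x vs)"
  shows "has_frechet_derivs sa sc V U r f D"
  unfolding hfd_iff using assms by (auto intro: usmall_mono_filter[OF _ at_le_nin])

end

lemma normed_over_scale_pair:
  assumes "normed_over s"
  shows "normed_over (scale_pair s)"
proof -
  interpret normed_over s by fact
  show ?thesis
  proof
    fix a b :: 'a and x y :: "'a \<times> 'b"
    show "scale_pair s a (x + y) = scale_pair s a x + scale_pair s a y"
      by (simp add: scale_pair_def scale_right_distrib distrib_left)
    show "scale_pair s (a + b) x = scale_pair s a x + scale_pair s b x"
      by (simp add: scale_pair_def scale_left_distrib distrib_right)
    show "scale_pair s a (scale_pair s b x) = scale_pair s (a * b) x"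
      by (simp add: scale_pair_def)
    show "scale_pair s 1 x = x" by (simp add: scale_pair_def)
    have "norm (a * fst x, s a (snd x)) = sqrt ((norm a)\<^sup>2 * ((norm (fst x))\<^sup>2 + (norm (snd x))\<^sup>2))"
      by (simp add: norm_Pair norm_mult norm_scale power_mult_distrib distrib_left)
    also have "\<dots> = norm a * norm x" by (simp add: real_sqrt_mult norm_prod_def)
    finally show "norm (scale_pair s a x) = norm a * norm x" by (simp add: scale_pair_def)
    show "scale_pair s (of_real r) x = r *\<^sub>R x" for r
      by (simp add: scale_pair_def scale_of_real scaleR_prod_def scaleR_conv_of_real)
  qed
qed

text \<open>\<open>\<epsilon>\<close> tends to \<open>0\<close> while \<open>b\<close> ranges over
  the ball of radius \<open>R\<close> in \<open>E\<close> without converging, so eventual statements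
  are uniform in \<open>b\<close>.\<close>

definition zfilter :: "'e set \<Rightarrow> real \<Rightarrow> ('k::real_normed_vector \<times> 'e::real_normed_vector) filter"
  where "zfilter E R = inf (filtercomap fst (nhds 0)) (principal (UNIV \<times> {b\<in>E. norm b \<le> R}))"

lemma eventually_zfilter:
  "eventually P (zfilter E R) \<longleftrightarrow> (\<exists>d>0. \<forall>\<epsilon> b. norm \<epsilon> < d \<longrightarrow> b \<in> E \<longrightarrow> norm b \<le> R \<longrightarrow> P (\<epsilon>, b))"
proof
  assume "eventually P (zfilter E R)"
  then obtain Q where Q: "eventually Q (nhds 0)"
    "\<And>\<epsilon> b. Q \<epsilon> \<Longrightarrow> b \<in> E \<Longrightarrow> norm b \<le> R \<Longrightarrow> P (\<epsilon>, b)"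
    unfolding zfilter_def eventually_inf_principal eventually_filtercomap by force
  from Q(1) obtain d where "d > 0" "\<And>\<epsilon>. norm \<epsilon> < d \<Longrightarrow> Q \<epsilon>" by (auto simp: eventually_nhds_metric)
  with Q(2) show "\<exists>d>0. \<forall>\<epsilon> b. norm \<epsilon> < d \<longrightarrow> b \<in> E \<longrightarrow> norm b \<le> R \<longrightarrow> P (\<epsilon>, b)" by blast
next
  assume "\<exists>d>0. \<forall>\<epsilon> b. norm \<epsilon> < d \<longrightarrow> b \<in> E \<longrightarrow> norm b \<le> R \<longrightarrow> P (\<epsilon>, b)"
  then obtain d where d: "d > 0" "\<And>\<epsilon> b. norm \<epsilon> < d \<Longrightarrow> b \<in> E \<Longrightarrow> norm b \<le> R \<Longrightarrow> P (\<epsilon>, b)" by blast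
  show "eventually P (zfilter E R)"
    unfolding zfilter_def eventually_inf_principal eventually_filtercomap
    by (rule exI[of _ "\<lambda>\<epsilon>. norm \<epsilon> < d"]) (use d in \<open>auto simp: eventually_nhds_metric\<close>)
qed

lemma tendsto_fst_zfilter: "(fst \<longlongrightarrow> 0) (zfilter E R)"
  unfolding zfilter_def by (rule tendsto_mono[OF inf_le1]) (rule filterlim_filtercomap)

locale pair_setting = E: normed_over se + C: normed_over sc
  for se :: "'k::real_normed_field \<Rightarrow> 'e::real_normed_vector \<Rightarrow> 'e"
    and sc :: "'k \<Rightarrow> 'c::real_normed_vector \<Rightarrow> 'c" +
  fixes E :: "'e set"
  assumes E: "E.subspace E"
begin

sublocale P: two_spaces "scale_pair se" sc
  unfolding two_spaces_def using normed_over_scale_pair E.normed_over_axioms C.normed_over_axioms by blast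

abbreviation "sp \<equiv> scale_pair se"
abbreviation zf :: "real \<Rightarrow> ('k \<times> 'e) filter" where "zf R \<equiv> zfilter E R"
abbreviation "V \<equiv> (UNIV :: 'k set) \<times> E"

lemma V: "P.A.subspace V"
  using E E.subspace_add E.subspace_scale E.subspace_0
  by (auto simp: P.A.subspace_def scale_pair_def zero_prod_def)

text \<open>Uniform continuity up to \<open>\<epsilon> = 0\<close> on bounded sets is not implied by smoothness in infinite dimensions; the
  contraction needs it for a neighbourhood of \<open>\<epsilon> = 0\<close> that works for all \<open>n\<close> with \<open>\<parallel>n\<parallel> < \<gamma>\<close>.\<close>

definition regular :: "nat \<Rightarrow> ('k \<times> 'e \<Rightarrow> 'c) \<Rightarrow> (nat \<Rightarrow> 'k \<times> 'e \<Rightarrow> ('k \<times> 'e) list \<Rightarrow> 'c) \<Rightarrow> bool"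
  where "regular r f D \<longleftrightarrow> has_frechet_derivs sp sc V V r f D \<and>
    (\<forall>R. ccont (zf R) V r D (\<lambda>p. p) (\<lambda>p. (0, snd p)))"

lemma ev_zV: "\<forall>\<^sub>F p in zf R. p \<in> V"
  unfolding eventually_zfilter by (auto intro: exI[of _ 1])

lemma ev_zV0: "\<forall>\<^sub>F p in zf R. (0, snd p) \<in> V"
  unfolding eventually_zfilter by (auto intro: exI[of _ 1])

lemma regularI:
  assumes D0: "\<And>x. x \<in> V \<Longrightarrow> D 0 x [] = f x"
    and ml: "\<And>m x. m \<le> r \<Longrightarrow> x \<in> V \<Longrightarrow> mlin sp sc V m (D m x)"
    and mb: "\<And>m x. m \<le> r \<Longrightarrow> x \<in> V \<Longrightarrow> mbdd V m (D m x)"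
    and df: "\<And>m x. m < r \<Longrightarrow> x \<in> V \<Longrightarrow> usmall (nin x V) (vl V m) (\<lambda>y vs. norm (y - x) * pn vs)
      (\<lambda>y vs. D m y vs - D m x vs - D (Suc m) x ((y - x) # vs))"
    and ct: "\<And>x. x \<in> V \<Longrightarrow> usmall (nin x V) (vl V r) (\<lambda>y. pn) (\<lambda>y vs. D r y vs - D r x vs)"
    and zc: "\<And>R. ccont (zf R) V r D (\<lambda>p. p) (\<lambda>p. (0, snd p))"
  shows "regular r f D"
  unfolding regular_def using P.hfd_from_ccont[of V D f r V] assms by auto

lemma regular_hfd: "regular r f D \<Longrightarrow> has_frechet_derivs sp sc V V r f D"
  by (simp add: regular_def)

lemma regular_ccont: "regular r f D \<Longrightarrow> ccont (zf R) V r D (\<lambda>p. p) (\<lambda>p. (0, snd p))"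
  by (simp add: regular_def)

lemma fst_tendsto_nin: "((\<lambda>y. fst y - fst x) \<longlongrightarrow> 0) (nin x V)"
proof -
  have "((\<lambda>y. fst y - fst x) \<longlongrightarrow> fst x - fst x) (nhds x)"
    by (intro tendsto_intros filterlim_ident)
  then show ?thesis unfolding nin_def by (simp add: tendsto_mono[OF inf_le1])
qed

definition Daff :: "'c \<Rightarrow> ('e \<Rightarrow> 'c) \<Rightarrow> nat \<Rightarrow> 'k \<times> 'e \<Rightarrow> ('k \<times> 'e) list \<Rightarrow> 'c"
  where "Daff a l m p vs = (if m = 0 then a + l (snd p) else if m = 1 then l (snd (hd vs)) else 0)"

lemma regular_affine:
  assumes lin: "\<And>c u v. u \<in> E \<Longrightarrow> v \<in> E \<Longrightarrow> l (se c u + v) = sc c (l u) + l v"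
    and bd: "\<And>u. u \<in> E \<Longrightarrow> norm (l u) \<le> C * norm u" and C: "C \<ge> 0"
  shows "regular r (\<lambda>p. a + l (snd p)) (Daff a l)"
proof -
  have add: "l (u + v) = l u + l v" if "u \<in> E" "v \<in> E" for u v
    using lin[OF that, of 1] by simp
  have diff: "l (u - v) = l u - l v" if "u \<in> E" "v \<in> E" for u v
    using add[of "u - v" v] that E.subspace_diff[OF E that] by simp
  have bd': "norm (l (snd p)) \<le> C * norm p" if "p \<in> V" for p
  proof -
    have "norm (l (snd p)) \<le> C * norm (snd p)" using bd that by auto
    also have "\<dots> \<le> C * norm p" using norm_snd_le[of "snd p" "fst p"] C by (intro mult_left_mono) auto
    finally show ?thesis .
  qed
  have mb: "norm (Daff a l m x vs) \<le> (norm a + C * norm (snd x) + C) * pn vs" if pt: "x \<in> V" "vs \<in> vl V m" for m x vs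
  proof -
    consider "m = 0" | h where "m = 1" "vs = [h]" "h \<in> V" | "m \<ge> 2"
    proof -
      assume *: "m = 0 \<Longrightarrow> thesis" "\<And>h. m = 1 \<Longrightarrow> vs = [h] \<Longrightarrow> h \<in> V \<Longrightarrow> thesis" "m \<ge> 2 \<Longrightarrow> thesis"
      show thesis
      proof (cases "m = 1")
        case True
        then obtain h where "vs = [h]" using pt by (auto simp: vl_def length_Suc_conv)
        then show thesis using * True pt by auto
      qed (use * in linarith)
    qed
    then show ?thesis
    proof cases
      case 1
      have "norm (a + l (snd x)) \<le> norm a + C * norm (snd x)"
        using bd[of "snd x"] pt by (intro norm_triangle_le add_left_mono) auto
      then show ?thesis using 1 pt C by (auto simp: Daff_def)
    next
      case 2
      have "norm (l (snd h)) \<le> C * norm h" using bd' 2 by blast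
      also have "\<dots> \<le> (norm a + C * norm (snd x) + C) * norm h" using C by (intro mult_right_mono) auto
      finally show ?thesis using 2 by (simp add: Daff_def)
    next
      case 3
      then show ?thesis using C by (auto simp: Daff_def)
    qed
  qed
  show ?thesis
  proof (rule regularI)
    show "Daff a l 0 x [] = a + l (snd x)" for x by (simp add: Daff_def)
    show "mlin sp sc V m (Daff a l m x)" for m x
    proof (rule mlinI)
      fix as bs u v c assume *: "set as \<subseteq> V" "set bs \<subseteq> V" "u \<in> V" "v \<in> V" "length as + length bs + 1 = m"
      then show "Daff a l m x (as @ (sp c u + v) # bs)
        = sc c (Daff a l m x (as @ u # bs)) + Daff a l m x (as @ v # bs)"
        by (cases as) (auto simp: Daff_def scale_pair_def lin)
    qed
    show "mbdd V m (Daff a l m x)" if "x \<in> V" for m x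
      unfolding mbdd_def using mb[OF that] C by (intro exI[of _ "norm a + C * norm (snd x) + C"]) auto
    have d: "Daff a l m y vs - Daff a l m x vs = Daff a l (Suc m) x ((y - x) # vs)"
      if "x \<in> V" "y \<in> V" for m x y vs
      using that by (auto simp: Daff_def diff)
    have evV: "\<forall>\<^sub>F y in nin x V. y \<in> V" for x by (auto simp: eventually_nin intro: exI[of _ 1])
    show "usmall (nin x V) (vl V m) (\<lambda>y vs. norm (y - x) * pn vs)
      (\<lambda>y vs. Daff a l m y vs - Daff a l m x vs - Daff a l (Suc m) x ((y - x) # vs))" if "x \<in> V" for m x
      by (rule usmall_cong[OF usmall_zero], simp, use evV in eventually_elim) (use d that in auto)
    show "usmall (nin x V) (vl V r) (\<lambda>y. pn) (\<lambda>y vs. Daff a l r y vs - Daff a l r x vs)" if x: "x \<in> V" for x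
    proof (rule usmall_shrink[OF _ tendsto_norm_diff_nin])
      show "ubdd (nin x V) (vl V r) (\<lambda>y vs. norm (y - x) * pn vs) (\<lambda>y vs. Daff a l r y vs - Daff a l r x vs)"
        unfolding ubdd_def
      proof (intro exI[of _ "C + 1"] conjI)
        show "\<forall>\<^sub>F y in nin x V. \<forall>vs\<in>vl V r. norm (Daff a l r y vs - Daff a l r x vs) \<le> (C + 1) * (norm (y - x) * pn vs)"
          using evV
        proof eventually_elim
          case (elim y)
          have "norm (l (snd (y - x))) \<le> C * norm (y - x)"
            by (rule bd'[OF P.A.subspace_diff[OF V elim x]])
          also have "\<dots> \<le> (C + 1) * norm (y - x)" by (intro mult_right_mono) auto
          finally show ?case
            using C d[OF x elim, of r] by (auto simp: Daff_def)
        qed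
      qed (use C in simp)
    qed simp
    show "ccont (zf R) V r (Daff a l) (\<lambda>p. p) (\<lambda>p. (0, snd p))" for R
    proof (rule ccontI)
      fix m
      show "usmall (zf R) (vl V m) (\<lambda>i. pn) (\<lambda>i vs. Daff a l m i vs - Daff a l m (0, snd i) vs)"
        by (rule usmall_cong[OF usmall_zero]) (auto simp: Daff_def)
      show "ubdd (zf R) (vl V m) (\<lambda>i. pn) (\<lambda>i. Daff a l m (0, snd i))"
        unfolding ubdd_def
      proof (intro exI[of _ "norm a + C * \<bar>R\<bar> + C + 1"] conjI)
        show "norm a + C * \<bar>R\<bar> + C + 1 > 0" using C by (simp add: add_nonneg_pos)
        show "\<forall>\<^sub>F i in zf R. \<forall>vs\<in>vl V m. norm (Daff a l m (0, snd i) vs) \<le> (norm a + C * \<bar>R\<bar> + C + 1) * pn vs"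
          unfolding eventually_zfilter
        proof (intro exI[of _ 1] conjI allI impI ballI)
          fix \<epsilon> :: 'k and b vs assume b: "b \<in> E" "norm b \<le> R" and vs: "vs \<in> vl V m"
          have "norm (Daff a l m (0, b) vs) \<le> (norm a + C * norm b + C) * pn vs"
            using mb[of "(0, b)" vs m] b vs by simp
          also have "\<dots> \<le> (norm a + C * \<bar>R\<bar> + C + 1) * pn vs"
          proof (rule mult_right_mono)
            have "C * norm b \<le> C * \<bar>R\<bar>" using b C by (intro mult_left_mono) auto
            then show "norm a + C * norm b + C \<le> norm a + C * \<bar>R\<bar> + C + 1" by simp
          qed simp
          finally show "norm (Daff a l m (0, snd (\<epsilon>, b)) vs) \<le> (norm a + C * \<bar>R\<bar> + C + 1) * pn vs" by simp
        qed simp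
      qed
    qed
  qed
qed

lemma regular_add:
  assumes f: "regular r f D" and g: "regular r g D'"
  shows "regular r (\<lambda>p. f p + g p) (\<lambda>m p vs. D m p vs + D' m p vs)"
proof (rule regularI)
  note hf = regular_hfd[OF f] and hg = regular_hfd[OF g]
  fix x assume x: "x \<in> V"
  show "D 0 x [] + D' 0 x [] = f x + g x"
    using P.hfd_0[OF hf V order_refl x] P.hfd_0[OF hg V order_refl x] by simp
  { fix m assume m: "m \<le> r"
    show "mlin sp sc V m (\<lambda>vs. D m x vs + D' m x vs)"
      by (intro P.mlin_plus P.hfd_mlin[OF hf V order_refl m x] P.hfd_mlin[OF hg V order_refl m x])
    show "mbdd V m (\<lambda>vs. D m x vs + D' m x vs)"
      by (intro mbdd_plus P.hfd_mbdd[OF hf V order_refl m x] P.hfd_mbdd[OF hg V order_refl m x]) }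
  { fix m assume m: "m < r"
    show "usmall (nin x V) (vl V m) (\<lambda>y vs. norm (y - x) * pn vs)
      (\<lambda>y vs. D m y vs + D' m y vs - (D m x vs + D' m x vs) - (D (Suc m) x ((y - x) # vs) + D' (Suc m) x ((y - x) # vs)))"
      using usmall_add[OF P.hfd_diff[OF hf V order_refl m x] P.hfd_diff[OF hg V order_refl m x]]
      by (simp add: algebra_simps) }
  show "usmall (nin x V) (vl V r) (\<lambda>y. pn) (\<lambda>y vs. D r y vs + D' r y vs - (D r x vs + D' r x vs))"
    using usmall_add[OF P.hfd_cont[OF hf V order_refl order_refl x] P.hfd_cont[OF hg V order_refl order_refl x]]
    by (simp add: algebra_simps)
next
  fix R
  note cf = ccontD[OF regular_ccont[OF f, of R]] and cg = ccontD[OF regular_ccont[OF g, of R]]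
  show "ccont (zf R) V r (\<lambda>m p vs. D m p vs + D' m p vs) (\<lambda>p. p) (\<lambda>p. (0, snd p))"
  proof (rule ccontI)
    fix m assume m: "m \<le> r"
    show "usmall (zf R) (vl V m) (\<lambda>i. pn)
        (\<lambda>i vs. D m i vs + D' m i vs - (D m (0, snd i) vs + D' m (0, snd i) vs))"
      using usmall_add[OF cf(1)[OF m] cg(1)[OF m]] by (simp add: algebra_simps)
    show "ubdd (zf R) (vl V m) (\<lambda>i. pn) (\<lambda>i vs. D m (0, snd i) vs + D' m (0, snd i) vs)"
      using ubdd_add[OF cf(3)[OF m] cg(3)[OF m]] by simp
  qed
qed

end

section \<open>Multiplication by the scalar variable\<close>

primrec removals :: "'a list \<Rightarrow> ('a \<times> 'a list) list" where
  "removals [] = []"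
| "removals (h # vs) = (h, vs) # map (\<lambda>(v, r). (v, h # r)) (removals vs)"

lemma removals_append: "removals (as @ bs)
    = map (\<lambda>(v, r). (v, r @ bs)) (removals as) @ map (\<lambda>(v, r). (v, as @ r)) (removals bs)"
  by (induction as) (auto simp: comp_def split_def)

lemma removals_mset: "(v, r) \<in> set (removals vs) \<Longrightarrow> mset (v # r) = mset vs"
  by (induction vs arbitrary: v r) auto

lemma length_removals: "length (removals vs) = length vs"
  by (induction vs) auto

lemma removals_vl:
  assumes "(v, r) \<in> set (removals vs)" "vs \<in> vl V m"
  shows "v \<in> V" "r \<in> vl V (m - 1)" "norm v * pn r = pn vs" "m \<ge> 1"
proof -
  have ms: "mset (v # r) = mset vs" using removals_mset[OF assms(1)] .
  have "set (v # r) \<subseteq> V" "length (v # r) = m"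
    using mset_eq_setD[OF ms] mset_eq_length[OF ms] assms(2) by (auto simp: vl_def)
  then show "v \<in> V" "r \<in> vl V (m - 1)" "m \<ge> 1" by (auto simp: vl_def)
  show "norm v * pn r = pn vs" using pn_mset[OF ms] by simp
qed

context pair_setting
begin

definition Rsum :: "(('k \<times> 'e) list \<Rightarrow> 'c) \<Rightarrow> ('k \<times> 'e) list \<Rightarrow> 'c"
  where "Rsum L vs = (\<Sum>(v, r)\<leftarrow>removals vs. sc (fst v) (L r))"

text \<open>The Leibniz rule for the product of \<open>\<epsilon>\<close> and a function:
  \<open>\<epsilon>\<close> is linear, so at most one direction falls on it, and \<open>Rsum\<close>
  runs over that direction. For \<open>m = 0\<close> the truncated index \<open>m - 1\<close> is
  harmless, because \<open>removals []\<close> is empty.\<close>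

definition Deps :: "(nat \<Rightarrow> 'k \<times> 'e \<Rightarrow> ('k \<times> 'e) list \<Rightarrow> 'c) \<Rightarrow> nat \<Rightarrow> 'k \<times> 'e \<Rightarrow> ('k \<times> 'e) list \<Rightarrow> 'c"
  where "Deps D m p vs = sc (fst p) (D m p vs) + Rsum (D (m - 1) p) vs"

lemma Rsum_Cons: "Rsum L (h # vs) = sc (fst h) (L vs) + Rsum (\<lambda>r. L (h # r)) vs"
  by (simp add: Rsum_def comp_def split_def)

lemma Rsum_diff: "Rsum (\<lambda>r. L r - L' r) vs = Rsum L vs - Rsum L' vs"
  by (simp add: Rsum_def C.scale_right_diff_distrib split_def sum_list_subtractf)

lemma Rsum_add: "Rsum (\<lambda>r. L r + L' r) vs = Rsum L vs + Rsum L' vs"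
  by (simp add: Rsum_def C.scale_right_distrib split_def sum_list_addf)

lemma Rsum_bound:
  assumes "\<And>r. r \<in> vl V (m - 1) \<Longrightarrow> m \<ge> 1 \<Longrightarrow> norm (L r) \<le> C * pn r" "vs \<in> vl V m"
  shows "norm (Rsum L vs) \<le> real m * (C * pn vs)"
proof -
  have "norm (Rsum L vs) \<le> real (length (removals vs)) * (C * pn vs)"
    unfolding Rsum_def
  proof (rule norm_sum_list_le)
    fix x assume x: "x \<in> set (removals vs)"
    obtain v r where [simp]: "x = (v, r)" by (cases x)
    note R = removals_vl[of v r, OF _ assms(2)]
    have "norm (sc (fst v) (L r)) \<le> norm v * norm (L r)"
      unfolding C.norm_scale using norm_fst_le[of "fst v" "snd v"] by (intro mult_right_mono) auto
    also have "\<dots> \<le> norm v * (C * pn r)"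
      using assms(1)[of r] R x by (intro mult_left_mono) auto
    also have "\<dots> = C * pn vs" using R(3) x by (simp add: mult_ac)
    finally show "norm (case x of (v, r) \<Rightarrow> sc (fst v) (L r)) \<le> C * pn vs" by simp
  qed
  then show ?thesis using assms(2) by (simp add: length_removals vl_def)
qed

text \<open>The varying vector either is the removed one or remains an argument of \<open>L\<close>,
  and the dependence is linear in both cases.\<close>

lemma Rsum_mlin:
  assumes L: "mlin sp sc V n L"
  shows "mlin sp sc V (Suc n) (Rsum L)"
proof (rule mlinI)
  fix as bs u v c
  assume *: "set as \<subseteq> V" "set bs \<subseteq> V" "u \<in> V" "v \<in> V" "length as + length bs + 1 = Suc n"
  have split: "Rsum L (as @ x # bs) = (\<Sum>(y, r)\<leftarrow>removals as. sc (fst y) (L (r @ x # bs)))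
      + (sc (fst x) (L (as @ bs)) + (\<Sum>(y, r)\<leftarrow>removals bs. sc (fst y) (L (as @ x # r))))" for x
    by (simp add: Rsum_def removals_append comp_def split_def)
  have as: "as \<in> vl V (length as)" and bs: "bs \<in> vl V (length bs)" using * by (auto simp: vl_def)
  have 1: "(\<Sum>(y, r)\<leftarrow>removals as. sc (fst y) (L (r @ (sp c u + v) # bs)))
      = sc c (\<Sum>(y, r)\<leftarrow>removals as. sc (fst y) (L (r @ u # bs))) + (\<Sum>(y, r)\<leftarrow>removals as. sc (fst y) (L (r @ v # bs)))"
  proof (rule C.sum_list_lin)
    fix x assume x: "x \<in> set (removals as)"
    obtain y r where [simp]: "x = (y, r)" by (cases x)
    have "L (r @ (sp c u + v) # bs) = sc c (L (r @ u # bs)) + L (r @ v # bs)"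
      by (rule mlinD[OF L]) (use removals_vl[of y r, OF _ as] x * in \<open>auto simp: vl_def\<close>)
    then show "(case x of (y, r) \<Rightarrow> sc (fst y) (L (r @ (sp c u + v) # bs)))
      = sc c (case x of (y, r) \<Rightarrow> sc (fst y) (L (r @ u # bs))) + (case x of (y, r) \<Rightarrow> sc (fst y) (L (r @ v # bs)))"
      by (simp add: C.scale_right_distrib C.scale_left_commute)
  qed
  have 2: "(\<Sum>(y, r)\<leftarrow>removals bs. sc (fst y) (L (as @ (sp c u + v) # r)))
      = sc c (\<Sum>(y, r)\<leftarrow>removals bs. sc (fst y) (L (as @ u # r))) + (\<Sum>(y, r)\<leftarrow>removals bs. sc (fst y) (L (as @ v # r)))"
  proof (rule C.sum_list_lin)
    fix x assume x: "x \<in> set (removals bs)"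
    obtain y r where [simp]: "x = (y, r)" by (cases x)
    have "L (as @ (sp c u + v) # r) = sc c (L (as @ u # r)) + L (as @ v # r)"
      by (rule mlinD[OF L]) (use removals_vl[of y r, OF _ bs] x * in \<open>auto simp: vl_def\<close>)
    then show "(case x of (y, r) \<Rightarrow> sc (fst y) (L (as @ (sp c u + v) # r)))
      = sc c (case x of (y, r) \<Rightarrow> sc (fst y) (L (as @ u # r))) + (case x of (y, r) \<Rightarrow> sc (fst y) (L (as @ v # r)))"
      by (simp add: C.scale_right_distrib C.scale_left_commute)
  qed
  show "Rsum L (as @ (sp c u + v) # bs) = sc c (Rsum L (as @ u # bs)) + Rsum L (as @ v # bs)"
    unfolding split 1 2
    by (simp add: scale_pair_def C.scale_right_distrib C.scale_left_distrib algebra_simps)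
qed

text \<open>Stated for two moving points, so that one proof covers continuity at a point
  (\<open>c\<close> constant) and the limit at \<open>\<epsilon> = 0\<close>
  (\<open>c i = (0, snd i)\<close> and \<open>M = 0\<close>).\<close>

lemma Deps_cont:
  assumes cc: "\<And>l. l \<le> m \<Longrightarrow> usmall F (vl V l) (\<lambda>i. pn) (\<lambda>i vs. D l (a i) vs - D l (c i) vs)"
    "ubdd F (vl V m) (\<lambda>i. pn) (\<lambda>i. D m (a i))"
    and ac: "((\<lambda>i. fst (a i) - fst (c i)) \<longlongrightarrow> 0) F"
    and c: "\<And>i. norm (fst (c i)) \<le> M"
  shows "usmall F (vl V m) (\<lambda>i. pn) (\<lambda>i vs. Deps D m (a i) vs - Deps D m (c i) vs)"
proof -
  have M: "M \<ge> 0" using c norm_ge_zero order_trans by blast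
  have 1: "usmall F (vl V m) (\<lambda>i. pn) (\<lambda>i vs. sc (fst (a i) - fst (c i)) (D m (a i) vs))"
  proof (rule usmall_shrink)
    show "ubdd F (vl V m) (\<lambda>i vs. norm (fst (a i) - fst (c i)) * pn vs) (\<lambda>i vs. sc (fst (a i) - fst (c i)) (D m (a i) vs))"
    proof -
      obtain C where C: "C > 0" "\<forall>\<^sub>F i in F. \<forall>vs\<in>vl V m. norm (D m (a i) vs) \<le> C * pn vs"
        using cc(2) by (rule ubddE)
      from C(2) have "\<forall>\<^sub>F i in F. \<forall>vs\<in>vl V m. norm (sc (fst (a i) - fst (c i)) (D m (a i) vs)) \<le> C * (norm (fst (a i) - fst (c i)) * pn vs)"
      proof eventually_elim
        case (elim i)
        show ?case
        proof
          fix vs assume vs: "vs \<in> vl V m"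
          show "norm (sc (fst (a i) - fst (c i)) (D m (a i) vs)) \<le> C * (norm (fst (a i) - fst (c i)) * pn vs)"
            using mult_left_mono[OF elim[rule_format, OF vs], of "norm (fst (a i) - fst (c i))"]
            by (simp add: C.norm_scale mult_ac)
        qed
      qed
      with C(1) show ?thesis by (auto simp: ubdd_def)
    qed
    show "((\<lambda>i. norm (fst (a i) - fst (c i))) \<longlongrightarrow> 0) F" using ac by (rule tendsto_norm_zero)
  qed simp
  have 2: "usmall F (vl V m) (\<lambda>i. pn) (\<lambda>i vs. sc (fst (c i)) (D m (a i) vs - D m (c i) vs))"
  proof (rule usmall_le[OF cc(1)[OF order_refl] M], intro always_eventually allI ballI)
    fix i q assume "q \<in> vl V m"
    then show "\<exists>p\<in>vl V m. norm (sc (fst (c i)) (D m (a i) q - D m (c i) q)) \<le> M * norm (D m (a i) p - D m (c i) p) \<and> pn p \<le> pn q"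
      using c[of i] by (intro bexI[of _ q]) (auto simp: C.norm_scale intro!: mult_right_mono)
  qed
  have 3: "usmall F (vl V m) (\<lambda>i. pn) (\<lambda>i vs. Rsum (\<lambda>r. D (m - 1) (a i) r - D (m - 1) (c i) r) vs)"
    unfolding usmall_def
  proof (intro allI impI)
    fix e :: real assume e: "e > 0"
    then have e1: "e / (real m + 1) > 0" by simp
    from usmallD[OF cc(1)[of "m - 1"] e1]
    show "\<forall>\<^sub>F i in F. \<forall>vs\<in>vl V m. norm (Rsum (\<lambda>r. D (m - 1) (a i) r - D (m - 1) (c i) r) vs) \<le> e * pn vs"
    proof (rule eventually_mono)
      fix i assume *: "\<forall>p\<in>vl V (m - 1). norm (D (m - 1) (a i) p - D (m - 1) (c i) p) \<le> e / (real m + 1) * pn p"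
      show "\<forall>vs\<in>vl V m. norm (Rsum (\<lambda>r. D (m - 1) (a i) r - D (m - 1) (c i) r) vs) \<le> e * pn vs"
      proof
        fix vs assume vs: "vs \<in> vl V m"
        have "norm (Rsum (\<lambda>r. D (m - 1) (a i) r - D (m - 1) (c i) r) vs) \<le> real m * (e / (real m + 1) * pn vs)"
          by (rule Rsum_bound[OF _ vs]) (use * in blast)
        also have "\<dots> = (real m / (real m + 1)) * (e * pn vs)" by simp
        also have "\<dots> \<le> 1 * (e * pn vs)" using e by (intro mult_right_mono) auto
        finally show "norm (Rsum (\<lambda>r. D (m - 1) (a i) r - D (m - 1) (c i) r) vs) \<le> e * pn vs" by simp
      qed
    qed simp
  qed
  have "Deps D m (a i) vs - Deps D m (c i) vs = (sc (fst (a i) - fst (c i)) (D m (a i) vs)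
      + sc (fst (c i)) (D m (a i) vs - D m (c i) vs)) + Rsum (\<lambda>r. D (m - 1) (a i) r - D (m - 1) (c i) r) vs" for i vs
    by (simp add: Deps_def Rsum_diff C.scale_left_diff_distrib C.scale_right_diff_distrib)
  then show ?thesis using usmall_add[OF usmall_add[OF 1 2] 3] by simp
qed

lemma regular_eps:
  assumes f: "regular r f D"
  shows "regular r (\<lambda>p. sc (fst p) (f p)) (Deps D)"
proof (rule regularI)
  note hf = regular_hfd[OF f]
  fix x assume x: "x \<in> V"
  show "Deps D 0 x [] = sc (fst x) (f x)"
    using P.hfd_0[OF hf V order_refl x] by (simp add: Deps_def Rsum_def)
  { fix m assume m: "m \<le> r"
    have "mlin sp sc V m (\<lambda>vs. sc (fst x) (D m x vs))"
      using P.hfd_mlin[OF hf V order_refl m x]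
      by (simp add: mlin_def C.scale_right_distrib C.scale_left_commute)
    moreover have "mlin sp sc V m (Rsum (D (m - 1) x))"
      using Rsum_mlin[OF P.hfd_mlin[OF hf V order_refl _ x], of "m - 1"] m
      by (cases m) (auto simp: mlin_def)
    ultimately show "mlin sp sc V m (Deps D m x)"
      unfolding Deps_def[abs_def] by (rule P.mlin_plus)
    obtain C where C: "C \<ge> 0" "\<And>vs. vs \<in> vl V m \<Longrightarrow> norm (D m x vs) \<le> C * pn vs"
      using P.hfd_mbdd[OF hf V order_refl m x] by (auto simp: mbdd_def)
    obtain C' where C': "C' \<ge> 0" "\<And>vs. vs \<in> vl V (m - 1) \<Longrightarrow> norm (D (m - 1) x vs) \<le> C' * pn vs"
      using P.hfd_mbdd[OF hf V order_refl le_trans[OF diff_le_self m] x, of 1] by (auto simp: mbdd_def)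
    show "mbdd V m (Deps D m x)"
      unfolding mbdd_def
    proof (intro exI[of _ "norm (fst x) * C + real m * C'"] conjI ballI)
      fix vs assume vs: "vs \<in> vl V m"
      have "norm (Deps D m x vs) \<le> norm (fst x) * (C * pn vs) + real m * (C' * pn vs)"
        unfolding Deps_def
        by (intro norm_triangle_le add_mono Rsum_bound vs C')
          (auto simp: C.norm_scale intro!: mult_left_mono C(2)[OF vs])
      then show "norm (Deps D m x vs) \<le> (norm (fst x) * C + real m * C') * pn vs"
        by (simp add: algebra_simps)
    qed (use C C' in auto) }
  { fix m assume m: "m < r"
    let ?F = "nin x V" and ?\<eta> = "\<lambda>y. norm (y - x)"
    note df = P.hfd_diff[OF hf V order_refl _ x]
    have evV: "\<forall>\<^sub>F y in ?F. y \<in> V" by (auto simp: eventually_nin intro: exI[of _ 1])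
    have 1: "usmall ?F (vl V m) (\<lambda>y vs. ?\<eta> y * pn vs)
        (\<lambda>y vs. sc (fst y) (D m y vs - D m x vs - D (Suc m) x ((y - x) # vs)))"
    proof (rule usmall_le[OF df[OF m], where K = "norm (fst x) + 1"])
      have "\<forall>\<^sub>F y in ?F. norm (fst y) \<le> norm (fst x) + 1"
        using tendstoD[OF fst_tendsto_nin[of x] zero_less_one]
      proof eventually_elim
        case (elim y)
        then show ?case using norm_triangle_ineq2[of "fst y" "fst x"] by simp
      qed
      then show "\<forall>\<^sub>F y in ?F. \<forall>q\<in>vl V m. \<exists>p\<in>vl V m.
        norm (sc (fst y) (D m y q - D m x q - D (Suc m) x ((y - x) # q)))
        \<le> (norm (fst x) + 1) * norm (D m y p - D m x p - D (Suc m) x ((y - x) # p)) \<and> ?\<eta> y * pn p \<le> ?\<eta> y * pn q"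
      proof eventually_elim
        case (elim y)
        show ?case
        proof
          fix q assume "q \<in> vl V m"
          then show "\<exists>p\<in>vl V m. norm (sc (fst y) (D m y q - D m x q - D (Suc m) x ((y - x) # q)))
            \<le> (norm (fst x) + 1) * norm (D m y p - D m x p - D (Suc m) x ((y - x) # p)) \<and> ?\<eta> y * pn p \<le> ?\<eta> y * pn q"
            using elim by (intro bexI[of _ q]) (auto simp: C.norm_scale intro!: mult_right_mono)
        qed
      qed
    qed simp
    \<comment> \<open>A term of second order: \<open>y - x\<close> enters both through the scalar
      factor and through the new direction.\<close>
    have 2: "usmall ?F (vl V m) (\<lambda>y vs. ?\<eta> y * pn vs) (\<lambda>y vs. sc (fst (y - x)) (D (Suc m) x ((y - x) # vs)))"
      unfolding usmall_def
    proof (intro allI impI)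
      fix e :: real assume e: "e > 0"
      obtain C where C: "C \<ge> 0" "\<And>vs. vs \<in> vl V (Suc m) \<Longrightarrow> norm (D (Suc m) x vs) \<le> C * pn vs"
        using P.hfd_mbdd[OF hf V order_refl _ x, of "Suc m"] m by (auto simp: mbdd_def)
      have "e / (C + 1) > 0" using e C by simp
      from tendstoD[OF fst_tendsto_nin[of x] this] evV
      show "\<forall>\<^sub>F y in ?F. \<forall>vs\<in>vl V m. norm (sc (fst (y - x)) (D (Suc m) x ((y - x) # vs))) \<le> e * (?\<eta> y * pn vs)"
      proof eventually_elim
        case (elim y)
        show ?case
        proof
          fix vs assume vs: "vs \<in> vl V m"
          have "norm (sc (fst (y - x)) (D (Suc m) x ((y - x) # vs))) \<le> e / (C + 1) * (C * (?\<eta> y * pn vs))"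
            unfolding C.norm_scale
            using elim(1) C(2)[of "(y - x) # vs"] vs P.A.subspace_diff[OF V elim(2) x] C(1) e
            by (intro mult_mono) auto
          also have "\<dots> = e * (C / (C + 1)) * (?\<eta> y * pn vs)" by simp
          also have "\<dots> \<le> e * 1 * (?\<eta> y * pn vs)"
            using C(1) e by (intro mult_right_mono mult_left_mono) auto
          finally show "norm (sc (fst (y - x)) (D (Suc m) x ((y - x) # vs))) \<le> e * (?\<eta> y * pn vs)" by simp
        qed
      qed
    qed
    have 3: "usmall ?F (vl V m) (\<lambda>y vs. ?\<eta> y * pn vs)
        (\<lambda>y vs. Rsum (\<lambda>r. D (m - 1) y r - D (m - 1) x r - D m x ((y - x) # r)) vs)"
    proof (cases "m = 0")
      case True
      then show ?thesis by (simp add: usmall_def Rsum_def)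
    next
      case False
      then have m': "m - 1 < r" "Suc (m - 1) = m" using m by auto
      show ?thesis
        unfolding usmall_def
      proof (intro allI impI)
        fix e :: real assume e: "e > 0"
        then have e1: "e / (real m + 1) > 0" by simp
        from usmallD[OF df[OF m'(1)] e1]
        show "\<forall>\<^sub>F y in ?F. \<forall>vs\<in>vl V m. norm (Rsum (\<lambda>r. D (m - 1) y r - D (m - 1) x r - D m x ((y - x) # r)) vs) \<le> e * (?\<eta> y * pn vs)"
          unfolding m'(2)
        proof eventually_elim
          case (elim y)
          show ?case
          proof
            fix vs assume vs: "vs \<in> vl V m"
            have "norm (Rsum (\<lambda>r. D (m - 1) y r - D (m - 1) x r - D m x ((y - x) # r)) vs)
                \<le> real m * ((e / (real m + 1) * ?\<eta> y) * pn vs)"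
              by (rule Rsum_bound[OF _ vs]) (use elim in \<open>simp add: mult.assoc\<close>)
            also have "\<dots> = (real m / (real m + 1)) * (e * (?\<eta> y * pn vs))" by simp
            also have "\<dots> \<le> 1 * (e * (?\<eta> y * pn vs))" using e by (intro mult_right_mono) auto
            finally show "norm (Rsum (\<lambda>r. D (m - 1) y r - D (m - 1) x r - D m x ((y - x) # r)) vs) \<le> e * (?\<eta> y * pn vs)" by simp
          qed
        qed
      qed
    qed
    have "Deps D m y vs - Deps D m x vs - Deps D (Suc m) x ((y - x) # vs)
      = (sc (fst y) (D m y vs - D m x vs - D (Suc m) x ((y - x) # vs)) + sc (fst (y - x)) (D (Suc m) x ((y - x) # vs)))
        + Rsum (\<lambda>r. D (m - 1) y r - D (m - 1) x r - D m x ((y - x) # r)) vs" for y vs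
      by (simp add: Deps_def Rsum_Cons Rsum_diff Rsum_add C.scale_left_diff_distrib C.scale_right_diff_distrib algebra_simps)
    then show "usmall ?F (vl V m) (\<lambda>y vs. ?\<eta> y * pn vs)
      (\<lambda>y vs. Deps D m y vs - Deps D m x vs - Deps D (Suc m) x ((y - x) # vs))"
      using usmall_add[OF usmall_add[OF 1 2] 3] by simp }
  note c = ccontD[OF P.hfd_ccont[OF hf V order_refl x]]
  show "usmall (nin x V) (vl V r) (\<lambda>y. pn) (\<lambda>y vs. Deps D r y vs - Deps D r x vs)"
    by (rule Deps_cont[where c = "\<lambda>_. x" and M = "norm (fst x)"]) (use c fst_tendsto_nin in auto)
next
  fix R
  note c = ccontD[OF regular_ccont[OF f, of R]]
  have sm: "usmall (zf R) (vl V m) (\<lambda>i. pn) (\<lambda>i vs. Deps D m i vs - Deps D m (0, snd i) vs)" if "m \<le> r" for m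
    by (rule Deps_cont[where M = 0]) (use c that tendsto_fst_zfilter in auto)
  show "ccont (zf R) V r (Deps D) (\<lambda>p. p) (\<lambda>p. (0, snd p))"
  proof (rule ccontI[OF sm])
    fix m assume m: "m \<le> r"
    obtain C where C: "C > 0" "\<forall>\<^sub>F i in zf R. \<forall>vs\<in>vl V (m - 1). norm (D (m - 1) (0, snd i) vs) \<le> C * pn vs"
      using c(3)[OF le_trans[OF diff_le_self m]] by (rule ubddE)
    show "ubdd (zf R) (vl V m) (\<lambda>i. pn) (\<lambda>i. Deps D m (0, snd i))"
      unfolding ubdd_def
    proof (intro exI[of _ "real m * C + 1"] conjI)
      show "real m * C + 1 > 0" using C by (simp add: add_nonneg_pos)
      show "\<forall>\<^sub>F i in zf R. \<forall>vs\<in>vl V m. norm (Deps D m (0, snd i) vs) \<le> (real m * C + 1) * pn vs"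
        using C(2)
      proof eventually_elim
        case (elim i)
        show ?case
        proof
          fix vs assume vs: "vs \<in> vl V m"
          have "norm (Deps D m (0, snd i) vs) \<le> real m * (C * pn vs)"
            using Rsum_bound[of m "D (m - 1) (0, snd i)" C vs] elim vs by (simp add: Deps_def)
          then show "norm (Deps D m (0, snd i) vs) \<le> (real m * C + 1) * pn vs"
            by (simp add: distrib_right add_increasing2 mult.assoc)
        qed
      qed
    qed
  qed
qed

end

section \<open>Limits of multilinear evaluations and bounds on compact sets\<close>

lemma (in two_spaces) mlin_tendsto:
  assumes L0: "mlin sa sc V j L0" "mbdd V j L0" and V: "A.subspace V"
    and A: "\<And>x. x \<in> set xs \<Longrightarrow> ((\<lambda>i. A i x) \<longlongrightarrow> A0 x) F" "\<And>i x. x \<in> set xs \<Longrightarrow> A i x \<in> V"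
      "\<And>x. x \<in> set xs \<Longrightarrow> A0 x \<in> V"
    and as: "set as \<subseteq> V" "length as + length xs = j"
  shows "((\<lambda>i. L0 (as @ map (A i) xs)) \<longlongrightarrow> L0 (as @ map A0 xs)) F"
  using A as
proof (induction xs arbitrary: as)
  case (Cons x xs)
  obtain C where C: "C \<ge> 0" "\<And>vs. vs \<in> vl V j \<Longrightarrow> norm (L0 vs) \<le> C * pn vs"
    using L0(2) by (auto simp: mbdd_def)
  have IH: "((\<lambda>i. L0 ((as @ [A0 x]) @ map (A i) xs)) \<longlongrightarrow> L0 ((as @ [A0 x]) @ map A0 xs)) F"
    by (rule Cons.IH) (use Cons.prems in auto)
  have pnt: "((\<lambda>i. pn (map (A i) xs)) \<longlongrightarrow> pn (map A0 xs)) F"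
    using Cons.prems(1) by (induction xs) (auto intro!: tendsto_mult tendsto_norm)
  have "((\<lambda>i. L0 (as @ (A i x - A0 x) # map (A i) xs)) \<longlongrightarrow> 0) F"
  proof (rule Lim_null_comparison)
    have "((\<lambda>i. C * (pn as * (norm (A i x - A0 x) * pn (map (A i) xs)))) \<longlongrightarrow> C * (pn as * (norm (A0 x - A0 x) * pn (map A0 xs)))) F"
      by (intro tendsto_mult tendsto_const tendsto_norm tendsto_diff pnt Cons.prems(1)) auto
    then show "((\<lambda>i. C * (pn as * (norm (A i x - A0 x) * pn (map (A i) xs)))) \<longlongrightarrow> 0) F" by simp
    show "\<forall>\<^sub>F i in F. norm (L0 (as @ (A i x - A0 x) # map (A i) xs)) \<le> C * (pn as * (norm (A i x - A0 x) * pn (map (A i) xs)))"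
    proof (intro always_eventually allI)
      fix i
      show "norm (L0 (as @ (A i x - A0 x) # map (A i) xs)) \<le> C * (pn as * (norm (A i x - A0 x) * pn (map (A i) xs)))"
        using C(2)[of "as @ (A i x - A0 x) # map (A i) xs"] Cons.prems
        by (auto simp: vl_def A.subspace_diff[OF V])
    qed
  qed
  from tendsto_add[OF this IH]
  have "((\<lambda>i. L0 (as @ (A i x - A0 x) # map (A i) xs) + L0 (as @ A0 x # map (A i) xs)) \<longlongrightarrow> L0 (as @ A0 x # map A0 xs)) F"
    by simp
  moreover have "L0 (as @ (A i x - A0 x) # map (A i) xs) = L0 (as @ A i x # map (A i) xs) - L0 (as @ A0 x # map (A i) xs)" for i
    by (rule mlin_diff[OF L0(1) V]) (use Cons.prems in auto)
  ultimately show ?case by simp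
qed simp

lemma (in two_spaces) family_tendsto:
  assumes L: "usmall F (vl V j) (\<lambda>i. pn) (\<lambda>i vs. L i vs - L0 vs)"
    and L0: "mlin sa sc V j L0" "mbdd V j L0" and V: "A.subspace V"
    and A: "\<And>x. x \<in> set xs \<Longrightarrow> ((\<lambda>i. A i x) \<longlongrightarrow> A0 x) F" "\<And>i x. x \<in> set xs \<Longrightarrow> A i x \<in> V"
      "\<And>x. x \<in> set xs \<Longrightarrow> A0 x \<in> V"
    and len: "length xs = j"
  shows "((\<lambda>i. L i (map (A i) xs)) \<longlongrightarrow> L0 (map A0 xs)) F"
proof -
  have pnt: "((\<lambda>i. pn (map (A i) xs)) \<longlongrightarrow> pn (map A0 xs)) F"
    using A(1) by (induction xs) (auto intro!: tendsto_mult tendsto_norm)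
  have mem: "map (A i) xs \<in> vl V j" for i using A(2) len by (auto simp: vl_def)
  have "((\<lambda>i. L i (map (A i) xs) - L0 (map (A i) xs)) \<longlongrightarrow> 0) F"
  proof (rule tendstoI)
    fix e :: real assume e: "e > 0"
    define M where "M = pn (map A0 xs) + 1"
    have M: "M > 0" by (simp add: M_def add_nonneg_pos)
    have e1: "e / (2 * M) > 0" using e M by simp
    have "\<forall>\<^sub>F i in F. pn (map (A i) xs) < M"
      by (rule order_tendstoD(2)[OF pnt]) (simp add: M_def)
    with usmallD[OF L e1] show "\<forall>\<^sub>F i in F. dist (L i (map (A i) xs) - L0 (map (A i) xs)) 0 < e"
    proof eventually_elim
      case (elim i)
      have "norm (L i (map (A i) xs) - L0 (map (A i) xs)) \<le> e / (2 * M) * pn (map (A i) xs)"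
        using elim mem by blast
      also have "\<dots> \<le> e / (2 * M) * M" using elim e1 by (intro mult_left_mono) auto
      also have "\<dots> < e" using e M by simp
      finally show ?case by simp
    qed
  qed
  moreover have "((\<lambda>i. L0 (map (A i) xs)) \<longlongrightarrow> L0 (map A0 xs)) F"
  proof -
    have "((\<lambda>i. L0 ([] @ map (A i) xs)) \<longlongrightarrow> L0 ([] @ map A0 xs)) F"
      by (rule mlin_tendsto[OF L0 V]) (use A len in auto)
    then show ?thesis by simp
  qed
  ultimately have "((\<lambda>i. L i (map (A i) xs) - L0 (map (A i) xs) + L0 (map (A i) xs)) \<longlongrightarrow> 0 + L0 (map A0 xs)) F"
    by (rule tendsto_add)
  then show ?thesis by simp
qed

lemma (in two_spaces) hfd_compact_bdd:
  assumes D: "has_frechet_derivs sa sc V V r f D" and V: "A.subspace V" and m: "m \<le> r"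
    and K: "compact K" "K \<subseteq> V"
  obtains C where "C \<ge> 0" "\<And>x vs. x \<in> K \<Longrightarrow> vs \<in> vl V m \<Longrightarrow> norm (D m x vs) \<le> C * pn vs"
proof -
  obtain d where d: "d > 0" "\<And>x y vs. x \<in> K \<Longrightarrow> y \<in> V \<Longrightarrow> dist y x < d \<Longrightarrow> vs \<in> vl V m \<Longrightarrow>
      norm (D m y vs - D m x vs) \<le> 1 * pn vs"
    using hfd_compact[OF D V m K zero_less_one] by blast
  obtain X where X: "finite X" "X \<subseteq> K" "K \<subseteq> (\<Union>x\<in>X. ball x d)"
  proof (rule compactE_image[OF K(1), of K "\<lambda>x. ball x d"])
    show "K \<subseteq> (\<Union>x\<in>K. ball x d)" using d(1) by auto
  qed auto
  have "\<forall>x\<in>X. \<exists>C\<ge>0. \<forall>vs\<in>vl V m. norm (D m x vs) \<le> C * pn vs"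
    using hfd_mbdd[OF D V order_refl m] X K by (auto simp: mbdd_def)
  from bchoice[OF this] obtain C where C: "\<forall>x\<in>X. C x \<ge> 0 \<and> (\<forall>vs\<in>vl V m. norm (D m x vs) \<le> C x * pn vs)"
    by blast
  show thesis
  proof (rule that[of "sum C X + 1"])
    show "sum C X + 1 \<ge> 0" using C by (simp add: sum_nonneg add_nonneg_pos less_imp_le)
    fix x vs assume x: "x \<in> K" and vs: "vs \<in> vl V m"
    obtain y where y: "y \<in> X" "dist x y < d" using X x by (auto simp: dist_commute)
    have yx: "y \<in> K" "x \<in> V" using y(1) X(2) x K(2) by auto
    have "norm (D m x vs) \<le> norm (D m x vs - D m y vs) + norm (D m y vs)"
      by (metis diff_add_cancel norm_triangle_ineq)
    also have "\<dots> \<le> 1 * pn vs + C y * pn vs"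
      using d(2)[OF yx y(2) vs] C y(1) vs by (intro add_mono) auto
    also have "\<dots> \<le> 1 * pn vs + sum C X * pn vs"
      using C y X(1) by (intro add_mono mult_right_mono member_le_sum) auto
    finally show "norm (D m x vs) \<le> (sum C X + 1) * pn vs" by (simp add: distrib_right)
  qed
qed

section \<open>Hadamard division by the scalar variable\<close>

locale pair_setting_banach = pair_setting se sc E
  for se :: "'k::real_normed_field \<Rightarrow> 'e::real_normed_vector \<Rightarrow> 'e"
    and sc :: "'k \<Rightarrow> 'c::banach \<Rightarrow> 'c" and E :: "'e set"
begin

definition S :: "real \<Rightarrow> 'k \<times> 'e \<Rightarrow> 'k \<times> 'e"
  where "S t p = (t *\<^sub>R fst p, snd p)"

lemma S_lin: "S t (sp c u + v) = sp c (S t u) + S t v"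
  by (simp add: S_def scale_pair_def scaleR_right_distrib)

lemma S_diff: "S t u - S t v = S t (u - v)"
  by (simp add: S_def scaleR_right_diff_distrib)

lemma S_V [simp]: "S t p \<in> V \<longleftrightarrow> p \<in> V"
  by (cases p) (simp add: S_def)

lemma norm_S: "t \<in> {0..1} \<Longrightarrow> norm (S t p) \<le> norm p"
  unfolding S_def norm_prod_def
  by (simp add: power_mult_distrib power_le_one mult_left_le_one_le)

lemma pn_S: "t \<in> {0..1} \<Longrightarrow> pn (map (S t) vs) \<le> pn vs"
  by (induction vs) (auto intro!: mult_mono norm_S)

definition ee :: "'k \<times> 'e" where "ee = (1, 0)"

lemma ee [simp]: "ee \<in> V" "norm ee = 1"
  using E.subspace_0[OF E] by (auto simp: ee_def norm_Pair)

lemma pn_S_ee: "t \<in> {0..1} \<Longrightarrow> pn (map (S t) vs @ [ee]) \<le> pn vs"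
  using pn_S by simp

lemma S_image: "set vs \<subseteq> V \<Longrightarrow> set (map (S t) vs) \<subseteq> V"
proof -
  assume vs: "set vs \<subseteq> V"
  have "S t ` set vs \<subseteq> V"
  proof (rule image_subsetI)
    fix x assume "x \<in> set vs"
    then have "x \<in> V" using vs by blast
    then show "S t x \<in> V" by (simp only: S_V)
  qed
  then show "set (map (S t) vs) \<subseteq> V" by simp
qed

lemma vl_S_ee: "vs \<in> vl V m \<Longrightarrow> map (S t) vs @ [ee] \<in> vl V (Suc m)"
  using S_image[of vs t] ee(1) by (simp add: vl_def)

text \<open>Differentiation under the integral sign: \<open>S t\<close> is linear, so by the chain
  rule each direction \<open>v\<close> turns into \<open>S t v\<close>. New directions are
  prepended, so \<open>ee\<close>, the direction of the first differentiation, stands last.\<close>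

definition Dh :: "(nat \<Rightarrow> 'k \<times> 'e \<Rightarrow> ('k \<times> 'e) list \<Rightarrow> 'c) \<Rightarrow> nat \<Rightarrow> 'k \<times> 'e \<Rightarrow> ('k \<times> 'e) list \<Rightarrow> 'c"
  where "Dh D m p vs = integral {0..1} (\<lambda>t. D (Suc m) (S t p) (map (S t) vs @ [ee]))"

lemma tendsto_S: "((\<lambda>t. S t p) \<longlongrightarrow> S t0 p) (at t0 within X)"
  unfolding S_def by (intro tendsto_intros)

lemma continuous_integrand:
  assumes D: "has_frechet_derivs sp sc V V r g D" and m: "Suc m \<le> r" and p: "p \<in> V" and vs: "vs \<in> vl V m"
  shows "continuous_on X (\<lambda>t. D (Suc m) (S t p) (map (S t) vs @ [ee]))"
  unfolding continuous_on_def
proof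
  fix t0
  \<comment> \<open>\<open>None\<close> encodes the fixed vector \<open>ee\<close>; the argument
    list becomes a single \<open>map\<close> with parameter \<open>t\<close>, as
    \<open>family_tendsto\<close> expects.\<close>
  let ?A = "\<lambda>t. case_option ee (S t)"
  have "((\<lambda>t. D (Suc m) (S t p) (map (?A t) (map Some vs @ [None]))) \<longlongrightarrow>
      D (Suc m) (S t0 p) (map (?A t0) (map Some vs @ [None]))) (at t0 within X)"
  proof (rule P.family_tendsto)
    have "filterlim (\<lambda>t. S t p) (nin (S t0 p) V) (at t0 within X)"
      unfolding nin_def filterlim_inf filterlim_principal using tendsto_S p by auto
    then show "usmall (at t0 within X) (vl V (Suc m)) (\<lambda>i. pn) (\<lambda>t vs. D (Suc m) (S t p) vs - D (Suc m) (S t0 p) vs)"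
      by (rule usmall_filtermap[OF P.hfd_cont[OF D V order_refl m S_V[THEN iffD2, OF p]]])
    show "mlin sp sc V (Suc m) (D (Suc m) (S t0 p))"
      using P.hfd_mlin[OF D V order_refl m] p by simp
    show "mbdd V (Suc m) (D (Suc m) (S t0 p))"
      using P.hfd_mbdd[OF D V order_refl m] p by simp
    fix x assume x: "x \<in> set (map Some vs @ [None])"
    show "((\<lambda>t. ?A t x) \<longlongrightarrow> ?A t0 x) (at t0 within X)"
      by (cases x) (auto intro: tendsto_S)
    show "?A t x \<in> V" for t using x vs by (auto simp: vl_def)
    show "?A t0 x \<in> V" using x vs by (auto simp: vl_def)
  qed (use vs V in \<open>auto simp: vl_def\<close>)
  then show "((\<lambda>t. D (Suc m) (S t p) (map (S t) vs @ [ee])) \<longlongrightarrow> D (Suc m) (S t0 p) (map (S t0) vs @ [ee])) (at t0 within X)"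
    by (simp add: comp_def)
qed

lemma compact_S: "compact ((\<lambda>t. S t p) ` {0..1})"
  by (intro compact_continuous_image) (auto simp: continuous_on_def intro: tendsto_S)

text \<open>Hadamard's division: \<open>g (\<epsilon>, b) = \<epsilon> \<cdot> (\<integral>\<^sub>0\<^sup>1 \<partial>\<^sub>\<epsilon> g (t \<epsilon>, b) dt)\<close>, with \<open>S t (\<epsilon>, b) = (t \<epsilon>, b)\<close> and \<open>ee = (1, 0)\<close>.\<close>

theorem regular_divide:
  assumes g: "regular (Suc r) g D" and g0: "\<And>b. b \<in> E \<Longrightarrow> g (0, b) = 0"
  shows "regular r (\<lambda>p. Dh D 0 p []) (Dh D)" and "p \<in> V \<Longrightarrow> g p = sc (fst p) (Dh D 0 p [])"
proof -
  note D = regular_hfd[OF g]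
  have cont: "continuous_on {0..1} (\<lambda>t. D (Suc m) (S t p) (map (S t) vs @ [ee]))"
    if "m \<le> r" "p \<in> V" "vs \<in> vl V m" for m p vs
    using continuous_integrand[OF D _ that(2,3)] that(1) by simp
  have ib: "(\<lambda>t. D (Suc m) (S t p) (map (S t) vs @ [ee])) integrable_on {0..1}"
    if "m \<le> r" "p \<in> V" "vs \<in> vl V m" for m p vs
    using cont[OF that] by (rule integrable_continuous_real)
  have int_le: "norm (integral {0..1} f) \<le> B" if "continuous_on {0..1} f" "\<And>t. t \<in> {0..1} \<Longrightarrow> norm (f t) \<le> B"
    for f :: "real \<Rightarrow> 'c" and B
    using integral_bound[of 0 1 f B] that by simp
  have pathV: "(\<lambda>t. S t p) ` {0..1} \<subseteq> V" if "p \<in> V" for p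
    using that by (intro image_subsetI) (simp only: S_V)
  \<comment> \<open>One estimate for continuity at a point and for the limit at
    \<open>\<epsilon> = 0\<close>: since \<open>S t\<close> does not increase norms, a bound along
    the two paths passes through the integral.\<close>
  have close: "norm (Dh D m y vs - Dh D m x vs) \<le> e * pn vs"
    if m: "m \<le> r" and x: "x \<in> V" and y: "y \<in> V" and vs: "vs \<in> vl V m" and e: "e \<ge> 0"
      and *: "\<And>t us. t \<in> {0..1} \<Longrightarrow> us \<in> vl V (Suc m) \<Longrightarrow> norm (D (Suc m) (S t y) us - D (Suc m) (S t x) us) \<le> e * pn us"
    for m x y vs e
  proof -
    have "Dh D m y vs - Dh D m x vs = integral {0..1} (\<lambda>t. D (Suc m) (S t y) (map (S t) vs @ [ee])
        - D (Suc m) (S t x) (map (S t) vs @ [ee]))"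
      unfolding Dh_def using ib[OF m x vs] ib[OF m y vs] by (simp add: integral_diff)
    also have "norm \<dots> \<le> e * pn vs"
    proof (rule int_le)
      fix t :: real assume t: "t \<in> {0..1}"
      have "norm (D (Suc m) (S t y) (map (S t) vs @ [ee]) - D (Suc m) (S t x) (map (S t) vs @ [ee]))
          \<le> e * pn (map (S t) vs @ [ee])" by (rule *[OF t vl_S_ee[OF vs]])
      also have "\<dots> \<le> e * pn vs" using pn_S_ee[OF t] e by (rule mult_left_mono)
      finally show "norm (D (Suc m) (S t y) (map (S t) vs @ [ee]) - D (Suc m) (S t x) (map (S t) vs @ [ee])) \<le> e * pn vs" .
    qed (intro continuous_intros cont m x y vs)
    finally show ?thesis .
  qed
  have bound: "norm (Dh D m x vs) \<le> C * pn vs"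
    if m: "m \<le> r" and x: "x \<in> V" and vs: "vs \<in> vl V m" and C: "C \<ge> 0"
      and *: "\<And>t us. t \<in> {0..1} \<Longrightarrow> us \<in> vl V (Suc m) \<Longrightarrow> norm (D (Suc m) (S t x) us) \<le> C * pn us"
    for m x vs C
    unfolding Dh_def
  proof (rule int_le[OF cont[OF m x vs]])
    fix t :: real assume t: "t \<in> {0..1}"
    have "norm (D (Suc m) (S t x) (map (S t) vs @ [ee])) \<le> C * pn (map (S t) vs @ [ee])"
      by (rule *[OF t vl_S_ee[OF vs]])
    also have "\<dots> \<le> C * pn vs" using pn_S_ee[OF t] C by (rule mult_left_mono)
    finally show "norm (D (Suc m) (S t x) (map (S t) vs @ [ee])) \<le> C * pn vs" .
  qed
  show "regular r (\<lambda>p. Dh D 0 p []) (Dh D)"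
  proof (rule regularI)
    fix x assume x: "x \<in> V"
    note K = compact_S[of x] pathV[OF x]
    { fix m assume m: "m \<le> r"
      show "mlin sp sc V m (Dh D m x)"
      proof (rule mlinI)
        fix as bs u v c
        assume *: "set as \<subseteq> V" "set bs \<subseteq> V" "u \<in> V" "v \<in> V" "length as + length bs + 1 = m"
        have vl: "as @ w # bs \<in> vl V m" if "w \<in> V" for w using * that by (auto simp: vl_def)
        have "D (Suc m) (S t x) (map (S t) (as @ (sp c u + v) # bs) @ [ee])
            = sc c (D (Suc m) (S t x) (map (S t) (as @ u # bs) @ [ee])) + D (Suc m) (S t x) (map (S t) (as @ v # bs) @ [ee])" for t
        proof -
          have "mlin sp sc V (Suc m) (D (Suc m) (S t x))"
            using m x by (intro P.hfd_mlin[OF D V order_refl]) (simp_all only: S_V Suc_le_mono)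
          then have "D (Suc m) (S t x) (map (S t) as @ (sp c (S t u) + S t v) # (map (S t) bs @ [ee]))
            = sc c (D (Suc m) (S t x) (map (S t) as @ S t u # (map (S t) bs @ [ee])))
              + D (Suc m) (S t x) (map (S t) as @ S t v # (map (S t) bs @ [ee]))"
          proof (rule mlinD)
            show "set (map (S t) bs @ [ee]) \<subseteq> V" using S_image[OF *(2), of t] ee(1) by simp
            show "set (map (S t) as) \<subseteq> V" by (rule S_image[OF *(1)])
            show "S t u \<in> V" "S t v \<in> V" using *(3,4) by (simp_all only: S_V)
            show "length (map (S t) as) + length (map (S t) bs @ [ee]) + 1 = Suc m" using *(5) by simp
          qed
          then show ?thesis by (simp add: S_lin)
        qed
        then have "Dh D m x (as @ (sp c u + v) # bs)
            = integral {0..1} (\<lambda>t. sc c (D (Suc m) (S t x) (map (S t) (as @ u # bs) @ [ee])) + D (Suc m) (S t x) (map (S t) (as @ v # bs) @ [ee]))"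
          by (simp only: Dh_def)
        also have "\<dots> = integral {0..1} (\<lambda>t. sc c (D (Suc m) (S t x) (map (S t) (as @ u # bs) @ [ee]))) + Dh D m x (as @ v # bs)"
          unfolding Dh_def
          by (intro integral_add ib m x vl *(4) integrable_linear[OF ib[OF m x vl[OF *(3)]] C.bounded_linear_scale[of c], unfolded comp_def])
        also have "integral {0..1} (\<lambda>t. sc c (D (Suc m) (S t x) (map (S t) (as @ u # bs) @ [ee]))) = sc c (Dh D m x (as @ u # bs))"
          unfolding Dh_def
          using integral_linear[OF ib[OF m x vl[OF *(3)]] C.bounded_linear_scale[of c]] by (simp add: comp_def)
        finally show "Dh D m x (as @ (sp c u + v) # bs) = sc c (Dh D m x (as @ u # bs)) + Dh D m x (as @ v # bs)" .
      qed
      obtain C where "C \<ge> 0" "\<And>y vs. y \<in> (\<lambda>t. S t x) ` {0..1} \<Longrightarrow> vs \<in> vl V (Suc m) \<Longrightarrow> norm (D (Suc m) y vs) \<le> C * pn vs"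
        using P.hfd_compact_bdd[OF D V _ K, of "Suc m"] m by auto
      then show "mbdd V m (Dh D m x)"
        unfolding mbdd_def using bound[OF m x] by (intro exI[of _ C]) auto }
    { fix m assume m: "m < r"
      show "usmall (nin x V) (vl V m) (\<lambda>y vs. norm (y - x) * pn vs)
        (\<lambda>y vs. Dh D m y vs - Dh D m x vs - Dh D (Suc m) x ((y - x) # vs))"
        unfolding usmall_def
      proof (intro allI impI)
        fix e :: real assume e: "e > 0"
        \<comment> \<open>Compactness of the path traced by \<open>S t x\<close> gives one
          \<open>d\<close> for all \<open>t\<close>, as the estimate under the integral
          requires.\<close>
        obtain d where d: "d > 0" "\<And>z y vs. z \<in> (\<lambda>t. S t x) ` {0..1} \<Longrightarrow> y \<in> V \<Longrightarrow> dist y z < d \<Longrightarrow>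
            vs \<in> vl V (Suc (Suc m)) \<Longrightarrow> norm (D (Suc (Suc m)) y vs - D (Suc (Suc m)) z vs) \<le> e * pn vs"
          using P.hfd_compact[OF D V _ K e, of "Suc (Suc m)"] m by auto
        show "\<forall>\<^sub>F y in nin x V. \<forall>vs\<in>vl V m. norm (Dh D m y vs - Dh D m x vs - Dh D (Suc m) x ((y - x) # vs)) \<le> e * (norm (y - x) * pn vs)"
          unfolding eventually_nin
        proof (intro exI[of _ d] conjI ballI impI d(1))
          fix y vs assume y: "y \<in> V" "dist y x < d" and vs: "vs \<in> vl V m"
          have yx: "y - x \<in> V" using P.A.subspace_diff[OF V y(1) x] .
          have m1: "m \<le> r" "Suc m \<le> r" using m by auto
          have yxvs: "(y - x) # vs \<in> vl V (Suc m)" using yx vs by simp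
          have "Dh D m y vs - Dh D m x vs - Dh D (Suc m) x ((y - x) # vs)
              = integral {0..1} (\<lambda>t. D (Suc m) (S t y) (map (S t) vs @ [ee]) - D (Suc m) (S t x) (map (S t) vs @ [ee])
                - D (Suc (Suc m)) (S t x) (map (S t) ((y - x) # vs) @ [ee]))"
            unfolding Dh_def
            using ib[OF m1(1) x vs] ib[OF m1(1) y(1) vs] ib[OF m1(2) x yxvs]
            by (simp add: integral_diff integrable_diff)
          also have "norm \<dots> \<le> e * (norm (y - x) * pn vs)"
          proof (rule int_le)
            fix t :: real assume t: "t \<in> {0..1}"
            have "norm (D (Suc m) (S t y) (map (S t) vs @ [ee]) - D (Suc m) (S t x) (map (S t) vs @ [ee])
                - D (Suc (Suc m)) (S t x) ((S t y - S t x) # map (S t) vs @ [ee]))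
                \<le> e * (norm (S t y - S t x) * pn (map (S t) vs @ [ee]))"
            proof (rule P.hfd_mvt[OF D V])
              fix s :: real and us assume s: "s \<in> {0..1}" and us: "us \<in> vl V (Suc (Suc m))"
              show "norm (D (Suc (Suc m)) (S t x + s *\<^sub>R (S t y - S t x)) us - D (Suc (Suc m)) (S t x) us) \<le> e * pn us"
              proof (rule d(2)[OF _ _ _ us])
                show "S t x + s *\<^sub>R (S t y - S t x) \<in> V"
                  unfolding S_diff using x yx by (intro P.A.subspace_add[OF V] P.A.subspace_scaleR[OF V]) auto
                have "norm (s *\<^sub>R S t (y - x)) \<le> 1 * norm (y - x)"
                  unfolding norm_scaleR using s norm_S[OF t, of "y - x"] by (intro mult_mono) auto
                then show "dist (S t x + s *\<^sub>R (S t y - S t x)) (S t x) < d"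
                  using y(2) by (simp add: S_diff dist_norm)
              qed (use t in auto)
            qed (use m x y vl_S_ee[OF vs] in auto)
            also have "\<dots> \<le> e * (norm (y - x) * pn vs)"
              unfolding S_diff using e pn_S_ee[OF t] norm_S[OF t] by (intro mult_left_mono mult_mono) auto
            finally show "norm (D (Suc m) (S t y) (map (S t) vs @ [ee]) - D (Suc m) (S t x) (map (S t) vs @ [ee])
                - D (Suc (Suc m)) (S t x) (map (S t) ((y - x) # vs) @ [ee])) \<le> e * (norm (y - x) * pn vs)"
              by (simp add: S_diff)
          qed (intro continuous_intros cont m1 x y vs yxvs)
          finally show "norm (Dh D m y vs - Dh D m x vs - Dh D (Suc m) x ((y - x) # vs)) \<le> e * (norm (y - x) * pn vs)" .
        qed
      qed }
    show "usmall (nin x V) (vl V r) (\<lambda>y. pn) (\<lambda>y vs. Dh D r y vs - Dh D r x vs)"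
      unfolding usmall_def
    proof (intro allI impI)
      fix e :: real assume e: "e > 0"
      obtain d where d: "d > 0" "\<And>z y vs. z \<in> (\<lambda>t. S t x) ` {0..1} \<Longrightarrow> y \<in> V \<Longrightarrow> dist y z < d \<Longrightarrow>
          vs \<in> vl V (Suc r) \<Longrightarrow> norm (D (Suc r) y vs - D (Suc r) z vs) \<le> e * pn vs"
        using P.hfd_compact[OF D V _ K e, of "Suc r"] by auto
      show "\<forall>\<^sub>F y in nin x V. \<forall>vs\<in>vl V r. norm (Dh D r y vs - Dh D r x vs) \<le> e * pn vs"
        unfolding eventually_nin
      proof (intro exI[of _ d] conjI ballI impI d(1))
        fix y vs assume y: "y \<in> V" "dist y x < d" and vs: "vs \<in> vl V r"
        show "norm (Dh D r y vs - Dh D r x vs) \<le> e * pn vs"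
        proof (rule close[OF order_refl x y(1) vs])
          fix t us assume t: "t \<in> {0..1::real}" and us: "us \<in> vl V (Suc r)"
          have "dist (S t y) (S t x) < d"
            using norm_S[OF t, of "y - x"] y(2) by (simp add: dist_norm S_diff)
          then show "norm (D (Suc r) (S t y) us - D (Suc r) (S t x) us) \<le> e * pn us"
            using t y us by (intro d(2)) auto
        qed (use e in simp)
      qed
    qed
  next
    fix R
    note c = ccontD[OF regular_ccont[OF g, of R]]
    show "ccont (zf R) V r (Dh D) (\<lambda>p. p) (\<lambda>p. (0, snd p))"
    proof (rule ccontI)
      fix m assume m: "m \<le> r"
      then have m1: "Suc m \<le> Suc r" by simp
      show "usmall (zf R) (vl V m) (\<lambda>i. pn) (\<lambda>i vs. Dh D m i vs - Dh D m (0, snd i) vs)"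
        unfolding usmall_def
      proof (intro allI impI)
        fix e :: real assume e: "e > 0"
        obtain d where d: "d > 0" "\<And>\<epsilon> b us. norm \<epsilon> < d \<Longrightarrow> b \<in> E \<Longrightarrow> norm b \<le> R \<Longrightarrow> us \<in> vl V (Suc m) \<Longrightarrow>
            norm (D (Suc m) (\<epsilon>, b) us - D (Suc m) (0, b) us) \<le> e * pn us"
          using usmallD[OF c(1)[OF m1] e] unfolding eventually_zfilter by auto
        show "\<forall>\<^sub>F i in zf R. \<forall>vs\<in>vl V m. norm (Dh D m i vs - Dh D m (0, snd i) vs) \<le> e * pn vs"
          unfolding eventually_zfilter
        proof (intro exI[of _ d] conjI allI impI ballI d(1))
          fix \<epsilon> :: 'k and b vs assume *: "norm \<epsilon> < d" "b \<in> E" "norm b \<le> R" "vs \<in> vl V m"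
          show "norm (Dh D m (\<epsilon>, b) vs - Dh D m (0, snd (\<epsilon>, b)) vs) \<le> e * pn vs"
          proof (rule close[OF m _ _ *(4)])
            fix t us assume t: "t \<in> {0..1::real}" and us: "us \<in> vl V (Suc m)"
            have "norm (t *\<^sub>R \<epsilon>) \<le> 1 * norm \<epsilon>" unfolding norm_scaleR using t by (intro mult_right_mono) auto
            then have "norm (t *\<^sub>R \<epsilon>) < d" using * by simp
            from d(2)[OF this *(2,3) us]
            show "norm (D (Suc m) (S t (\<epsilon>, b)) us - D (Suc m) (S t (0, snd (\<epsilon>, b))) us) \<le> e * pn us"
              by (simp add: S_def)
          qed (use * e in auto)
        qed
      qed
      obtain C where C: "C > 0" "\<forall>\<^sub>F i in zf R. \<forall>vs\<in>vl V (Suc m). norm (D (Suc m) (0, snd i) vs) \<le> C * pn vs"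
        using c(3)[OF m1] by (rule ubddE)
      show "ubdd (zf R) (vl V m) (\<lambda>i. pn) (\<lambda>i. Dh D m (0, snd i))"
        unfolding ubdd_def
      proof (intro exI[of _ C] conjI C(1))
        show "\<forall>\<^sub>F i in zf R. \<forall>vs\<in>vl V m. norm (Dh D m (0, snd i) vs) \<le> C * pn vs"
          using C(2) ev_zV0
        proof eventually_elim
          case (elim i)
          show ?case
          proof
            fix vs assume vs: "vs \<in> vl V m"
            show "norm (Dh D m (0, snd i) vs) \<le> C * pn vs"
              by (rule bound[OF m elim(2) vs]) (use elim(1) C(1) in \<open>auto simp: S_def\<close>)
          qed
        qed
      qed
    qed
  qed simp
  show "g p = sc (fst p) (Dh D 0 p [])" if p: "p \<in> V"
  proof -
    \<comment> \<open>The path \<open>S t p\<close> is the real line through \<open>x\<close> in the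
      direction \<open>h\<close>, so the fundamental theorem applies; \<open>h\<close> is
      \<open>fst p\<close> times \<open>ee\<close>, and linearity over \<open>'k\<close> pulls
      \<open>fst p\<close> out of the integral.\<close>
    define x where "x = (0 :: 'k, snd p)"
    define h where "h = (fst p, 0 :: 'e)"
    have xV: "x \<in> V" "h \<in> V" using p E.subspace_0[OF E] by (auto simp: x_def h_def)
    have Sx: "x + t *\<^sub>R h = S t p" for t by (simp add: x_def h_def S_def)
    have hee: "D (Suc 0) (S t p) [h] = sc (fst p) (D (Suc 0) (S t p) [ee])" for t
    proof -
      have "h = sp (fst p) ee" by (simp add: h_def ee_def scale_pair_def)
      then show ?thesis
        using P.mlin_scale[OF P.hfd_mlin[OF D V order_refl, of "Suc 0" "S t p"] V, of "[]" "[]" ee "fst p"] p by simp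
    qed
    have "((\<lambda>t. D (Suc 0) (S t p) [h]) has_integral D 0 (S 1 p) [] - D 0 (S 0 p) []) {0..1}"
    proof (rule fundamental_theorem_of_calculus)
      fix t :: real
      show "((\<lambda>t. D 0 (S t p) []) has_vector_derivative D (Suc 0) (S t p) [h]) (at t within {0..1})"
        using P.hfd_line[OF D V _ xV, of 0 "[]" t] unfolding Sx by simp
    qed simp
    moreover have "D 0 (S 1 p) [] = g p" using P.hfd_0[OF D V order_refl p] by (simp add: S_def)
    moreover have "D 0 (S 0 p) [] = 0"
      using P.hfd_0[OF D V order_refl, of "S 0 p"] g0[of "snd p"] p by (auto simp: S_def)
    ultimately have "integral {0..1} (\<lambda>t. sc (fst p) (D (Suc 0) (S t p) [ee])) = g p"
      unfolding hee by (simp add: integral_unique)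
    then show ?thesis
      using integral_linear[OF ib[of 0 p "[]"] C.bounded_linear_scale[of "fst p"]] p
      by (simp add: comp_def Dh_def)
  qed
qed

end

text \<open>The derivatives of \<open>g\<close> are not assumed to be uniformly continuous on
  bounded sets; \<open>gc\<close> asks for closeness only along the values of \<open>f\<close> as
  \<open>\<epsilon>\<close> tends to \<open>0\<close>.\<close>

lemma regular_compose:
  assumes "pair_setting se s2 E" "pair_setting se sc E"
    and f: "pair_setting.regular se s2 E r f Df"
    and g: "has_frechet_derivs s2 sc UNIV UNIV r g Dg"
    and gc: "\<And>R. ccont (zfilter E R) UNIV r Dg f (\<lambda>p. f (0, snd p))"
  shows "pair_setting.regular se sc E r (\<lambda>p. g (f p)) (FD Dg Df f)"
proof -
  interpret A: pair_setting se s2 E by fact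
  interpret B: pair_setting se sc E by fact
  interpret T: three_spaces "scale_pair se" s2 sc ..
  have hg: "mlin s2 sc UNIV l (Dg l x)" if "l \<le> r" for l x
    using T.B.hfd_mlin[OF g A.C.subspace_UNIV order_refl that] by simp
  have "has_frechet_derivs (scale_pair se) sc A.V A.V r (\<lambda>x. g (f x)) (FD Dg Df f)"
    by (rule T.hfd_compose[OF A.regular_hfd[OF f] g A.V A.C.subspace_UNIV]) auto
  moreover have "ccont (zfilter E R) A.V r (FD Dg Df f) (\<lambda>p. p) (\<lambda>p. (0, snd p))" for R
  proof (rule ccontI)
    fix m assume m: "m \<le> r"
    note cf = ccontD[OF A.regular_ccont[OF f, of R]] and cg = ccontD[OF gc, of _ R]
    show "usmall (zfilter E R) (vl A.V m) (\<lambda>i. pn) (\<lambda>i vs. FD Dg Df f m i vs - FD Dg Df f m (0, snd i) vs)"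
      by (rule FD_ccont[where ?V2.0 = UNIV])
        (use m cf cg T.B.mlin_mdiff[OF hg A.C.subspace_UNIV] in auto)
    show "ubdd (A.zf R) (vl A.V m) (\<lambda>i. pn) (\<lambda>i. FD Dg Df f m (0, snd i))"
      by (rule FD_ubdd[where ?V2.0 = UNIV and a = "\<lambda>i. (0, snd i)"]) (use m cf cg in auto)
  qed
  ultimately show ?thesis by (simp add: B.regular_def)
qed

text \<open>Supplies \<open>gc\<close> of \<open>regular_compose\<close> for the cone: all its
  points tend to one point \<open>x\<close>, so continuity of the derivatives at that single point
  gives uniformity.\<close>

lemma (in two_spaces) ccont_at_limit:
  assumes g: "has_frechet_derivs sa sc UNIV UNIV r g Dg" and a: "filterlim a (nhds x) F"
  shows "ccont F UNIV r Dg a (\<lambda>_. x)"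
proof (rule ccontI)
  have n: "nin x UNIV = nhds x" by (simp add: nin_def)
  fix m assume m: "m \<le> r"
  show "usmall F (vl UNIV m) (\<lambda>i. pn) (\<lambda>i vs. Dg m (a i) vs - Dg m x vs)"
    by (rule usmall_filtermap[OF hfd_cont[OF g A.subspace_UNIV order_refl m, of x, unfolded n, OF UNIV_I] a])
  show "ubdd F (vl UNIV m) (\<lambda>i. pn) (\<lambda>i. Dg m x)"
    using hfd_mbdd[OF g A.subspace_UNIV order_refl m] by (intro mbdd_imp_ubdd) auto
qed

lemma (in pair_setting) regular_tendsto:
  assumes f: "regular r f D"
  shows "((\<lambda>p. f p - f (0, snd p)) \<longlongrightarrow> 0) (zf R)"
proof (rule tendstoI)
  fix e :: real assume "e > 0"
  then have "e / 2 > 0" by simp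
  from usmallD[OF ccontD(1)[OF regular_ccont[OF f, of R] le0] this] ev_zV ev_zV0
  show "\<forall>\<^sub>F p in zf R. dist (f p - f (0, snd p)) 0 < e"
  proof eventually_elim
    case (elim p)
    then have "norm (f p - f (0, snd p)) \<le> e / 2"
      using P.hfd_0[OF regular_hfd[OF f] V order_refl] by simp
    also have "\<dots> < e" using \<open>e > 0\<close> by simp
    finally show ?case by simp
  qed
qed

section \<open>Symmetry of higher derivatives\<close>

context two_spaces
begin

context
  fixes r f D
  assumes D: "has_frechet_derivs sa sc UNIV UNIV r f D"
begin

lemma UD_mlin: "m \<le> r \<Longrightarrow> mlin sa sc UNIV m (D m x)"
  using hfd_mlin[OF D A.subspace_UNIV order_refl] by simp

lemma UD_line:
  "m < r \<Longrightarrow> length vs = m \<Longrightarrow>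
    ((\<lambda>s. D m (x + s *\<^sub>R h) vs) has_vector_derivative D (Suc m) (x + s0 *\<^sub>R h) (h # vs)) (at s0 within S)"
  using hfd_line[OF D A.subspace_UNIV, of m x h vs s0 S] by (simp add: vl_def)

text \<open>The mixed second difference is symmetric in \<open>h1\<close> and \<open>h2\<close>;
  expanding it with a remainder small against \<open>s\<^sup>2\<close> in both orders compares the
  two second derivatives.\<close>

lemma second_difference:
  assumes m: "Suc m < r" and vs: "length vs = m" and e: "e > 0"
  obtains d where "d > 0" "\<And>s. 0 < s \<Longrightarrow> s < d \<Longrightarrow>
    norm (D m (x + s *\<^sub>R h1 + s *\<^sub>R h2) vs - D m (x + s *\<^sub>R h1) vs - D m (x + s *\<^sub>R h2) vs + D m x vs
      - s\<^sup>2 *\<^sub>R D (Suc (Suc m)) x (h2 # h1 # vs)) \<le> e * s\<^sup>2"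
proof -
  \<comment> \<open>Dominates the increments of both evaluation points relative to \<open>s\<close>.
    The factor \<open>3\<close> in \<open>e1\<close> is two parts for the variation of
    \<open>\<phi>'\<close> on the interval and one part for its value at \<open>0\<close>.\<close>
  define B where "B = (2 * norm h1 + norm h2 + 1) * pn (h1 # vs) + 1"
  have B: "B > 0" unfolding B_def by (intro add_nonneg_pos mult_nonneg_nonneg) auto
  define e1 where "e1 = e / (3 * B)"
  have e1: "e1 > 0" using e B by (simp add: e1_def)
  have mem: "h1 # vs \<in> vl UNIV (Suc m)" using vs by (simp add: vl_def)
  obtain d where d0: "d > 0" "\<forall>y\<in>UNIV. dist y x < d \<longrightarrow> (\<forall>us\<in>vl UNIV (Suc m).
      norm (D (Suc m) y us - D (Suc m) x us - D (Suc (Suc m)) x ((y - x) # us)) \<le> e1 * (norm (y - x) * pn us))"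
    using usmallD[OF hfd_diff[OF D A.subspace_UNIV order_refl m UNIV_I[of x]] e1]
    unfolding eventually_nin by (elim exE conjE)
  have d: "d > 0" "norm (D (Suc m) y (h1 # vs) - D (Suc m) x (h1 # vs) - D (Suc (Suc m)) x ((y - x) # h1 # vs))
        \<le> e1 * (norm (y - x) * pn (h1 # vs))" if "dist y x < d" for y
    using d0(2)[rule_format, OF UNIV_I that mem] d0(1) by auto
  let ?D2 = "D (Suc (Suc m)) x (h2 # h1 # vs)"
  define N where "N = norm h1 + norm h2 + 1"
  have N: "N > 0" by (simp add: N_def add_nonneg_pos)
  show thesis
  proof (rule that[of "d / N"])
    show "d / N > 0" using d0(1) N by simp
    fix s :: real assume s: "0 < s" "s < d / N"
    \<comment> \<open>The increment in direction \<open>h2\<close> as a function of the step in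
      direction \<open>h1\<close>; the second difference is
      \<open>\<phi> s - \<phi> 0\<close>.\<close>
    define \<phi> where "\<phi> \<tau> = D m (x + s *\<^sub>R h2 + \<tau> *\<^sub>R h1) vs - D m (x + \<tau> *\<^sub>R h1) vs" for \<tau>
    define \<phi>' where "\<phi>' \<tau> = D (Suc m) (x + s *\<^sub>R h2 + \<tau> *\<^sub>R h1) (h1 # vs) - D (Suc m) (x + \<tau> *\<^sub>R h1) (h1 # vs)" for \<tau>
    have der: "(\<phi> has_vector_derivative \<phi>' \<tau>) (at \<tau> within {0..s})" for \<tau>
      unfolding \<phi>_def \<phi>'_def using m vs by (intro has_vector_derivative_diff UD_line) auto
    have est: "norm (\<phi>' \<tau> - s *\<^sub>R ?D2) \<le> e1 * B * s" if \<tau>: "\<tau> \<in> {0..s}" for \<tau>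
    proof -
      let ?y = "x + s *\<^sub>R h2 + \<tau> *\<^sub>R h1" and ?z = "x + \<tau> *\<^sub>R h1"
      have yx: "?y - x = s *\<^sub>R h2 + \<tau> *\<^sub>R h1" and zx: "?z - x = \<tau> *\<^sub>R h1" by simp_all
      have \<tau>h: "norm (\<tau> *\<^sub>R h1) \<le> s * norm h1" using \<tau> s by (auto intro: mult_right_mono)
      have nz: "norm (?z - x) \<le> s * norm h1" unfolding zx by (rule \<tau>h)
      have ny: "norm (?y - x) \<le> s * (norm h1 + norm h2)"
        unfolding yx using \<tau>h s by (intro norm_triangle_le) (simp add: algebra_simps)
      have sN: "s * N < d" using s N by (simp add: pos_less_divide_eq)
      have "s * norm h1 < s * N" "s * (norm h1 + norm h2) < s * N"
        using s by (auto simp: N_def add_strict_increasing2 intro!: mult_strict_left_mono add_nonneg_pos)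
      then have "dist ?z x < d" "dist ?y x < d" using nz ny sN unfolding dist_norm by linarith+
      note d(2)[OF this(1)] d(2)[OF this(2)]
      then have 1: "norm (D (Suc m) ?z (h1 # vs) - D (Suc m) x (h1 # vs) - D (Suc (Suc m)) x ((\<tau> *\<^sub>R h1) # h1 # vs))
            \<le> e1 * ((s * norm h1) * pn (h1 # vs))"
          "norm (D (Suc m) ?y (h1 # vs) - D (Suc m) x (h1 # vs) - D (Suc (Suc m)) x ((s *\<^sub>R h2 + \<tau> *\<^sub>R h1) # h1 # vs))
            \<le> e1 * ((s * (norm h1 + norm h2)) * pn (h1 # vs))"
        using nz ny e1 unfolding yx zx
        by (auto elim!: order_trans intro!: mult_left_mono mult_right_mono simp del: pn_simps)
      have 2: "D (Suc (Suc m)) x ((s *\<^sub>R h2 + \<tau> *\<^sub>R h1) # h1 # vs) = s *\<^sub>R ?D2 + D (Suc (Suc m)) x ((\<tau> *\<^sub>R h1) # h1 # vs)"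
        using mlin_add[OF UD_mlin A.subspace_UNIV, of "Suc (Suc m)" "[]" "h1 # vs" "s *\<^sub>R h2" "\<tau> *\<^sub>R h1" x]
          mlin_scaleR[OF UD_mlin A.subspace_UNIV, of "Suc (Suc m)" "[]" "h1 # vs" h2 x s] m vs by simp
      have "\<phi>' \<tau> - s *\<^sub>R ?D2 = (D (Suc m) ?y (h1 # vs) - D (Suc m) x (h1 # vs) - D (Suc (Suc m)) x ((s *\<^sub>R h2 + \<tau> *\<^sub>R h1) # h1 # vs))
        - (D (Suc m) ?z (h1 # vs) - D (Suc m) x (h1 # vs) - D (Suc (Suc m)) x ((\<tau> *\<^sub>R h1) # h1 # vs))"
        unfolding 2 \<phi>'_def by simp
      also have "norm \<dots> \<le> e1 * ((s * (norm h1 + norm h2)) * pn (h1 # vs)) + e1 * ((s * norm h1) * pn (h1 # vs))"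
        by (rule norm_triangle_le_diff[OF add_mono[OF 1(2) 1(1)]])
      also have "\<dots> = e1 * s * ((2 * norm h1 + norm h2) * pn (h1 # vs))" by (simp add: algebra_simps)
      also have "\<dots> \<le> e1 * s * B"
        using e1 s unfolding B_def by (intro mult_left_mono) (auto simp: distrib_right)
      finally show ?thesis by (simp add: mult_ac)
    qed
    have "norm (\<phi> s - \<phi> 0 - (s - 0) *\<^sub>R \<phi>' 0) \<le> norm (s - 0) * (2 * (e1 * B * s))"
    proof (rule vector_differentiable_bound_linearization[where S = "{0..s}", OF der])
      show "closed_segment 0 s \<subseteq> {0..s}" using s by (simp add: closed_segment_eq_real_ivl)
      show "0 \<in> {0..s}" using s by simp
      fix \<tau> assume "\<tau> \<in> {0..s}"
      have "\<phi>' \<tau> - \<phi>' 0 = (\<phi>' \<tau> - s *\<^sub>R ?D2) - (\<phi>' 0 - s *\<^sub>R ?D2)" by simp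
      also have "norm \<dots> \<le> e1 * B * s + e1 * B * s"
        using s by (intro norm_triangle_le_diff[OF add_mono[OF est[OF \<open>\<tau> \<in> {0..s}\<close>] est]]) auto
      finally show "norm (\<phi>' \<tau> - \<phi>' 0) \<le> 2 * (e1 * B * s)" by (simp only: mult_2)
    qed
    then have a: "norm (\<phi> s - \<phi> 0 - s *\<^sub>R \<phi>' 0) \<le> 2 * (e1 * B) * s\<^sup>2"
      using s by (simp add: power2_eq_square mult_ac)
    have "norm (s *\<^sub>R (\<phi>' 0 - s *\<^sub>R ?D2)) \<le> s * (e1 * B * s)"
      using est[of 0] s by (simp add: mult_left_mono)
    then have b: "norm (s *\<^sub>R (\<phi>' 0 - s *\<^sub>R ?D2)) \<le> e1 * B * s\<^sup>2" by (simp add: power2_eq_square mult_ac)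
    have "norm (\<phi> s - \<phi> 0 - s\<^sup>2 *\<^sub>R ?D2) = norm ((\<phi> s - \<phi> 0 - s *\<^sub>R \<phi>' 0) + s *\<^sub>R (\<phi>' 0 - s *\<^sub>R ?D2))"
      by (simp add: scaleR_right_diff_distrib power2_eq_square)
    also have "\<dots> \<le> 2 * (e1 * B) * s\<^sup>2 + e1 * B * s\<^sup>2" using a b by (rule norm_triangle_mono)
    also have "\<dots> = 3 * (e1 * B) * s\<^sup>2" by (simp add: algebra_simps)
    also have "3 * (e1 * B) = e" using B by (simp add: e1_def)
    finally have "norm (\<phi> s - \<phi> 0 - s\<^sup>2 *\<^sub>R ?D2) \<le> e * s\<^sup>2" .
    moreover have "\<phi> s - \<phi> 0 = D m (x + s *\<^sub>R h1 + s *\<^sub>R h2) vs - D m (x + s *\<^sub>R h1) vs - D m (x + s *\<^sub>R h2) vs + D m x vs"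
      by (simp add: \<phi>_def add_ac)
    ultimately show "norm (D m (x + s *\<^sub>R h1 + s *\<^sub>R h2) vs - D m (x + s *\<^sub>R h1) vs - D m (x + s *\<^sub>R h2) vs + D m x vs
      - s\<^sup>2 *\<^sub>R ?D2) \<le> e * s\<^sup>2" by simp
  qed
qed

lemma second_derivative_symmetric:
  assumes m: "Suc m < r" and vs: "length vs = m"
  shows "D (Suc (Suc m)) x (h1 # h2 # vs) = D (Suc (Suc m)) x (h2 # h1 # vs)"
proof -
  let ?a = "D (Suc (Suc m)) x (h1 # h2 # vs)" and ?b = "D (Suc (Suc m)) x (h2 # h1 # vs)"
  have "norm (?a - ?b) \<le> 0 + e" if e: "e > 0" for e
  proof -
    have e2: "e / 2 > 0" using e by simp
    obtain d1 where d1: "d1 > 0" "\<And>s. 0 < s \<Longrightarrow> s < d1 \<Longrightarrow>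
      norm (D m (x + s *\<^sub>R h1 + s *\<^sub>R h2) vs - D m (x + s *\<^sub>R h1) vs - D m (x + s *\<^sub>R h2) vs + D m x vs
        - s\<^sup>2 *\<^sub>R ?b) \<le> e / 2 * s\<^sup>2"
      using second_difference[OF m vs e2, of x h1 h2] by blast
    obtain d2 where d2: "d2 > 0" "\<And>s. 0 < s \<Longrightarrow> s < d2 \<Longrightarrow>
      norm (D m (x + s *\<^sub>R h2 + s *\<^sub>R h1) vs - D m (x + s *\<^sub>R h2) vs - D m (x + s *\<^sub>R h1) vs + D m x vs
        - s\<^sup>2 *\<^sub>R ?a) \<le> e / 2 * s\<^sup>2"
      using second_difference[OF m vs e2, of x h2 h1] by blast
    define s where "s = min d1 d2 / 2"
    have s: "0 < s" "s < d1" "s < d2" using d1(1) d2(1) by (auto simp: s_def min_def)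
    let ?\<Delta> = "D m (x + s *\<^sub>R h1 + s *\<^sub>R h2) vs - D m (x + s *\<^sub>R h1) vs - D m (x + s *\<^sub>R h2) vs + D m x vs"
    have \<Delta>: "D m (x + s *\<^sub>R h2 + s *\<^sub>R h1) vs - D m (x + s *\<^sub>R h2) vs - D m (x + s *\<^sub>R h1) vs + D m x vs = ?\<Delta>"
      by (simp add: add_ac)
    have "s\<^sup>2 * norm (?a - ?b) = norm ((?\<Delta> - s\<^sup>2 *\<^sub>R ?b) - (?\<Delta> - s\<^sup>2 *\<^sub>R ?a))"
      by (simp add: scaleR_right_diff_distrib[symmetric])
    also have "\<dots> \<le> e / 2 * s\<^sup>2 + e / 2 * s\<^sup>2"
      by (rule norm_triangle_le_diff[OF add_mono[OF d1(2)[OF s(1,2)] d2(2)[OF s(1,3), unfolded \<Delta>]]])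
    also have "\<dots> = s\<^sup>2 * e" by simp
    finally show ?thesis using s by simp
  qed
  then have "norm (?a - ?b) \<le> 0" by (rule field_le_epsilon)
  then show ?thesis by simp
qed

text \<open>Only the two outermost directions need the second difference. For deeper positions the
  identity of lower order holds at every point, and differentiating it in direction \<open>u\<close>
  prepends \<open>u\<close> to both sides.\<close>

lemma derivative_swap:
  assumes "length us + length vs + 2 \<le> r"
  shows "D (length us + length vs + 2) x (us @ a # b # vs) = D (length us + length vs + 2) x (us @ b # a # vs)"
  using assms
proof (induction us arbitrary: x)
  case Nil
  then show ?case using second_derivative_symmetric[of "length vs" vs x a b] by simp
next
  case (Cons u us)
  let ?m = "length us + length vs + 2"
  have m: "?m < r" using Cons.prems by simp
  have eq: "D ?m y (us @ a # b # vs) = D ?m y (us @ b # a # vs)" for y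
    by (rule Cons.IH) (use Cons.prems in simp)
  have 1: "((\<lambda>s. D ?m (x + s *\<^sub>R u) (us @ a # b # vs)) has_vector_derivative
      D (Suc ?m) (x + 0 *\<^sub>R u) (u # us @ a # b # vs)) (at 0)"
    by (rule UD_line[OF m]) simp
  have 2: "((\<lambda>s. D ?m (x + s *\<^sub>R u) (us @ b # a # vs)) has_vector_derivative
      D (Suc ?m) (x + 0 *\<^sub>R u) (u # us @ b # a # vs)) (at 0)"
    by (rule UD_line[OF m]) simp
  show ?case using vector_derivative_unique_at[OF 1 2[folded eq]] by simp
qed

end

end

text \<open>Adjacent transpositions generate all permutations; the fixed prefix \<open>us\<close>
  allows the entries to be matched one after the other.\<close>

lemma swap_invariant_mset:
  assumes swap: "\<And>us a b vs. length us + length vs + 2 = m \<Longrightarrow> L (us @ a # b # vs) = L (us @ b # a # vs)"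
    and "mset vs = mset ws" "length us + length vs = m"
  shows "L (us @ vs) = L (us @ ws)"
proof -
  have move: "L (us @ xs @ a # ys) = L (us @ a # xs @ ys)" if "length us + length xs + length ys + 1 = m" for us xs a ys
    using that
  proof (induction xs arbitrary: us)
    case (Cons x xs)
    have "L ((us @ [x]) @ xs @ a # ys) = L ((us @ [x]) @ a # xs @ ys)"
      by (rule Cons.IH) (use Cons.prems in simp)
    also have "\<dots> = L (us @ x # a # xs @ ys)" by simp
    also have "\<dots> = L (us @ a # x # xs @ ys)" by (rule swap) (use Cons.prems in simp)
    finally show ?case by simp
  qed simp
  show ?thesis
    using assms(2,3)
  proof (induction vs arbitrary: us ws)
    case (Cons a vs)
    have "a \<in> set ws" using mset_eq_setD[OF Cons.prems(1)] by auto
    then obtain w1 w2 where ws: "ws = w1 @ a # w2" by (auto simp: in_set_conv_decomp)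
    have ms: "mset vs = mset (w1 @ w2)" using Cons.prems(1) by (simp add: ws)
    have "L ((us @ [a]) @ vs) = L ((us @ [a]) @ w1 @ w2)"
      by (rule Cons.IH[OF ms]) (use Cons.prems in simp)
    also have "\<dots> = L (us @ a # w1 @ w2)" by simp
    also have "\<dots> = L (us @ w1 @ a # w2)"
      using mset_eq_length[OF ms] Cons.prems(2) by (intro move[symmetric]) simp
    finally show ?case by (simp add: ws)
  qed simp
qed

section \<open>The multinomial formula for symmetric multilinear maps\<close>

definition compositions :: "nat \<Rightarrow> nat \<Rightarrow> (nat \<Rightarrow> nat) set"
  where "compositions i \<beta> = {n. (\<forall>\<tau>. \<tau> \<notin> {1..i} \<longrightarrow> n \<tau> = 0) \<and> (\<Sum>\<tau>=1..i. n \<tau>) = \<beta>}"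

lemma finite_compositions: "finite (compositions i \<beta>)"
proof (rule finite_subset)
  show "compositions i \<beta> \<subseteq> {n. \<forall>\<tau>. (\<tau> \<in> {1..i} \<longrightarrow> n \<tau> \<in> {0..\<beta>}) \<and> (\<tau> \<notin> {1..i} \<longrightarrow> n \<tau> = 0)}"
  proof
    fix n assume n: "n \<in> compositions i \<beta>"
    have "n \<tau> \<le> \<beta>" if "\<tau> \<in> {1..i}" for \<tau>
      using n that member_le_sum[of \<tau> "{1..i}" n] by (auto simp: compositions_def)
    with n show "n \<in> {n. \<forall>\<tau>. (\<tau> \<in> {1..i} \<longrightarrow> n \<tau> \<in> {0..\<beta>}) \<and> (\<tau> \<notin> {1..i} \<longrightarrow> n \<tau> = 0)}"
      by (auto simp: compositions_def)
  qed
  show "finite {n. \<forall>\<tau>. (\<tau> \<in> {1..i} \<longrightarrow> n \<tau> \<in> {0..\<beta>}) \<and> (\<tau> \<notin> {1..i} \<longrightarrow> n \<tau> = (0::nat))}"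
    by (rule finite_set_of_finite_funs) auto
qed

definition blocks :: "(nat \<Rightarrow> nat) \<Rightarrow> (nat \<Rightarrow> 'b) \<Rightarrow> nat \<Rightarrow> 'b list"
  where "blocks n X i = concat (map (\<lambda>\<tau>. replicate (n \<tau>) (X \<tau>)) [1..<Suc i])"

lemma blocks_Suc: "blocks n X (Suc i) = blocks n X i @ replicate (n (Suc i)) (X (Suc i))"
  by (simp add: blocks_def)

lemma blocks_0 [simp]: "blocks n X 0 = []"
  by (simp add: blocks_def)

lemma blocks_cong: "(\<And>\<tau>. \<tau> \<in> {1..i} \<Longrightarrow> n \<tau> = n' \<tau>) \<Longrightarrow> (\<And>\<tau>. \<tau> \<in> {1..i} \<Longrightarrow> n \<tau> > 0 \<Longrightarrow> X \<tau> = X' \<tau>) \<Longrightarrow> blocks n X i = blocks n' X' i"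
proof (induction i)
  case (Suc i)
  have "blocks n X i = blocks n' X' i" by (rule Suc.IH) (use Suc.prems in auto)
  moreover have "replicate (n (Suc i)) (X (Suc i)) = replicate (n' (Suc i)) (X' (Suc i))"
    using Suc.prems(1)[of "Suc i"] Suc.prems(2)[of "Suc i"] by (cases "n (Suc i)") auto
  ultimately show ?case by (simp add: blocks_Suc)
qed simp

lemma length_blocks: "length (blocks n X i) = (\<Sum>\<tau>=1..i. n \<tau>)"
  by (induction i) (auto simp: blocks_Suc)

context two_spaces
begin

context
  fixes L :: "'a list \<Rightarrow> 'c" and M :: nat
  assumes L: "mlin sa sc UNIV M L"
    and sym: "\<And>vs ws. length vs = M \<Longrightarrow> mset vs = mset ws \<Longrightarrow> L vs = L ws"
begin

lemma binomial_multilinear: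
  assumes "length ws + \<beta> = M"
  shows "L (ws @ replicate \<beta> (a + b)) = (\<Sum>j\<le>\<beta>. real (\<beta> choose j) *\<^sub>R L (ws @ replicate j a @ replicate (\<beta> - j) b))"
  using assms
proof (induction \<beta> arbitrary: ws)
  case (Suc \<beta>)
  define F where "F j = L (ws @ replicate j a @ replicate (Suc \<beta> - j) b)" for j
  have 1: "L (ws @ a # replicate \<beta> (a + b)) = (\<Sum>j\<le>\<beta>. real (\<beta> choose j) *\<^sub>R F (Suc j))"
    using Suc.IH[of "ws @ [a]"] Suc.prems by (simp add: F_def)
  have "L (ws @ b # replicate j a @ replicate (\<beta> - j) b) = F j" if "j \<le> \<beta>" for j
    unfolding F_def using that Suc.prems by (intro sym) (auto simp: Suc_diff_le)
  then have 2: "L (ws @ b # replicate \<beta> (a + b)) = (\<Sum>j\<le>\<beta>. real (\<beta> choose j) *\<^sub>R F j)"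
    using Suc.IH[of "ws @ [b]"] Suc.prems by simp
  have "L (ws @ replicate (Suc \<beta>) (a + b)) = L (ws @ a # replicate \<beta> (a + b)) + L (ws @ b # replicate \<beta> (a + b))"
    using mlin_add[OF L A.subspace_UNIV, of ws "replicate \<beta> (a + b)" a b] Suc.prems by simp
  also have "\<dots> = (\<Sum>j\<le>\<beta>. real (\<beta> choose j) *\<^sub>R F (Suc j)) + (\<Sum>j\<le>Suc \<beta>. real (\<beta> choose j) *\<^sub>R F j)"
    unfolding 1 2 by simp
  also have "\<dots> = F 0 + (\<Sum>j\<le>\<beta>. real (Suc \<beta> choose Suc j) *\<^sub>R F (Suc j))"
    by (subst sum.atMost_Suc_shift) (simp add: sum.distrib[symmetric] scaleR_left_distrib[symmetric] add_ac del: binomial_Suc_Suc sum.atMost_Suc, simp add: add_ac)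
  also have "\<dots> = (\<Sum>j\<le>Suc \<beta>. real (Suc \<beta> choose j) *\<^sub>R F j)"
    unfolding sum.atMost_Suc_shift[of "\<lambda>j. real (Suc \<beta> choose j) *\<^sub>R F j" \<beta>] by simp
  finally show ?case by (simp add: F_def del: sum.atMost_Suc)
qed simp

text \<open>Induction on the number of summands: the binomial formula splits off the last one. The
  prefix \<open>ws\<close> stores its copies while the induction hypothesis expands the
  others.\<close>

lemma multinomial_multilinear:
  assumes "length ws + \<beta> = M"
  shows "(1 / fact \<beta>) *\<^sub>R L (ws @ replicate \<beta> (\<Sum>\<tau>=1..i. X \<tau>))
    = (\<Sum>n\<in>compositions i \<beta>. (1 / (\<Prod>\<tau>=1..i. fact (n \<tau>))) *\<^sub>R L (ws @ blocks n X i))"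
  using assms
proof (induction i arbitrary: ws \<beta>)
  case 0
  show ?case
  proof (cases \<beta>)
    case 0
    have "compositions 0 0 = {\<lambda>_. 0}" by (auto simp: compositions_def)
    then show ?thesis by (simp add: 0)
  next
    case (Suc b)
    have "compositions 0 \<beta> = {}" using Suc by (auto simp: compositions_def)
    moreover have "L (ws @ replicate \<beta> 0) = 0"
      using mlin_zero[OF L A.subspace_UNIV, of ws "replicate b 0"] "0.prems" Suc by simp
    ultimately show ?thesis by simp
  qed
next
  case (Suc i)
  let ?a = "\<Sum>\<tau>=1..i. X \<tau>" and ?b = "X (Suc i)"
  have "(1 / fact \<beta>) *\<^sub>R L (ws @ replicate \<beta> (\<Sum>\<tau>=1..Suc i. X \<tau>))
      = (1 / fact \<beta>) *\<^sub>R (\<Sum>j\<le>\<beta>. real (\<beta> choose j) *\<^sub>R L (ws @ replicate j ?a @ replicate (\<beta> - j) ?b))"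
    using binomial_multilinear[OF Suc.prems, of ?a ?b] by simp
  also have "\<dots> = (\<Sum>j\<le>\<beta>. \<Sum>n\<in>compositions i j. (1 / fact (\<beta> - j)) *\<^sub>R (1 / (\<Prod>\<tau>=1..i. fact (n \<tau>))) *\<^sub>R L (ws @ blocks n X i @ replicate (\<beta> - j) ?b))"
    unfolding scaleR_sum_right
  proof (rule sum.cong[OF refl])
    fix j assume "j \<in> {..\<beta>}"
    then have j: "j \<le> \<beta>" by simp
    have "(1 / fact \<beta>) *\<^sub>R real (\<beta> choose j) *\<^sub>R L (ws @ replicate j ?a @ replicate (\<beta> - j) ?b)
        = (1 / fact (\<beta> - j)) *\<^sub>R (1 / fact j) *\<^sub>R L ((ws @ replicate (\<beta> - j) ?b) @ replicate j ?a)"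
    proof -
      have "L (ws @ replicate j ?a @ replicate (\<beta> - j) ?b) = L ((ws @ replicate (\<beta> - j) ?b) @ replicate j ?a)"
        using Suc.prems j by (intro sym) auto
      then show ?thesis using j by (simp add: binomial_fact field_simps)
    qed
    also have "(1 / fact j) *\<^sub>R L ((ws @ replicate (\<beta> - j) ?b) @ replicate j ?a)
        = (\<Sum>n\<in>compositions i j. (1 / (\<Prod>\<tau>=1..i. fact (n \<tau>))) *\<^sub>R L ((ws @ replicate (\<beta> - j) ?b) @ blocks n X i))"
      by (rule Suc.IH) (use Suc.prems j in simp)
    also have "(1 / fact (\<beta> - j)) *\<^sub>R \<dots> = (\<Sum>n\<in>compositions i j. (1 / fact (\<beta> - j)) *\<^sub>R (1 / (\<Prod>\<tau>=1..i. fact (n \<tau>))) *\<^sub>R L (ws @ blocks n X i @ replicate (\<beta> - j) ?b))"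
      unfolding scaleR_sum_right
    proof (rule sum.cong[OF refl])
      fix n assume "n \<in> compositions i j"
      then have "L ((ws @ replicate (\<beta> - j) ?b) @ blocks n X i) = L (ws @ blocks n X i @ replicate (\<beta> - j) ?b)"
        using Suc.prems j by (intro sym) (auto simp: length_blocks compositions_def)
      then show "(1 / fact (\<beta> - j)) *\<^sub>R (1 / (\<Prod>\<tau>=1..i. fact (n \<tau>))) *\<^sub>R L ((ws @ replicate (\<beta> - j) ?b) @ blocks n X i)
        = (1 / fact (\<beta> - j)) *\<^sub>R (1 / (\<Prod>\<tau>=1..i. fact (n \<tau>))) *\<^sub>R L (ws @ blocks n X i @ replicate (\<beta> - j) ?b)" by simp
    qed
    finally show "(1 / fact \<beta>) *\<^sub>R real (\<beta> choose j) *\<^sub>R L (ws @ replicate j ?a @ replicate (\<beta> - j) ?b)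
      = (\<Sum>n\<in>compositions i j. (1 / fact (\<beta> - j)) *\<^sub>R (1 / (\<Prod>\<tau>=1..i. fact (n \<tau>))) *\<^sub>R L (ws @ blocks n X i @ replicate (\<beta> - j) ?b))" .
  qed
  also have "\<dots> = (\<Sum>(j, n)\<in>Sigma {..\<beta>} (compositions i). (1 / fact (\<beta> - j)) *\<^sub>R (1 / (\<Prod>\<tau>=1..i. fact (n \<tau>))) *\<^sub>R L (ws @ blocks n X i @ replicate (\<beta> - j) ?b))"
    by (rule sum.Sigma) (auto simp: finite_compositions)
  \<comment> \<open>A pair of \<open>j\<close> and a composition of \<open>j\<close> into
    \<open>i\<close> parts corresponds to a composition of \<open>\<beta>\<close> whose last part is
    \<open>\<beta> - j\<close>.\<close>
  also have "\<dots> = (\<Sum>n\<in>compositions (Suc i) \<beta>. (1 / (\<Prod>\<tau>=1..Suc i. fact (n \<tau>))) *\<^sub>R L (ws @ blocks n X (Suc i)))"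
  proof (rule sum.reindex_bij_witness[where i = "\<lambda>n. (\<beta> - n (Suc i), n(Suc i := 0))" and j = "\<lambda>(j, n). n(Suc i := \<beta> - j)"])
    fix p assume "p \<in> Sigma {..\<beta>} (compositions i)"
    then obtain j n where p: "p = (j, n)" "j \<le> \<beta>" "n \<in> compositions i j" by auto
    have n0: "n (Suc i) = 0" using p(3) by (auto simp: compositions_def)
    have b: "blocks (n(Suc i := \<beta> - j)) X i = blocks n X i" by (rule blocks_cong) auto
    have s: "(\<Sum>\<tau>=1..i. (n(Suc i := \<beta> - j)) \<tau>) = (\<Sum>\<tau>=1..i. n \<tau>)" by (rule sum.cong) auto
    have pr: "(\<Prod>\<tau>=1..i. fact ((n(Suc i := \<beta> - j)) \<tau>)) = (\<Prod>\<tau>=1..i. fact (n \<tau>) :: real)" by (rule prod.cong) auto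
    show "(\<lambda>n. (\<beta> - n (Suc i), n(Suc i := 0))) ((\<lambda>(j, n). n(Suc i := \<beta> - j)) p) = p"
      using p n0 by (auto simp: fun_eq_iff)
    show "(\<lambda>(j, n). n(Suc i := \<beta> - j)) p \<in> compositions (Suc i) \<beta>"
      using p s unfolding compositions_def by auto
    show "(1 / (\<Prod>\<tau>=1..Suc i. fact (((\<lambda>(j, n). n(Suc i := \<beta> - j)) p) \<tau>))) *\<^sub>R L (ws @ blocks ((\<lambda>(j, n). n(Suc i := \<beta> - j)) p) X (Suc i))
      = (case p of (j, n) \<Rightarrow> (1 / fact (\<beta> - j)) *\<^sub>R (1 / (\<Prod>\<tau>=1..i. fact (n \<tau>))) *\<^sub>R L (ws @ blocks n X i @ replicate (\<beta> - j) ?b))"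
      unfolding p prod.case blocks_Suc b by (simp add: pr mult.commute)
  next
    fix n assume n: "n \<in> compositions (Suc i) \<beta>"
    have s: "(\<Sum>\<tau>=1..i. (n(Suc i := 0)) \<tau>) = (\<Sum>\<tau>=1..i. n \<tau>)" by (rule sum.cong) auto
    show "(\<lambda>(j, n). n(Suc i := \<beta> - j)) (\<beta> - n (Suc i), n(Suc i := 0)) = n"
      using n by (auto simp: fun_eq_iff compositions_def)
    show "(\<beta> - n (Suc i), n(Suc i := 0)) \<in> Sigma {..\<beta>} (compositions i)"
      using n s unfolding compositions_def by auto
  qed
  finally show ?case .
qed

lemma blocks_scaleR:
  assumes "length ws + (\<Sum>\<tau>=1..i. n \<tau>) = M"
  shows "L (blocks n (\<lambda>\<tau>. s ^ \<tau> *\<^sub>R Y \<tau>) i @ ws) = s ^ (\<Sum>\<tau>=1..i. \<tau> * n \<tau>) *\<^sub>R L (blocks n Y i @ ws)"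
  using assms
proof (induction i arbitrary: ws)
  case (Suc i)
  have rep: "L (us @ replicate m (c *\<^sub>R y) @ vs) = c ^ m *\<^sub>R L (us @ replicate m y @ vs)"
    if "length us + m + length vs = M" for us vs m c y
    using that
  proof (induction m arbitrary: us)
    case (Suc m)
    have "L (us @ (c *\<^sub>R y) # replicate m (c *\<^sub>R y) @ vs) = c *\<^sub>R L ((us @ [y]) @ replicate m (c *\<^sub>R y) @ vs)"
      using mlin_scaleR[OF L A.subspace_UNIV, of us "replicate m (c *\<^sub>R y) @ vs" y c] Suc.prems by simp
    also have "\<dots> = c *\<^sub>R c ^ m *\<^sub>R L ((us @ [y]) @ replicate m y @ vs)"
      using Suc.IH[of "us @ [y]"] Suc.prems by simp
    finally show ?case by simp
  qed simp
  have "L (blocks n (\<lambda>\<tau>. s ^ \<tau> *\<^sub>R Y \<tau>) i @ replicate (n (Suc i)) (s ^ Suc i *\<^sub>R Y (Suc i)) @ ws)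
      = s ^ (\<Sum>\<tau>=1..i. \<tau> * n \<tau>) *\<^sub>R L (blocks n Y i @ replicate (n (Suc i)) (s ^ Suc i *\<^sub>R Y (Suc i)) @ ws)"
    by (rule Suc.IH) (use Suc.prems in simp)
  also have "L (blocks n Y i @ replicate (n (Suc i)) (s ^ Suc i *\<^sub>R Y (Suc i)) @ ws)
      = (s ^ Suc i) ^ n (Suc i) *\<^sub>R L (blocks n Y i @ replicate (n (Suc i)) (Y (Suc i)) @ ws)"
    by (rule rep) (use Suc.prems in \<open>simp add: length_blocks\<close>)
  finally show ?case
    by (simp add: blocks_Suc power_add power_mult[symmetric] del: power_Suc)
qed simp

end

end

section \<open>The Taylor expansion along the cone\<close>

text \<open>The power of \<open>s\<close> that a term carries when its entries with index
  \<open>\<tau>\<close> are scaled by \<open>s ^ \<tau>\<close>.\<close>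

definition weight :: "nat \<Rightarrow> (nat \<Rightarrow> nat) \<Rightarrow> nat"
  where "weight i n = (\<Sum>\<tau>=1..i. \<tau> * n \<tau>)"

definition Tcoeff :: "(nat \<Rightarrow> 'b list \<Rightarrow> 'c) \<Rightarrow> nat \<Rightarrow> (nat \<Rightarrow> 'b::real_vector) \<Rightarrow> nat \<Rightarrow> (nat \<Rightarrow> nat) \<Rightarrow> 'c::real_vector"
  where "Tcoeff G0 i c \<beta> n = (1 / (\<Prod>\<tau>=1..i. fact (n \<tau>))) *\<^sub>R G0 \<beta> (blocks n (\<lambda>\<tau>. (1 / fact \<tau>) *\<^sub>R c \<tau>) i)"

lemma T_eq: "T G0 i c = fact i *\<^sub>R (\<Sum>\<beta>=1..i. \<Sum>n | n \<in> compositions i \<beta> \<and> weight i n = i. Tcoeff G0 i c \<beta> n)"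
  by (simp add: T_def Tcoeff_def compositions_def weight_def blocks_def scaleR_sum_right)

lemma weight_ge: "n \<in> compositions i \<beta> \<Longrightarrow> \<beta> \<le> weight i n"
  unfolding compositions_def weight_def by (auto intro!: sum_mono)

text \<open>A term of weight \<open>i\<close> uses no index above \<open>i\<close>. Hence all
  \<open>T G0 i\<close> with \<open>i \<le> M\<close> can be written over the common index range
  \<open>1..M\<close>, as coefficients of one polynomial.\<close>

lemma weight_extend:
  assumes "i \<le> M"
  shows "{n \<in> compositions i \<beta>. weight i n = i} = {n \<in> compositions M \<beta>. weight M n = i}"
proof -
  have ext: "(\<Sum>\<tau>=1..M. g \<tau> (n \<tau>)) = (\<Sum>\<tau>=1..i. g \<tau> (n \<tau>))"
    if "\<forall>\<tau>. \<tau> \<notin> {1..i} \<longrightarrow> n \<tau> = 0" "\<And>\<tau>. g \<tau> 0 = 0" for n and g :: "nat \<Rightarrow> nat \<Rightarrow> nat"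
    using assms that by (intro sum.mono_neutral_right) auto
  have supp: "\<forall>\<tau>. \<tau> \<notin> {1..i} \<longrightarrow> n \<tau> = 0" if "n \<in> compositions M \<beta>" "weight M n = i" for n
  proof (intro allI impI)
    fix \<tau> assume \<tau>: "\<tau> \<notin> {1..i}"
    show "n \<tau> = 0"
    proof (rule ccontr)
      assume "n \<tau> \<noteq> 0"
      then have M: "\<tau> \<in> {1..M}" using that by (auto simp: compositions_def)
      then have "\<tau> * n \<tau> \<le> weight M n"
        unfolding weight_def by (intro member_le_sum) auto
      moreover have "\<tau> \<le> \<tau> * n \<tau>" using \<open>n \<tau> \<noteq> 0\<close> by simp
      ultimately have "\<tau> \<le> i" using that(2) by linarith
      then show False using \<tau> M by simp
    qed
  qed
  show ?thesis
  proof (intro set_eqI iffI)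
    fix n assume "n \<in> {n \<in> compositions i \<beta>. weight i n = i}"
    then show "n \<in> {n \<in> compositions M \<beta>. weight M n = i}"
      using ext[of n "\<lambda>_ x. x"] ext[of n "\<lambda>\<tau> x. \<tau> * x"] assms by (auto simp: compositions_def weight_def)
  next
    fix n assume n: "n \<in> {n \<in> compositions M \<beta>. weight M n = i}"
    then have "\<forall>\<tau>. \<tau> \<notin> {1..i} \<longrightarrow> n \<tau> = 0" using supp by blast
    with n show "n \<in> {n \<in> compositions i \<beta>. weight i n = i}"
      using ext[of n "\<lambda>_ x. x"] ext[of n "\<lambda>\<tau> x. \<tau> * x"] by (auto simp: compositions_def weight_def)
  qed
qed

lemma blocks_extend: "i \<le> M \<Longrightarrow> (\<And>\<tau>. \<tau> \<notin> {1..i} \<Longrightarrow> n \<tau> = 0) \<Longrightarrow> blocks n X M = blocks n X i"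
  by (induction M rule: dec_induct) (auto simp: blocks_Suc)

lemma T_extend:
  assumes "1 \<le> i" "i \<le> M"
  shows "(1 / fact i) *\<^sub>R T G0 i c = (\<Sum>\<beta>=1..M. \<Sum>n | n \<in> compositions M \<beta> \<and> weight M n = i. Tcoeff G0 M c \<beta> n)"
proof -
  have "(1 / fact i) *\<^sub>R T G0 i c = (\<Sum>\<beta>=1..i. \<Sum>n | n \<in> compositions i \<beta> \<and> weight i n = i. Tcoeff G0 i c \<beta> n)"
    by (simp add: T_eq)
  also have "\<dots> = (\<Sum>\<beta>=1..i. \<Sum>n | n \<in> compositions M \<beta> \<and> weight M n = i. Tcoeff G0 M c \<beta> n)"
  proof (rule sum.cong[OF refl], rule sum.cong)
    fix \<beta>
    show "{n. n \<in> compositions i \<beta> \<and> weight i n = i} = {n. n \<in> compositions M \<beta> \<and> weight M n = i}"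
      using weight_extend[OF assms(2)] by simp
    fix n assume "n \<in> {n. n \<in> compositions M \<beta> \<and> weight M n = i}"
    then have "n \<in> compositions i \<beta>" using weight_extend[OF assms(2), of \<beta>] by blast
    then have z: "\<And>\<tau>. \<tau> \<notin> {1..i} \<Longrightarrow> n \<tau> = 0" by (auto simp: compositions_def)
    have "(\<Prod>\<tau>=1..M. fact (n \<tau>)) = (\<Prod>\<tau>=1..i. fact (n \<tau>) :: real)"
      using assms z by (intro prod.mono_neutral_right) auto
    then show "Tcoeff G0 i c \<beta> n = Tcoeff G0 M c \<beta> n"
      using blocks_extend[OF assms(2), of n "\<lambda>\<tau>. (1 / fact \<tau>) *\<^sub>R c \<tau>"] z by (simp add: Tcoeff_def)
  qed
  also have "\<dots> = (\<Sum>\<beta>=1..M. \<Sum>n | n \<in> compositions M \<beta> \<and> weight M n = i. Tcoeff G0 M c \<beta> n)"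
  proof (rule sum.mono_neutral_left)
    show "\<forall>\<beta>\<in>{1..M} - {1..i}. (\<Sum>n | n \<in> compositions M \<beta> \<and> weight M n = i. Tcoeff G0 M c \<beta> n) = 0"
    proof
      fix \<beta> assume "\<beta> \<in> {1..M} - {1..i}"
      then have "{n. n \<in> compositions M \<beta> \<and> weight M n = i} = {}"
        using weight_ge by fastforce
      then show "(\<Sum>n | n \<in> compositions M \<beta> \<and> weight M n = i. Tcoeff G0 M c \<beta> n) = 0" by (simp only: sum.empty)
    qed
  qed (use assms in auto)
  finally show ?thesis .
qed

lemma T_cong: "(\<And>\<tau>. \<tau> \<in> {1..i} \<Longrightarrow> c \<tau> = c' \<tau>) \<Longrightarrow> T G0 i c = T G0 i c'"
proof -
  assume *: "\<And>\<tau>. \<tau> \<in> {1..i} \<Longrightarrow> c \<tau> = c' \<tau>"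
  have "blocks n (\<lambda>\<tau>. (1 / fact \<tau>) *\<^sub>R c \<tau>) i = blocks n (\<lambda>\<tau>. (1 / fact \<tau>) *\<^sub>R c' \<tau>) i" for n
    by (rule blocks_cong) (auto simp: *)
  then show ?thesis by (simp add: T_eq Tcoeff_def)
qed

lemma pn_replicate: "pn (replicate m x) = norm x ^ m"
  by (induction m) auto

locale two_spaces_banach = two_spaces sa sc
  for sa :: "'k::real_normed_field \<Rightarrow> 'a::real_normed_vector \<Rightarrow> 'a"
    and sc :: "'k \<Rightarrow> 'c::banach \<Rightarrow> 'c"
begin

text \<open>The integral form of the remainder along the real segment from \<open>0\<close> to
  \<open>x\<close>; continuity of the derivative of order \<open>n + 1\<close> at \<open>0\<close>
  bounds it by \<open>C0 + 1\<close> on a ball.\<close>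

lemma taylor_at_0:
  assumes D: "has_frechet_derivs sa sc UNIV UNIV r G DG" and n: "Suc n \<le> r"
  obtains C \<rho> where "C \<ge> 0" "\<rho> > 0" "\<And>x. norm x < \<rho> \<Longrightarrow>
    norm (G x - (\<Sum>i<Suc n. (1 / fact i) *\<^sub>R DG i 0 (replicate i x))) \<le> C * norm x ^ Suc n"
proof -
  obtain C0 where C0: "C0 \<ge> 0" "\<And>vs. vs \<in> vl UNIV (Suc n) \<Longrightarrow> norm (DG (Suc n) 0 vs) \<le> C0 * pn vs"
    using hfd_mbdd[OF D A.subspace_UNIV order_refl n UNIV_I[of 0]] by (auto simp: mbdd_def)
  obtain \<rho> where \<rho>: "\<rho> > 0" "\<forall>y\<in>UNIV. dist y 0 < \<rho> \<longrightarrow> (\<forall>vs\<in>vl UNIV (Suc n).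
      norm (DG (Suc n) y vs - DG (Suc n) 0 vs) \<le> 1 * pn vs)"
    using usmallD[OF hfd_cont[OF D A.subspace_UNIV order_refl n UNIV_I[of 0]] zero_less_one]
    unfolding eventually_nin by (elim exE conjE)
  show thesis
  proof (rule that[of "C0 + 1" \<rho>])
    fix x :: 'a assume x: "norm x < \<rho>"
    let ?Df = "\<lambda>i t. DG i (t *\<^sub>R x) (replicate i x)"
    let ?f = "\<lambda>t. ((1 - t) ^ (Suc n - 1) / fact (Suc n - 1)) *\<^sub>R ?Df (Suc n) t"
    have "(?f has_integral ?Df 0 1 - (\<Sum>i<Suc n. ((1 - 0) ^ i / fact i) *\<^sub>R ?Df i 0)) {0..1}"
    proof (rule Taylor_has_integral)
      fix m :: nat and t :: real assume "m < Suc n"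
      then show "((\<lambda>t. ?Df m t) has_vector_derivative ?Df (Suc m) t) (at t within {0..1})"
        using UD_line[OF D, of m "replicate m x" 0 x t "{0..1}"] n by simp
    qed auto
    moreover have "norm (?f t) \<le> (C0 + 1) * norm x ^ Suc n" if t: "t \<in> {0..1}" for t
    proof -
      have "norm (t *\<^sub>R x) \<le> 1 * norm x" unfolding norm_scaleR using t by (intro mult_right_mono) auto
      then have tx: "dist (t *\<^sub>R x) 0 < \<rho>" using x by simp
      have rep: "replicate (Suc n) x \<in> vl UNIV (Suc n)" by (simp add: vl_def)
      have "norm (?Df (Suc n) t) \<le> norm (?Df (Suc n) t - DG (Suc n) 0 (replicate (Suc n) x)) + norm (DG (Suc n) 0 (replicate (Suc n) x))"
        by (metis diff_add_cancel norm_triangle_ineq)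
      also have "\<dots> \<le> 1 * pn (replicate (Suc n) x) + C0 * pn (replicate (Suc n) x)"
        by (rule add_mono[OF \<rho>(2)[rule_format, OF UNIV_I tx rep] C0(2)[OF rep]])
      also have "\<dots> = (C0 + 1) * norm x ^ Suc n" unfolding pn_replicate by (simp add: distrib_right)
      finally have 1: "norm (?Df (Suc n) t) \<le> (C0 + 1) * norm x ^ Suc n" .
      have "(1 - t) ^ n / fact n \<le> 1 / 1"
        using t by (intro frac_le power_le_one) auto
      then have "\<bar>(1 - t) ^ n / fact n\<bar> \<le> 1" using t by simp
      then have "norm (?f t) \<le> 1 * ((C0 + 1) * norm x ^ Suc n)"
        unfolding norm_scaleR using 1 C0 by (intro mult_mono) auto
      then show ?thesis by simp
    qed
    ultimately have "norm (?Df 0 1 - (\<Sum>i<Suc n. ((1 - 0) ^ i / fact i) *\<^sub>R ?Df i 0)) \<le> ((C0 + 1) * norm x ^ Suc n) * measure lborel {0..1::real}"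
      using C0 by (intro has_integral_bound_real[where S = "{}" and f = ?f]) auto
    then show "norm (G x - (\<Sum>i<Suc n. (1 / fact i) *\<^sub>R DG i 0 (replicate i x))) \<le> (C0 + 1) * norm x ^ Suc n"
      using hfd_0[OF D A.subspace_UNIV order_refl, of x] by simp
  qed (use C0 \<rho> in auto)
qed

text \<open>The Taylor polynomial of \<open>G\<close> at \<open>0\<close>, evaluated on the cone, is
  a polynomial in \<open>s\<close> whose coefficient of index \<open>i\<close>, for
  \<open>1 \<le> i \<le> M\<close>, is \<open>T\<close> of order \<open>i\<close> divided by
  \<open>fact i\<close>. Coefficients below \<open>j\<close> vanish; those above \<open>j\<close>,
  and the Taylor remainder of order \<open>M + 1\<close>, disappear after division by
  \<open>s ^ j\<close>, as \<open>j \<le> M\<close>.\<close>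

lemma cone_limit:
  assumes D: "has_frechet_derivs sa sc UNIV UNIV r G DG" and G0: "G 0 = 0" and M: "Suc M \<le> r"
    and j: "1 \<le> j" "j \<le> M" and T0: "\<And>i. 1 \<le> i \<Longrightarrow> i < j \<Longrightarrow> T (\<lambda>\<beta>. DG \<beta> 0) i c = 0"
  shows "((\<lambda>s. (1 / s ^ j) *\<^sub>R G (\<Sum>i=1..M. (s ^ i / fact i) *\<^sub>R c i)) \<longlongrightarrow> (1 / fact j) *\<^sub>R T (\<lambda>\<beta>. DG \<beta> 0) j c) (at_right 0)"
proof -
  let ?X = "\<lambda>s::real. \<Sum>i=1..M. (s ^ i / fact i) *\<^sub>R c i"
  let ?G0 = "\<lambda>\<beta>. DG \<beta> 0"
  let ?A = "Tcoeff ?G0 M c"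
  define Q where "Q i = (\<Sum>\<beta>=1..M. \<Sum>n | n \<in> compositions M \<beta> \<and> weight M n = i. ?A \<beta> n)" for i
  define P where "P s = (\<Sum>i<Suc M. (1 / fact i) *\<^sub>R DG i 0 (replicate i (?X s)))" for s
  have P: "P s = (\<Sum>i\<le>M * M. s ^ i *\<^sub>R Q i)" for s
  proof -
    \<comment> \<open>The degree is at most \<open>M * M\<close>, as there are at most
      \<open>M\<close> factors, each of weight at most \<open>M\<close>.\<close>
    have comp: "(1 / fact \<beta>) *\<^sub>R DG \<beta> 0 (replicate \<beta> (?X s))
        = (\<Sum>i\<le>M * M. \<Sum>n | n \<in> compositions M \<beta> \<and> weight M n = i. s ^ i *\<^sub>R ?A \<beta> n)" if \<beta>: "\<beta> \<in> {1..M}" for \<beta>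
    proof -
      have ml: "mlin sa sc UNIV \<beta> (DG \<beta> 0)" using UD_mlin[OF D] \<beta> M by simp
      have sym: "DG \<beta> 0 vs = DG \<beta> 0 ws" if "length vs = \<beta>" "mset vs = mset ws" for vs ws
      proof -
        have sw: "DG \<beta> 0 (us @ a # b # xs) = DG \<beta> 0 (us @ b # a # xs)" if len: "length us + length xs + 2 = \<beta>" for us a b xs
          using derivative_swap[OF D, of us xs 0 a b] \<beta> M unfolding len by simp
        show ?thesis using swap_invariant_mset[of \<beta> "DG \<beta> 0" vs ws "[]", OF sw] that by simp
      qed
      have X: "?X s = (\<Sum>\<tau>=1..M. s ^ \<tau> *\<^sub>R ((1 / fact \<tau>) *\<^sub>R c \<tau>))" by simp
      have "(1 / fact \<beta>) *\<^sub>R DG \<beta> 0 (replicate \<beta> (?X s))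
        = (\<Sum>n\<in>compositions M \<beta>. (1 / (\<Prod>\<tau>=1..M. fact (n \<tau>))) *\<^sub>R DG \<beta> 0 (blocks n (\<lambda>\<tau>. s ^ \<tau> *\<^sub>R ((1 / fact \<tau>) *\<^sub>R c \<tau>)) M))"
        unfolding X using multinomial_multilinear[OF ml sym, of "[]"] by simp
      also have "\<dots> = (\<Sum>n\<in>compositions M \<beta>. s ^ weight M n *\<^sub>R ?A \<beta> n)"
      proof (rule sum.cong[OF refl])
        fix n assume "n \<in> compositions M \<beta>"
        then have "length ([]::'a list) + (\<Sum>\<tau>=1..M. n \<tau>) = \<beta>" by (simp add: compositions_def)
        from blocks_scaleR[OF ml sym this, of s "\<lambda>\<tau>. (1 / fact \<tau>) *\<^sub>R c \<tau>"]
        show "(1 / (\<Prod>\<tau>=1..M. fact (n \<tau>))) *\<^sub>R DG \<beta> 0 (blocks n (\<lambda>\<tau>. s ^ \<tau> *\<^sub>R ((1 / fact \<tau>) *\<^sub>R c \<tau>)) M)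
          = s ^ weight M n *\<^sub>R ?A \<beta> n"
          by (simp add: Tcoeff_def weight_def)
      qed
      also have "\<dots> = (\<Sum>i\<le>M * M. \<Sum>n | n \<in> compositions M \<beta> \<and> weight M n = i. s ^ weight M n *\<^sub>R ?A \<beta> n)"
      proof (rule sum.group[symmetric, OF finite_compositions finite_atMost])
        have "weight M n \<le> M * M" if "n \<in> compositions M \<beta>" for n
        proof -
          have "weight M n \<le> (\<Sum>\<tau>=1..M. M * n \<tau>)" unfolding weight_def by (intro sum_mono) simp
          also have "\<dots> = M * \<beta>" using that by (simp add: compositions_def sum_distrib_left[symmetric])
          also have "\<dots> \<le> M * M" using \<beta> by simp
          finally show ?thesis .
        qed
        then show "weight M ` compositions M \<beta> \<subseteq> {..M * M}" by auto
      qed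
      also have "\<dots> = (\<Sum>i\<le>M * M. \<Sum>n | n \<in> compositions M \<beta> \<and> weight M n = i. s ^ i *\<^sub>R ?A \<beta> n)"
        by (intro sum.cong) auto
      finally show ?thesis .
    qed
    have "P s = (\<Sum>\<beta>=1..M. (1 / fact \<beta>) *\<^sub>R DG \<beta> 0 (replicate \<beta> (?X s)))"
    proof -
      have "DG 0 0 [] = 0" using hfd_0[OF D A.subspace_UNIV order_refl UNIV_I] G0 by simp
      moreover have "{..<Suc M} = insert 0 {1..M}" by auto
      ultimately show ?thesis by (simp add: P_def)
    qed
    also have "\<dots> = (\<Sum>\<beta>=1..M. \<Sum>i\<le>M * M. \<Sum>n | n \<in> compositions M \<beta> \<and> weight M n = i. s ^ i *\<^sub>R ?A \<beta> n)"
      by (rule sum.cong[OF refl comp])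
    also have "\<dots> = (\<Sum>i\<le>M * M. s ^ i *\<^sub>R Q i)"
      by (subst sum.swap) (simp add: Q_def scaleR_sum_right)
    finally show ?thesis .
  qed
  have Qj: "Q i = (1 / fact i) *\<^sub>R T ?G0 i c" if "1 \<le> i" "i \<le> M" for i
    unfolding Q_def by (rule T_extend[OF that, symmetric])
  have Q0: "Q i = 0" if "i < j" for i
  proof (cases "i = 0")
    case True
    have "(\<Sum>n | n \<in> compositions M \<beta> \<and> weight M n = 0. ?A \<beta> n) = 0" if "\<beta> \<in> {1..M}" for \<beta>
    proof -
      have "{n. n \<in> compositions M \<beta> \<and> weight M n = 0} = {}" using weight_ge that by fastforce
      then show ?thesis by (simp only: sum.empty)
    qed
    then show ?thesis by (simp add: Q_def True)
  next
    case False
    then show ?thesis using that j Qj[of i] T0[of i] by simp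
  qed
  have pos: "\<forall>\<^sub>F s in at_right (0::real). 0 < s \<and> s < 1"
    using eventually_at_right_less[of 0] eventually_at_right_real[of 0 1] by (auto elim: eventually_mono)
  have lim1: "((\<lambda>s. (1 / s ^ j) *\<^sub>R P s) \<longlongrightarrow> Q j) (at_right 0)"
  proof -
    have "((\<lambda>s. \<Sum>i\<le>M * M. (s ^ i / s ^ j) *\<^sub>R Q i) \<longlongrightarrow> (\<Sum>i\<le>M * M. if i = j then Q j else 0)) (at_right 0)"
    proof (rule tendsto_sum)
      fix i assume "i \<in> {..M * M}"
      consider "i < j" | "i = j" | "i > j" by linarith
      then show "((\<lambda>s. (s ^ i / s ^ j) *\<^sub>R Q i) \<longlongrightarrow> (if i = j then Q j else 0)) (at_right 0)"
      proof cases
        case 1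
        then show ?thesis using Q0 by simp
      next
        case 2
        have "\<forall>\<^sub>F s in at_right 0. Q j = (s ^ j / s ^ j) *\<^sub>R Q j"
          using pos by eventually_elim simp
        then show ?thesis using 2 by (simp add: tendsto_eventually eventually_mono[OF _ sym])
      next
        case 3
        have "((\<lambda>s. s ^ (i - j) *\<^sub>R Q i) \<longlongrightarrow> 0 ^ (i - j) *\<^sub>R Q i) (at_right 0)"
          by (intro tendsto_intros)
        then have "((\<lambda>s. s ^ (i - j) *\<^sub>R Q i) \<longlongrightarrow> 0) (at_right 0)" using 3 by (simp add: power_0_left)
        then have "((\<lambda>s. (s ^ i / s ^ j) *\<^sub>R Q i) \<longlongrightarrow> 0) (at_right 0)"
        proof (rule Lim_transform_eventually)
          show "\<forall>\<^sub>F s in at_right 0. s ^ (i - j) *\<^sub>R Q i = (s ^ i / s ^ j) *\<^sub>R Q i"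
            using pos by eventually_elim (use 3 in \<open>simp add: power_diff\<close>)
        qed
        then show ?thesis using 3 by simp
      qed
    qed
    moreover have "j \<le> M * M" using j by (meson le_square order_trans)
    ultimately show ?thesis unfolding P by (simp add: scaleR_sum_right)
  qed
  define B where "B = (\<Sum>i=1..M. norm (c i)) + 1"
  have B: "B > 0" unfolding B_def by (intro add_nonneg_pos sum_nonneg) auto
  have Xb: "norm (?X s) \<le> s * B" if "0 < s" "s < 1" for s
  proof -
    have "norm (?X s) \<le> (\<Sum>i=1..M. s * norm (c i))"
    proof (rule order_trans[OF norm_sum], rule sum_mono)
      fix i assume i: "i \<in> {1..M}"
      have "s ^ i / fact i \<le> s / 1"
      proof (rule frac_le)
        show "s ^ i \<le> s" using that i power_decreasing[of 1 i s] by simp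
      qed (use that in auto)
      then have "(s ^ i / fact i) * norm (c i) \<le> s * norm (c i)"
        by (intro mult_right_mono) auto
      then show "norm ((s ^ i / fact i) *\<^sub>R c i) \<le> s * norm (c i)"
        using that by simp
    qed
    also have "\<dots> = s * (\<Sum>i=1..M. norm (c i))" by (simp add: sum_distrib_left)
    also have "\<dots> \<le> s * B" using that by (intro mult_left_mono) (auto simp: B_def)
    finally show ?thesis .
  qed
  obtain C \<rho> where C: "C \<ge> 0" "\<rho> > 0" "\<And>x. norm x < \<rho> \<Longrightarrow>
    norm (G x - (\<Sum>i<Suc M. (1 / fact i) *\<^sub>R DG i 0 (replicate i x))) \<le> C * norm x ^ Suc M"
    using taylor_at_0[OF D M] by blast
  have lim2: "((\<lambda>s. (1 / s ^ j) *\<^sub>R (G (?X s) - P s)) \<longlongrightarrow> 0) (at_right 0)"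
  proof (rule Lim_null_comparison)
    have "((\<lambda>s. C * B ^ Suc M * s ^ (Suc M - j)) \<longlongrightarrow> C * B ^ Suc M * 0 ^ (Suc M - j)) (at_right (0::real))"
      by (intro tendsto_intros)
    then show "((\<lambda>s. C * B ^ Suc M * s ^ (Suc M - j)) \<longlongrightarrow> 0) (at_right (0::real))"
      using j by (simp add: power_0_left)
    have "\<forall>\<^sub>F s in at_right 0. s < \<rho> / B"
      using eventually_at_right_real[of 0 "\<rho> / B"] C(2) B by (auto elim: eventually_mono)
    then show "\<forall>\<^sub>F s in at_right 0. norm ((1 / s ^ j) *\<^sub>R (G (?X s) - P s)) \<le> C * B ^ Suc M * s ^ (Suc M - j)"
      using pos
    proof eventually_elim
      case (elim s)
      have "s * B < \<rho>" using elim B by (simp add: pos_less_divide_eq)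
      then have "norm (?X s) < \<rho>" using Xb[of s] elim by linarith
      then have "norm (G (?X s) - P s) \<le> C * norm (?X s) ^ Suc M" unfolding P_def by (rule C(3))
      also have "\<dots> \<le> C * (s * B) ^ Suc M"
        using Xb[of s] elim C(1) by (intro mult_left_mono power_mono) auto
      finally have "norm (G (?X s) - P s) \<le> C * (s * B) ^ Suc M" .
      then have "norm ((1 / s ^ j) *\<^sub>R (G (?X s) - P s)) \<le> (1 / s ^ j) * (C * (s * B) ^ Suc M)"
        using elim by (simp add: mult_left_mono divide_right_mono)
      also have "\<dots> = C * B ^ Suc M * (s ^ Suc M / s ^ j)" by (simp only: power_mult_distrib) simp
      also have "s ^ Suc M / s ^ j = s ^ (Suc M - j)" using elim j by (subst power_diff) auto
      finally show ?case .
    qed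
  qed
  have "((\<lambda>s. (1 / s ^ j) *\<^sub>R P s + (1 / s ^ j) *\<^sub>R (G (?X s) - P s)) \<longlongrightarrow> Q j + 0) (at_right 0)"
    using lim1 lim2 by (rule tendsto_add)
  moreover have "(1 / s ^ j) *\<^sub>R P s + (1 / s ^ j) *\<^sub>R (G (?X s) - P s) = (1 / s ^ j) *\<^sub>R G (?X s)" for s
    by (simp add: scaleR_right_distrib[symmetric])
  ultimately show ?thesis using Qj[OF j] by simp
qed

end

section \<open>The undetermined coefficients as affine functions\<close>

text \<open>Two entries with index above \<open>k\<close>, or one such entry squared, would have
  weight at least \<open>2k + 2\<close>. Since \<open>i \<le> 2k + 1\<close>, each term contains at
  most one entry of \<open>y\<close>, and only to the first power.\<close>

lemma (in two_spaces) linear_part_T: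
  assumes L: "\<And>\<beta>. \<beta> \<le> i \<Longrightarrow> mlin sa sc UNIV \<beta> (G0 \<beta>)" and i: "i \<le> 2 * k + 1"
  shows "linear_part (\<lambda>y. T G0 i (join k z y)) (\<lambda>\<tau>. sa c (u \<tau>) + v \<tau>)
    = sc c (linear_part (\<lambda>y. T G0 i (join k z y)) u) + linear_part (\<lambda>y. T G0 i (join k z y)) v"
proof -
  let ?t = "\<lambda>y \<beta> n. Tcoeff G0 i (join k z y) \<beta> n"
  let ?N = "\<lambda>\<beta>. {n. n \<in> compositions i \<beta> \<and> weight i n = i}"
  have lp: "linear_part (\<lambda>y. T G0 i (join k z y)) y
      = fact i *\<^sub>R (\<Sum>\<beta>=1..i. \<Sum>n\<in>?N \<beta>. ?t y \<beta> n - ?t (\<lambda>_. 0) \<beta> n)" for y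
    by (simp add: linear_part_def T_eq sum_subtractf scaleR_right_diff_distrib)
  have main: "?t (\<lambda>\<tau>. sa c (u \<tau>) + v \<tau>) \<beta> n - ?t (\<lambda>_. 0) \<beta> n
      = sc c (?t u \<beta> n - ?t (\<lambda>_. 0) \<beta> n) + (?t v \<beta> n - ?t (\<lambda>_. 0) \<beta> n)"
    if \<beta>: "\<beta> \<in> {1..i}" and n: "n \<in> ?N \<beta>" for \<beta> n
  proof (cases "\<exists>\<tau>0\<in>{k+1..i}. n \<tau>0 \<noteq> 0")
    case False
    \<comment> \<open>A term without an index above \<open>k\<close> does not depend on
      \<open>y\<close> and cancels in the linear part.\<close>
    have b: "blocks n (\<lambda>\<tau>. (1 / fact \<tau>) *\<^sub>R join k z y \<tau>) i = blocks n (\<lambda>\<tau>. (1 / fact \<tau>) *\<^sub>R join k z y' \<tau>) i" for y y'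
    proof (rule blocks_cong)
      fix \<tau> assume "\<tau> \<in> {1..i}" "n \<tau> > 0"
      then have "\<tau> \<le> k" using False by (metis Suc_eq_plus1 atLeastAtMost_iff neq0_conv not_less_eq_eq)
      then show "(1 / fact \<tau>) *\<^sub>R join k z y \<tau> = (1 / fact \<tau>) *\<^sub>R join k z y' \<tau>" by (simp add: join_def)
    qed simp
    have t0: "?t y \<beta> n = ?t (\<lambda>_. 0) \<beta> n" for y using b[of y "\<lambda>_. 0"] by (simp add: Tcoeff_def)
    show ?thesis
      unfolding t0[of "\<lambda>\<tau>. sa c (u \<tau>) + v \<tau>"] t0[of u] t0[of v] by simp
  next
    case True
    then obtain \<tau>0 where \<tau>0: "\<tau>0 \<in> {k+1..i}" "n \<tau>0 \<noteq> 0" by blast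
    have w: "weight i n = i" and s: "(\<Sum>\<tau>=1..i. n \<tau>) = \<beta>" using n by (auto simp: compositions_def)
    have split: "weight i n = \<tau>0 * n \<tau>0 + (\<Sum>\<tau>\<in>{1..i}-{\<tau>0}. \<tau> * n \<tau>)"
      unfolding weight_def using \<tau>0 by (intro sum.remove) auto
    have n1: "n \<tau>0 = 1"
    proof (rule ccontr)
      assume "n \<tau>0 \<noteq> 1"
      then have "2 \<le> n \<tau>0" using \<tau>0 by simp
      then have "(k + 1) * 2 \<le> \<tau>0 * n \<tau>0" using \<tau>0 by (intro mult_le_mono) auto
      then show False using split w i by simp
    qed
    have others: "n \<tau> = 0" if "\<tau> \<in> {k+1..i}" "\<tau> \<noteq> \<tau>0" for \<tau>
    proof (rule ccontr)
      assume "n \<tau> \<noteq> 0"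
      then have "(k + 1) * 1 \<le> \<tau> * n \<tau>" using that by (intro mult_le_mono) auto
      also have "\<tau> * n \<tau> \<le> (\<Sum>\<tau>\<in>{1..i}-{\<tau>0}. \<tau> * n \<tau>)"
        using that by (intro member_le_sum) auto
      finally show False using split w i \<tau>0 n1 by simp
    qed
    let ?f = "\<lambda>y \<tau>. replicate (n \<tau>) ((1 / fact \<tau>) *\<^sub>R join k z y \<tau>)"
    have fz: "?f y \<tau> = ?f (\<lambda>_. 0) \<tau>" if "\<tau> \<in> {1..i}" "\<tau> \<noteq> \<tau>0" for y \<tau>
    proof (cases "\<tau> \<le> k")
      case False
      then show ?thesis using others[of \<tau>] that by simp
    qed (simp add: join_def)
    define P where "P = concat (map (?f (\<lambda>_. 0)) [1..<\<tau>0])"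
    define R where "R = concat (map (?f (\<lambda>_. 0)) [Suc \<tau>0..<Suc i])"
    have "[1..<Suc i] = [1..<\<tau>0] @ [\<tau>0..<Suc i]"
      using \<tau>0 upt_add_eq_append[of 1 \<tau>0 "Suc i - \<tau>0"] by (simp del: upt_Suc)
    moreover have "[\<tau>0..<Suc i] = \<tau>0 # [Suc \<tau>0..<Suc i]"
      by (rule upt_conv_Cons) (use \<tau>0 in simp)
    ultimately have "[1..<Suc i] = [1..<\<tau>0] @ \<tau>0 # [Suc \<tau>0..<Suc i]" by (simp only:)
    then have bl: "blocks n (\<lambda>\<tau>. (1 / fact \<tau>) *\<^sub>R join k z y \<tau>) i = P @ ((1 / fact \<tau>0) *\<^sub>R y \<tau>0) # R" for y
    proof -
      assume u: "[1..<Suc i] = [1..<\<tau>0] @ \<tau>0 # [Suc \<tau>0..<Suc i]"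
      have m1: "map (?f y) [1..<\<tau>0] = map (?f (\<lambda>_. 0)) [1..<\<tau>0]"
        by (rule map_cong[OF refl fz]) (use \<tau>0 in auto)
      have m2: "map (?f y) [Suc \<tau>0..<Suc i] = map (?f (\<lambda>_. 0)) [Suc \<tau>0..<Suc i]"
        by (rule map_cong[OF refl fz]) (use \<tau>0 in auto)
      have m3: "?f y \<tau>0 = [(1 / fact \<tau>0) *\<^sub>R y \<tau>0]" using n1 \<tau>0 by (simp add: join_def)
      show ?thesis
        by (simp only: blocks_def u P_def R_def map_append list.map concat_append concat.simps m1 m2 m3
            append_Cons append_Nil)
    qed
    have len: "length P + length R + 1 = \<beta>"
      using length_blocks[of n "\<lambda>\<tau>. (1 / fact \<tau>) *\<^sub>R join k z (\<lambda>_. 0) \<tau>" i] s by (simp add: bl)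
    have ml: "mlin sa sc UNIV \<beta> (G0 \<beta>)" using L \<beta> by simp
    let ?a = "1 / (\<Prod>\<tau>=1..i. fact (n \<tau>)) :: real"
    have t: "?t y \<beta> n = (?a * (1 / fact \<tau>0)) *\<^sub>R G0 \<beta> (P @ y \<tau>0 # R)" for y
      unfolding Tcoeff_def bl using mlin_scaleR[OF ml A.subspace_UNIV, of P R "y \<tau>0" "1 / fact \<tau>0"] len by simp
    have z: "?t (\<lambda>_. 0) \<beta> n = 0"
      unfolding t using mlin_zero[OF ml A.subspace_UNIV, of P R] len by simp
    have "G0 \<beta> (P @ (sa c (u \<tau>0) + v \<tau>0) # R) = sc c (G0 \<beta> (P @ u \<tau>0 # R)) + G0 \<beta> (P @ v \<tau>0 # R)"
      by (rule mlinD[OF ml]) (use len in auto)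
    then show ?thesis
      unfolding z t by (simp add: scaleR_right_distrib C.scale_scaleR)
  qed
  have "(\<Sum>\<beta>=1..i. \<Sum>n\<in>?N \<beta>. ?t (\<lambda>\<tau>. sa c (u \<tau>) + v \<tau>) \<beta> n - ?t (\<lambda>_. 0) \<beta> n)
      = sc c (\<Sum>\<beta>=1..i. \<Sum>n\<in>?N \<beta>. ?t u \<beta> n - ?t (\<lambda>_. 0) \<beta> n) + (\<Sum>\<beta>=1..i. \<Sum>n\<in>?N \<beta>. ?t v \<beta> n - ?t (\<lambda>_. 0) \<beta> n)"
    by (intro C.sum_lin main)
  then show ?thesis
    unfolding lp by (simp add: scaleR_right_distrib C.scale_scaleR)
qed

section \<open>Open mapping and contraction\<close>

text \<open>The open mapping argument on a closed set \<open>S\<close> that is a real subspace but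
  not a type. By Baire, the closure of the image of some ball of \<open>S\<close> contains a ball;
  differences of approximate preimages solve the equation up to half the right hand side, and
  iteration removes the error.\<close>

lemma bounded_right_inverse:
  fixes f :: "'a::banach \<Rightarrow> 'c::banach"
  assumes S: "closed S" "0 \<in> S" "\<And>u v. u \<in> S \<Longrightarrow> v \<in> S \<Longrightarrow> u + v \<in> S" "\<And>r u. u \<in> S \<Longrightarrow> r *\<^sub>R u \<in> S"
    and add: "\<And>u v. u \<in> S \<Longrightarrow> v \<in> S \<Longrightarrow> f (u + v) = f u + f v"
    and sc: "\<And>r u. u \<in> S \<Longrightarrow> f (r *\<^sub>R u) = r *\<^sub>R f u"
    and bd: "\<And>u. u \<in> S \<Longrightarrow> norm (f u) \<le> B * norm u"
    and onto: "f ` S = UNIV"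
  obtains K where "K > 0" "\<And>y. \<exists>u\<in>S. f u = y \<and> norm u \<le> K * norm y"
proof -
  have minus: "u - v \<in> S" "f (u - v) = f u - f v" if "u \<in> S" "v \<in> S" for u v
  proof -
    have v: "(-1) *\<^sub>R v \<in> S" using S(4) that by blast
    show "u - v \<in> S" using S(3)[OF that(1) v] by simp
    show "f (u - v) = f u - f v" using add[OF that(1) v] sc[OF that(2), of "-1"] by simp
  qed
  define A where "A n = closure (f ` (S \<inter> cball 0 (real n)))" for n
  have "\<exists>n. interior (A n) \<noteq> {}"
  proof (rule ccontr)
    assume "\<not> ?thesis"
    then have "euclidean interior_of \<Union>(range A) = {}"
      by (intro Baire_category_alt) (auto simp: completely_metrizable_space_euclidean A_def)
    moreover have "\<Union>(range A) = UNIV"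
    proof -
      have "y \<in> \<Union>(range A)" for y
      proof -
        obtain u where u: "u \<in> S" "f u = y" using onto by (metis UNIV_I imageE)
        obtain n where "norm u \<le> real n" using real_arch_simple by blast
        then have "y \<in> f ` (S \<inter> cball 0 (real n))" using u by auto
        then have "y \<in> A n" unfolding A_def by (rule subsetD[OF closure_subset])
        then show ?thesis by blast
      qed
      then show ?thesis by blast
    qed
    ultimately show False by simp
  qed
  then obtain n y0 where "y0 \<in> interior (A n)" by blast
  then obtain r where r: "r > 0" "ball y0 r \<subseteq> A n" by (meson mem_interior)
  \<comment> \<open>Two preimages of norm at most \<open>n\<close>, rescaled by
    \<open>1 / c = 2 * norm y / r\<close>, differ by at most \<open>4 * n / r * norm y\<close>; the
    summand \<open>1\<close> keeps \<open>K1\<close> positive for \<open>n = 0\<close>.\<close>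
  define K1 where "K1 = (4 * real n + 1) / r"
  have K1: "K1 > 0" using r by (simp add: K1_def add_nonneg_pos)
  have near: "\<exists>w\<in>S. norm w \<le> K1 * norm y \<and> norm (f w - y) \<le> norm y / 2" for y
  proof (cases "y = 0")
    case True
    then show ?thesis using S(2) minus(2)[OF S(2) S(2)] by (intro bexI[of _ 0]) auto
  next
    case False
    \<comment> \<open>With this scaling \<open>y0 + c *\<^sub>R y\<close> has distance
      \<open>r / 2\<close> from \<open>y0\<close> and stays in the ball, while two approximation
      errors of \<open>r / 8\<close> become \<open>norm y / 2\<close> after division by
      \<open>c\<close>.\<close>
    define c where "c = r / (2 * norm y)"
    have c: "c > 0" using False r by (simp add: c_def)
    have ncy: "norm (c *\<^sub>R y) = r / 2" using False r by (simp add: c_def)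
    have mem: "y0 \<in> A n" "y0 + c *\<^sub>R y \<in> A n" using r ncy by (auto simp: subset_iff dist_norm)
    have e: "r / 8 > 0" using r by simp
    obtain v where v: "v \<in> S" "norm v \<le> real n" "dist (f v) y0 < r / 8"
      using mem(1)[unfolded A_def closure_approachable, rule_format, OF e] by auto
    obtain u where u: "u \<in> S" "norm u \<le> real n" "dist (f u) (y0 + c *\<^sub>R y) < r / 8"
      using mem(2)[unfolded A_def closure_approachable, rule_format, OF e] by auto
    define w where "w = (1 / c) *\<^sub>R (u - v)"
    have wS: "w \<in> S" using minus(1)[OF u(1) v(1)] S(4) by (simp add: w_def)
    have fw: "f w = (1 / c) *\<^sub>R (f u - f v)"
      using sc[OF minus(1)[OF u(1) v(1)]] minus(2)[OF u(1) v(1)] by (simp add: w_def)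
    have "norm w = (1 / c) * norm (u - v)" using c by (simp add: w_def)
    also have "\<dots> \<le> (1 / c) * (2 * real n)"
      using u(2) v(2) norm_triangle_ineq4[of u v] c by (intro mult_left_mono) auto
    also have "\<dots> = 4 * real n / r * norm y" using False r by (simp add: c_def)
    also have "\<dots> \<le> K1 * norm y" using r by (intro mult_right_mono) (auto simp: K1_def divide_right_mono)
    finally have nw: "norm w \<le> K1 * norm y" .
    have "norm (f w - y) = norm ((1 / c) *\<^sub>R ((f u - (y0 + c *\<^sub>R y)) - (f v - y0)))"
      unfolding fw using c by (simp add: algebra_simps)
    also have "\<dots> = (1 / c) * norm ((f u - (y0 + c *\<^sub>R y)) - (f v - y0))" using c by simp
    also have "\<dots> \<le> (1 / c) * (r / 8 + r / 8)"
      using u(3) v(3) c norm_triangle_ineq4[of "f u - (y0 + c *\<^sub>R y)" "f v - y0"]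
      by (intro mult_left_mono) (auto simp: dist_norm)
    also have "\<dots> = norm y / 2" using False r by (simp add: c_def field_simps)
    finally show ?thesis using wS nw by blast
  qed
  define w where "w y = (SOME w. w \<in> S \<and> norm w \<le> K1 * norm y \<and> norm (f w - y) \<le> norm y / 2)" for y
  have w: "w y \<in> S" "norm (w y) \<le> K1 * norm y" "norm (f (w y) - y) \<le> norm y / 2" for y
    using someI_ex[of "\<lambda>w. w \<in> S \<and> norm w \<le> K1 * norm y \<and> norm (f w - y) \<le> norm y / 2"] near[of y]
    unfolding w_def by blast+
  have "\<exists>u\<in>S. f u = y \<and> norm u \<le> (2 * K1) * norm y" for y
  proof -
    \<comment> \<open>The residual after \<open>k\<close> corrections. It at least halves each time,
      so the corrections, each at most \<open>K1\<close> times the current residual, sum to at most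
      \<open>2 * K1 * norm y\<close>.\<close>
    define res where "res k = ((\<lambda>y. y - f (w y)) ^^ k) y" for k
    have res: "norm (res k) \<le> norm y * (1 / 2) ^ k" for k
    proof (induction k)
      case (Suc k)
      have "norm (res (Suc k)) = norm (f (w (res k)) - res k)" by (simp add: res_def norm_minus_commute)
      also have "\<dots> \<le> norm (res k) / 2" by (rule w(3))
      finally show ?case using Suc by simp
    qed (simp add: res_def)
    define ps where "ps m = (\<Sum>k<m. w (res k))" for m
    have ps: "ps m \<in> S \<and> f (ps m) = y - res m" for m
    proof (induction m)
      case 0
      show ?case using S(2) minus(2)[OF S(2) S(2)] by (simp add: ps_def res_def)
    next
      case (Suc m)
      have "ps (Suc m) = ps m + w (res m)" by (simp add: ps_def)
      moreover have "res (Suc m) = res m - f (w (res m))" by (simp add: res_def)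
      ultimately show ?case using Suc S(3) w(1) add by simp
    qed
    have wb: "norm (w (res k)) \<le> K1 * norm y * (1 / 2) ^ k" for k
    proof -
      have "norm (w (res k)) \<le> K1 * norm (res k)" by (rule w(2))
      also have "\<dots> \<le> K1 * (norm y * (1 / 2) ^ k)" using res K1 by (intro mult_left_mono) auto
      finally show ?thesis by simp
    qed
    have geo: "(\<lambda>k. K1 * norm y * (1 / 2) ^ k) sums (K1 * norm y * 2)"
      using sums_mult[OF geometric_sums[of "1/2 :: real"], of "K1 * norm y"] by simp
    have sn: "summable (\<lambda>k. norm (w (res k)))"
      by (rule summable_comparison_test'[OF sums_summable[OF geo], of 0]) (use wb in simp)
    define u where "u = (\<Sum>k. w (res k))"
    have lim: "ps \<longlonglongrightarrow> u"
      unfolding ps_def u_def using summable_LIMSEQ[OF summable_norm_cancel[OF sn]] .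
    have uS: "u \<in> S" using closed_sequentially[OF S(1) _ lim] ps by blast
    have "norm u \<le> (\<Sum>k. norm (w (res k)))" unfolding u_def by (rule summable_norm[OF sn])
    also have "\<dots> \<le> (\<Sum>k. K1 * norm y * (1 / 2) ^ k)" by (rule suminf_le[OF wb sn sums_summable[OF geo]])
    also have "\<dots> = (2 * K1) * norm y" using sums_unique[OF geo] by simp
    finally have nu: "norm u \<le> (2 * K1) * norm y" .
    have res0: "res \<longlonglongrightarrow> 0"
    proof (rule Lim_null_comparison)
      show "\<forall>\<^sub>F k in sequentially. norm (res k) \<le> norm y * (1 / 2) ^ k" using res by simp
      have "(\<lambda>k. norm y * (1 / 2) ^ k) \<longlonglongrightarrow> norm y * 0"
        by (intro tendsto_mult tendsto_const LIMSEQ_power_zero) simp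
      then show "(\<lambda>k. norm y * (1 / 2) ^ k) \<longlonglongrightarrow> 0" by simp
    qed
    have "(\<lambda>m. f (ps m) - f u) \<longlonglongrightarrow> 0"
    proof (rule Lim_null_comparison)
      show "\<forall>\<^sub>F m in sequentially. norm (f (ps m) - f u) \<le> B * norm (ps m - u)"
        using bd[OF minus(1)[OF _ uS]] minus(2)[OF _ uS] ps by (intro always_eventually) metis
      have "(\<lambda>m. B * norm (ps m - u)) \<longlonglongrightarrow> B * norm (u - u)" by (intro tendsto_intros lim)
      then show "(\<lambda>m. B * norm (ps m - u)) \<longlonglongrightarrow> 0" by simp
    qed
    then have "(\<lambda>m. f (ps m)) \<longlonglongrightarrow> f u" by (rule LIM_zero_cancel)
    moreover have "(\<lambda>m. f (ps m)) \<longlonglongrightarrow> y - 0" using ps by (simp only:) (intro tendsto_intros res0)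
    ultimately have "f u = y" using LIMSEQ_unique by fastforce
    with uS nu show ?thesis by blast
  qed
  then show thesis using that[of "2 * K1"] K1 by simp
qed

lemma perturbed_solution:
  fixes A0 :: "'a::banach \<Rightarrow> 'c::real_normed_vector"
  assumes Nc: "closed Nc" "\<And>u v. u \<in> Nc \<Longrightarrow> v \<in> Nc \<Longrightarrow> u - v \<in> Nc"
    and A0: "\<And>u v. u \<in> Nc \<Longrightarrow> v \<in> Nc \<Longrightarrow> A0 (u - v) = A0 u - A0 v"
    and K: "K > 0" "\<And>u. u \<in> Nc \<Longrightarrow> norm u \<le> K * norm (A0 u)"
    and \<Lambda>: "\<And>y. \<Lambda> y \<in> Nc" "\<And>y. A0 (\<Lambda> y) = y"
    and u0: "u0 \<in> Nc" and F0: "K * norm (F u0) \<le> \<rho> / 2"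
    and F: "\<And>u v. u \<in> Nc \<inter> cball u0 \<rho> \<Longrightarrow> v \<in> Nc \<inter> cball u0 \<rho> \<Longrightarrow>
      norm (F u - F v - A0 (u - v)) \<le> (1 / (2 * K)) * norm (u - v)"
  shows "\<exists>u\<in>Nc \<inter> cball u0 \<rho>. F u = 0"
proof -
  let ?S = "Nc \<inter> cball u0 \<rho>" and ?\<Psi> = "\<lambda>u. u - \<Lambda> (F u)"
  have \<rho>: "\<rho> \<ge> 0"
  proof -
    have "0 \<le> K * norm (F u0)" using K by simp
    with F0 show ?thesis by linarith
  qed
  have lip: "norm (?\<Psi> u - ?\<Psi> v) \<le> 1 / 2 * norm (u - v)" if "u \<in> ?S" "v \<in> ?S" for u v
  proof -
    have m: "u - v \<in> Nc" "\<Lambda> (F u) - \<Lambda> (F v) \<in> Nc" using that Nc(2) \<Lambda> by auto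
    have eq: "?\<Psi> u - ?\<Psi> v = (u - v) - (\<Lambda> (F u) - \<Lambda> (F v))" by simp
    have "A0 (?\<Psi> u - ?\<Psi> v) = A0 (u - v) - (F u - F v)"
      unfolding eq A0[OF m] A0[OF \<Lambda>(1) \<Lambda>(1)] \<Lambda>(2) ..
    also have "norm \<dots> = norm (F u - F v - A0 (u - v))" by (rule norm_minus_commute)
    finally have An: "norm (A0 (?\<Psi> u - ?\<Psi> v)) = norm (F u - F v - A0 (u - v))" .
    have "norm (?\<Psi> u - ?\<Psi> v) \<le> K * norm (A0 (?\<Psi> u - ?\<Psi> v))"
      by (rule K(2)) (simp only: eq Nc(2)[OF m])
    then have "norm (?\<Psi> u - ?\<Psi> v) \<le> K * norm (F u - F v - A0 (u - v))" unfolding An .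
    also have "\<dots> \<le> K * ((1 / (2 * K)) * norm (u - v))"
      using F[OF that] K by (intro mult_left_mono) auto
    also have "\<dots> = 1 / 2 * norm (u - v)" using K by simp
    finally show ?thesis .
  qed
  have u0S: "u0 \<in> ?S" using u0 \<rho> by simp
  have "norm (\<Lambda> (F u0)) \<le> K * norm (F u0)" using K(2)[OF \<Lambda>(1), of "F u0"] \<Lambda>(2) by simp
  then have base: "norm (?\<Psi> u0 - u0) \<le> \<rho> / 2" using F0 by simp
  have "\<exists>!u\<in>?S. ?\<Psi> u = u"
  proof (rule Banach_fix)
    show "complete ?S" using Nc(1) by (simp add: complete_eq_closed closed_Int)
    show "?S \<noteq> {}" using u0S by blast
    show "?\<Psi> ` ?S \<subseteq> ?S"
    proof (rule image_subsetI)
      fix u assume u: "u \<in> ?S"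
      have "norm (?\<Psi> u - u0) \<le> norm (?\<Psi> u - ?\<Psi> u0) + norm (?\<Psi> u0 - u0)"
        using norm_triangle_ineq[of "?\<Psi> u - ?\<Psi> u0" "?\<Psi> u0 - u0"] by simp
      also have "\<dots> \<le> 1 / 2 * norm (u - u0) + \<rho> / 2" by (intro add_mono lip u u0S base)
      also have "\<dots> \<le> \<rho>" using u by (simp add: dist_norm norm_minus_commute)
      finally show "?\<Psi> u \<in> ?S"
        using u \<Lambda>(1) Nc(2) by (simp add: dist_norm norm_minus_commute)
    qed
    show "dist (?\<Psi> u) (?\<Psi> v) \<le> 1 / 2 * dist u v" if "u \<in> ?S" "v \<in> ?S" for u v
      unfolding dist_norm using lip[OF that] .
  qed auto
  then obtain u where u: "u \<in> ?S" "?\<Psi> u = u" by blast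
  have "F u = A0 (\<Lambda> (F u))" by (simp add: \<Lambda>)
  also have "\<Lambda> (F u) = 0" using u(2) by simp
  also have "A0 0 = 0" using A0[OF u0 u0] by simp
  finally show ?thesis using u(1) by blast
qed

section \<open>The blown-up equation\<close>

lemma normed_over_scale_seq:
  fixes s :: "'k::real_normed_field \<Rightarrow> 'b::banach \<Rightarrow> 'b"
  assumes "banach_over s"
  shows "normed_over (scale_seq s)"
proof -
  interpret banach_over s by fact
  note a = apply_scale_seq
  show ?thesis
  proof
    fix a b :: 'k and x y :: "nat \<Rightarrow>\<^sub>C 'b"
    show "scale_seq s a (x + y) = scale_seq s a x + scale_seq s a y"
      by (rule bcontfun_eqI) (simp add: a scale_right_distrib)
    show "scale_seq s (a + b) x = scale_seq s a x + scale_seq s b x"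
      by (rule bcontfun_eqI) (simp add: a scale_left_distrib)
    show mult: "scale_seq s a (scale_seq s b x) = scale_seq s (a * b) x" for a b x
      by (rule bcontfun_eqI) (simp add: apply_scale_seq)
    show one: "scale_seq s 1 x = x" for x
      by (rule bcontfun_eqI) (simp add: apply_scale_seq)
    show "scale_seq s (of_real r) x = r *\<^sub>R x" for r
      by (rule bcontfun_eqI) (simp add: a scale_of_real)
    have le: "norm (scale_seq s a x) \<le> norm a * norm x" for a x
      by (rule norm_bound) (simp add: apply_scale_seq norm_scale mult_left_mono norm_bounded)
    show "norm (scale_seq s a x) = norm a * norm x"
    proof (cases "a = 0")
      case True
      then show ?thesis using le[of a x] by simp
    next
      case False
      \<comment> \<open>The reverse inequality is \<open>le\<close> for the inverse scalar.\<close>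
      have "norm x = norm (scale_seq s (inverse a) (scale_seq s a x))"
        using False by (simp add: mult one)
      also have "\<dots> \<le> norm (inverse a) * norm (scale_seq s a x)" by (rule le)
      finally have "norm a * norm x \<le> norm a * (norm (inverse a) * norm (scale_seq s a x))"
        by (intro mult_left_mono) auto
      also have "\<dots> = norm (scale_seq s a x)" using False by (simp add: norm_inverse)
      finally show ?thesis using le[of a x] by simp
    qed
  qed
qed

lemma (in pair_setting) regular_eps_power:
  assumes "regular r f D"
  shows "\<exists>D. regular r (\<lambda>p. sc (fst p ^ i) (f p)) D"
proof (induction i)
  case 0
  show ?case using assms by auto
next
  case (Suc i)
  then obtain D' where "regular r (\<lambda>p. sc (fst p ^ i) (f p)) D'" by blast
  from regular_eps[OF this] show ?case by auto
qed

lemma (in pair_setting) regular_sum: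
  fixes n :: nat
  assumes "\<And>i. i \<in> {1..n} \<Longrightarrow> \<exists>D. regular r (f i) D"
  shows "\<exists>D. regular r (\<lambda>p. \<Sum>i=1..n. f i p) D"
  using assms
proof (induction n)
  case 0
  have "regular r (\<lambda>p. 0 + (\<lambda>_. 0) (snd p)) (Daff 0 (\<lambda>_. 0))"
    by (rule regular_affine[where C = 0]) auto
  then show ?case by auto
next
  case (Suc n)
  then obtain D D' where "regular r (\<lambda>p. \<Sum>i=1..n. f i p) D" "regular r (f (Suc n)) D'"
    by force
  from regular_add[OF this] show ?case by auto
qed

locale cone_setting =
  fixes sB :: "'k::real_normed_field \<Rightarrow> 'b::banach \<Rightarrow> 'b" and sC :: "'k \<Rightarrow> 'c::banach \<Rightarrow> 'c"
    and k q :: nat and G :: "'b \<Rightarrow> 'c" and DG :: "nat \<Rightarrow> 'b \<Rightarrow> 'b list \<Rightarrow> 'c" and z :: "nat \<Rightarrow> 'b"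
    and E :: "(nat \<Rightarrow>\<^sub>C 'b) set"
  assumes sB: "banach_over sB" and sC: "banach_over sC"
    and k: "k \<ge> 1" and q: "q \<ge> 2 * k + 2"
    and DG: "has_frechet_derivs sB sC UNIV UNIV q G DG" and G_0: "G 0 = 0"
    and Tz: "\<forall>i\<in>{1..2*k}. T (\<lambda>\<beta>. DG \<beta> 0) i z = 0"
    and E_eq: "E = B_times_kernel_Delta (\<lambda>\<beta>. DG \<beta> 0) k z"
begin

sublocale B: banach_over sB by (rule sB)
sublocale C: banach_over sC by (rule sC)
sublocale BC: two_spaces_banach sB sC ..

abbreviation "se \<equiv> scale_seq sB"
abbreviation "G0 \<equiv> \<lambda>\<beta>. DG \<beta> 0"

sublocale S: normed_over se by (rule normed_over_scale_seq[OF sB])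

text \<open>For \<open>i\<close> from \<open>k + 1\<close> to \<open>2k\<close> these are the rows
  of \<open>Delta\<close>, and for \<open>i = 2k + 1\<close> it is \<open>W\<close>; one family
  allows a single linearity lemma.\<close>

definition LP where "LP i = linear_part (\<lambda>y. T G0 i (join k z y))"

lemma LP_lin:
  assumes "i \<le> 2 * k + 1"
  shows "LP i (\<lambda>\<tau>. sB c (u \<tau>) + v \<tau>) = sC c (LP i u) + LP i v"
  unfolding LP_def using assms q
  by (intro BC.linear_part_T BC.UD_mlin[OF DG]) auto

lemma LP_seq:
  assumes "i \<le> 2 * k + 1"
  shows "LP i (apply_bcontfun (se c u + v)) = sC c (LP i (apply_bcontfun u)) + LP i (apply_bcontfun v)"
proof -
  have "apply_bcontfun (se c u + v) = (\<lambda>\<tau>. sB c (apply_bcontfun u \<tau>) + apply_bcontfun v \<tau>)"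
    by (rule ext) (simp add: B.apply_scale_seq)
  then show ?thesis using LP_lin[OF assms] by simp
qed

lemma W_LP: "W G0 k z = LP (2 * k + 1)"
  by (rule ext) (simp add: W_def LP_def)

text \<open>\<open>T\<close> of order at most \<open>2k\<close> does not see the entry of index
  \<open>2k + 1\<close>, so setting that entry to zero in the definition of the space changes none
  of the conditions.\<close>

lemma E_iff: "y \<in> E \<longleftrightarrow> (\<forall>i. i \<notin> {k+1..2*k+1} \<longrightarrow> apply_bcontfun y i = 0)
    \<and> (\<forall>i\<in>{k+1..2*k}. LP i (apply_bcontfun y) = 0)"
proof -
  have "T G0 i (join k z ((apply_bcontfun y)(2*k+1 := 0))) = T G0 i (join k z (apply_bcontfun y))"
    if "i \<in> {k+1..2*k}" for i
    by (rule T_cong) (use that in \<open>auto simp: join_def\<close>)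
  then have "linear_part (\<lambda>y. T G0 i (join k z y)) ((apply_bcontfun y)(2*k+1 := 0)) = LP i (apply_bcontfun y)"
    if "i \<in> {k+1..2*k}" for i
    using that by (simp add: linear_part_def LP_def)
  then show ?thesis
    unfolding E_eq B_times_kernel_Delta_def kernel_Delta_def Delta_def
    by (auto simp: fun_eq_iff)
qed

lemma LP_0: "i \<le> 2 * k + 1 \<Longrightarrow> LP i (\<lambda>_. 0) = 0"
  by (simp add: LP_def linear_part_def)

lemma E_subspace: "S.subspace E"
  unfolding S.subspace_def
proof (intro conjI ballI allI)
  show "0 \<in> E" by (simp add: E_iff LP_0 zero_bcontfun.rep_eq[abs_def])
  show "x + y \<in> E" if "x \<in> E" "y \<in> E" for x y
    using that LP_seq[of _ 1 x y] by (auto simp: E_iff)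
  show "se c x \<in> E" if "x \<in> E" for c x
    using that LP_seq[of _ c x 0] LP_0 by (auto simp: E_iff B.apply_scale_seq zero_bcontfun.rep_eq[abs_def])
qed

sublocale PB: pair_setting se sB E
  by unfold_locales (rule E_subspace)
sublocale PC: pair_setting_banach se sC E
  by unfold_locales (rule E_subspace)

definition pt where "pt p = cone_point sB k z (fst p) (snd p)"

text \<open>The form suited to the closure properties of regular functions: each summand is a power
  of \<open>\<epsilon>\<close> times an affine function of \<open>b\<close>.\<close>

lemma pt_eq: "pt p = (\<Sum>i=1..2*k+1. sB (fst p ^ i) (sB (1 / fact i) (z i)
    + sB (1 / fact i) (if i \<le> k then 0 else apply_bcontfun (snd p) i)))"
proof -
  let ?f = "\<lambda>i. sB (fst p ^ i) (sB (1 / fact i) (z i)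
    + sB (1 / fact i) (if i \<le> k then 0 else apply_bcontfun (snd p) i))"
  have f: "?f i = sB (fst p ^ i / fact i) (z i + (if i \<le> k then 0 else apply_bcontfun (snd p) i))" for i
    by (simp add: B.scale_right_distrib[symmetric])
  have "(\<Sum>i=1..k+(k+1). ?f i) = (\<Sum>i=1..k. ?f i) + (\<Sum>i=k+1..k+(k+1). ?f i)"
    by (rule sum.ub_add_nat) simp
  moreover have "(\<Sum>i=1..k. ?f i) = (\<Sum>i=1..k. sB (fst p ^ i / fact i) (z i))"
    unfolding f by (rule sum.cong) auto
  moreover have "(\<Sum>i=k+1..k+(k+1). ?f i) = (\<Sum>i=k+1..k+(k+1). sB (fst p ^ i / fact i) (z i + apply_bcontfun (snd p) i))"
    unfolding f by (rule sum.cong) auto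
  moreover have "k + (k + 1) = 2 * k + 1" by simp
  ultimately show ?thesis by (simp only: pt_def cone_point_def)
qed

lemma pt_0: "pt (0, b) = 0"
  unfolding pt_eq by (intro sum.neutral) (auto simp: power_0_left)

lemma pt_regular: "\<exists>D. PB.regular q pt D"
proof -
  have "\<exists>D. PB.regular q (\<lambda>p. \<Sum>i=1..2*k+1. sB (fst p ^ i) (sB (1 / fact i) (z i)
    + sB (1 / fact i) (if i \<le> k then 0 else apply_bcontfun (snd p) i))) D"
  proof (rule PB.regular_sum)
    fix i
    have "PB.regular q (\<lambda>p. sB (1 / fact i) (z i) + (\<lambda>b. sB (1 / fact i) (if i \<le> k then 0 else apply_bcontfun b i)) (snd p))
        (PB.Daff (sB (1 / fact i) (z i)) (\<lambda>b. sB (1 / fact i) (if i \<le> k then 0 else apply_bcontfun b i)))"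
    proof (rule PB.regular_affine[where C = "norm (1 / fact i :: 'k)"])
      show "sB (1 / fact i) (if i \<le> k then 0 else apply_bcontfun (se c u + v) i)
        = sB c (sB (1 / fact i) (if i \<le> k then 0 else apply_bcontfun u i)) + sB (1 / fact i) (if i \<le> k then 0 else apply_bcontfun v i)" for c u v
        by (simp add: B.apply_scale_seq B.scale_right_distrib mult.commute)
      show "norm (sB (1 / fact i) (if i \<le> k then 0 else apply_bcontfun u i)) \<le> norm (1 / fact i :: 'k) * norm u" for u
        unfolding B.norm_scale by (intro mult_left_mono) (auto simp: norm_bounded)
    qed simp
    from PB.regular_eps_power[OF this, of i]
    show "\<exists>D. PB.regular q (\<lambda>p. sB (fst p ^ i) (sB (1 / fact i) (z i)
      + sB (1 / fact i) (if i \<le> k then 0 else apply_bcontfun (snd p) i))) D" .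
  qed
  then show ?thesis unfolding pt_eq[abs_def] .
qed

definition g where "g p = G (pt p)"

lemma g_regular: "\<exists>D. PC.regular q g D"
proof -
  obtain D where D: "PB.regular q pt D" using pt_regular by blast
  have "ccont (zfilter E R) UNIV q DG pt (\<lambda>p. pt (0, snd p))" for R
  proof -
    have "filterlim pt (nhds 0) (zfilter E R)"
      using PB.regular_tendsto[OF D, of R] by (simp add: pt_0)
    from BC.ccont_at_limit[OF DG this] show ?thesis by (simp add: pt_0)
  qed
  from regular_compose[OF PB.pair_setting_axioms PC.pair_setting_axioms D DG this]
  show ?thesis unfolding g_def[abs_def] by blast
qed

definition coeffs where "coeffs b i = join k z (\<lambda>i. z i + apply_bcontfun b i) i"

lemma pt_real: "pt (of_real s, b) = (\<Sum>i=1..2*k+1. (s ^ i / fact i) *\<^sub>R coeffs b i)"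
  unfolding pt_eq
proof (rule sum.cong[OF refl])
  fix i
  have "of_real s ^ i * (1 / fact i) = (of_real (s ^ i / fact i) :: 'k)" by simp
  then show "sB (fst (of_real s, b) ^ i) (sB (1 / fact i) (z i)
      + sB (1 / fact i) (if i \<le> k then 0 else apply_bcontfun (snd (of_real s, b)) i)) = (s ^ i / fact i) *\<^sub>R coeffs b i"
    unfolding B.scale_right_distrib[symmetric] B.scale_scale fst_conv snd_conv
    by (simp only: B.scale_of_real) (simp add: coeffs_def join_def)
qed

lemma T_coeffs:
  assumes b: "b \<in> E" and i: "1 \<le> i" "i \<le> 2 * k + 1"
  shows "T G0 i (coeffs b) = T G0 i z + LP i (apply_bcontfun b)"
proof -
  have "LP i (\<lambda>\<tau>. sB 1 (apply_bcontfun b \<tau>) + z \<tau>) = sC 1 (LP i (apply_bcontfun b)) + LP i z"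
    by (rule LP_lin[OF i(2)])
  moreover have "T G0 i (join k z z) = T G0 i z" by (rule T_cong) (simp add: join_def)
  moreover have "coeffs b = join k z (\<lambda>\<tau>. apply_bcontfun b \<tau> + z \<tau>)"
    by (rule ext) (simp add: coeffs_def join_def add.commute)
  ultimately show ?thesis
    by (simp add: LP_def linear_part_def algebra_simps)
qed

lemma T_coeffs_0:
  assumes b: "b \<in> E" and i: "1 \<le> i" "i \<le> 2 * k"
  shows "T G0 i (coeffs b) = 0"
proof (cases "i \<le> k")
  case True
  have "T G0 i (coeffs b) = T G0 i z"
    by (rule T_cong) (use True in \<open>auto simp: coeffs_def join_def\<close>)
  then show ?thesis using Tz i by simp
next
  case False
  then show ?thesis using T_coeffs[OF b i(1)] b i Tz by (auto simp: E_iff)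
qed

text \<open>At \<open>\<epsilon> = 0\<close> the factorisation of \<open>g\<close> says nothing
  about \<open>h\<close>; continuity of \<open>h\<close> recovers its value as the limit along real
  \<open>\<epsilon> > 0\<close>, where \<open>cone_limit\<close> applies.\<close>

lemma quotient_at_0:
  assumes h: "PC.regular r h D" and gh: "\<And>p. p \<in> PC.V \<Longrightarrow> g p = sC (fst p ^ j) (h p)"
    and b: "b \<in> E" and j: "1 \<le> j" "j \<le> 2 * k + 1"
  shows "h (0, b) = (1 / fact j) *\<^sub>R T G0 j (coeffs b)"
proof -
  have "((\<lambda>s. (1 / s ^ j) *\<^sub>R G (\<Sum>i=1..2*k+1. (s ^ i / fact i) *\<^sub>R coeffs b i)) \<longlongrightarrow> (1 / fact j) *\<^sub>R T G0 j (coeffs b)) (at_right 0)"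
    by (rule BC.cone_limit[OF DG G_0]) (use q j T_coeffs_0[OF b] in auto)
  then have 1: "((\<lambda>s. (1 / s ^ j) *\<^sub>R g (of_real s, b)) \<longlongrightarrow> (1 / fact j) *\<^sub>R T G0 j (coeffs b)) (at_right 0)"
    by (simp only: g_def pt_real)
  have "\<forall>\<^sub>F s in at_right 0. (1 / s ^ j) *\<^sub>R g (of_real s, b) = h (of_real s, b)"
    using eventually_at_right_less[of "0::real"]
  proof eventually_elim
    case (elim s)
    have "sC (of_real s ^ j) (h (of_real s, b)) = (s ^ j) *\<^sub>R h (of_real s, b)"
      by (simp only: C.scale_of_real of_real_power[symmetric])
    then show ?case using gh[of "(of_real s, b)"] b elim by simp
  qed
  from Lim_transform_eventually[OF 1 this]
  have "((\<lambda>s. h (of_real s, b)) \<longlongrightarrow> (1 / fact j) *\<^sub>R T G0 j (coeffs b)) (at_right 0)" .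
  moreover have "((\<lambda>s. h (of_real s, b)) \<longlongrightarrow> h (0, b)) (at_right 0)"
  proof (rule filterlim_compose[OF PC.P.hfd_tendsto[OF PC.regular_hfd[OF h] PC.V order_refl]])
    show "(0, b) \<in> PC.V" using b by simp
    have "((\<lambda>s. (of_real s :: 'k, b)) \<longlongrightarrow> (of_real 0, b)) (at_right 0)"
      by (intro tendsto_intros)
    then show "filterlim (\<lambda>s. (of_real s, b)) (nin (0, b) PC.V) (at_right 0)"
      using b by (simp add: nin_def filterlim_inf filterlim_principal)
  qed
  ultimately show ?thesis using tendsto_unique[OF trivial_limit_at_right_real] by blast
qed

lemma blow_up: "j \<le> 2 * k + 1 \<Longrightarrow> \<exists>h D. PC.regular (q - j) h D \<and> (\<forall>p\<in>PC.V. g p = sC (fst p ^ j) (h p))"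
proof (induction j)
  case 0
  show ?case using g_regular by auto
next
  case (Suc j)
  then obtain h D where h: "PC.regular (q - j) h D" and gh: "\<forall>p\<in>PC.V. g p = sC (fst p ^ j) (h p)" by auto
  have qj: "q - j = Suc (q - Suc j)" using Suc.prems q by simp
  \<comment> \<open>The condition for one more division. For \<open>j = 0\<close> it is
    \<open>G 0 = 0\<close>, and for \<open>1 \<le> j \<le> 2k\<close> the vanishing of
    \<open>T\<close> of order \<open>j\<close> at the perturbed coefficients.\<close>
  have h0: "h (0, b) = 0" if b: "b \<in> E" for b
  proof (cases "j = 0")
    case True
    then show ?thesis using bspec[OF gh, of "(0, b)"] b G_0 by (simp add: g_def pt_0)
  next
    case False
    then show ?thesis
      using quotient_at_0[OF h _ b, of j] gh T_coeffs_0[OF b, of j] Suc.prems by simp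
  qed
  show ?case
  proof (intro exI conjI ballI)
    show "PC.regular (q - Suc j) (\<lambda>p. PC.Dh D 0 p []) (PC.Dh D)"
      by (rule PC.regular_divide(1)[OF h[unfolded qj] h0])
    fix p assume p: "p \<in> PC.V"
    have "h p = sC (fst p) (PC.Dh D 0 p [])"
      by (rule PC.regular_divide(2)[OF h[unfolded qj] h0 p])
    then
    show "g p = sC (fst p ^ Suc j) (PC.Dh D 0 p [])"
      using bspec[OF gh p] by (simp add: mult.commute)
  qed
qed

end

text \<open>The library proves completeness of \<^typ>\<open>'a \<Rightarrow>\<^sub>C 'b\<close> only over metric spaces.\<close>

instantiation nat :: metric_space
begin

definition dist_nat :: "nat \<Rightarrow> nat \<Rightarrow> real"
  where "dist_nat m n = \<bar>real m - real n\<bar>"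

definition uniformity_nat :: "(nat \<times> nat) filter"
  where "uniformity_nat = (INF e\<in>{0 <..}. principal {(x, y). dist x y < e})"

instance
proof
  show "uniformity = (INF e\<in>{0 <..}. principal {(x::nat, y). dist x y < e})"
    by (rule uniformity_nat_def)
  have eq: "b = a" if "\<bar>real a - real b\<bar> < 1" for a b :: nat using that by linarith
  have "\<forall>\<^sub>F (x', y) in uniformity. x' = x \<longrightarrow> y \<in> U" if "x \<in> U" for x and U :: "nat set"
    unfolding uniformity_nat_def
    by (rule eventually_INF1[of 1]) (use that in \<open>auto simp: eventually_principal dist_nat_def dest: eq\<close>)
  then show "open U \<longleftrightarrow> (\<forall>x\<in>U. \<forall>\<^sub>F (x', y) in uniformity. x' = x \<longrightarrow> y \<in> U)" for U :: "nat set"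
    by (auto simp: open_discrete)
qed (auto simp: dist_nat_def)

end

instance bcontfun :: (metric_space, banach) banach ..

text \<open>\<open>\<delta>2\<close> precedes \<open>\<delta>1\<close>, because
  \<open>\<delta>1\<close> must make the deviation of \<open>H\<close> from its values at
  \<open>\<epsilon> = 0\<close> small compared with \<open>\<delta>2\<close>. The equivalence leaves
  out \<open>\<epsilon> = 0\<close>, where all cone points coincide and do not determine
  \<open>nc\<close>.\<close>

lemma (in cone_setting) solution_branch:
  fixes N Nc :: "(nat \<Rightarrow>\<^sub>C 'b) set" and bbar :: "nat \<Rightarrow>\<^sub>C 'b" and \<gamma> :: real
  assumes onto: "(\<lambda>y. W G0 k z (apply_bcontfun y)) ` E = UNIV"
    and N: "N = {y\<in>E. W G0 k z (apply_bcontfun y) = 0}"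
    and Nc: "S.subspace Nc" "closed Nc"
    and sum: "E = {u + v | u v. u \<in> Nc \<and> v \<in> N}" and int: "Nc \<inter> N = {0}"
    and bbar: "bbar \<in> Nc" "W G0 k z (apply_bcontfun bbar) = - T G0 (2*k+1) z"
    and \<gamma>: "\<gamma> > 0"
  shows "\<forall>\<^sub>F \<delta>2 in at_right 0. \<forall>\<^sub>F \<delta>1 in at_right 0.
    \<exists>b :: 'k \<times> (nat \<Rightarrow>\<^sub>C 'b) \<Rightarrow> (nat \<Rightarrow>\<^sub>C 'b).
      C_frechet (scale_pair se) se (UNIV \<times> N) (ball 0 \<delta>1 \<times> (N \<inter> ball 0 \<gamma>)) (q - (2 * k + 1)) b \<and>
      b ` (ball 0 \<delta>1 \<times> (N \<inter> ball 0 \<gamma>)) \<subseteq> Nc \<inter> ball bbar \<delta>2 \<and>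
      (\<forall>n \<in> N \<inter> ball 0 \<gamma>. b (0, n) = bbar) \<and>
      (\<forall>\<epsilon> \<in> ball 0 \<delta>1 - {0}. \<forall>nc \<in> Nc \<inter> ball bbar \<delta>2. \<forall>n \<in> N \<inter> ball 0 \<gamma>.
         G (cone_point sB k z \<epsilon> (nc + n)) = 0 \<longleftrightarrow> nc = b (\<epsilon>, n))"
proof -
  define r where "r = q - (2 * k + 1)"
  \<comment> \<open>One derivative survives the \<open>2k + 1\<close> divisions because
    \<open>q \<ge> 2k + 2\<close>.\<close>
  have r1: "r \<ge> 1" using q by (simp add: r_def)
  obtain H DH where H: "PC.regular r H DH" and gH: "\<forall>p\<in>PC.V. g p = sC (fst p ^ (2 * k + 1)) (H p)"
    using blow_up[OF order_refl] unfolding r_def by blast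
  note hH = PC.regular_hfd[OF H]
  \<comment> \<open>The factor between \<open>T\<close> of order \<open>2k + 1\<close> and the
    corresponding coefficient in powers of \<open>\<epsilon>\<close>, which is the value of
    \<open>H\<close> at \<open>\<epsilon> = 0\<close>.\<close>
  define \<kappa> :: real where "\<kappa> = 1 / fact (2 * k + 1)"
  define A0 where "A0 u = \<kappa> *\<^sub>R LP (2 * k + 1) (apply_bcontfun u)" for u
  have \<kappa>: "\<kappa> \<noteq> 0" by (simp add: \<kappa>_def)
  have A0_lin: "A0 (se c u + v) = sC c (A0 u) + A0 v" for c u v
    unfolding A0_def LP_seq[OF order_refl] by (simp add: scaleR_right_distrib C.scale_scaleR)
  have A0_add: "A0 (u + v) = A0 u + A0 v" for u v using A0_lin[of 1 u v] by simp
  have A0_0: "A0 0 = 0" using A0_add[of 0 0] by simp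
  have A0_diff: "A0 (u - v) = A0 u - A0 v" for u v using A0_add[of "u - v" v] by simp
  have A0_scale: "A0 (se c u) = sC c (A0 u)" for c u using A0_lin[of c u 0] A0_0 by simp
  have A0_scaleR: "A0 (s *\<^sub>R u) = s *\<^sub>R A0 u" for s u
    using A0_scale[of "of_real s" u] by (simp add: S.scale_of_real C.scale_of_real)
  have H0: "H (0, b) = \<kappa> *\<^sub>R T G0 (2 * k + 1) z + A0 b" if b: "b \<in> E" for b
    using quotient_at_0[OF H _ b, of "2 * k + 1"] gH T_coeffs[OF b, of "2 * k + 1"]
    by (simp add: A0_def \<kappa>_def scaleR_right_distrib)
  \<comment> \<open>Along a real line in direction \<open>(0, u)\<close> the affine formula
    \<open>H0\<close> holds, and derivatives on the line are unique.\<close>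
  have DH0: "DH 1 (0, b) [(0, u)] = A0 u" if b: "b \<in> E" and u: "u \<in> E" for b u
  proof -
    have "((\<lambda>s. DH 0 ((0, b) + s *\<^sub>R (0, u)) []) has_vector_derivative DH (Suc 0) ((0, b) + 0 *\<^sub>R (0, u)) ((0, u) # [])) (at 0)"
      by (rule PC.P.hfd_line[OF hH PC.V]) (use r1 b u in auto)
    moreover have "DH 0 ((0, b) + s *\<^sub>R (0, u)) [] = (\<kappa> *\<^sub>R T G0 (2 * k + 1) z + A0 b) + s *\<^sub>R A0 u" for s
    proof -
      have m: "b + s *\<^sub>R u \<in> E"
        using S.subspace_add[OF E_subspace b S.subspace_scaleR[OF E_subspace u]] .
      then show ?thesis
        using PC.P.hfd_0[OF hH PC.V order_refl, of "(0, b + s *\<^sub>R u)"] H0[OF m] by (simp add: A0_add A0_scaleR)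
    qed
    moreover have "((\<lambda>s. (\<kappa> *\<^sub>R T G0 (2 * k + 1) z + A0 b) + s *\<^sub>R A0 u) has_vector_derivative A0 u) (at 0)"
      by (auto intro!: derivative_eq_intros)
    ultimately show ?thesis using vector_derivative_unique_at by fastforce
  qed
  have N_iff: "y \<in> N \<longleftrightarrow> y \<in> E \<and> A0 y = 0" for y
    using \<kappa> by (simp add: N W_LP A0_def)
  have N_sub: "S.subspace N"
    using S.subspace_0[OF E_subspace] S.subspace_add[OF E_subspace] S.subspace_scale[OF E_subspace]
    unfolding S.subspace_def by (simp add: N_iff A0_0 A0_add A0_scale)
  have NE: "N \<subseteq> E" by (auto simp: N_iff)
  have NcE: "u \<in> E" if "u \<in> Nc" for u
  proof -
    have "u + 0 \<in> E" unfolding sum using that S.subspace_0[OF N_sub] by blast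
    then show ?thesis by simp
  qed
  have Nc_diff: "u - v \<in> Nc" if "u \<in> Nc" "v \<in> Nc" for u v using S.subspace_diff[OF Nc(1)] that .
  have inj: "u = 0" if "u \<in> Nc" "A0 u = 0" for u
  proof -
    have "u \<in> N" using that(2) NcE[OF that(1)] by (simp add: N_iff)
    with that(1) have "u \<in> {0}" unfolding int[symmetric] by blast
    then show ?thesis by simp
  qed
  have A0_onto: "A0 ` Nc = UNIV"
  proof -
    have "y \<in> A0 ` Nc" for y
    proof -
      have "(1 / \<kappa>) *\<^sub>R y \<in> (\<lambda>y. W G0 k z (apply_bcontfun y)) ` E" by (simp add: onto)
      then obtain x where x: "x \<in> E" "W G0 k z (apply_bcontfun x) = (1 / \<kappa>) *\<^sub>R y" by auto
      then have "A0 x = y" using \<kappa> by (simp add: A0_def W_LP)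
      moreover obtain u v where uv: "x = u + v" "u \<in> Nc" "v \<in> N" using x(1) unfolding sum by blast
      ultimately have "A0 u = y" by (simp add: A0_add N_iff)
      with uv show ?thesis by blast
    qed
    then show ?thesis by blast
  qed
  obtain B where B: "\<And>u. u \<in> E \<Longrightarrow> norm (A0 u) \<le> B * norm u"
  proof -
    have z0: "(0, 0) \<in> PC.V" using S.subspace_0[OF E_subspace] by simp
    obtain C where C: "\<forall>vs\<in>vl PC.V 1. norm (DH 1 (0, 0) vs) \<le> C * pn vs"
      using PC.P.hfd_mbdd[OF hH PC.V order_refl r1 z0] by (auto simp: mbdd_def)
    have "norm (A0 u) \<le> C * norm u" if u: "u \<in> E" for u
      using bspec[OF C, of "[(0, u)]"] DH0[OF S.subspace_0[OF E_subspace] u] u by (simp add: norm_Pair)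
    then show thesis by (rule that)
  qed
  obtain K where K: "K > 0" "\<And>y. \<exists>u\<in>Nc. A0 u = y \<and> norm u \<le> K * norm y"
  proof (rule bounded_right_inverse[of Nc A0 B])
    show "closed Nc" "0 \<in> Nc" "A0 ` Nc = UNIV" by (rule Nc(2) S.subspace_0[OF Nc(1)] A0_onto)+
    show "A0 (u + v) = A0 u + A0 v" "A0 (s *\<^sub>R u) = s *\<^sub>R A0 u" for s u v by (rule A0_add A0_scaleR)+
    fix K' assume "0 < K'" "\<And>y. \<exists>u\<in>Nc. A0 u = y \<and> norm u \<le> K' * norm y"
    then show thesis by (rule that)
  next
    show "u + v \<in> Nc" if "u \<in> Nc" "v \<in> Nc" for u v using S.subspace_add[OF Nc(1)] that .
    show "s *\<^sub>R u \<in> Nc" if "u \<in> Nc" for s u using S.subspace_scaleR[OF Nc(1)] that .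
    show "norm (A0 u) \<le> B * norm u" if "u \<in> Nc" for u using B NcE that by blast
  qed
  obtain \<Lambda> where \<Lambda>: "\<And>y. \<Lambda> y \<in> Nc" "\<And>y. A0 (\<Lambda> y) = y" "\<And>y. norm (\<Lambda> y) \<le> K * norm y"
    using K(2) by metis
  have Kb: "norm u \<le> K * norm (A0 u)" if u: "u \<in> Nc" for u
  proof -
    have "\<Lambda> (A0 u) - u = 0" using inj[OF Nc_diff[OF \<Lambda>(1) u]] by (simp add: A0_diff \<Lambda>)
    then show ?thesis using \<Lambda>(3)[of "A0 u"] by simp
  qed
  \<comment> \<open>The Lipschitz estimate below spends \<open>e\<close> three times, twice for the
    oscillation along the segment and once at its start; the total \<open>1 / (2 * K)\<close> is
    what \<open>perturbed_solution\<close> allows.\<close>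
  define e where "e = 1 / (6 * K)"
  have e: "e > 0" using K by (simp add: e_def)
  \<comment> \<open>Contains every \<open>n + u\<close> with \<open>norm n < \<gamma>\<close> and
    \<open>dist bbar u < 1\<close>; this is why \<open>\<delta>2 < 1\<close> is imposed.\<close>
  define R where "R = norm bbar + 1 + \<gamma>"
  obtain d1 where d1: "d1 > 0" "\<And>\<epsilon> b vs. norm \<epsilon> < d1 \<Longrightarrow> b \<in> E \<Longrightarrow> norm b \<le> R \<Longrightarrow> vs \<in> vl PC.V 1 \<Longrightarrow>
      norm (DH 1 (\<epsilon>, b) vs - DH 1 (0, b) vs) \<le> e * pn vs"
    using usmallD[OF ccontD(1)[OF PC.regular_ccont[OF H, of R] r1] e] unfolding eventually_zfilter by auto
  have near: "norm (DH 1 (\<epsilon>, b) [(0, u)] - A0 u) \<le> e * norm u"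
    if "norm \<epsilon> < d1" "b \<in> E" "norm b \<le> R" "u \<in> E" for \<epsilon> b u
    using d1(2)[OF that(1-3), of "[(0, u)]"] DH0[OF that(2,4)] that(4) by (simp add: norm_Pair)
  have lip: "norm (H (\<epsilon>, b) - H (\<epsilon>, b') - A0 (b - b')) \<le> (1 / (2 * K)) * norm (b - b')"
    if \<epsilon>: "norm \<epsilon> < d1" and b: "b \<in> E" "norm b \<le> R" and b': "b' \<in> E" "norm b' \<le> R" for \<epsilon> b b'
  proof -
    define h where "h = b - b'"
    have hE: "h \<in> E" unfolding h_def by (rule S.subspace_diff[OF E_subspace b(1) b'(1)])
    have mem: "b' + s *\<^sub>R h \<in> E" for s
      using S.subspace_add[OF E_subspace b'(1) S.subspace_scaleR[OF E_subspace hE]] .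
    have bnd: "norm (b' + s *\<^sub>R h) \<le> R" if s: "s \<in> {0..1}" for s
    proof -
      have "b' + s *\<^sub>R h = (1 - s) *\<^sub>R b' + s *\<^sub>R b" by (simp add: h_def algebra_simps)
      also have "norm \<dots> \<le> (1 - s) * R + s * R"
        using s b b' by (intro norm_triangle_le add_mono) (auto intro!: mult_left_mono)
      finally show ?thesis by (simp add: algebra_simps)
    qed
    let ?f = "\<lambda>s. DH 0 ((\<epsilon>, b') + s *\<^sub>R (0, h)) []" and ?f' = "\<lambda>s. DH (Suc 0) ((\<epsilon>, b') + s *\<^sub>R (0, h)) ((0, h) # [])"
    have fn: "norm (?f' s - A0 h) \<le> e * norm h" if s: "s \<in> {0..1}" for s
      using near[OF \<epsilon> mem bnd[OF s] hE] by simp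
    have "norm (?f 1 - ?f 0 - (1 - 0) *\<^sub>R ?f' 0) \<le> norm (1 - 0 :: real) * (2 * (e * norm h))"
    proof (rule vector_differentiable_bound_linearization[where S = "{0..1}"])
      show "(?f has_vector_derivative ?f' s) (at s within {0..1})" for s
        by (rule PC.P.hfd_line[OF hH PC.V]) (use r1 b' hE in auto)
      show "closed_segment 0 1 \<subseteq> {0..1::real}" by (simp add: closed_segment_eq_real_ivl)
      fix s :: real assume s: "s \<in> {0..1}"
      have "?f' s - ?f' 0 = (?f' s - A0 h) - (?f' 0 - A0 h)" by simp
      also have "norm \<dots> \<le> e * norm h + e * norm h"
        by (rule norm_triangle_le_diff[OF add_mono[OF fn[OF s] fn]]) simp
      finally show "norm (?f' s - ?f' 0) \<le> 2 * (e * norm h)" by (simp only: mult_2)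
    qed simp
    then have 1: "norm (?f 1 - ?f 0 - ?f' 0) \<le> 2 * (e * norm h)" by simp
    have f1: "?f 1 = H (\<epsilon>, b)" "?f 0 = H (\<epsilon>, b')"
      using PC.P.hfd_0[OF hH PC.V order_refl] b b' by (simp_all add: h_def)
    have "norm (H (\<epsilon>, b) - H (\<epsilon>, b') - A0 h) = norm ((?f 1 - ?f 0 - ?f' 0) + (?f' 0 - A0 h))"
      unfolding f1 by simp
    also have "\<dots> \<le> 2 * (e * norm h) + e * norm h"
      by (rule norm_triangle_mono[OF 1 fn]) simp
    also have "\<dots> = (1 / (2 * K)) * norm h" using K by (simp add: e_def field_simps)
    finally show ?thesis unfolding h_def .
  qed
  \<comment> \<open>\<open>A0\<close> vanishes on \<open>N\<close>, so \<open>bbar\<close> is a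
    solution at \<open>\<epsilon> = 0\<close> for every \<open>n\<close>; it is the common centre of
    all the contractions, without any restriction on \<open>\<gamma>\<close>.\<close>
  have Hbbar: "H (0, n + bbar) = 0" if "n \<in> N" for n
  proof -
    have "n + bbar \<in> E" using that S.subspace_add[OF E_subspace] N_iff NcE[OF bbar(1)] by blast
    moreover have "A0 bbar = \<kappa> *\<^sub>R (- T G0 (2 * k + 1) z)" using bbar(2) by (simp add: A0_def W_LP)
    ultimately show ?thesis using H0[of "n + bbar"] that by (simp add: A0_add N_iff)
  qed
  have G_H: "G (cone_point sB k z \<epsilon> b) = sC (\<epsilon> ^ (2 * k + 1)) (H (\<epsilon>, b))" if "b \<in> E" for \<epsilon> b
    using bspec[OF gH, of "(\<epsilon>, b)"] that by (simp add: g_def pt_def)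
  interpret PN: pair_setting se sC N by unfold_locales (rule N_sub)
  have main: "\<exists>b :: 'k \<times> (nat \<Rightarrow>\<^sub>C 'b) \<Rightarrow> (nat \<Rightarrow>\<^sub>C 'b).
      C_frechet (scale_pair se) se (UNIV \<times> N) (ball 0 \<delta>1 \<times> (N \<inter> ball 0 \<gamma>)) r b \<and>
      b ` (ball 0 \<delta>1 \<times> (N \<inter> ball 0 \<gamma>)) \<subseteq> Nc \<inter> ball bbar \<delta>2 \<and>
      (\<forall>n \<in> N \<inter> ball 0 \<gamma>. b (0, n) = bbar) \<and>
      (\<forall>\<epsilon> \<in> ball 0 \<delta>1 - {0}. \<forall>nc \<in> Nc \<inter> ball bbar \<delta>2. \<forall>n \<in> N \<inter> ball 0 \<gamma>.
         G (cone_point sB k z \<epsilon> (nc + n)) = 0 \<longleftrightarrow> nc = b (\<epsilon>, n))"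
    if \<delta>2: "0 < \<delta>2" "\<delta>2 < 1" and \<delta>1: "0 < \<delta>1" "\<delta>1 < d1"
      and sm: "\<And>\<epsilon> b. norm \<epsilon> < \<delta>1 \<Longrightarrow> b \<in> E \<Longrightarrow> norm b \<le> R \<Longrightarrow> norm (H (\<epsilon>, b) - H (0, b)) \<le> \<delta>2 / (4 * K)"
    for \<delta>1 \<delta>2
  proof -
    define U where "U = ball (0::'k) \<delta>1 \<times> (N \<inter> ball 0 \<gamma>)"
    have UD: "norm (fst p) < \<delta>1" "norm (fst p) < d1" "snd p \<in> N" "norm (snd p) < \<gamma>" "snd p \<in> E" if "p \<in> U" for p
      using that \<delta>1 NE by (auto simp: U_def)
    have bd: "n + u \<in> E" "norm (n + u) \<le> R" if "n \<in> N" "norm n < \<gamma>" "u \<in> Nc" "dist bbar u < 1" for n u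
    proof -
      show "n + u \<in> E" using S.subspace_add[OF E_subspace _ NcE[OF that(3)]] that(1) N_iff by blast
      have "norm u \<le> norm bbar + dist bbar u" using norm_triangle_sub[of u bbar] by (simp add: dist_norm norm_minus_commute)
      then show "norm (n + u) \<le> R" using norm_triangle_ineq[of n u] that by (simp add: R_def)
    qed
    have lipU: "norm (H (fst p, snd p + u) - H (fst p, snd p + v) - A0 (u - v)) \<le> (1 / (2 * K)) * norm (u - v)"
      if "p \<in> U" "u \<in> Nc" "dist bbar u < 1" "v \<in> Nc" "dist bbar v < 1" for p u v
      using lip[OF UD(2)[OF that(1)] bd[OF UD(3,4)[OF that(1)] that(2,3)] bd[OF UD(3,4)[OF that(1)] that(4,5)]] by simp
    \<comment> \<open>The radius \<open>\<delta>2 / 2\<close> puts the closed ball inside the open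
      ball of radius \<open>\<delta>2\<close>. The bound \<open>\<delta>2 / (4 * K)\<close> in
      \<open>sm\<close> is chosen so that multiplication by \<open>K\<close> gives half of this
      radius.\<close>
    have sol: "\<exists>u\<in>Nc \<inter> cball bbar (\<delta>2 / 2). H (fst p, snd p + u) = 0" if p: "p \<in> U" for p
    proof (rule perturbed_solution[OF Nc(2) Nc_diff A0_diff K(1) Kb \<Lambda>(1,2) bbar(1)])
      have "norm (H (fst p, snd p + bbar) - H (0, snd p + bbar)) \<le> \<delta>2 / (4 * K)"
        using UD[OF p] by (intro sm bd bbar) auto
      then have "norm (H (fst p, snd p + bbar)) \<le> \<delta>2 / (4 * K)" using Hbbar[OF UD(3)[OF p]] by simp
      then have "K * norm (H (fst p, snd p + bbar)) \<le> K * (\<delta>2 / (4 * K))" using K(1) by (intro mult_left_mono) auto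
      also have "\<dots> = \<delta>2 / 2 / 2" using K(1) by simp
      finally show "K * norm (H (fst p, snd p + bbar)) \<le> \<delta>2 / 2 / 2" .
      fix u v assume "u \<in> Nc \<inter> cball bbar (\<delta>2 / 2)" "v \<in> Nc \<inter> cball bbar (\<delta>2 / 2)"
      then show "norm (H (fst p, snd p + u) - H (fst p, snd p + v) - A0 (u - v)) \<le> (1 / (2 * K)) * norm (u - v)"
        using \<delta>2 by (intro lipU[OF p]) auto
    qed auto
    \<comment> \<open>Differences of values of \<open>H\<close> control distances in
      \<open>Nc\<close>: this gives uniqueness of the solution and also its continuity.\<close>
    have est: "norm (u - v) \<le> 2 * K * norm (H (fst p, snd p + u) - H (fst p, snd p + v))"
      if p: "p \<in> U" and u: "u \<in> Nc" "dist bbar u < 1" and v: "v \<in> Nc" "dist bbar v < 1" for p u v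
    proof -
      let ?h = "H (fst p, snd p + u) - H (fst p, snd p + v)"
      have "norm (A0 (u - v)) \<le> norm ?h + norm (?h - A0 (u - v))"
        using norm_triangle_ineq4[of ?h "?h - A0 (u - v)"] by simp
      also have "\<dots> \<le> norm ?h + (1 / (2 * K)) * norm (u - v)" using lipU[OF p u v] by simp
      finally have "K * norm (A0 (u - v)) \<le> K * (norm ?h + (1 / (2 * K)) * norm (u - v))"
        using K(1) by (intro mult_left_mono) auto
      moreover have "K * (norm ?h + (1 / (2 * K)) * norm (u - v)) = K * norm ?h + norm (u - v) / 2"
        using K(1) by (simp add: distrib_left)
      ultimately show ?thesis using Kb[OF Nc_diff[OF u(1) v(1)]] by linarith
    qed
    define b where "b p = (SOME u. u \<in> Nc \<inter> ball bbar \<delta>2 \<and> H (fst p, snd p + u) = 0)" for p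
    have b: "b p \<in> Nc" "dist bbar (b p) < \<delta>2" "H (fst p, snd p + b p) = 0" if p: "p \<in> U" for p
    proof -
      have "\<exists>u. u \<in> Nc \<inter> ball bbar \<delta>2 \<and> H (fst p, snd p + u) = 0"
        using sol[OF p] \<delta>2 by force
      from someI_ex[OF this] show "b p \<in> Nc" "dist bbar (b p) < \<delta>2" "H (fst p, snd p + b p) = 0"
        unfolding b_def by auto
    qed
    have b1: "dist bbar (b p) < 1" if "p \<in> U" for p using b(2)[OF that] \<delta>2 by simp
    have uniq: "u = b p" if p: "p \<in> U" and u: "u \<in> Nc" "dist bbar u < \<delta>2" "H (fst p, snd p + u) = 0" for p u
      using est[OF p u(1) _ b(1)[OF p] b1[OF p]] u b(3)[OF p] \<delta>2 by simp
    have bE: "snd p + b p \<in> E" "norm (snd p + b p) \<le> R" if p: "p \<in> U" for p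
      using bd[OF UD(3,4)[OF p] b(1)[OF p] b1[OF p]] by auto
    \<comment> \<open>At the parameter \<open>y\<close> the estimate \<open>est\<close> compares the
      solution \<open>b y\<close> with the candidate \<open>b x\<close>, whose defect
      \<open>?h y\<close> tends to its value \<open>0\<close> at \<open>x\<close>.\<close>
    have bcont: "(b \<longlongrightarrow> b x) (at x within U)" if x: "x \<in> U" for x
    proof (rule LIM_zero_cancel, rule Lim_null_comparison)
      let ?h = "\<lambda>y. H (fst y, snd y + b x)"
      have evU: "\<forall>\<^sub>F y in at x within U. y \<in> U" by (simp add: eventually_at_filter)
      then show "\<forall>\<^sub>F y in at x within U. norm (b y - b x) \<le> 2 * K * norm (?h y)"
      proof eventually_elim
        case (elim y)
        show ?case using est[OF elim b(1)[OF elim] b1[OF elim] b(1)[OF x] b1[OF x]] b(3)[OF elim] by simp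
      qed
      have "(?h \<longlongrightarrow> H (fst x, snd x + b x)) (at x within U)"
      proof (rule filterlim_compose[OF PC.P.hfd_tendsto[OF hH PC.V order_refl]])
        show "(fst x, snd x + b x) \<in> PC.V" using bE[OF x] by simp
        have "((\<lambda>y. (fst y, snd y + b x)) \<longlongrightarrow> (fst x, snd x + b x)) (at x within U)"
          by (intro tendsto_intros)
        moreover have "\<forall>\<^sub>F y in at x within U. (fst y, snd y + b x) \<in> PC.V"
          using evU
        proof eventually_elim
          case (elim y)
          show ?case using bd(1)[OF UD(3,4)[OF elim] b(1)[OF x] b1[OF x]] by simp
        qed
        ultimately show "filterlim (\<lambda>y. (fst y, snd y + b x)) (nin (fst x, snd x + b x) PC.V) (at x within U)"
          by (simp add: nin_def filterlim_inf filterlim_principal)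
      qed
      from tendsto_mult_right_zero[OF tendsto_norm_zero, of _ _ "2 * K"] this
      show "((\<lambda>y. 2 * K * norm (?h y)) \<longlongrightarrow> 0) (at x within U)" using b(3)[OF x] by simp
    qed
    have w_eq: "x + (0, b x) = (fst x, snd x + b x)" for x by (simp add: prod_eq_iff)
    have nearU: "norm (DH 1 (x + (0, b x)) [(0, u)] - A0 u) \<le> e * norm u" if "x \<in> U" "u \<in> Nc" for x u
      unfolding w_eq by (rule near[OF UD(2)[OF that(1)] bE[OF that(1)] NcE[OF that(2)]])
    have mlU: "mlin PC.sp sC PC.V 1 (DH 1 (x + (0, b x)))" if "x \<in> U" for x
      unfolding w_eq using bE[OF that] by (intro PC.P.hfd_mlin[OF hH PC.V order_refl r1]) simp
    \<comment> \<open>The partial derivative is a perturbation of \<open>A0\<close>, so the same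
      contraction inverts it: for the map \<open>DH 1 (x + (0, b x)) [(0, u)] - y\<close> with
      centre \<open>0\<close>, the defect \<open>- y\<close> dictates the radius
      \<open>2 * K * norm y\<close>.\<close>
    have invex: "\<exists>u. u \<in> Nc \<and> DH 1 (x + (0, b x)) [(0, u)] = y" if x: "x \<in> U" for x y
    proof -
      have "\<exists>u\<in>Nc \<inter> cball 0 (2 * K * norm y). DH 1 (x + (0, b x)) [(0, u)] - y = 0"
      proof (rule perturbed_solution[OF Nc(2) Nc_diff A0_diff K(1) Kb \<Lambda>(1,2) S.subspace_0[OF Nc(1)]])
        have "(0::'k, 0::nat \<Rightarrow>\<^sub>C 'b) = 0" by (simp add: zero_prod_def)
        then have "DH 1 (x + (0, b x)) [(0, 0)] = 0"
          using PC.P.mlin_zero[OF mlU[OF x] PC.V, of "[]" "[]"] by simp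
        then show "K * norm (DH 1 (x + (0, b x)) [(0, 0)] - y) \<le> 2 * K * norm y / 2" by simp
        fix u v assume uv: "u \<in> Nc \<inter> cball 0 (2 * K * norm y)" "v \<in> Nc \<inter> cball 0 (2 * K * norm y)"
        have "(0::'k, u - v) = (0, u) - (0, v)" by simp
        then have "DH 1 (x + (0, b x)) [(0, u - v)] = DH 1 (x + (0, b x)) [(0, u)] - DH 1 (x + (0, b x)) [(0, v)]"
          using PC.P.mlin_diff[OF mlU[OF x] PC.V, of "[]" "[]" "(0, u)" "(0, v)"] uv NcE by simp
        then have "norm (DH 1 (x + (0, b x)) [(0, u)] - y - (DH 1 (x + (0, b x)) [(0, v)] - y) - A0 (u - v)) \<le> e * norm (u - v)"
          using nearU[OF x, of "u - v"] uv Nc_diff by simp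
        also have "\<dots> \<le> (1 / (2 * K)) * norm (u - v)"
          using K(1) by (intro mult_right_mono) (auto simp: e_def divide_simps)
        finally show "norm (DH 1 (x + (0, b x)) [(0, u)] - y - (DH 1 (x + (0, b x)) [(0, v)] - y) - A0 (u - v)) \<le> (1 / (2 * K)) * norm (u - v)" .
      qed auto
      then show ?thesis by auto
    qed
    define invA where "invA x y = (SOME u. u \<in> Nc \<and> DH 1 (x + (0, b x)) [(0, u)] = y)" for x y
    have invA: "invA x y \<in> Nc" "DH 1 (x + (0, b x)) [(0, invA x y)] = y" if "x \<in> U" for x y
      using someI_ex[OF invex[OF that, of y]] unfolding invA_def by auto
    \<comment> \<open>Since \<open>K * e = 1 / 6\<close>, the error term is absorbed on the left,
      which leaves the factor \<open>6 / 5 * K\<close>, below \<open>2 * K\<close>.\<close>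
    have Kbound: "norm u \<le> 2 * K * norm (DH 1 (x + (0, b x)) [(0, u)])" if x: "x \<in> U" and u: "u \<in> Nc" for x u
    proof -
      let ?d = "DH 1 (x + (0, b x)) [(0, u)]"
      have "norm (A0 u) \<le> norm ?d + norm (?d - A0 u)"
        using norm_triangle_ineq4[of ?d "?d - A0 u"] by simp
      also have "\<dots> \<le> norm ?d + e * norm u" using nearU[OF x u] by simp
      finally have "K * norm (A0 u) \<le> K * (norm ?d + e * norm u)" using K(1) by (intro mult_left_mono) auto
      moreover have "K * (norm ?d + e * norm u) = K * norm ?d + norm u / 6"
        using K(1) by (simp add: e_def distrib_left)
      ultimately have "norm u \<le> K * norm ?d + norm u / 6" using Kb[OF u] by linarith
      then show ?thesis using norm_ge_zero[of u] K(1) by linarith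
    qed
    \<comment> \<open>Parameters are the pairs \<open>(\<epsilon>, n)\<close> in
      \<open>UNIV \<times> N\<close>, and \<open>Pair 0\<close> embeds the unknown into the space of
      pairs on which \<open>H\<close> is smooth.\<close>
    interpret I: implicit_setup PC.sp sC se PC.V r H DH "UNIV \<times> N" U Nc "Pair 0" b invA "2 * K"
    proof (intro implicit_setup.intro implicit_setup_axioms.intro)
      show "two_spaces PC.sp sC" by (rule PC.P.two_spaces_axioms)
      show "normed_over se" by (rule S.normed_over_axioms)
      show "has_frechet_derivs PC.sp sC PC.V PC.V r H DH" by (rule hH)
      show "PB.P.A.subspace PC.V" by (rule PC.V)
      show "PB.P.A.subspace (UNIV \<times> N)" by (rule PN.V)
      show "UNIV \<times> N \<subseteq> PC.V" using NE by auto
      show "U \<subseteq> UNIV \<times> N" by (auto simp: U_def)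
      show "S.subspace Nc" by (rule Nc(1))
      show "(0::'k, u + v) = (0, u) + (0, v)" for u v :: "nat \<Rightarrow>\<^sub>C 'b" by simp
      show "(0::'k, se c u) = PC.sp c (0, u)" for c u by (simp add: scale_pair_def)
      show "norm (0::'k, u) = norm u" for u :: "nat \<Rightarrow>\<^sub>C 'b" by (simp add: norm_Pair)
      show "(0, u) \<in> PC.V" if "u \<in> Nc" for u using NcE[OF that] by simp
      show "b x \<in> Nc" if "x \<in> U" for x by (rule b(1)[OF that])
      show "(b \<longlongrightarrow> b x) (at x within U)" if "x \<in> U" for x by (rule bcont[OF that])
      show "H (x + (0, b x)) = 0" if "x \<in> U" for x unfolding w_eq by (rule b(3)[OF that])
      show "invA x y \<in> Nc" "DH 1 (x + (0, b x)) [(0, invA x y)] = y" if "x \<in> U" for x y by (rule invA[OF that])+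
      show "0 < 2 * K" using K(1) by simp
      show "norm u \<le> 2 * K * norm (DH 1 (x + (0, b x)) [(0, u)])" if "x \<in> U" "u \<in> Nc" for x u by (rule Kbound[OF that])
      show "1 \<le> r" by (rule r1)
    qed
    have C: "C_frechet PC.sp se (UNIV \<times> N) U r b" by (rule I.implicit_C_frechet)
    have b0: "b (0, n) = bbar" if "n \<in> N \<inter> ball 0 \<gamma>" for n
    proof (rule uniq[symmetric])
      show "(0, n) \<in> U" using that \<delta>1 by (simp add: U_def)
      show "H (fst (0, n), snd (0, n) + bbar) = 0" using Hbbar that by simp
    qed (use bbar \<delta>2 in auto)
    have iff: "G (cone_point sB k z \<epsilon> (nc + n)) = 0 \<longleftrightarrow> nc = b (\<epsilon>, n)"
      if \<epsilon>: "\<epsilon> \<in> ball 0 \<delta>1 - {0}" and nc: "nc \<in> Nc \<inter> ball bbar \<delta>2" and n: "n \<in> N \<inter> ball 0 \<gamma>" for \<epsilon> nc n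
    proof -
      have p: "(\<epsilon>, n) \<in> U" using \<epsilon> n by (simp add: U_def)
      have "nc + n \<in> E" using S.subspace_add[OF E_subspace NcE] nc n NE by blast
      then have "G (cone_point sB k z \<epsilon> (nc + n)) = sC (\<epsilon> ^ (2 * k + 1)) (H (\<epsilon>, n + nc))"
        by (simp only: G_H add.commute[of n nc])
      moreover have "\<epsilon> ^ (2 * k + 1) \<noteq> 0" using \<epsilon> by simp
      ultimately have "G (cone_point sB k z \<epsilon> (nc + n)) = 0 \<longleftrightarrow> H (\<epsilon>, n + nc) = 0"
        by (simp only: C.scale_eq_0_iff simp_thms)
      also have "\<dots> \<longleftrightarrow> nc = b (\<epsilon>, n)"
        using uniq[OF p, of nc] b(3)[OF p] nc by auto
      finally show ?thesis .
    qed
    show ?thesis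
      by (intro exI[of _ b] conjI ballI image_subsetI)
        (use C b b0 iff in \<open>auto simp: U_def\<close>)
  qed
  show ?thesis
    unfolding eventually_at_right_field r_def[symmetric]
  proof (rule exI[of _ 1], rule conjI[OF zero_less_one], intro allI impI)
    fix \<delta>2 :: real assume \<delta>2: "0 < \<delta>2" "\<delta>2 < 1"
    then have "\<delta>2 / (4 * K) > 0" using K(1) by simp
    from usmallD[OF ccontD(1)[OF PC.regular_ccont[OF H, of R] le0] this]
    obtain d2 where d2: "d2 > 0" "\<And>\<epsilon> b. norm \<epsilon> < d2 \<Longrightarrow> b \<in> E \<Longrightarrow> norm b \<le> R \<Longrightarrow>
        norm (DH 0 (\<epsilon>, b) [] - DH 0 (0, b) []) \<le> \<delta>2 / (4 * K)"
      unfolding eventually_zfilter by auto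
    show "\<exists>d>0. \<forall>\<delta>1>0. \<delta>1 < d \<longrightarrow> (\<exists>b :: 'k \<times> (nat \<Rightarrow>\<^sub>C 'b) \<Rightarrow> (nat \<Rightarrow>\<^sub>C 'b).
      C_frechet (scale_pair se) se (UNIV \<times> N) (ball 0 \<delta>1 \<times> (N \<inter> ball 0 \<gamma>)) r b \<and>
      b ` (ball 0 \<delta>1 \<times> (N \<inter> ball 0 \<gamma>)) \<subseteq> Nc \<inter> ball bbar \<delta>2 \<and>
      (\<forall>n \<in> N \<inter> ball 0 \<gamma>. b (0, n) = bbar) \<and>
      (\<forall>\<epsilon> \<in> ball 0 \<delta>1 - {0}. \<forall>nc \<in> Nc \<inter> ball bbar \<delta>2. \<forall>n \<in> N \<inter> ball 0 \<gamma>.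
         G (cone_point sB k z \<epsilon> (nc + n)) = 0 \<longleftrightarrow> nc = b (\<epsilon>, n)))"
    proof (intro exI[of _ "min d1 d2"] conjI allI impI)
      show "0 < min d1 d2" using d1(1) d2(1) by simp
      fix \<delta>1 :: real assume \<delta>1: "0 < \<delta>1" "\<delta>1 < min d1 d2"
      show "\<exists>b :: 'k \<times> (nat \<Rightarrow>\<^sub>C 'b) \<Rightarrow> (nat \<Rightarrow>\<^sub>C 'b).
        C_frechet (scale_pair se) se (UNIV \<times> N) (ball 0 \<delta>1 \<times> (N \<inter> ball 0 \<gamma>)) r b \<and>
        b ` (ball 0 \<delta>1 \<times> (N \<inter> ball 0 \<gamma>)) \<subseteq> Nc \<inter> ball bbar \<delta>2 \<and>
        (\<forall>n \<in> N \<inter> ball 0 \<gamma>. b (0, n) = bbar) \<and>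
        (\<forall>\<epsilon> \<in> ball 0 \<delta>1 - {0}. \<forall>nc \<in> Nc \<inter> ball bbar \<delta>2. \<forall>n \<in> N \<inter> ball 0 \<gamma>.
           G (cone_point sB k z \<epsilon> (nc + n)) = 0 \<longleftrightarrow> nc = b (\<epsilon>, n))"
      proof (rule main[OF \<delta>2])
        fix \<epsilon> :: 'k and b assume *: "norm \<epsilon> < \<delta>1" "b \<in> E" "norm b \<le> R"
        then have "norm (DH 0 (\<epsilon>, b) [] - DH 0 (0, b) []) \<le> \<delta>2 / (4 * K)" using \<delta>1 by (intro d2) auto
        then show "norm (H (\<epsilon>, b) - H (0, b)) \<le> \<delta>2 / (4 * K)"
          using PC.P.hfd_0[OF hH PC.V order_refl] * by simp
      qed (use \<delta>1 in auto)
    qed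
  qed
qed

theorem theorem1:
  fixes sB :: "'k::real_normed_field \<Rightarrow> 'b::banach \<Rightarrow> 'b"
    and sC :: "'k \<Rightarrow> 'c::banach \<Rightarrow> 'c"
    and k q :: nat
    and G :: "'b \<Rightarrow> 'c"
    and DG :: "nat \<Rightarrow> 'b \<Rightarrow> 'b list \<Rightarrow> 'c"
    and G0 :: "nat \<Rightarrow> 'b list \<Rightarrow> 'c"
    and z :: "nat \<Rightarrow> 'b"
    and E N Nc :: "(nat \<Rightarrow>\<^sub>C 'b) set"
    and bbar :: "nat \<Rightarrow>\<^sub>C 'b"
    and \<gamma> :: real
  assumes "banach_over sB" and "banach_over sC"
    and "k \<ge> 1" and "q \<ge> 2 * k + 2"
    and "has_frechet_derivs sB sC UNIV UNIV q G DG"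
    and "G 0 = 0"
    and G0: "G0 = (\<lambda>\<beta>. DG \<beta> 0)"
    and "\<forall>i\<in>{1..2*k}. T G0 i z = 0"
    and "z (2*k+1) = 0"
    and E: "E = B_times_kernel_Delta G0 k z"
    and "(\<lambda>y. W G0 k z (apply_bcontfun y)) ` E = UNIV"
    and N: "N = {y\<in>E. W G0 k z (apply_bcontfun y) = 0}"
    and "module.subspace (scale_seq sB) Nc" and "closed Nc"
    and "E = {u + v | u v. u \<in> Nc \<and> v \<in> N}" and "Nc \<inter> N = {0}"
    and "bbar \<in> Nc"
    and "W G0 k z (apply_bcontfun bbar) = - T G0 (2*k+1) z"
    and "\<gamma> > 0"
  shows "\<forall>\<^sub>F \<delta>2 in at_right 0. \<forall>\<^sub>F \<delta>1 in at_right 0.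
    \<exists>b :: 'k \<times> (nat \<Rightarrow>\<^sub>C 'b) \<Rightarrow> (nat \<Rightarrow>\<^sub>C 'b).
      C_frechet (scale_pair (scale_seq sB)) (scale_seq sB)
        (UNIV \<times> N) (ball 0 \<delta>1 \<times> (N \<inter> ball 0 \<gamma>)) (q - 2*k - 1) b \<and>
      b ` (ball 0 \<delta>1 \<times> (N \<inter> ball 0 \<gamma>)) \<subseteq> Nc \<inter> ball bbar \<delta>2 \<and>
      (\<forall>n \<in> N \<inter> ball 0 \<gamma>. b (0, n) = bbar) \<and>
      {x. G x = 0 \<and> (\<exists>\<epsilon> \<in> ball 0 \<delta>1. \<exists>nc \<in> Nc \<inter> ball bbar \<delta>2. \<exists>n \<in> N \<inter> ball 0 \<gamma>.
            x = cone_point sB k z \<epsilon> (nc + n))}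
        = {cone_point sB k z \<epsilon> (b (\<epsilon>, n) + n) | \<epsilon> n. \<epsilon> \<in> ball 0 \<delta>1 \<and> n \<in> N \<inter> ball 0 \<gamma>} \<and>
      (\<forall>\<epsilon> \<in> ball 0 \<delta>1 - {0}. \<forall>nc \<in> Nc \<inter> ball bbar \<delta>2. \<forall>n \<in> N \<inter> ball 0 \<gamma>.
         G (cone_point sB k z \<epsilon> (nc + n)) = 0 \<longleftrightarrow> nc = b (\<epsilon>, n))"
proof -
  interpret cone_setting sB sC k q G DG z E
    by (rule cone_setting.intro[OF assms(1-6) assms(8)[unfolded G0] assms(10)[unfolded G0]])
  \<comment> \<open>For \<open>\<epsilon> = 0\<close> every parameter gives the vertex of the cone,
    which is a solution. It therefore belongs to both sets of points, whatever \<open>nc\<close>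
    is.\<close>
  have "cone_point sB k z 0 b = 0" for b using pt_0[of b] by (simp add: pt_def)
  then have vertex: "cone_point sB k z 0 b = cone_point sB k z 0 b'" "G (cone_point sB k z 0 b) = 0" for b b'
    using G_0 by simp_all
  have "\<forall>\<^sub>F \<delta>2 in at_right 0. \<forall>\<^sub>F \<delta>1 in at_right 0.
    \<exists>b :: 'k \<times> (nat \<Rightarrow>\<^sub>C 'b) \<Rightarrow> (nat \<Rightarrow>\<^sub>C 'b).
      C_frechet (scale_pair se) se (UNIV \<times> N) (ball 0 \<delta>1 \<times> (N \<inter> ball 0 \<gamma>)) (q - (2 * k + 1)) b \<and>
      b ` (ball 0 \<delta>1 \<times> (N \<inter> ball 0 \<gamma>)) \<subseteq> Nc \<inter> ball bbar \<delta>2 \<and>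
      (\<forall>n \<in> N \<inter> ball 0 \<gamma>. b (0, n) = bbar) \<and>
      (\<forall>\<epsilon> \<in> ball 0 \<delta>1 - {0}. \<forall>nc \<in> Nc \<inter> ball bbar \<delta>2. \<forall>n \<in> N \<inter> ball 0 \<gamma>.
         G (cone_point sB k z \<epsilon> (nc + n)) = 0 \<longleftrightarrow> nc = b (\<epsilon>, n))"
    by (rule solution_branch[OF assms(11)[unfolded G0] assms(12)[unfolded G0] assms(13-17) assms(18)[unfolded G0] assms(19)])
  then show ?thesis
  proof (elim eventually_mono ex_forward, elim conjE, intro conjI)
    fix \<delta>2 \<delta>1 :: real and b :: "'k \<times> (nat \<Rightarrow>\<^sub>C 'b) \<Rightarrow> (nat \<Rightarrow>\<^sub>C 'b)"
    assume C: "C_frechet (scale_pair se) se (UNIV \<times> N) (ball 0 \<delta>1 \<times> (N \<inter> ball 0 \<gamma>)) (q - (2 * k + 1)) b"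
      and bNc: "b ` (ball 0 \<delta>1 \<times> (N \<inter> ball 0 \<gamma>)) \<subseteq> Nc \<inter> ball bbar \<delta>2"
      and iff: "\<forall>\<epsilon> \<in> ball 0 \<delta>1 - {0}. \<forall>nc \<in> Nc \<inter> ball bbar \<delta>2. \<forall>n \<in> N \<inter> ball 0 \<gamma>.
         G (cone_point sB k z \<epsilon> (nc + n)) = 0 \<longleftrightarrow> nc = b (\<epsilon>, n)"
    show "C_frechet (scale_pair se) se (UNIV \<times> N) (ball 0 \<delta>1 \<times> (N \<inter> ball 0 \<gamma>)) (q - 2 * k - 1) b"
      using C by simp
    show "{x. G x = 0 \<and> (\<exists>\<epsilon> \<in> ball 0 \<delta>1. \<exists>nc \<in> Nc \<inter> ball bbar \<delta>2. \<exists>n \<in> N \<inter> ball 0 \<gamma>.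
            x = cone_point sB k z \<epsilon> (nc + n))}
        = {cone_point sB k z \<epsilon> (b (\<epsilon>, n) + n) | \<epsilon> n. \<epsilon> \<in> ball 0 \<delta>1 \<and> n \<in> N \<inter> ball 0 \<gamma>}"
    proof (intro set_eqI iffI)
      fix x assume "x \<in> {x. G x = 0 \<and> (\<exists>\<epsilon> \<in> ball 0 \<delta>1. \<exists>nc \<in> Nc \<inter> ball bbar \<delta>2. \<exists>n \<in> N \<inter> ball 0 \<gamma>.
            x = cone_point sB k z \<epsilon> (nc + n))}"
      then obtain \<epsilon> nc n where *: "G x = 0" "\<epsilon> \<in> ball 0 \<delta>1" "nc \<in> Nc \<inter> ball bbar \<delta>2" "n \<in> N \<inter> ball 0 \<gamma>"
        "x = cone_point sB k z \<epsilon> (nc + n)" by blast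
      have "x = cone_point sB k z \<epsilon> (b (\<epsilon>, n) + n)"
      proof (cases "\<epsilon> = 0")
        case True
        then show ?thesis using *(5) vertex(1) by blast
      next
        case False
        then have "nc = b (\<epsilon>, n)" using * iff by blast
        then show ?thesis using *(5) by simp
      qed
      then show "x \<in> {cone_point sB k z \<epsilon> (b (\<epsilon>, n) + n) | \<epsilon> n. \<epsilon> \<in> ball 0 \<delta>1 \<and> n \<in> N \<inter> ball 0 \<gamma>}"
        using * by blast
    next
      fix x assume "x \<in> {cone_point sB k z \<epsilon> (b (\<epsilon>, n) + n) | \<epsilon> n. \<epsilon> \<in> ball 0 \<delta>1 \<and> n \<in> N \<inter> ball 0 \<gamma>}"
      then obtain \<epsilon> n where *: "\<epsilon> \<in> ball 0 \<delta>1" "n \<in> N \<inter> ball 0 \<gamma>" "x = cone_point sB k z \<epsilon> (b (\<epsilon>, n) + n)"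
        by blast
      have bn: "b (\<epsilon>, n) \<in> Nc \<inter> ball bbar \<delta>2" using bNc * by blast
      have "G x = 0"
      proof (cases "\<epsilon> = 0")
        case True
        then show ?thesis using *(3) vertex(2) by blast
      next
        case False
        then show ?thesis using iff * bn by blast
      qed
      then show "x \<in> {x. G x = 0 \<and> (\<exists>\<epsilon> \<in> ball 0 \<delta>1. \<exists>nc \<in> Nc \<inter> ball bbar \<delta>2. \<exists>n \<in> N \<inter> ball 0 \<gamma>.
            x = cone_point sB k z \<epsilon> (nc + n))}"
        using * bn by blast
    qed
  qed auto
qed

end
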